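(* Let $n\ge 2$ and let $p,q\ge 0$ be integers with $1\le k:=p+q<n$. Let $Z$ be the Grassmannian of $h$-isotropic $k$-planes in $\mathbb{C}^{2n}$, and let $D$ be the open $Sp(2n,\mathbb{R})$-orbit in $Z$ of isotropic $k$-planes of signature $(p,q)$. For $Y=\mu(\nu^{-1}(B))$, where $B$ is any relatively compact domain with smooth boundary in $\mathcal{M}_D$ containing $[C_0]$, it follows that $$c(Y)\ \ge\ \min\{n-p,\ n-q\}.$$
   Context: $G_0=\mathrm{Aut}(\mathbb{R}^{2n},h)\cong Sp(2n,\mathbb{R})$ where $h$ is a non-degenerate alternating bilinear form, extended complex bilinearly to $\mathbb{C}^{2n}$; $G=Sp(2n,\mathbb{C})$ is its complexification. The signature of a $k$-plane $V\subset\mathbb{C}^{2n}$ is that of the restriction to $V$ of the Hermitian form $(v,w)\mapsto i\,h(v,\bar w)$ on $\mathbb{C}^{2n}$ (of signature $(n,n)$). Cycle space: let $K_0$ be a maximal compact subgroup of $G_0$ and $K\subset G$ its complexification. $K_0$ has a unique orbit $C_0$ in $D$ which is a complex submanifold (the base cycle). With $m=\dim_{\mathbb{C}}C_0$, let $\mathcal{M}_Z:=G.[C_0]$ be the orbit of $C_0$ in the space $\mathcal{C}_m(Z)$ of $m$-dimensional compact cycles in $Z$, and let $\mathcal{M}_D$ be the connected component containing $[C_0]$ of the (open) set of $[C]\in\mathcal{M}_Z$ with $C\subset D$. Let $\mathfrak{X}_D=\{(z,[C])\in D\times\mathcal{M}_D: z\in C\}$ with projections $\mu:\mathfrak{X}_D\to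 D$ (open) and $\nu:\mathfrak{X}_D\to\mathcal{M}_D$ (proper). Supporting cycles and $c(Y)$: $Y=\mu(\nu^{-1}(B))$ is a relatively compact open subset of $D$. For $p_0\in\partial Y$ a supporting cycle at $p_0$ is a cycle $C$ with $[C]\in\partial B$ and $p_0\in C$ (such cycles exist for every $p_0\in\partial Y$ and lie in the closure of $Y$). Let $c(C,p_0)$ be the maximal $d\ge 0$ for which there is a $d$-dimensional polydisk contained in $C$, centered at $p_0$, which except for $p_0$ lies in $Y$; that is, a holomorphic map $F:\Delta_d(\rho)=\{z\in\mathbb{C}^d:|z_i|\le \rho\ \forall i\}\to C$ with $F(0)=p_0$, with $dF$ of rank $d$ everywhere, and $F(\Delta_d(\rho)\setminus\{0\})\subset Y$. Let $c(p_0)$ be the maximum of $c(C,p_0)$ over all supporting cycles $C$ at $p_0$, and let $c(Y)$ be the minimum of $c(p_0)$ over $p_0\in\partial Y$. *)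

theory Defs
  imports "HOL-Analysis.Analysis"
begin

section \<open>Quotient topologies\<close>

definition quot_topology :: "'a topology \<Rightarrow> ('a \<Rightarrow> 'b) \<Rightarrow> 'b topology" where
  "quot_topology X f = topology (\<lambda>U. U \<subseteq> f ` topspace X \<and> openin X {x \<in> topspace X. f x \<in> U})"

lemma openin_quot_topology:
  "openin (quot_topology X f) U \<longleftrightarrow>
     U \<subseteq> f ` topspace X \<and> openin X {x \<in> topspace X. f x \<in> U}"
proof -
  have "istopology (\<lambda>U. U \<subseteq> f ` topspace X \<and> openin X {x \<in> topspace X. f x \<in> U})"
    unfolding istopology_def
  proof (intro conjI allI impI)
    fix S T
    assume S: "S \<subseteq> f ` topspace X \<and> openin X {x \<in> topspace X. f x \<in> S}"
      and T: "T \<subseteq> f ` topspace X \<and> openin X {x \<in> topspace X. f x \<in> T}"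
    have "{x \<in> topspace X. f x \<in> S \<inter> T} =
        {x \<in> topspace X. f x \<in> S} \<inter> {x \<in> topspace X. f x \<in> T}"
      by auto
    then show "openin X {x \<in> topspace X. f x \<in> S \<inter> T}"
      using S T by (simp add: openin_Int)
    show "S \<inter> T \<subseteq> f ` topspace X"
      using S by blast
  next
    fix \<K>
    assume K: "\<forall>K\<in>\<K>. K \<subseteq> f ` topspace X \<and> openin X {x \<in> topspace X. f x \<in> K}"
    have "{x \<in> topspace X. f x \<in> \<Union>\<K>} = (\<Union>K\<in>\<K>. {x \<in> topspace X. f x \<in> K})"
      by auto
    moreover have "openin X (\<Union>K\<in>\<K>. {x \<in> topspace X. f x \<in> K})"
      using K by (intro openin_Union) auto
    ultimately show "openin X {x \<in> topspace X. f x \<in> \<Union>\<K>}"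
      by metis
    show "\<Union>\<K> \<subseteq> f ` topspace X"
      using K by blast
  qed
  then show ?thesis
    unfolding quot_topology_def by (simp add: topology_inverse')
qed

lemma topspace_quot_topology: "topspace (quot_topology X f) = f ` topspace X"
proof
  show "topspace (quot_topology X f) \<subseteq> f ` topspace X"
    using openin_quot_topology openin_topspace by metis
  have "{x \<in> topspace X. f x \<in> f ` topspace X} = topspace X" by auto
  then have "openin (quot_topology X f) (f ` topspace X)"
    by (simp add: openin_quot_topology)
  then show "f ` topspace X \<subseteq> topspace (quot_topology X f)"
    by (rule openin_subset)
qed


section \<open>Symplectic linear algebra\<close>

text \<open>The real vector space is \<open>real^'v\<close> with \<open>CARD('v) = 2 * n\<close>; the form \<open>h\<close> on it is arbitrary.\<close>

definition symplectic_form :: "(real^'v \<Rightarrow> real^'v \<Rightarrow> real) \<Rightarrow> bool" where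
  "symplectic_form h \<longleftrightarrow>
     bilinear h \<and> (\<forall>x. h x x = 0) \<and> (\<forall>x. (\<forall>y. h x y = 0) \<longrightarrow> x = 0)"

definition vec_Re :: "complex^'v \<Rightarrow> real^'v" where
  "vec_Re x = (\<chi> i. Re (x $ i))"

definition vec_Im :: "complex^'v \<Rightarrow> real^'v" where
  "vec_Im x = (\<chi> i. Im (x $ i))"

definition vec_cnj :: "complex^'v \<Rightarrow> complex^'v" where
  "vec_cnj x = (\<chi> i. cnj (x $ i))"

text \<open>The complex bilinear extension of \<open>h\<close>.\<close>

definition complexify_form ::
    "(real^'v \<Rightarrow> real^'v \<Rightarrow> real) \<Rightarrow> complex^'v \<Rightarrow> complex^'v \<Rightarrow> complex" where
  "complexify_form h x y =
     Complex (h (vec_Re x) (vec_Re y) - h (vec_Im x) (vec_Im y))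
             (h (vec_Re x) (vec_Im y) + h (vec_Im x) (vec_Re y))"

definition hermitian_form ::
    "(real^'v \<Rightarrow> real^'v \<Rightarrow> real) \<Rightarrow> complex^'v \<Rightarrow> complex^'v \<Rightarrow> complex" where
  "hermitian_form h v w = \<i> * complexify_form h v (vec_cnj w)"

text \<open>Signature of the restriction of \<open>hermitian_form h\<close> to a subspace; the diagonal values
  \<open>hermitian_form h v v\<close> are real.\<close>

definition pos_index :: "(real^'v \<Rightarrow> real^'v \<Rightarrow> real) \<Rightarrow> (complex^'v) set \<Rightarrow> nat" where
  "pos_index h V = Max {vec.dim W | W. vec.subspace W \<and> W \<subseteq> V \<and>
     (\<forall>v\<in>W. v \<noteq> 0 \<longrightarrow> Re (hermitian_form h v v) > 0)}"

definition neg_index :: "(real^'v \<Rightarrow> real^'v \<Rightarrow> real) \<Rightarrow> (complex^'v) set \<Rightarrow> nat" where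
  "neg_index h V = Max {vec.dim W | W. vec.subspace W \<and> W \<subseteq> V \<and>
     (\<forall>v\<in>W. v \<noteq> 0 \<longrightarrow> Re (hermitian_form h v v) < 0)}"

definition signature :: "(real^'v \<Rightarrow> real^'v \<Rightarrow> real) \<Rightarrow> (complex^'v) set \<Rightarrow> nat \<times> nat" where
  "signature h V = (pos_index h V, neg_index h V)"

definition isotropic_grassmannian ::
    "(real^'v \<Rightarrow> real^'v \<Rightarrow> real) \<Rightarrow> nat \<Rightarrow> (complex^'v) set set" where
  "isotropic_grassmannian h k = {V. vec.subspace V \<and> vec.dim V = k \<and>
     (\<forall>x\<in>V. \<forall>y\<in>V. complexify_form h x y = 0)}"

definition flag_domain ::
    "(real^'v \<Rightarrow> real^'v \<Rightarrow> real) \<Rightarrow> nat \<Rightarrow> nat \<Rightarrow> (complex^'v) set set" where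
  "flag_domain h p q = {V \<in> isotropic_grassmannian h (p + q). signature h V = (p, q)}"


section \<open>The groups\<close>

definition Sp_complex :: "(real^'v \<Rightarrow> real^'v \<Rightarrow> real) \<Rightarrow> (complex^'v^'v) set" where
  "Sp_complex h = {g. \<forall>x y. complexify_form h (g *v x) (g *v y) = complexify_form h x y}"

definition Sp_real :: "(real^'v \<Rightarrow> real^'v \<Rightarrow> real) \<Rightarrow> (complex^'v^'v) set" where
  "Sp_real h = (\<lambda>a :: real^'v^'v. \<chi> i j. complex_of_real (a $ i $ j)) `
     {a. \<forall>x y. h (a *v x) (a *v y) = h x y}"

definition matrix_subgroup :: "(complex^'v^'v) set \<Rightarrow> (complex^'v^'v) set \<Rightarrow> bool" where
  "matrix_subgroup L G \<longleftrightarrow> L \<subseteq> G \<and> mat 1 \<in> L \<and>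
     (\<forall>a\<in>L. \<forall>b\<in>L. a ** b \<in> L) \<and> (\<forall>a\<in>L. matrix_inv a \<in> L)"

definition maximal_compact_subgroup :: "(complex^'v^'v) set \<Rightarrow> (complex^'v^'v) set \<Rightarrow> bool" where
  "maximal_compact_subgroup L G \<longleftrightarrow> matrix_subgroup L G \<and> compact L \<and>
     (\<forall>M. matrix_subgroup M G \<and> compact M \<and> L \<subseteq> M \<longrightarrow> M = L)"

definition act_plane :: "complex^'v^'v \<Rightarrow> (complex^'v) set \<Rightarrow> (complex^'v) set" where
  "act_plane g V = (\<lambda>x. g *v x) ` V"

definition act_cycle :: "complex^'v^'v \<Rightarrow> (complex^'v) set set \<Rightarrow> (complex^'v) set set" where
  "act_cycle g C = act_plane g ` C"


section \<open>The Grassmannian as a complex manifold\<close>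

text \<open>Points and tangent vectors of $\mathbb{C}^d$ are extensional functions on \<open>{..<d}\<close>, so that
  \<open>d\<close> can be quantified over.  The Grassmannian of \<open>k\<close>-planes carries the quotient topology of
  the space of \<open>k\<close>-frames, and holomorphic maps into it are those that locally lift to
  holomorphic families of frames.\<close>

definition frames :: "nat \<Rightarrow> (nat \<Rightarrow> complex^'v) set" where
  "frames k = {b \<in> {..<k} \<rightarrow>\<^sub>E UNIV. inj_on b {..<k} \<and> vec.independent (b ` {..<k})}"

definition grassmannian_topology :: "nat \<Rightarrow> (complex^'v) set topology" where
  "grassmannian_topology k =
     quot_topology (subtopology (product_topology (\<lambda>_. euclidean) {..<k}) (frames k))
       (\<lambda>b. vec.span (b ` {..<k}))"

definition isotropic_grassmannian_topology ::
    "(real^'v \<Rightarrow> real^'v \<Rightarrow> real) \<Rightarrow> nat \<Rightarrow> (complex^'v) set topology" where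
  "isotropic_grassmannian_topology h k =
     subtopology (grassmannian_topology k) (isotropic_grassmannian h k)"

text \<open>\<open>f\<close> is complex differentiable at \<open>z\<close> as a function on $\mathbb{C}^d$,
  with partial derivatives \<open>D j\<close>, \<open>j < d\<close>.\<close>

definition has_complex_partials ::
    "nat \<Rightarrow> ((nat \<Rightarrow> complex) \<Rightarrow> complex^'v) \<Rightarrow> (nat \<Rightarrow> complex^'v) \<Rightarrow> (nat \<Rightarrow> complex) \<Rightarrow> bool" where
  "has_complex_partials d f D z \<longleftrightarrow>
     (\<forall>e>0. \<exists>\<delta>>0. \<forall>w \<in> {..<d} \<rightarrow>\<^sub>E UNIV. (\<forall>j<d. norm (w j - z j) < \<delta>) \<longrightarrow>
        norm (f w - f z - (\<Sum>j<d. (w j - z j) *s D j)) \<le> e * (\<Sum>j<d. norm (w j - z j)))"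

definition holomorphic_frame ::
    "nat \<Rightarrow> nat \<Rightarrow> ((nat \<Rightarrow> complex) \<Rightarrow> (complex^'v) set) \<Rightarrow> (nat \<Rightarrow> complex) set \<Rightarrow>
      (nat \<Rightarrow> (nat \<Rightarrow> complex) \<Rightarrow> complex^'v) \<Rightarrow> bool" where
  "holomorphic_frame k d F U f \<longleftrightarrow>
     (\<forall>w\<in>U. (\<lambda>i\<in>{..<k}. f i w) \<in> frames k \<and> vec.span ((\<lambda>i. f i w) ` {..<k}) = F w \<and>
        (\<forall>i<k. \<exists>D. has_complex_partials d (f i) D w))"

definition holomorphic_into_grassmannian ::
    "nat \<Rightarrow> nat \<Rightarrow> ((nat \<Rightarrow> complex) \<Rightarrow> (complex^'v) set) \<Rightarrow> (nat \<Rightarrow> complex) set \<Rightarrow> bool" where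
  "holomorphic_into_grassmannian k d F S \<longleftrightarrow>
     (\<forall>z\<in>S. \<exists>r>0. \<exists>f. holomorphic_frame k d F (PiE {..<d} (\<lambda>j. ball (z j) r)) f)"

text \<open>The tangent space of the Grassmannian at \<open>V\<close> is $\mathrm{Hom}(V, \mathbb{C}^{2n}/V)$.
  In terms of a holomorphic frame \<open>f\<close> with partial derivatives \<open>D i j\<close> of \<open>f i\<close> at \<open>z\<close>,
  the differential of \<open>F\<close> sends \<open>v\<close> to the homomorphism that maps \<open>f i z\<close> to the class of
  \<open>\<Sum>j<d. v j *s D i j\<close> modulo \<open>F z\<close>.  Rank \<open>d\<close> means that this linear map is injective.\<close>

definition differential_rank_full ::
    "nat \<Rightarrow> nat \<Rightarrow> ((nat \<Rightarrow> complex) \<Rightarrow> (complex^'v) set) \<Rightarrow> (nat \<Rightarrow> complex) \<Rightarrow> bool" where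
  "differential_rank_full k d F z \<longleftrightarrow>
     (\<exists>r>0. \<exists>f D. holomorphic_frame k d F (PiE {..<d} (\<lambda>j. ball (z j) r)) f \<and>
        (\<forall>i<k. has_complex_partials d (f i) (D i) z) \<and>
        (\<forall>v :: nat \<Rightarrow> complex.
           (\<forall>i<k. (\<Sum>j<d. v j *s D i j) \<in> F z) \<longrightarrow> (\<forall>j<d. v j = 0)))"

definition complex_submanifold :: "nat \<Rightarrow> nat \<Rightarrow> (complex^'v) set set \<Rightarrow> bool" where
  "complex_submanifold k m S \<longleftrightarrow> S \<subseteq> topspace (grassmannian_topology k) \<and>
     (\<forall>V\<in>S. \<exists>F. \<exists>r>0.
        (let \<Delta> = {..<m} \<rightarrow>\<^sub>E ball 0 r in
          F (\<lambda>j\<in>{..<m}. 0) = V \<and>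
          holomorphic_into_grassmannian k m F \<Delta> \<and>
          (\<forall>z\<in>\<Delta>. differential_rank_full k m F z) \<and>
          openin (subtopology (grassmannian_topology k) S) (F ` \<Delta>) \<and>
          embedding_map (product_topology (\<lambda>_. top_of_set (ball 0 r)) {..<m})
            (subtopology (grassmannian_topology k) S) F))"


section \<open>Base cycle and cycle space\<close>

definition base_cycle ::
    "nat \<Rightarrow> (complex^'v) set set \<Rightarrow> (complex^'v^'v) set \<Rightarrow> (complex^'v) set set \<Rightarrow> bool" where
  "base_cycle k D K0 C0 \<longleftrightarrow>
     (\<exists>V\<in>D. C0 = (\<lambda>g. act_plane g V) ` K0) \<and> C0 \<subseteq> D \<and> (\<exists>m. complex_submanifold k m C0)"

text \<open>The orbit of the cycle \<open>C0\<close> under \<open>Sp_complex h\<close>, with its structure of a homogeneous space: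
  the quotient topology (and below the quotient smooth structure) under \<open>g \<mapsto> act_cycle g C0\<close>.\<close>

definition cycle_orbit_topology ::
    "(real^'v \<Rightarrow> real^'v \<Rightarrow> real) \<Rightarrow> (complex^'v) set set \<Rightarrow> (complex^'v) set set topology" where
  "cycle_orbit_topology h C0 =
     quot_topology (top_of_set (Sp_complex h)) (\<lambda>g. act_cycle g C0)"

definition cycle_space ::
    "(real^'v \<Rightarrow> real^'v \<Rightarrow> real) \<Rightarrow> (complex^'v) set set \<Rightarrow> (complex^'v) set set \<Rightarrow>
      (complex^'v) set set set" where
  "cycle_space h D C0 =
     connected_component_of_set (subtopology (cycle_orbit_topology h C0) {C. C \<subseteq> D}) C0"

definition cycle_space_topology ::
    "(real^'v \<Rightarrow> real^'v \<Rightarrow> real) \<Rightarrow> (complex^'v) set set \<Rightarrow> (complex^'v) set set \<Rightarrow>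
      (complex^'v) set set topology" where
  "cycle_space_topology h D C0 = subtopology (cycle_orbit_topology h C0) (cycle_space h D C0)"

definition universal_family ::
    "(real^'v \<Rightarrow> real^'v \<Rightarrow> real) \<Rightarrow> (complex^'v) set set \<Rightarrow> (complex^'v) set set \<Rightarrow>
      ((complex^'v) set \<times> (complex^'v) set set) set" where
  "universal_family h D C0 = {(z, C). z \<in> D \<and> C \<in> cycle_space h D C0 \<and> z \<in> C}"

text \<open>The set $\mu(\nu^{-1}(B))$.\<close>

definition swept_set ::
    "(real^'v \<Rightarrow> real^'v \<Rightarrow> real) \<Rightarrow> (complex^'v) set set \<Rightarrow> (complex^'v) set set \<Rightarrow>
      (complex^'v) set set set \<Rightarrow> (complex^'v) set set" where
  "swept_set h D C0 B = fst ` {x \<in> universal_family h D C0. snd x \<in> B}"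


section \<open>Domains with smooth boundary in the cycle space\<close>

text \<open>To be used on open sets \<open>W\<close> only.\<close>

primrec Ck_on :: "nat \<Rightarrow> ('a::euclidean_space \<Rightarrow> real) \<Rightarrow> 'a set \<Rightarrow> bool" where
  "Ck_on 0 f W \<longleftrightarrow> continuous_on W f"
| "Ck_on (Suc m) f W \<longleftrightarrow> (\<forall>x\<in>W. f differentiable (at x)) \<and>
     (\<forall>v. Ck_on m (\<lambda>x. frechet_derivative f (at x) v) W)"

definition smooth_on :: "('a::euclidean_space \<Rightarrow> real) \<Rightarrow> 'a set \<Rightarrow> bool" where
  "smooth_on f W \<longleftrightarrow> (\<forall>m. Ck_on m f W)"

definition Sp_tangent_space ::
    "(real^'v \<Rightarrow> real^'v \<Rightarrow> real) \<Rightarrow> complex^'v^'v \<Rightarrow> (complex^'v^'v) set" where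
  "Sp_tangent_space h g = {X. \<forall>x y.
     complexify_form h (X *v x) (g *v y) + complexify_form h (g *v x) (X *v y) = 0}"

text \<open>\<open>\<rho>\<close> is a smooth function without critical points on the open subset \<open>U\<close> of the orbit of
  \<open>C0\<close>.  Since the orbit map is a submersion, both properties can be read off from the pullback of
  \<open>\<rho>\<close> to the closed submanifold \<open>Sp_complex h\<close> of the space of matrices; \<open>\<phi>\<close> is a local smooth
  extension of that pullback.\<close>

definition smooth_noncritical ::
    "(real^'v \<Rightarrow> real^'v \<Rightarrow> real) \<Rightarrow> (complex^'v) set set \<Rightarrow> ((complex^'v) set set \<Rightarrow> real) \<Rightarrow>
      (complex^'v) set set set \<Rightarrow> bool" where
  "smooth_noncritical h C0 \<rho> U \<longleftrightarrow>
     (\<forall>g\<in>Sp_complex h. act_cycle g C0 \<in> U \<longrightarrow>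
        (\<exists>W \<phi>. open W \<and> g \<in> W \<and> smooth_on \<phi> W \<and>
           (\<forall>g'\<in>W \<inter> Sp_complex h. act_cycle g' C0 \<in> U \<longrightarrow> \<phi> g' = \<rho> (act_cycle g' C0)) \<and>
           (\<exists>X\<in>Sp_tangent_space h g. frechet_derivative \<phi> (at g) X \<noteq> 0)))"

definition smooth_boundary ::
    "(real^'v \<Rightarrow> real^'v \<Rightarrow> real) \<Rightarrow> (complex^'v) set set \<Rightarrow> (complex^'v) set set \<Rightarrow>
      (complex^'v) set set set \<Rightarrow> bool" where
  "smooth_boundary h D C0 B \<longleftrightarrow>
     (\<forall>C \<in> cycle_space_topology h D C0 frontier_of B.
        \<exists>U \<rho>. openin (cycle_space_topology h D C0) U \<and> C \<in> U \<and>
          smooth_noncritical h C0 \<rho> U \<and> B \<inter> U = {C' \<in> U. \<rho> C' < 0})"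

definition relatively_compact_domain :: "'a topology \<Rightarrow> 'a set \<Rightarrow> bool" where
  "relatively_compact_domain T B \<longleftrightarrow>
     openin T B \<and> B \<noteq> {} \<and> connectedin T B \<and> compactin T (T closure_of B)"


section \<open>The invariant c(Y)\<close>

definition supporting_cycles ::
    "(real^'v \<Rightarrow> real^'v \<Rightarrow> real) \<Rightarrow> (complex^'v) set set \<Rightarrow> (complex^'v) set set \<Rightarrow>
      (complex^'v) set set set \<Rightarrow> (complex^'v) set \<Rightarrow> (complex^'v) set set set" where
  "supporting_cycles h D C0 B p0 = {C \<in> cycle_space_topology h D C0 frontier_of B. p0 \<in> C}"

definition polydisk_in_cycle ::
    "nat \<Rightarrow> nat \<Rightarrow> (complex^'v) set set \<Rightarrow> (complex^'v) set set \<Rightarrow> (complex^'v) set \<Rightarrow> bool" where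
  "polydisk_in_cycle k d Y C p0 \<longleftrightarrow>
     (\<exists>F. \<exists>\<rho>>0.
        (let \<Delta> = {..<d} \<rightarrow>\<^sub>E cball 0 \<rho>; origin = (\<lambda>j\<in>{..<d}. 0) in
          F ` \<Delta> \<subseteq> C \<and> F origin = p0 \<and>
          holomorphic_into_grassmannian k d F \<Delta> \<and>
          (\<forall>z\<in>\<Delta>. differential_rank_full k d F z) \<and>
          F ` (\<Delta> - {origin}) \<subseteq> Y))"

definition c_cycle ::
    "nat \<Rightarrow> (complex^'v) set set \<Rightarrow> (complex^'v) set set \<Rightarrow> (complex^'v) set \<Rightarrow> nat" where
  "c_cycle k Y C p0 = Max {d. polydisk_in_cycle k d Y C p0}"

definition c_point ::
    "(real^'v \<Rightarrow> real^'v \<Rightarrow> real) \<Rightarrow> nat \<Rightarrow> (complex^'v) set set \<Rightarrow> (complex^'v) set set \<Rightarrow>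
      (complex^'v) set set set \<Rightarrow> (complex^'v) set \<Rightarrow> nat" where
  "c_point h k D C0 B p0 =
     Max ((\<lambda>C. c_cycle k (swept_set h D C0 B) C p0) ` supporting_cycles h D C0 B p0)"

definition c_swept ::
    "(real^'v \<Rightarrow> real^'v \<Rightarrow> real) \<Rightarrow> nat \<Rightarrow> (complex^'v) set set \<Rightarrow> (complex^'v) set set \<Rightarrow>
      (complex^'v) set set set \<Rightarrow> nat" where
  "c_swept h k D C0 B =
     Min (c_point h k D C0 B `
       (isotropic_grassmannian_topology h k frontier_of swept_set h D C0 B))"

end

theory Submission
  imports Defs
begin

text \<open>
  A maximal compact subgroup of the real symplectic group is the unitary group of a compatible complex
  structure \<open>J\<close>. Since the base cycle is both a unitary orbit and a complex submanifold, the gradient of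
  the moment map of the circle generated by \<open>J\<close> is tangent to it while the moment map is constant on
  it; hence its planes are \<open>J\<close>-invariant, and it consists of all isotropic planes split, with dimensions
  \<open>p\<close> and \<open>q\<close>, along the Lagrangian eigenspaces of \<open>J\<close>.

  At a boundary cycle \<open>C\<close> (a translate, split along Lagrangians \<open>L\<close>, \<open>M\<close>) the differential of a defining
  function of \<open>B\<close> is a functional on the symplectic Lie algebra, the symmetric square of the space, and
  so a quadratic form \<open>Q\<close>. If \<open>Q x x \<noteq> 0\<close> for some \<open>x\<close> orthogonal to a plane \<open>V\<close> of \<open>C\<close>, then a transvection
  along a multiple of \<open>x\<close> fixes \<open>V\<close> and moves \<open>C\<close> into \<open>B\<close>, so \<open>V\<close> lies in the swept set. Invariance of \<open>C\<close>
  gives \<open>Q = 0\<close> on \<open>L\<close> times \<open>M\<close>, so \<open>Q w w \<noteq> 0\<close> for some \<open>w\<close> in \<open>L\<close> or in \<open>M\<close>. In the first case \<open>Q\<close>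
  vanishes on the orthogonal of a boundary plane, but no longer after a small nontrivial shear in one of
  \<open>n - q\<close> independent directions that tilt its orthogonal in \<open>L\<close> towards \<open>w\<close>; the second case gives \<open>n - p\<close>.
\<close>


section \<open>The complexified symplectic form\<close>

text \<open>Only first-order information about the boundary enters, and its sign never has to be
  controlled. The cycles form an orbit of a complex group, so the real differential is the real part
  of a complex quadratic form \<open>Q\<close>; as soon as \<open>Q x x\<close> is nonzero, a
  complex multiple of \<open>x\<close> gives it the value -1. The number \<open>n - q\<close> is (n
  - 1) - (q - 1): the annihilator of \<open>w\<close> cuts out a hyperplane of \<open>M\<close> and
  a hyperplane of \<open>V \<inter> M\<close>. Whether \<open>w\<close> lies in \<open>L\<close> or
  in \<open>M\<close> depends on the boundary cycle, whence the minimum. The obstacle before this is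
  that the base cycle is known only as an orbit with holomorphic charts. Its tangent spaces are
  stable under multiplication by i, so the rotation direction \<open>J\<close> brings with it the
  gradient direction. The cycle space is a connected component. Paths in the group, rather than
  neighbourhoods alone, certify that a nearby cycle still belongs to it. \<open>Max\<close> and
  \<open>Min\<close> carry information only on finite nonempty sets. This is why polydisk dimensions
  are bounded, and why supporting cycles and boundary points of the swept set are shown to
  exist.\<close>

lemma vec_Re_cnj_simps [simp]:
  "vec_Re (x + y) = vec_Re x + vec_Re y" "vec_Im (x + y) = vec_Im x + vec_Im y"
  "vec_Re (c *s x) = Re c *\<^sub>R vec_Re x - Im c *\<^sub>R vec_Im x"
  "vec_Im (c *s x) = Re c *\<^sub>R vec_Im x + Im c *\<^sub>R vec_Re x"
  "vec_Re (vec_cnj x) = vec_Re x" "vec_Im (vec_cnj x) = - vec_Im x"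
  by (simp_all add: vec_Re_def vec_Im_def vec_cnj_def vec_eq_iff)

lemma vec_cnj_simps [simp]:
  "vec_cnj (vec_cnj x) = x" "vec_cnj (x + y) = vec_cnj x + vec_cnj y"
  "vec_cnj (x - y) = vec_cnj x - vec_cnj y" "vec_cnj (- x) = - vec_cnj x"
  "vec_cnj 0 = 0" "vec_cnj (c *s x) = cnj c *s vec_cnj x"
  "vec_cnj (r *\<^sub>R x) = r *\<^sub>R vec_cnj x"
  by (simp_all add: vec_cnj_def vec_eq_iff)

lemma vec_cnj_eq_iff [simp]: "vec_cnj x = vec_cnj y \<longleftrightarrow> x = y"
  by (metis vec_cnj_simps(1))

lemma vec_cnj_sum: "vec_cnj (sum f A) = (\<Sum>a\<in>A. vec_cnj (f a))"
  by (induction A rule: infinite_finite_induct) auto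

lemma bounded_linear_vec_cnj: "bounded_linear vec_cnj"
  by (intro linear_conv_bounded_linear[THEN iffD1] linearI) auto

lemma scaleR_eq_vector_scalar: "r *\<^sub>R (x :: complex^'v) = complex_of_real r *s x"
  by (simp add: vec_eq_iff) (simp add: scaleR_conv_of_real)

lemma vec_Re_zero_iff: "vec_Re x = 0 \<and> vec_Im x = 0 \<longleftrightarrow> x = 0"
  by (auto simp: vec_Re_def vec_Im_def vec_eq_iff complex_eq_iff)

definition vec_of_real :: "real^'v \<Rightarrow> complex^'v" where
  "vec_of_real x = (\<chi> i. complex_of_real (x $ i))"

lemma vec_of_real_simps [simp]:
  "vec_Re (vec_of_real x) = x" "vec_Im (vec_of_real x) = 0"
  "vec_Re (\<i> *s vec_of_real x) = 0" "vec_Im (\<i> *s vec_of_real x) = x"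
  by (simp_all add: vec_Re_def vec_Im_def vec_of_real_def vec_eq_iff)

locale symplectic_space =
  fixes h :: "real^'v \<Rightarrow> real^'v \<Rightarrow> real"
  assumes symplectic: "symplectic_form h"
begin

abbreviation \<sigma> :: "complex^'v \<Rightarrow> complex^'v \<Rightarrow> complex" where "\<sigma> \<equiv> complexify_form h"

lemma bilinear_h: "bilinear h" and h_self: "h x x = 0"
  and h_nondegenerate: "(\<And>y. h x y = 0) \<Longrightarrow> x = 0"
  using symplectic by (auto simp: symplectic_form_def)

lemmas h_simps = bilinear_ladd[OF bilinear_h] bilinear_radd[OF bilinear_h]
  bilinear_lmul[OF bilinear_h] bilinear_rmul[OF bilinear_h]
  bilinear_lneg[OF bilinear_h] bilinear_rneg[OF bilinear_h]
  bilinear_lsub[OF bilinear_h] bilinear_rsub[OF bilinear_h]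
  bilinear_lzero[OF bilinear_h] bilinear_rzero[OF bilinear_h]

lemma h_swap: "h y x = - h x y"
  using h_self[of "x + y"] h_self[of x] h_self[of y] by (simp add: h_simps)

lemma \<sigma>_add [simp]:
  "\<sigma> (x + y) z = \<sigma> x z + \<sigma> y z" "\<sigma> z (x + y) = \<sigma> z x + \<sigma> z y"
  by (simp_all add: complexify_form_def h_simps complex_eq_iff)

lemma \<sigma>_scale [simp]:
  "\<sigma> (c *s x) z = c * \<sigma> x z" "\<sigma> z (c *s x) = c * \<sigma> z x"
  by (simp_all add: complexify_form_def h_simps complex_eq_iff algebra_simps)

lemma \<sigma>_scaleR [simp]:
  "\<sigma> (r *\<^sub>R x) z = of_real r * \<sigma> x z" "\<sigma> z (r *\<^sub>R x) = of_real r * \<sigma> z x"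
  by (simp_all add: scaleR_eq_vector_scalar)

lemma \<sigma>_minus [simp]: "\<sigma> (- x) z = - \<sigma> x z" "\<sigma> z (- x) = - \<sigma> z x"
  using \<sigma>_scale(1)[of "-1" x z] \<sigma>_scale(2)[of z "-1" x]
  by (simp_all add: vector_sneg_minus1[symmetric])

lemma \<sigma>_diff [simp]:
  "\<sigma> (x - y) z = \<sigma> x z - \<sigma> y z" "\<sigma> z (x - y) = \<sigma> z x - \<sigma> z y"
  using \<sigma>_add(1)[of x "-y" z] \<sigma>_add(2)[of z x "-y"] by simp_all

lemma \<sigma>_zero [simp]: "\<sigma> 0 z = 0" "\<sigma> z 0 = 0"
  using \<sigma>_scale(1)[of 0 0 z] \<sigma>_scale(2)[of z 0 0] by simp_all

lemma \<sigma>_sum: "\<sigma> (sum f A) z = (\<Sum>a\<in>A. \<sigma> (f a) z)" "\<sigma> z (sum f A) = (\<Sum>a\<in>A. \<sigma> z (f a))"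
  by (induction A rule: infinite_finite_induct) auto

lemma \<sigma>_swap: "\<sigma> y x = - \<sigma> x y"
  unfolding complexify_form_def
  by (simp add: complex_eq_iff h_swap[of "vec_Re y"] h_swap[of "vec_Im y"])

lemma \<sigma>_self [simp]: "\<sigma> x x = 0"
  using \<sigma>_swap[of x x] by simp

lemma \<sigma>_cnj: "\<sigma> (vec_cnj x) (vec_cnj y) = cnj (\<sigma> x y)"
  by (simp add: complexify_form_def complex_eq_iff h_simps)

lemma \<sigma>_nondegenerate: assumes "\<And>y. \<sigma> x y = 0" shows "x = 0"
proof -
  have "h (vec_Re x) y = 0 \<and> h (vec_Im x) y = 0" for y
    using assms[of "vec_of_real y"] by (simp add: complexify_form_def complex_eq_iff h_simps)
  then show ?thesis
    using h_nondegenerate vec_Re_zero_iff by blast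
qed

lemma bounded_bilinear_\<sigma>: "bounded_bilinear \<sigma>"
  by (intro bilinear_conv_bounded_bilinear[THEN iffD1])
    (simp add: bilinear_def linear_iff, simp add: scaleR_conv_of_real)

lemmas tendsto_\<sigma> [tendsto_intros] = bounded_bilinear.tendsto[OF bounded_bilinear_\<sigma>]
lemmas continuous_on_\<sigma> [continuous_intros] = bounded_bilinear.continuous_on[OF bounded_bilinear_\<sigma>]

lemma functional_representable:
  obtains x where "\<And>v. \<sigma> v x = (\<Sum>i\<in>UNIV. v $ i * l $ i)"
proof -
  define M :: "complex^'v^'v" where "M = (\<chi> i j. \<sigma> (axis i 1) (axis j 1))"
  have exp: "\<sigma> v x = (\<Sum>i\<in>UNIV. v $ i * (M *v x) $ i)" for v x
  proof -
    have "\<sigma> v x = \<sigma> (\<Sum>i\<in>UNIV. v $ i *s axis i 1) (\<Sum>j\<in>UNIV. x $ j *s axis j 1)"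
      by (simp add: basis_expansion)
    also have "\<dots> = (\<Sum>i\<in>UNIV. v $ i * (\<Sum>j\<in>UNIV. x $ j * \<sigma> (axis i 1) (axis j 1)))"
      unfolding \<sigma>_sum(1) by (simp add: \<sigma>_sum(2) sum_distrib_left algebra_simps)
    finally show ?thesis
      by (simp add: M_def matrix_vector_mult_def mult.commute)
  qed
  have "inj ((*v) M)"
  proof (rule vec.linear_inj_iff_eq_0[THEN iffD2, rule_format])
    show "Vector_Spaces.linear (*s) (*s) ((*v) M)" by (rule matrix_vector_mul_linear_gen)
    fix x assume "M *v x = 0"
    then have "\<sigma> x v = 0" for v using exp[of v x] \<sigma>_swap[of x v] by simp
    then show "x = 0" by (rule \<sigma>_nondegenerate)
  qed
  then have "surj ((*v) M)"
    by (intro vec.linear_inj_imp_surj matrix_vector_mul_linear_gen)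
  then obtain x where "M *v x = l" by (metis surjD)
  with exp show ?thesis by (intro that[of x]) simp
qed

text \<open>This is the double annihilator property of complex subspaces. The component
  \<open>w\<close> of \<open>z\<close> orthogonal to \<open>A\<close> is conjugated, so that the
  real part of \<open>\<sigma> v x\<close> is the real inner product with \<open>w\<close>; the
  imaginary part on \<open>A\<close> is recovered by testing -i times a vector of
  \<open>A\<close>.\<close>

lemma separating_vector:
  assumes A: "vec.subspace A" and z: "z \<notin> A"
  obtains x where "\<And>a. a \<in> A \<Longrightarrow> \<sigma> a x = 0" "\<sigma> z x \<noteq> 0"
proof -
  have sub: "subspace A"
    using A unfolding subspace_def vec.subspace_def scaleR_eq_vector_scalar by blast
  obtain y w where y: "y \<in> span A" and w: "\<And>a. a \<in> span A \<Longrightarrow> orthogonal w a" and zyw: "z = y + w"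
    by (metis orthogonal_subspace_decomp_exists)
  have spA: "span A = A" using sub by (simp add: span_eq_iff)
  have w0: "w \<noteq> 0" using z y zyw spA by auto
  obtain x where x: "\<And>v. \<sigma> v x = (\<Sum>i\<in>UNIV. v $ i * vec_cnj w $ i)"
    by (metis functional_representable)
  have re: "Re (\<sigma> v x) = w \<bullet> v" for v
    by (simp add: x inner_vec_def vec_cnj_def inner_complex_def algebra_simps)
  have zero: "\<sigma> a x = 0" if "a \<in> A" for a
  proof (rule complex_eqI)
    show "Re (\<sigma> a x) = Re 0" using w[of a] that spA by (simp add: re orthogonal_def)
    have "(- \<i>) *s a \<in> A" using vec.subspace_scale[OF A that] by blast
    then have "Re (\<sigma> ((- \<i>) *s a) x) = 0" using w spA by (simp only: re orthogonal_def)
    then show "Im (\<sigma> a x) = Im 0" by simp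
  qed
  moreover have "\<sigma> z x \<noteq> 0"
  proof -
    have "w \<bullet> z = w \<bullet> w" using w[OF y] by (simp add: zyw inner_add_right orthogonal_def)
    then have "Re (\<sigma> z x) \<noteq> 0" using w0 by (simp add: re)
    then show ?thesis by auto
  qed
  ultimately show ?thesis by (rule that)
qed

end


section \<open>Complex structures invariant under a compact group\<close>

lemma minus_matrix_vector_mult: "(- A) *v x = - (A *v x)"
  and matrix_vector_mult_minus: "A *v (- x) = - (A *v x)" for A :: "'a::ring_1^'n^'m"
  by (simp_all add: matrix_vector_mult_def vec_eq_iff sum_negf)

definition quad :: "real^'v^'v \<Rightarrow> real^'v \<Rightarrow> real" where
  "quad S x = x \<bullet> (S *v x)"

text \<open>On symmetric \<open>S\<close> with \<open>g\<close> invertible this is the square of a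
  Euclidean norm of \<open>transpose g ** S ** g\<close>: by polarization the values on the sums of
  two basis vectors determine the matrix.\<close>

definition quad_energy :: "real^'v^'v \<Rightarrow> real^'v^'v \<Rightarrow> real" where
  "quad_energy g S = (\<Sum>i\<in>UNIV. \<Sum>j\<in>UNIV. (quad S (g *v (axis i 1 + axis j 1)))\<^sup>2)"

lemma continuous_on_quad [continuous_intros]:
  assumes "continuous_on A S" and "continuous_on A x"
  shows "continuous_on A (\<lambda>a. quad (S a) (x a))"
  using assms unfolding quad_def inner_vec_def matrix_vector_mult_def
  by (auto intro!: continuous_intros)

lemma continuous_on_matrix_vector_mult_left [continuous_intros]:
  fixes g :: "'a::topological_space \<Rightarrow> real^'n^'m"
  assumes "continuous_on A g"
  shows "continuous_on A (\<lambda>a. g a *v x)"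
  unfolding matrix_vector_mult_def continuous_on_vec_lambda
  using assms by (auto intro!: continuous_intros)

lemma continuous_on_quad_energy [continuous_intros]:
  assumes "continuous_on A g" and "continuous_on A S"
  shows "continuous_on A (\<lambda>a. quad_energy (g a) (S a))"
  unfolding quad_energy_def using assms by (intro continuous_intros)

lemma quad_add: "quad (S + T) x = quad S x + quad T x"
  and quad_scaleR: "quad (c *\<^sub>R S) x = c * quad S x"
  and quad_diff: "quad (S - T) x = quad S x - quad T x"
  by (simp_all add: quad_def matrix_vector_mult_add_rdistrib inner_add_right
      matrix_vector_mult_diff_rdistrib inner_diff_right scaleR_matrix_vector_assoc[symmetric])

lemma inner_vector_matrix: "x \<bullet> (y v* g) = (g *v x) \<bullet> (y :: real^'n)"
  by (metis dot_lmul_matrix inner_commute)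

lemma quad_conjugate: "quad (transpose g ** S ** g) x = quad S (g *v x)"
  by (simp add: quad_def matrix_vector_mul_assoc[symmetric] inner_vector_matrix)

lemma symmetric_matrix_inner:
  fixes S :: "real^'v^'v"
  assumes "transpose S = S" shows "x \<bullet> (S *v y) = (S *v x) \<bullet> y"
  by (metis assms dot_lmul_matrix vector_transpose_matrix transpose_matrix_vector)

lemma quad_polarization:
  fixes S :: "real^'v^'v"
  assumes "transpose S = S"
  shows "2 * (x \<bullet> (S *v y)) = quad S (x + y) - quad S x - quad S y"
  using symmetric_matrix_inner[OF assms, of x y]
  by (simp add: quad_def matrix_vector_right_distrib inner_add_left inner_add_right inner_commute)

lemma quad_axis_double: "quad S (g *v (axis i 1 + axis i 1)) = 4 * quad S (g *v axis i 1)"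
  unfolding quad_def matrix_vector_right_distrib inner_add_left inner_add_right by simp

lemma symmetric_matrix_eq_0:
  fixes S g :: "real^'v^'v"
  assumes sym: "transpose S = S" and g: "surj ((*v) g)"
    and z: "\<And>i j. quad S (g *v (axis i 1 + axis j 1)) = 0"
  shows "S = 0"
proof -
  have "quad S (g *v axis i 1) = 0" for i
    using z[of i i] quad_axis_double[of S g i] by simp
  then have 1: "(g *v axis i 1) \<bullet> (S *v (g *v axis j 1)) = 0" for i j
    using z[of i j] quad_polarization[OF sym, of "g *v axis i 1" "g *v axis j 1"]
    by (simp add: matrix_vector_right_distrib)
  have "transpose g ** S ** g = 0"
  proof -
    have "(axis i 1 :: real^'v) \<bullet> ((transpose g ** S ** g) *v axis j 1) = 0" for i j
      using 1[of i j] by (simp add: matrix_vector_mul_assoc[symmetric] inner_vector_matrix)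
    then show ?thesis
      by (simp add: vec_eq_iff inner_axis' matrix_vector_mult_basis column_def)
  qed
  then have "x \<bullet> ((transpose g ** S ** g) *v y) = 0" for x y
    by simp
  then have "(g *v x) \<bullet> (S *v (g *v y)) = 0" for x y
    by (simp add: matrix_vector_mul_assoc[symmetric] inner_vector_matrix)
  then have "x \<bullet> (S *v y) = 0" for x y
    using g by (metis surjD)
  then have "S *v y = 0" for y
    by (metis inner_eq_zero_iff)
  then show ?thesis
    by (metis matrix_eq matrix_vector_mult_0)
qed

lemma quad_square_le_energy: "(quad S (g *v (axis i 1 + axis j 1)))\<^sup>2 \<le> quad_energy g S"
proof -
  have "(quad S (g *v (axis i 1 + axis j 1)))\<^sup>2 \<le> (\<Sum>j\<in>UNIV. (quad S (g *v (axis i 1 + axis j 1)))\<^sup>2)"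
    by (rule member_le_sum) auto
  also have "\<dots> \<le> quad_energy g S"
    unfolding quad_energy_def by (rule member_le_sum) (auto simp: sum_nonneg)
  finally show ?thesis .
qed

context symplectic_space
begin

text \<open>The conditions are non-strict so that the set is closed and stable under midpoints;
  positive definiteness is then a consequence of the nondegeneracy of \<open>h\<close>.\<close>

definition majorants :: "(real^'v^'v) set" where
  "majorants = {S. transpose S = S \<and> (\<forall>x. 0 \<le> quad S x) \<and> (\<forall>x y. (h x y)\<^sup>2 \<le> quad S x * quad S y)}"

lemma closed_majorants: "closed majorants"
proof -
  have 1: "closed {S. transpose S = (S :: real^'v^'v)}"
    unfolding transpose_def vec_eq_iff
    by (auto intro!: closed_Collect_all closed_Collect_eq continuous_intros)
  have 2: "closed {S. 0 \<le> quad S x}" for x :: "real^'v"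
    by (intro closed_Collect_le continuous_intros)
  have 3: "closed {S. (h x y)\<^sup>2 \<le> quad S x * quad S y}" for x y
    by (intro closed_Collect_le continuous_intros)
  show ?thesis
    unfolding majorants_def
    by (intro closed_Collect_conj closed_Collect_all 1 2 3)
qed

lemma majorants_nonempty: "majorants \<noteq> {}"
proof -
  obtain b where b: "\<And>x y. norm (h x y) \<le> b * norm x * norm y"
    using bilinear_bounded[OF bilinear_h] by blast
  define S :: "real^'v^'v" where "S = \<bar>b\<bar> *\<^sub>R mat 1"
  have qS: "quad S x = \<bar>b\<bar> * (norm x)\<^sup>2" for x
    by (simp add: S_def quad_scaleR) (simp add: quad_def power2_norm_eq_inner)
  have "(h x y)\<^sup>2 \<le> quad S x * quad S y" for x y
  proof -
    have "\<bar>h x y\<bar> \<le> \<bar>b\<bar> * norm x * norm y"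
      using b[of x y] by (smt (verit, best) mult_right_mono norm_ge_zero real_norm_def)
    then have "\<bar>h x y\<bar>\<^sup>2 \<le> (\<bar>b\<bar> * norm x * norm y)\<^sup>2" by (intro power_mono) auto
    then show ?thesis by (simp add: qS power2_eq_square algebra_simps)
  qed
  moreover have "transpose S = S"
    by (simp add: S_def vec_eq_iff transpose_def mat_def)
  ultimately have "S \<in> majorants" by (simp add: majorants_def qS)
  then show ?thesis by blast
qed

lemma average_in_majorants:
  assumes "transpose S = S" "transpose T = T" "\<And>x. 0 \<le> quad S x" "\<And>x. 0 \<le> quad T x"
    and "\<And>x y. 4 * (h x y)\<^sup>2 \<le> (quad S x + quad T x) * (quad S y + quad T y)"
  shows "(1/2) *\<^sub>R (S + T) \<in> majorants"
  using assms by (simp add: majorants_def quad_scaleR quad_add transpose_def vec_eq_iff mult.commute)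

text \<open>When a product of two sums is expanded, two of the four terms are at least
  \<open>t\<close>. The other two have the same product, so their geometric mean, and hence their
  arithmetic mean, is at least \<open>t\<close> as well.\<close>

lemma amgm_from_product:
  fixes p q u v t :: real
  assumes "t \<le> u" "t \<le> v" "0 \<le> t" "0 \<le> p" "0 \<le> q" "p * q = u * v"
  shows "2 * t \<le> p + q"
proof (rule power2_le_imp_le)
  have "t * t \<le> u * v" using assms by (intro mult_mono) auto
  moreover have "4 * (p * q) \<le> (p + q)\<^sup>2"
    using zero_le_power2[of "p - q"] by (simp add: power2_eq_square algebra_simps)
  ultimately show "(2 * t)\<^sup>2 \<le> (p + q)\<^sup>2" using assms by (simp add: power2_eq_square)
qed (use assms in auto)

lemma majorants_midpoint:
  assumes "S \<in> majorants" "T \<in> majorants"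
  shows "(1/2) *\<^sub>R (S + T) \<in> majorants"
proof (rule average_in_majorants)
  fix x y
  have "(h x y)\<^sup>2 \<le> quad S x * quad S y" "(h x y)\<^sup>2 \<le> quad T x * quad T y"
    "0 \<le> quad S x" "0 \<le> quad T x" "0 \<le> quad S y" "0 \<le> quad T y"
    using assms by (auto simp: majorants_def)
  then show "4 * (h x y)\<^sup>2 \<le> (quad S x + quad T x) * (quad S y + quad T y)"
    using amgm_from_product[of "(h x y)\<^sup>2" "quad S x * quad S y" "quad T x * quad T y"
        "quad S x * quad T y" "quad T x * quad S y"]
    by (simp add: algebra_simps)
qed (use assms in \<open>auto simp: majorants_def\<close>)

lemma quad_pos_majorant:
  assumes "S \<in> majorants" "x \<noteq> 0" shows "0 < quad S x"
proof -
  obtain y where "h x y \<noteq> 0" using h_nondegenerate assms(2) by blast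
  then have "0 < quad S x * quad S y" 
    using assms(1) by (auto simp: majorants_def intro: less_le_trans[of _ "(h x y)\<^sup>2"])
  then show ?thesis using assms(1) by (auto simp: majorants_def zero_less_mult_iff less_le)
qed

definition form_matrix :: "real^'v^'v" where
  "form_matrix = (\<chi> i j. h (axis i 1) (axis j 1))"

lemma form_matrix: "h x y = x \<bullet> (form_matrix *v y)"
proof -
  have exp: "x = (\<Sum>i\<in>UNIV. (x $ i) *\<^sub>R axis i 1)" for x :: "real^'v"
    by (metis (no_types) basis_expansion[of x, unfolded scalar_mult_eq_scaleR])
  have "h x y = h (\<Sum>i\<in>UNIV. (x $ i) *\<^sub>R axis i 1) (\<Sum>j\<in>UNIV. (y $ j) *\<^sub>R axis j 1)"
    by (intro arg_cong2[where f = h] exp)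
  also have "\<dots> = (\<Sum>(i, j)\<in>UNIV \<times> UNIV. h ((x $ i) *\<^sub>R axis i 1) ((y $ j) *\<^sub>R axis j 1))"
    by (simp add: bilinear_sum[OF bilinear_h])
  also have "\<dots> = (\<Sum>i\<in>UNIV. \<Sum>j\<in>UNIV. x $ i * (y $ j * h (axis i 1) (axis j 1)))"
    by (simp add: sum.cartesian_product h_simps ac_simps)
  finally show ?thesis
    by (simp add: form_matrix_def inner_vec_def matrix_vector_mult_def sum_distrib_left algebra_simps)
qed

lemma preserving_surj:
  assumes "\<And>x y. h (g *v x) (g *v y) = h x y" shows "surj ((*v) g)"
proof -
  have "inj ((*v) g)"
  proof (rule vec.linear_inj_iff_eq_0[THEN iffD2, rule_format])
    show "Vector_Spaces.linear (*s) (*s) ((*v) g)" by (rule matrix_vector_mul_linear_gen)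
    fix x assume "g *v x = 0"
    then show "x = 0" using assms[of x] by (intro h_nondegenerate) (simp add: h_simps)
  qed
  then show ?thesis by (intro vec.linear_inj_imp_surj matrix_vector_mul_linear_gen)
qed

text \<open>Among the majorants of \<open>h\<close>, those of least energy (the supremum over the group) are unique by
  strict convexity, hence invariant; and replacing a majorant by its average with its \<open>h\<close>-dual does
  not increase the energy, so the minimizer is self-dual, i.e. comes from a complex structure.\<close>

lemma compact_group_minimal_majorant:
  fixes G :: "(real^'v^'v) set"
  assumes G: "compact G" "mat 1 \<in> G" and surj: "\<And>g. g \<in> G \<Longrightarrow> surj ((*v) g)"
  obtains S m where "S \<in> majorants" "\<And>g. g \<in> G \<Longrightarrow> quad_energy g S \<le> m"
    "\<And>T. T \<in> majorants \<Longrightarrow> (\<And>g. g \<in> G \<Longrightarrow> quad_energy g T \<le> m) \<Longrightarrow> T = S"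
proof -
  define L where "L c = {S \<in> majorants. \<forall>g\<in>G. quad_energy g S \<le> c}" for c
  have Lmono: "L c \<subseteq> L d" if "c \<le> d" for c d using that by (force simp: L_def)
  have Lnn: "0 \<le> c" if ne: "L c \<noteq> {}" for c
  proof -
    obtain S where "S \<in> L c" using ne by blast
    then have "quad_energy (mat 1) S \<le> c" using G(2) by (simp add: L_def)
    moreover have "0 \<le> quad_energy (mat 1) S" unfolding quad_energy_def by (intro sum_nonneg) auto
    ultimately show ?thesis by simp
  qed
  have Lne: "\<exists>c. L c \<noteq> {}"
  proof -
    obtain S where S: "S \<in> majorants" using majorants_nonempty by blast
    have "\<exists>g\<in>G. \<forall>g'\<in>G. quad_energy g' S \<le> quad_energy g S"
      using G by (intro continuous_attains_sup) (auto intro!: continuous_intros)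
    then show ?thesis using S by (auto simp: L_def)
  qed
  \<comment> \<open>Boundedness uses only the identity element of \<open>G\<close>: its energy
    bounds the form on sums of basis vectors, and polarization bounds the entries.\<close>
  have Lcompact: "compact (L c)" for c
  proof -
    have "closed (L c)"
    proof -
      have "L c = majorants \<inter> (\<Inter>g\<in>G. {S. quad_energy g S \<le> c})" by (auto simp: L_def)
      moreover have "closed {S. quad_energy g S \<le> c}" for g :: "real^'v^'v"
        by (intro closed_Collect_le continuous_intros)
      ultimately show ?thesis using closed_majorants by (auto intro!: closed_Int closed_INT)
    qed
    moreover have "bounded (L c)"
    proof -
      have *: "\<bar>S $ i $ j\<bar> \<le> 2 * sqrt c" if "S \<in> L c" for S i j
      proof -
        have sym: "transpose S = S" using that by (simp add: L_def majorants_def)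
        have "quad_energy (mat 1) S \<le> c"
          using that G(2) by (simp add: L_def)
        then have "(quad S (axis i 1 + axis j 1))\<^sup>2 \<le> c" for i j
          using quad_square_le_energy[of S "mat 1" i j] by simp
        then have b: "\<bar>quad S (axis i 1 + axis j 1)\<bar> \<le> sqrt c" for i j
          by (metis real_sqrt_abs real_sqrt_le_iff)
        have "4 * quad S (axis i 1) = quad S (axis i 1 + axis i 1)" for i
          using quad_axis_double[of S "mat 1" i] by simp
        then have "4 * \<bar>quad S (axis i 1)\<bar> \<le> sqrt c" for i
          using b[of i i] by (smt (verit, best))
        moreover have "S $ i $ j = axis i 1 \<bullet> (S *v axis j 1)"
          by (simp add: inner_axis' matrix_vector_mult_basis column_def)
        ultimately show ?thesis
          using quad_polarization[OF sym, of "axis i 1" "axis j 1"] b[of i j]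
          by (smt (verit, best))
      qed
      have "norm S \<le> (\<Sum>i\<in>(UNIV::'v set). \<Sum>j\<in>(UNIV::'v set). 2 * sqrt c)" if "S \<in> L c" for S
      proof -
        have "norm S \<le> (\<Sum>i\<in>UNIV. norm (S $ i))" unfolding norm_vec_def[of S] by (rule L2_set_le_sum) simp
        also have "\<dots> \<le> (\<Sum>i\<in>UNIV. \<Sum>j\<in>UNIV. \<bar>S $ i $ j\<bar>)"
          by (intro sum_mono norm_le_l1_cart)
        also have "\<dots> \<le> (\<Sum>i\<in>(UNIV::'v set). \<Sum>j\<in>(UNIV::'v set). 2 * sqrt c)"
          by (intro sum_mono *[OF that])
        finally show ?thesis .
      qed
      then show ?thesis unfolding bounded_iff by blast
    qed
    ultimately show ?thesis by (simp add: compact_eq_bounded_closed)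
  qed
  define m where "m = Inf {c. L c \<noteq> {}}"
  have bdd: "bdd_below {c. L c \<noteq> {}}" using Lnn by (auto simp: bdd_below_def)
  have m_le: "m \<le> c" if "L c \<noteq> {}" for c
    unfolding m_def using that bdd by (intro cInf_lower) auto
  \<comment> \<open>The infimum is attained because these sublevel sets are nested, compact and
    nonempty.\<close>
  have "L (m + 1 / real (Suc k)) \<noteq> {}" for k
  proof -
    have "\<exists>c\<in>{c. L c \<noteq> {}}. c < m + 1 / real (Suc k)"
      by (rule cInf_lessD) (use Lne in \<open>auto simp flip: m_def\<close>)
    then obtain c where "L c \<noteq> {}" "c < m + 1 / real (Suc k)" by auto
    then show ?thesis using Lmono[of c "m + 1 / real (Suc k)"] by auto
  qed
  then have "(\<Inter>k. L (m + 1 / real (Suc k))) \<noteq> {}"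
    by (intro compact_nest Lcompact Lmono) (auto simp: frac_le)
  then obtain S where S: "\<And>k. S \<in> L (m + 1 / real (Suc k))" by blast
  have SL: "S \<in> L m"
  proof -
    have "quad_energy g S \<le> m" if "g \<in> G" for g
    proof (rule field_le_epsilon)
      fix e :: real assume "0 < e"
      then obtain k where "1 / real (Suc k) < e" by (meson nat_approx_posE)
      moreover have "quad_energy g S \<le> m + 1 / real (Suc k)" using S[of k] that by (auto simp: L_def)
      ultimately show "quad_energy g S \<le> m + e" by linarith
    qed
    then show ?thesis using S by (auto simp: L_def)
  qed
  have uniq: "T = S" if T: "T \<in> L m" for T
  proof (rule ccontr)
    assume "T \<noteq> S"
    define N where "N = (1/2) *\<^sub>R (T + S)"
    have N: "N \<in> majorants" using T SL majorants_midpoint by (auto simp: N_def L_def)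
    \<comment> \<open>The largest energy of the midpoint is attained at some \<open>g\<close>. There
      the parallelogram law for the quadratic form \<open>quad_energy g\<close> leaves no room for a
      nonzero \<open>T - S\<close>.\<close>
    have "\<exists>g\<in>G. \<forall>g'\<in>G. quad_energy g' N \<le> quad_energy g N"
      using G by (intro continuous_attains_sup) (auto intro!: continuous_intros)
    then obtain g where g: "g \<in> G" and gmax: "\<And>g'. g' \<in> G \<Longrightarrow> quad_energy g' N \<le> quad_energy g N"
      by blast
    have "L (quad_energy g N) \<noteq> {}" using N gmax by (auto simp: L_def)
    then have "m \<le> quad_energy g N" by (rule m_le)
    moreover have "4 * quad_energy g N + quad_energy g (T - S) = 2 * quad_energy g T + 2 * quad_energy g S"
      unfolding quad_energy_def N_def sum_distrib_left sum.distrib[symmetric]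
      by (intro sum.cong refl) (simp add: quad_scaleR quad_add quad_diff power2_eq_square algebra_simps)
    moreover have "quad_energy g T \<le> m" "quad_energy g S \<le> m" using g T SL by (auto simp: L_def)
    ultimately have "quad_energy g (T - S) \<le> 0" by linarith
    then have "(quad (T - S) (g *v (axis i 1 + axis j 1)))\<^sup>2 \<le> 0" for i j
      using quad_square_le_energy order_trans by blast
    then have "quad (T - S) (g *v (axis i 1 + axis j 1)) = 0" for i j
      by simp
    moreover have "transpose (T - S) = T - S"
      using T SL by (auto simp: L_def majorants_def transpose_def vec_eq_iff)
    ultimately have "T - S = 0" using surj[OF g] by (intro symmetric_matrix_eq_0)
    with \<open>T \<noteq> S\<close> show False by simp
  qed
  have mem: "T \<in> L m \<longleftrightarrow> T \<in> majorants \<and> (\<forall>g\<in>G. quad_energy g T \<le> m)" for T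
    by (simp add: L_def)
  show ?thesis
  proof (rule that[of S m])
    show "T = S" if "T \<in> majorants" "\<And>g. g \<in> G \<Longrightarrow> quad_energy g T \<le> m" for T
      using that uniq mem by blast
  qed (use SL mem in blast)+
qed

text \<open>The energy bound is taken over the whole group, so pulling back by a group element
  preserves it and uniqueness makes the minimizer \<open>S\<close> invariant. With A the composite
  of the inverse of \<open>S\<close> and the matrix of \<open>h\<close>, the dual form is
  \<open>quad S (A x)\<close>; equality of \<open>S\<close> with its dual says that A squares to -1,
  and J = -A.\<close>

lemma compact_group_compatible_structure:
  fixes G :: "(real^'v^'v) set"
  assumes G: "compact G" "mat 1 \<in> G" and mult: "\<And>a b. a \<in> G \<Longrightarrow> b \<in> G \<Longrightarrow> a ** b \<in> G"
    and pres: "\<And>g x y. g \<in> G \<Longrightarrow> h (g *v x) (g *v y) = h x y"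
  obtains J :: "real^'v^'v" where "\<And>x. J *v (J *v x) = - x" "\<And>x y. h (J *v x) (J *v y) = h x y"
    "\<And>x. x \<noteq> 0 \<Longrightarrow> 0 < h x (J *v x)" "\<And>g. g \<in> G \<Longrightarrow> g ** J = J ** g"
proof -
  have surj: "surj ((*v) g)" if "g \<in> G" for g
    using pres[OF that] by (rule preserving_surj)
  obtain S m where S: "S \<in> majorants" and Sm: "\<And>g. g \<in> G \<Longrightarrow> quad_energy g S \<le> m"
    and uniq: "\<And>T. T \<in> majorants \<Longrightarrow> (\<And>g. g \<in> G \<Longrightarrow> quad_energy g T \<le> m) \<Longrightarrow> T = S"
    using compact_group_minimal_majorant[OF G surj] by metis
  have sym: "transpose S = S" and nn: "\<And>x. 0 \<le> quad S x"
    and maj: "\<And>x y. (h x y)\<^sup>2 \<le> quad S x * quad S y"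
    using S by (auto simp: majorants_def)
  note symS = symmetric_matrix_inner[OF sym]
  have inv: "transpose g ** S ** g = S" if g: "g \<in> G" for g
  proof (rule uniq)
    show "transpose g ** S ** g \<in> majorants"
      using nn maj[of "g *v x" "g *v y" for x y] pres[OF g]
      by (simp add: majorants_def quad_conjugate matrix_transpose_mul sym matrix_mul_assoc)
    show "quad_energy g' (transpose g ** S ** g) \<le> m" if "g' \<in> G" for g'
      using Sm[OF mult[OF g that]]
      by (simp add: quad_energy_def quad_conjugate matrix_vector_mul_assoc)
  qed
  have invS: "(g *v x) \<bullet> (S *v (g *v y)) = x \<bullet> (S *v y)" if "g \<in> G" for g x y
    using inv[OF that] inner_vector_matrix
    by (metis matrix_vector_mul_assoc transpose_matrix_vector)
  have "\<exists>T. T ** S = mat 1"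
    unfolding matrix_left_invertible_ker
    using quad_pos_majorant[OF S] by (metis inner_zero_right less_irrefl quad_def)
  then obtain T where TS: "T ** S = mat 1" by blast
  then have ST: "S ** T = mat 1" by (simp add: matrix_left_right_inverse)
  define M where "M = form_matrix"
  have M: "h x y = x \<bullet> (M *v y)" for x y by (simp add: M_def form_matrix)
  define A where "A x = T *v (M *v x)" for x
  have SA: "S *v A x = M *v x" for x
    by (simp add: A_def matrix_vector_mul_assoc matrix_mul_assoc ST)
  have quadA: "quad S (A x) = - h x (A x)" for x
    using h_swap[of x "A x"] by (simp add: quad_def SA M)
  have symMT: "transpose (M ** T ** M) = M ** T ** M"
  proof -
    have "transpose M $ i $ j = (- M) $ i $ j" for i j
      using h_swap[of "axis i 1" "axis j 1"] by (simp add: M_def form_matrix_def transpose_def)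
    then have "transpose M = - M"
      by (simp add: vec_eq_iff)
    moreover have "transpose T = T"
      by (metis ST TS matrix_mul_assoc matrix_mul_lid matrix_mul_rid matrix_transpose_mul sym transpose_mat)
    ultimately show ?thesis
      by (simp add: matrix_transpose_mul matrix_eq matrix_vector_mul_assoc[symmetric]
          matrix_vector_mult_minus minus_matrix_vector_mult)
  qed
  define D where "D = - (M ** T ** M)"
  have Dv: "D *v x = - (M *v A x)" for x
    by (simp add: D_def A_def minus_matrix_vector_mult matrix_vector_mul_assoc matrix_mul_assoc)
  have quadD: "quad D x = quad S (A x)" for x
    by (simp add: quad_def[of D] Dv quadA M)
  \<comment> \<open>The majorant inequality is tested at \<open>y = A x\<close>, where
    \<open>h x (A x)\<close> is \<open>- quad S (A x)\<close>; one factor then cancels.\<close>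
  have D_le: "quad D x \<le> quad S x" for x
  proof (cases "quad S (A x) = 0")
    case False
    have "(quad S (A x))\<^sup>2 \<le> quad S x * quad S (A x)"
      using maj[of x "A x"] by (simp add: quadA)
    then show ?thesis using False nn[of "A x"]
      by (simp add: quadD power2_eq_square)
  qed (use nn in \<open>simp add: quadD\<close>)
  have cs: "(x \<bullet> (S *v y))\<^sup>2 \<le> quad S x * quad S y" for x y
  proof (cases "x = 0")
    case False
    then have pos: "0 < quad S x" by (rule quad_pos_majorant[OF S])
    let ?t = "x \<bullet> (S *v y)"
    have "0 \<le> quad S (quad S x *\<^sub>R y - ?t *\<^sub>R x)" by (rule nn)
    also have "\<dots> = quad S x * (quad S x * quad S y - ?t\<^sup>2)"
      using symS[of y x]
      by (simp add: quad_def matrix_vector_mult_diff_distrib matrix_vector_mult_scaleR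
          inner_diff_left inner_diff_right inner_commute power2_eq_square algebra_simps)
    finally show ?thesis using pos by (simp add: zero_le_mult_iff)
  qed (simp add: quad_def)
  have hD: "(h x y)\<^sup>2 \<le> quad D x * quad S y" for x y
  proof -
    have "h x y = - (A x \<bullet> (S *v y))"
      using h_swap[of y x] symS[of "A x" y] by (simp add: SA M inner_commute)
    then show ?thesis using cs[of "A x" y] by (simp add: quadD)
  qed
  \<comment> \<open>\<open>D\<close> lies below \<open>S\<close> and may fail to be a majorant. The
    mixed estimates \<open>hD\<close>, which come from Cauchy-Schwarz for \<open>S\<close>, suffice
    for the average.\<close>
  have "(1/2) *\<^sub>R (S + D) \<in> majorants"
  proof (rule average_in_majorants)
    fix x y
    show "4 * (h x y)\<^sup>2 \<le> (quad S x + quad D x) * (quad S y + quad D y)"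
      using amgm_from_product[of "(h x y)\<^sup>2" "quad D x * quad S y" "quad S x * quad D y"
          "quad S x * quad S y" "quad D x * quad D y"] hD[of x y] hD[of y x] h_swap[of x y] nn quadD
      by (simp add: algebra_simps)
  qed (use sym nn quadD symMT in \<open>auto simp: D_def transpose_def vec_eq_iff\<close>)
  moreover have "quad_energy g ((1/2) *\<^sub>R (S + D)) \<le> m" if "g \<in> G" for g
  proof -
    have "quad_energy g ((1/2) *\<^sub>R (S + D)) \<le> quad_energy g S"
      unfolding quad_energy_def using D_le nn quadD
      by (intro sum_mono power_mono) (auto simp: quad_scaleR quad_add)
    then show ?thesis using Sm[OF that] by linarith
  qed
  ultimately have "(1/2) *\<^sub>R (S + D) = S" by (rule uniq)
  then have "D = S" by (simp add: vec_eq_iff field_simps)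
  then have SM: "S *v x = - (M *v A x)" for x using Dv[of x] by simp
  define J where "J = - (T ** M)"
  have J: "J *v x = - A x" for x by (simp add: J_def A_def minus_matrix_vector_mult matrix_vector_mul_assoc)
  have Aneg: "A (- x) = - A x" for x by (simp add: A_def matrix_vector_mult_minus minus_matrix_vector_mult)
  have hJ: "h x (J *v y) = x \<bullet> (S *v y)" for x y
    by (simp add: J M SM h_simps matrix_vector_mult_minus minus_matrix_vector_mult)
  have JJ: "J *v (J *v x) = - x" for x
  proof -
    have "A (A x) = T *v (- (S *v x))" using SM[of x] by (simp add: A_def[of "A x"])
    also have "\<dots> = - x" by (simp add: matrix_vector_mult_minus minus_matrix_vector_mult matrix_vector_mul_assoc TS)
    finally show ?thesis by (simp add: J Aneg)
  qed
  have "h (J *v x) (J *v y) = h x y" for x y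
    using hJ[of "J *v x" y] hJ[of y "J *v x"] symS[of y "J *v x"] h_swap[of x y]
    by (simp add: JJ h_simps inner_commute)
  moreover have "0 < h x (J *v x)" if "x \<noteq> 0" for x
    using quad_pos_majorant[OF S that] by (simp add: hJ quad_def)
  moreover have "g ** J = J ** g" if g: "g \<in> G" for g
  proof -
    have "h (g *v x) (J *v (g *v y)) = h (g *v x) (g *v (J *v y))" for x y
      by (simp add: hJ invS[OF g] pres[OF g])
    then have eq: "h (J *v (g *v y) - g *v (J *v y)) (g *v x) = 0" for x y
      by (simp add: h_swap[of _ "g *v x"] bilinear_rsub[OF bilinear_h])
    have "h (J *v (g *v y) - g *v (J *v y)) x = 0" for x y
    proof -
      obtain x' where "x = g *v x'" using surj[OF g] by (rule surjE)
      then show ?thesis by (simp only: eq)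
    qed
    then have "J *v (g *v y) - g *v (J *v y) = 0" for y
      by (rule h_nondegenerate)
    then show ?thesis
      by (simp add: matrix_eq matrix_vector_mul_assoc[symmetric])
  qed
  ultimately show ?thesis by (intro that[of J] JJ)
qed

end


section \<open>Maximal compact subgroups\<close>

lemma tendsto_matrix_vector_mult [tendsto_intros]:
  fixes g :: "'a \<Rightarrow> ('b::real_normed_algebra_1)^'n^'m"
  assumes "(g \<longlongrightarrow> G) F" "(x \<longlongrightarrow> X) F"
  shows "((\<lambda>a. g a *v x a) \<longlongrightarrow> G *v X) F"
  unfolding matrix_vector_mult_def using assms
  by (intro tendsto_vec_lambda tendsto_sum tendsto_mult tendsto_vec_nth)

lemma tendsto_matrix_matrix_mult [tendsto_intros]:
  fixes g :: "'a \<Rightarrow> ('b::real_normed_algebra_1)^'n^'m"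
  assumes "(g \<longlongrightarrow> G) F" "(x \<longlongrightarrow> X) F"
  shows "((\<lambda>a. g a ** x a) \<longlongrightarrow> G ** X) F"
  unfolding matrix_matrix_mult_def using assms
  by (intro tendsto_vec_lambda tendsto_sum tendsto_mult tendsto_vec_nth)

lemma continuous_on_matrix_vector_mult [continuous_intros]:
  fixes g :: "'a::topological_space \<Rightarrow> ('b::real_normed_algebra_1)^'n^'m"
  shows "continuous_on A g \<Longrightarrow> continuous_on A x \<Longrightarrow> continuous_on A (\<lambda>a. g a *v x a)"
  by (auto simp: continuous_on_def intro!: tendsto_intros)

lemma continuous_on_matrix_matrix_mult [continuous_intros]:
  fixes g :: "'a::topological_space \<Rightarrow> ('b::real_normed_algebra_1)^'n^'m"
  shows "continuous_on A g \<Longrightarrow> continuous_on A x \<Longrightarrow> continuous_on A (\<lambda>a. g a ** x a)"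
  by (auto simp: continuous_on_def intro!: tendsto_intros)

lemmas tendsto_vec_cnj [tendsto_intros] = bounded_linear.tendsto[OF bounded_linear_vec_cnj]
lemmas continuous_on_vec_cnj [continuous_intros] = bounded_linear.continuous_on[OF bounded_linear_vec_cnj]

definition complexify_matrix :: "real^'v^'v \<Rightarrow> complex^'v^'v" where
  "complexify_matrix a = (\<chi> i j. complex_of_real (a $ i $ j))"

lemma complexify_matrix_mult_vec:
  "vec_Re (complexify_matrix a *v x) = a *v vec_Re x"
  "vec_Im (complexify_matrix a *v x) = a *v vec_Im x"
  by (simp_all add: complexify_matrix_def vec_Re_def vec_Im_def vec_eq_iff matrix_vector_mult_def)

lemma complexify_matrix_of_real: "complexify_matrix a *v vec_of_real x = vec_of_real (a *v x)"
  by (simp add: complexify_matrix_def vec_of_real_def vec_eq_iff matrix_vector_mult_def)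

lemma complexify_matrix_mult: "complexify_matrix (a ** b) = complexify_matrix a ** complexify_matrix b"
  by (simp add: complexify_matrix_def vec_eq_iff matrix_matrix_mult_def)

lemma complexify_matrix_1: "complexify_matrix (mat 1) = mat 1"
  by (simp add: complexify_matrix_def vec_eq_iff mat_def)

lemma vec_cnj_complexify_matrix: "vec_cnj (complexify_matrix a *v x) = complexify_matrix a *v vec_cnj x"
  by (simp add: complexify_matrix_def vec_cnj_def vec_eq_iff matrix_vector_mult_def)

lemma matrix_vector_mult_axis: "((g :: 'a::semiring_1^'n^'m) *v axis j 1) $ i = g $ i $ j"
  by (simp add: matrix_vector_mult_def axis_def if_distrib cong: if_cong)

lemma real_matrix:
  assumes "\<And>x. vec_cnj (g *v x) = g *v vec_cnj x"
  shows "g = complexify_matrix (\<chi> i j. Re (g $ i $ j))"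
proof -
  have "cnj (g $ i $ j) = g $ i $ j" for i j
  proof -
    have "vec_cnj (axis j 1) = (axis j 1 :: complex^'a)"
      by (simp add: vec_cnj_def axis_def vec_eq_iff)
    then have "vec_cnj (g *v axis j 1) $ i = (g *v axis j 1) $ i"
      using assms[of "axis j 1"] by simp
    then show ?thesis by (simp add: vec_cnj_def matrix_vector_mult_axis)
  qed
  then have "g $ i $ j = complex_of_real (Re (g $ i $ j))" for i j
    by (metis Reals_cnj_iff of_real_Re)
  then show ?thesis
    by (simp add: complexify_matrix_def vec_eq_iff)
qed

context symplectic_space
begin

lemma Sp_complexD: "g \<in> Sp_complex h \<Longrightarrow> \<sigma> (g *v x) (g *v y) = \<sigma> x y"
  by (simp add: Sp_complex_def)

lemma Sp_complex_inj: assumes "g \<in> Sp_complex h" shows "inj ((*v) g)"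
proof (rule vec.linear_inj_iff_eq_0[THEN iffD2, rule_format])
  show "Vector_Spaces.linear (*s) (*s) ((*v) g)" by (rule matrix_vector_mul_linear_gen)
  fix x assume "g *v x = 0"
  then show "x = 0" using Sp_complexD[OF assms, of x] by (intro \<sigma>_nondegenerate) simp
qed

lemma Sp_complex_inv:
  assumes "g \<in> Sp_complex h"
  shows "matrix_inv g ** g = mat 1" "g ** matrix_inv g = mat 1"
    "matrix_inv g *v (g *v x) = x" "g *v (matrix_inv g *v x) = x"
proof -
  have "invertible g"
    using Sp_complex_inj[OF assms] by (metis matrix_left_invertible_injective invertible_left_inverse)
  then have 1: "g ** matrix_inv g = mat 1 \<and> matrix_inv g ** g = mat 1"
    unfolding matrix_inv_def invertible_def by (rule someI_ex)
  then show "matrix_inv g ** g = mat 1" "g ** matrix_inv g = mat 1" by auto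
  with 1 show "matrix_inv g *v (g *v x) = x" "g *v (matrix_inv g *v x) = x"
    by (simp_all add: matrix_vector_mul_assoc)
qed

lemma Sp_complex_group:
  "mat 1 \<in> Sp_complex h" "a \<in> Sp_complex h \<Longrightarrow> b \<in> Sp_complex h \<Longrightarrow> a ** b \<in> Sp_complex h"
  "a \<in> Sp_complex h \<Longrightarrow> matrix_inv a \<in> Sp_complex h"
proof -
  show "matrix_inv a \<in> Sp_complex h" if a: "a \<in> Sp_complex h"
    unfolding Sp_complex_def mem_Collect_eq
    by (metis Sp_complexD Sp_complex_inv(4) a)
qed (simp_all add: Sp_complex_def matrix_vector_mul_assoc[symmetric])

lemma complexify_preserving:
  "complexify_matrix a \<in> Sp_complex h \<longleftrightarrow> (\<forall>x y. h (a *v x) (a *v y) = h x y)"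
proof
  assume a: "complexify_matrix a \<in> Sp_complex h"
  have "h (a *v x) (a *v y) = h x y" for x y
    using Sp_complexD[OF a, of "vec_of_real x" "vec_of_real y"]
    by (simp add: complexify_matrix_of_real) (simp add: complexify_form_def h_simps)
  then show "\<forall>x y. h (a *v x) (a *v y) = h x y" by blast
qed (simp add: Sp_complex_def complexify_form_def complexify_matrix_mult_vec)

lemma Sp_real_eq: "Sp_real h = {g \<in> Sp_complex h. \<forall>x. vec_cnj (g *v x) = g *v vec_cnj x}"
proof -
  have "Sp_real h = complexify_matrix ` {a. complexify_matrix a \<in> Sp_complex h}"
    unfolding complexify_preserving Sp_real_def by (simp add: complexify_matrix_def[abs_def])
  also have "\<dots> = {g \<in> Sp_complex h. \<forall>x. vec_cnj (g *v x) = g *v vec_cnj x}"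
  proof (intro set_eqI iffI)
    fix g assume g: "g \<in> {g \<in> Sp_complex h. \<forall>x. vec_cnj (g *v x) = g *v vec_cnj x}"
    then have "g = complexify_matrix (\<chi> i j. Re (g $ i $ j))" by (intro real_matrix) blast
    with g show "g \<in> complexify_matrix ` {a. complexify_matrix a \<in> Sp_complex h}"
      by (intro image_eqI) auto
  qed (auto simp: vec_cnj_complexify_matrix)
  finally show ?thesis .
qed

end

section \<open>The Hermitian inner product and the unitary group of a compatible complex
  structure\<close>

locale compatible_structure = symplectic_space h for h :: "real^'v \<Rightarrow> real^'v \<Rightarrow> real" +
  fixes J :: "complex^'v^'v"
  assumes JJ [simp]: "J *v (J *v x) = - x"
    and \<sigma>_J [simp]: "\<sigma> (J *v x) (J *v y) = \<sigma> x y"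
    and cnj_J [simp]: "vec_cnj (J *v x) = J *v vec_cnj x"
    and J_pos: "x \<noteq> 0 \<Longrightarrow> 0 < Re (\<sigma> x (J *v vec_cnj x))"
begin

definition ip :: "complex^'v \<Rightarrow> complex^'v \<Rightarrow> complex" where
  "ip x y = \<sigma> x (J *v vec_cnj y)"

lemma ip_simps [simp]:
  "ip (x + y) z = ip x z + ip y z" "ip z (x + y) = ip z x + ip z y"
  "ip (x - y) z = ip x z - ip y z" "ip z (x - y) = ip z x - ip z y"
  "ip (c *s x) z = c * ip x z" "ip z (c *s x) = cnj c * ip z x"
  "ip 0 z = 0" "ip z 0 = 0" "ip (- x) z = - ip x z" "ip z (- x) = - ip z x"
  by (simp_all add: ip_def matrix_vector_right_distrib matrix_vector_mult_diff_distrib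
      vector_scalar_commute matrix_vector_mult_minus)

lemma ip_scaleR [simp]: "ip (r *\<^sub>R x) z = of_real r * ip x z" "ip z (r *\<^sub>R x) = of_real r * ip z x"
  by (simp_all add: scaleR_eq_vector_scalar)

lemma ip_sum: "ip (sum f A) z = (\<Sum>a\<in>A. ip (f a) z)" "ip z (sum f A) = (\<Sum>a\<in>A. ip z (f a))"
  by (induction A rule: infinite_finite_induct) auto

lemma ip_cnj_sym: "cnj (ip x y) = ip y x"
proof -
  have "cnj (ip x y) = \<sigma> (vec_cnj x) (J *v y)"
    by (simp add: ip_def flip: \<sigma>_cnj)
  also have "\<dots> = \<sigma> (J *v vec_cnj x) (- y)"
    using \<sigma>_J[of "vec_cnj x" "J *v y"] by simp
  also have "\<dots> = ip y x"
    using \<sigma>_swap[of "J *v vec_cnj x" y] by (simp add: ip_def)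
  finally show ?thesis .
qed

lemma ip_self_real: "ip x x = of_real (Re (ip x x))"
  using ip_cnj_sym[of x x] by (metis Reals_cnj_iff of_real_Re)

lemma ip_pos: "x \<noteq> 0 \<Longrightarrow> 0 < Re (ip x x)"
  using J_pos by (simp add: ip_def)

lemma ip_nonneg: "0 \<le> Re (ip x x)"
  using ip_pos[of x] by (cases "x = 0") auto

lemma ip_eq_0_iff: "ip x x = 0 \<longleftrightarrow> x = 0"
  using ip_pos[of x] by (cases "x = 0") auto

lemma bounded_bilinear_ip: "bounded_bilinear ip"
  by (intro bilinear_conv_bounded_bilinear[THEN iffD1])
    (simp add: bilinear_def linear_iff, simp add: scaleR_conv_of_real)

lemmas tendsto_ip [tendsto_intros] = bounded_bilinear.tendsto[OF bounded_bilinear_ip]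
lemmas continuous_on_ip [continuous_intros] = bounded_bilinear.continuous_on[OF bounded_bilinear_ip]

lemma ip_ge_norm: obtains c where "0 < c" "\<And>x. c * (norm x)\<^sup>2 \<le> Re (ip x x)"
proof -
  have "\<exists>u\<in>sphere 0 1. \<forall>x\<in>sphere 0 1. Re (ip u u) \<le> Re (ip x x)"
  proof (rule continuous_attains_inf)
    show "sphere (0 :: complex^'v) 1 \<noteq> {}"
      using vector_choose_size[of 1] by (metis dist_0_norm empty_iff mem_sphere zero_le_one)
  qed (auto intro!: continuous_intros)
  then obtain u where u: "norm u = 1" and min: "\<And>x. norm x = 1 \<Longrightarrow> Re (ip u u) \<le> Re (ip x x)"
    by auto
  have "Re (ip u u) * (norm x)\<^sup>2 \<le> Re (ip x x)" for x
  proof (cases "x = 0")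
    case False
    have "Re (ip u u) \<le> Re (ip ((1 / norm x) *\<^sub>R x) ((1 / norm x) *\<^sub>R x))"
      using False by (intro min) simp
    also have "\<dots> = Re (ip x x) / (norm x)\<^sup>2"
      by (simp add: power2_eq_square)
    finally show ?thesis using False by (simp add: field_simps)
  qed simp
  moreover have "0 < Re (ip u u)" using u by (intro ip_pos) auto
  ultimately show ?thesis using that by blast
qed

definition unitary_group :: "(complex^'v^'v) set" where
  "unitary_group = {g \<in> Sp_complex h. (\<forall>x. vec_cnj (g *v x) = g *v vec_cnj x) \<and>
     (\<forall>x. g *v (J *v x) = J *v (g *v x))}"

lemma unitary_ip: "g \<in> unitary_group \<Longrightarrow> ip (g *v x) (g *v y) = ip x y"
  using Sp_complexD[of g x "J *v vec_cnj y"] by (simp add: ip_def unitary_group_def)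

lemma unitary_in_Sp: "g \<in> unitary_group \<Longrightarrow> g \<in> Sp_complex h"
  by (simp add: unitary_group_def)

lemma compact_unitary_group: "compact unitary_group"
proof -
  obtain c where c: "0 < c" "\<And>x. c * (norm x)\<^sup>2 \<le> Re (ip x x)" using ip_ge_norm by blast
  have "closed unitary_group"
    unfolding unitary_group_def Sp_complex_def mem_Collect_eq
    by (intro closed_Collect_conj closed_Collect_all closed_Collect_eq continuous_intros)
  moreover have "bounded unitary_group"
  proof -
    define b where "b j = sqrt (Re (ip (axis j 1) (axis j 1)) / c)" for j :: 'v
    have "norm g \<le> (\<Sum>i\<in>(UNIV::'v set). \<Sum>j\<in>UNIV. b j)" if g: "g \<in> unitary_group" for g
    proof -
      have e: "norm (g $ i $ j) \<le> b j" for i j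
      proof -
        have "c * (norm (g *v axis j 1))\<^sup>2 \<le> Re (ip (axis j 1) (axis j 1))"
          using c(2)[of "g *v axis j 1"] unitary_ip[OF g] by simp
        then have "norm (g *v axis j 1) \<le> b j"
          using c(1) unfolding b_def by (intro real_le_rsqrt) (simp add: field_simps)
        moreover have "norm ((g *v axis j 1) $ i) \<le> norm (g *v axis j 1)"
          by (rule Finite_Cartesian_Product.norm_nth_le)
        ultimately show ?thesis by (simp add: matrix_vector_mult_axis)
      qed
      have "norm g \<le> (\<Sum>i\<in>UNIV. norm (g $ i))"
        unfolding norm_vec_def[of g] by (rule L2_set_le_sum) simp
      also have "\<dots> \<le> (\<Sum>i\<in>UNIV. \<Sum>j\<in>UNIV. norm (g $ i $ j))"
      proof (rule sum_mono)
        show "norm (g $ i) \<le> (\<Sum>j\<in>UNIV. norm (g $ i $ j))" for i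
          unfolding norm_vec_def[of "g $ i"] by (rule L2_set_le_sum) simp
      qed
      also have "\<dots> \<le> (\<Sum>i\<in>(UNIV::'v set). \<Sum>j\<in>UNIV. b j)" by (intro sum_mono e)
      finally show ?thesis .
    qed
    then show ?thesis unfolding bounded_iff by blast
  qed
  ultimately show ?thesis by (simp add: compact_eq_bounded_closed)
qed

lemma unitary_group_subgroup: "matrix_subgroup unitary_group (Sp_real h)"
proof -
  have "matrix_inv a \<in> unitary_group" if a: "a \<in> unitary_group" for a
  proof -
    note inv = Sp_complex_inv[OF unitary_in_Sp[OF a]]
    have "vec_cnj (matrix_inv a *v x) = matrix_inv a *v vec_cnj x" for x
      using a inv(3)[of "vec_cnj (matrix_inv a *v x)"] inv(4)[of x] by (simp add: unitary_group_def) metis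
    moreover have "matrix_inv a *v (J *v x) = J *v (matrix_inv a *v x)" for x
      using a inv(3)[of "J *v (matrix_inv a *v x)"] inv(4)[of x] by (simp add: unitary_group_def)
    ultimately show ?thesis
      using Sp_complex_group(3)[OF unitary_in_Sp[OF a]] by (simp add: unitary_group_def)
  qed
  then show ?thesis
    by (auto simp: matrix_subgroup_def Sp_real_eq unitary_group_def Sp_complex_group
        matrix_vector_mul_assoc[symmetric])
qed

end

text \<open>The elements of \<open>K\<close> are complexified real matrices, so the fixed complex
  structure is found over the reals and then complexified. Commuting with it places \<open>K\<close>
  inside a compact subgroup, and maximality turns the inclusion into equality.\<close>

lemma (in symplectic_space) maximal_compact_is_unitary_group:
  assumes K: "maximal_compact_subgroup K (Sp_real h)"
  obtains J where "compatible_structure h J" "K = compatible_structure.unitary_group h J"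
proof -
  have KS: "K \<subseteq> Sp_real h" and K1: "mat 1 \<in> K" and Kc: "compact K"
    and Km: "\<And>a b. a \<in> K \<Longrightarrow> b \<in> K \<Longrightarrow> a ** b \<in> K"
    and Kmax: "\<And>M. matrix_subgroup M (Sp_real h) \<Longrightarrow> compact M \<Longrightarrow> K \<subseteq> M \<Longrightarrow> M = K"
    using K by (auto simp: maximal_compact_subgroup_def matrix_subgroup_def)
  define G where "G = (\<lambda>g :: complex^'v^'v. \<chi> i j. Re (g $ i $ j)) ` K"
  have Gc: "compact G" unfolding G_def
    by (intro compact_continuous_image Kc continuous_intros)
  have KG: "complexify_matrix (\<chi> i j. Re (g $ i $ j)) = g" if "g \<in> K" for g
    using KS that real_matrix[of g] by (auto simp: Sp_real_eq)
  have GK: "complexify_matrix a \<in> K" if "a \<in> G" for a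
    using that KG by (auto simp: G_def)
  have Gre: "(\<chi> i j. Re (complexify_matrix a $ i $ j)) = a" for a :: "real^'v^'v"
    by (simp add: complexify_matrix_def vec_eq_iff)
  have inG: "a \<in> G" if "complexify_matrix a \<in> K" for a
    unfolding G_def using that Gre[of a] by (metis imageI)
  obtain J0 :: "real^'v^'v" where J0: "\<And>x. J0 *v (J0 *v x) = - x" "\<And>x y. h (J0 *v x) (J0 *v y) = h x y"
    "\<And>x. x \<noteq> 0 \<Longrightarrow> 0 < h x (J0 *v x)" "\<And>g. g \<in> G \<Longrightarrow> g ** J0 = J0 ** g"
  proof (rule compact_group_compatible_structure[OF Gc])
    show "mat 1 \<in> G" using K1 by (intro inG) (simp add: complexify_matrix_1)
    show "a ** b \<in> G" if "a \<in> G" "b \<in> G" for a b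
      using that by (intro inG) (simp add: complexify_matrix_mult Km GK)
    show "h (g *v x) (g *v y) = h x y" if "g \<in> G" for g x y
      using GK[OF that] KS complexify_preserving[of g] by (auto simp: Sp_real_eq)
  qed blast
  define J where "J = complexify_matrix J0"
  have "compatible_structure h J"
  proof unfold_locales
    fix x y :: "complex^'v"
    show "J *v (J *v x) = - x"
    proof -
      have "complexify_matrix (J0 ** J0) = - mat 1"
      proof -
        have "J0 ** J0 = - mat 1"
          by (simp add: matrix_eq matrix_vector_mul_assoc[symmetric] J0 minus_matrix_vector_mult)
        then show ?thesis by (simp add: complexify_matrix_def vec_eq_iff mat_def)
      qed
      then show ?thesis
        by (simp add: J_def matrix_vector_mul_assoc complexify_matrix_mult[symmetric]
            minus_matrix_vector_mult)
    qed
    show "\<sigma> (J *v x) (J *v y) = \<sigma> x y"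
      using J0(2) complexify_preserving[of J0] by (auto simp: J_def Sp_complexD)
    show "vec_cnj (J *v x) = J *v vec_cnj x" by (simp add: J_def vec_cnj_complexify_matrix)
    assume "x \<noteq> 0"
    then have "vec_Re x \<noteq> 0 \<or> vec_Im x \<noteq> 0" using vec_Re_zero_iff by blast
    then have "0 < h (vec_Re x) (J0 *v vec_Re x) + h (vec_Im x) (J0 *v vec_Im x)"
      using J0(3)[of "vec_Re x"] J0(3)[of "vec_Im x"]
      by (cases "vec_Re x = 0"; cases "vec_Im x = 0") (auto simp: h_simps)
    then show "0 < Re (\<sigma> x (J *v vec_cnj x))"
      by (simp add: complexify_form_def J_def complexify_matrix_mult_vec h_simps
          matrix_vector_mult_minus)
  qed
  then interpret compatible_structure h J .
  have "K \<subseteq> unitary_group"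
  proof
    fix g assume g: "g \<in> K"
    define a where "a = (\<chi> i j. Re (g $ i $ j))"
    have ga: "g = complexify_matrix a" using KG[OF g] by (simp add: a_def)
    then have "a \<in> G" using g inG by simp
    then have "g ** J = J ** g"
      using J0(4) by (simp add: ga J_def complexify_matrix_mult[symmetric])
    then show "g \<in> unitary_group"
      using g KS by (auto simp: unitary_group_def Sp_real_eq matrix_vector_mul_assoc)
  qed
  then have "unitary_group = K"
    by (intro Kmax unitary_group_subgroup compact_unitary_group)
  then show ?thesis
    by (intro that[of J]) (unfold_locales, simp)
qed


section \<open>Linear algebra of split planes\<close>

lemma span_family: "vec.span (b ` {..<k :: nat}) = {\<Sum>i<k. c i *s b i | c. True}"
proof
  have "vec.subspace {\<Sum>i<k. c i *s b i | c. True}"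
  proof (rule vec.subspaceI)
    show "0 \<in> {\<Sum>i<k. c i *s b i | c. True}"
      by (auto intro!: exI[of _ "\<lambda>_. 0"])
    fix x y a assume "x \<in> {\<Sum>i<k. c i *s b i | c. True}"
    then obtain c where x: "x = (\<Sum>i<k. c i *s b i)" by blast
    have "a *s x = (\<Sum>i<k. (a * c i) *s b i)"
      by (simp add: x vec.scale_sum_right vector_smult_assoc)
    then show "a *s x \<in> {\<Sum>i<k. c i *s b i | c. True}" by (auto intro!: exI[of _ "\<lambda>i. a * c i"])
    assume "y \<in> {\<Sum>i<k. c i *s b i | c. True}"
    then obtain d where y: "y = (\<Sum>i<k. d i *s b i)" by blast
    have "x + y = (\<Sum>i<k. (c i + d i) *s b i)"
      by (simp add: x y sum.distrib vec.scale_left_distrib)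
    then show "x + y \<in> {\<Sum>i<k. c i *s b i | c. True}" by (auto intro!: exI[of _ "\<lambda>i. c i + d i"])
  qed
  moreover have "b j \<in> {\<Sum>i<k. c i *s b i | c. True}" if "j < k" for j
  proof -
    have "(\<Sum>i<k. (if i = j then 1 else 0) *s b i) = (\<Sum>i<k. if i = j then b i else 0)"
      by (intro sum.cong) auto
    also have "\<dots> = b j" using that by simp
    finally show ?thesis by (auto intro!: exI[of _ "\<lambda>i. if i = j then 1 else 0"])
  qed
  ultimately show "vec.span (b ` {..<k}) \<subseteq> {\<Sum>i<k. c i *s b i | c. True}"
    by (intro vec.span_minimal) auto
next
  show "{\<Sum>i<k. c i *s b i | c. True} \<subseteq> vec.span (b ` {..<k})"
    by clarsimp (intro vec.span_sum vec.span_scale vec.span_base, simp)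
qed

lemma independent_family_iff:
  "inj_on b {..<k :: nat} \<and> vec.independent (b ` {..<k}) \<longleftrightarrow>
     (\<forall>c. (\<Sum>i<k. c i *s b i) = 0 \<longrightarrow> (\<forall>i<k. c i = 0))"
proof (intro iffI allI impI)
  fix c i assume b: "inj_on b {..<k} \<and> vec.independent (b ` {..<k})"
    and s: "(\<Sum>i<k. c i *s b i) = 0" and "i < k"
  define u where "u = (\<lambda>v. c (the_inv_into {..<k} b v))"
  have ub: "u (b i) = c i" if "i < k" for i
    using b that by (simp add: u_def the_inv_into_f_f)
  have "(\<Sum>v\<in>b ` {..<k}. u v *s v) = (\<Sum>i<k. u (b i) *s b i)"
    using b by (simp add: sum.reindex)
  also have "\<dots> = 0" using s ub by simp
  finally show "c i = 0"
    using b \<open>i < k\<close> ub vec.independentD[of "b ` {..<k}" "b ` {..<k}" u "b i"] by simp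
next
  assume s: "\<forall>c. (\<Sum>i<k. c i *s b i) = 0 \<longrightarrow> (\<forall>i<k. c i = 0)"
  have inj: "inj_on b {..<k}"
  proof (rule inj_onI, rule ccontr)
    fix i j assume ij: "i \<in> {..<k}" "j \<in> {..<k}" "b i = b j" "i \<noteq> j"
    define c where "c l = (if l = i then 1 else 0) - (if l = j then 1 else 0 :: 'a)" for l
    have "(\<Sum>l<k. c l *s b l) = (\<Sum>l<k. (if l = i then b l else 0) - (if l = j then b l else 0))"
      by (intro sum.cong) (auto simp: c_def vec.scale_left_diff_distrib)
    also have "\<dots> = b i - b j" using ij by (simp add: sum_subtractf)
    finally have "c i = 0" using s ij by auto
    then show False using ij by (simp add: c_def)
  qed
  moreover have "vec.independent (b ` {..<k})"
  proof
    assume "vec.dependent (b ` {..<k})"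
    then obtain u v where u: "v \<in> b ` {..<k}" "u v \<noteq> 0" "(\<Sum>v\<in>b ` {..<k}. u v *s v) = 0"
      by (auto simp: vec.dependent_finite)
    then have "(\<Sum>i<k. u (b i) *s b i) = 0" using inj by (simp add: sum.reindex)
    then show False using s u by auto
  qed
  ultimately show "inj_on b {..<k} \<and> vec.independent (b ` {..<k})" by blast
qed

lemma dim_span_family:
  "\<forall>c. (\<Sum>i<k::nat. c i *s b i) = 0 \<longrightarrow> (\<forall>i<k. c i = 0) \<Longrightarrow> vec.dim (vec.span (b ` {..<k})) = k"
  using independent_family_iff[of b k] card_image[of b "{..<k}"]
    vec.dim_span_eq_card_independent[of "b ` {..<k}"] by simp

lemma span_vec_cnj: "x \<in> vec.span B \<Longrightarrow> vec_cnj x \<in> vec.span (vec_cnj ` B)"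
proof (induction rule: vec.span_induct_alt)
  case (step c x y)
  then show ?case by (simp add: vec.span_add vec.span_scale vec.span_base)
qed (simp add: vec.span_zero)

text \<open>Conjugation is only semilinear, so facts on images under linear maps do not apply. One
  inequality, read off from a basis, suffices because conjugation is an involution.\<close>

lemma dim_vec_cnj: "vec.dim (vec_cnj ` A) = vec.dim A"
proof -
  have le: "vec.dim (vec_cnj ` A) \<le> vec.dim A" for A :: "(complex^'a) set"
  proof -
    obtain B where B: "B \<subseteq> A" "vec.independent B" "A \<subseteq> vec.span B" "card B = vec.dim A"
      using vec.basis_exists[of A] by blast
    then have "vec.dim (vec_cnj ` A) \<le> card (vec_cnj ` B)"
      using span_vec_cnj by (intro vec.dim_le_card) (auto intro: vec.finiteI_independent)
    also have "\<dots> \<le> card B" using B vec.finiteI_independent by (intro card_image_le) auto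
    finally show ?thesis using B by simp
  qed
  from le[of A] le[of "vec_cnj ` A"] show ?thesis by (simp add: image_image)
qed

lemma subspace_vec_cnj: "vec.subspace A \<Longrightarrow> vec.subspace (vec_cnj ` A)"
proof (rule vec.subspaceI)
  assume A: "vec.subspace A"
  show "0 \<in> vec_cnj ` A" using vec.subspace_0[OF A] by (metis image_eqI vec_cnj_simps(5))
  fix c x y assume "x \<in> vec_cnj ` A"
  then obtain a where a: "a \<in> A" "x = vec_cnj a" by blast
  have "c *s x = vec_cnj (cnj c *s a)" by (simp add: a)
  then show "c *s x \<in> vec_cnj ` A" using vec.subspace_scale[OF A a(1)] by blast
  assume "y \<in> vec_cnj ` A"
  then show "x + y \<in> vec_cnj ` A"
    using a vec.subspace_add[OF A a(1)] by (auto simp flip: vec_cnj_simps(2))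
qed

context symplectic_space
begin

definition split_planes ::
    "(complex^'v) set \<Rightarrow> (complex^'v) set \<Rightarrow> nat \<Rightarrow> nat \<Rightarrow> (complex^'v) set set" where
  "split_planes L M p q = {V. vec.subspace V \<and> (\<forall>x\<in>V. \<forall>y\<in>V. \<sigma> x y = 0) \<and>
     vec.dim (V \<inter> L) = p \<and> vec.dim (V \<inter> M) = q \<and> (\<forall>x\<in>V. \<exists>a\<in>V \<inter> L. \<exists>b\<in>V \<inter> M. x = a + b)}"

definition lagrangian_pair :: "nat \<Rightarrow> (complex^'v) set \<Rightarrow> (complex^'v) set \<Rightarrow> bool" where
  "lagrangian_pair n L M \<longleftrightarrow> vec.subspace L \<and> vec.subspace M \<and> vec.dim L = n \<and> vec.dim M = n \<and>
     (\<forall>x\<in>L. \<forall>y\<in>L. \<sigma> x y = 0) \<and> (\<forall>x\<in>M. \<forall>y\<in>M. \<sigma> x y = 0) \<and> (\<forall>x. \<exists>a\<in>L. \<exists>b\<in>M. x = a + b)"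

lemma lagrangian_pair_swap: "lagrangian_pair n L M \<Longrightarrow> lagrangian_pair n M L"
proof -
  have "(\<exists>a\<in>A. \<exists>b\<in>B. x = a + b) \<longleftrightarrow> (\<exists>b\<in>B. \<exists>a\<in>A. x = b + a)" for A B and x :: "complex^'v"
    by (metis add.commute)
  then show "lagrangian_pair n L M \<Longrightarrow> lagrangian_pair n M L"
    unfolding lagrangian_pair_def by blast
qed

lemma split_planes_swap: "split_planes L M p q = split_planes M L q p"
proof -
  have "(\<exists>a\<in>A. \<exists>b\<in>B. x = a + b) \<longleftrightarrow> (\<exists>b\<in>B. \<exists>a\<in>A. x = b + a)" for A B and x :: "complex^'v"
    by (metis add.commute)
  then show ?thesis unfolding split_planes_def by (intro Collect_cong) blast
qed

end

section \<open>Eigenspaces of the complex structure and orthonormal families\<close>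

context compatible_structure
begin

text \<open>The eigenvalue is -i because with this sign \<open>hermitian_form h\<close> restricts to
  \<open>ip\<close> and is positive; on the other eigenspace it is \<open>- ip\<close>.\<close>

definition Epos :: "(complex^'v) set" where "Epos = {x. J *v x = - \<i> *s x}"
definition Eneg :: "(complex^'v) set" where "Eneg = {x. J *v x = \<i> *s x}"

lemma subspace_Epos: "vec.subspace Epos" and subspace_Eneg: "vec.subspace Eneg"
  by (auto intro!: vec.subspaceI simp: Epos_def Eneg_def matrix_vector_right_distrib
      vector_scalar_commute vec.scale_right_distrib vector_smult_assoc mult.commute)

lemma cnj_Epos [simp]: "vec_cnj x \<in> Epos \<longleftrightarrow> x \<in> Eneg"
  and cnj_Eneg [simp]: "vec_cnj x \<in> Eneg \<longleftrightarrow> x \<in> Epos"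
proof -
  have 1: "vec_cnj x \<in> Epos \<longleftrightarrow> x \<in> Eneg" for x
  proof -
    have "vec_cnj x \<in> Epos \<longleftrightarrow> vec_cnj (J *v x) = vec_cnj (\<i> *s x)"
      by (simp add: Epos_def del: vec_cnj_eq_iff)
    then show ?thesis by (simp only: Eneg_def mem_Collect_eq vec_cnj_eq_iff)
  qed
  show "vec_cnj x \<in> Epos \<longleftrightarrow> x \<in> Eneg" by (rule 1)
  show "vec_cnj x \<in> Eneg \<longleftrightarrow> x \<in> Epos" using 1[of "vec_cnj x"] by simp
qed

lemma Epos_Eneg_decomp:
  "(1/2) *s (x + \<i> *s (J *v x)) \<in> Epos" "(1/2) *s (x - \<i> *s (J *v x)) \<in> Eneg"
  "x = (1/2) *s (x + \<i> *s (J *v x)) + (1/2) *s (x - \<i> *s (J *v x))"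
  by (simp_all add: Epos_def Eneg_def vector_scalar_commute matrix_vector_right_distrib
      matrix_vector_mult_diff_distrib vec_eq_iff field_simps)

lemma Epos_isotropic: "x \<in> Epos \<Longrightarrow> y \<in> Epos \<Longrightarrow> \<sigma> x y = 0"
  and Eneg_isotropic: "x \<in> Eneg \<Longrightarrow> y \<in> Eneg \<Longrightarrow> \<sigma> x y = 0"
  using \<sigma>_J[of x y] by (simp_all add: Epos_def Eneg_def del: \<sigma>_J)

lemma ip_cnj: "ip (vec_cnj x) (vec_cnj y) = cnj (ip x y)"
  by (simp add: ip_def flip: \<sigma>_cnj)

lemma J_cnj: "y \<in> Epos \<Longrightarrow> J *v vec_cnj y = \<i> *s vec_cnj y" "y \<in> Eneg \<Longrightarrow> J *v vec_cnj y = - \<i> *s vec_cnj y"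
  using cnj_Eneg[of y] cnj_Epos[of y] by (auto simp: Epos_def Eneg_def simp del: cnj_Eneg cnj_Epos cnj_J)

lemma ip_Epos_Eneg: "x \<in> Epos \<Longrightarrow> y \<in> Eneg \<Longrightarrow> ip x y = 0"
  by (simp add: ip_def Epos_isotropic flip: cnj_J)
    (simp add: Eneg_def Epos_isotropic)

lemma ip_J: "ip (J *v x) (J *v y) = ip x y"
  by (simp add: ip_def del: JJ)

lemma \<sigma>_Epos_cnj: "y \<in> Epos \<Longrightarrow> \<sigma> x (vec_cnj y) = - \<i> * ip x y"
proof -
  assume "y \<in> Epos"
  then show ?thesis by (simp add: ip_def J_cnj)
qed

lemma hermitian_Epos: "x \<in> Epos \<Longrightarrow> hermitian_form h x x = ip x x"
  by (simp add: hermitian_form_def \<sigma>_Epos_cnj)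

lemma hermitian_Eneg: "x \<in> Eneg \<Longrightarrow> hermitian_form h x x = - ip x x"
proof -
  assume "x \<in> Eneg"
  then show ?thesis by (simp add: ip_def hermitian_form_def J_cnj)
qed

lemma dim_Epos: "CARD('v) = 2 * n \<Longrightarrow> vec.dim Epos = n"
  and dim_Eneg: "CARD('v) = 2 * n \<Longrightarrow> vec.dim Eneg = n"
proof -
  have "Eneg = vec_cnj ` Epos"
    by (auto simp: image_iff) (metis cnj_Epos vec_cnj_simps(1))
  then have eq: "vec.dim Eneg = vec.dim Epos" by (simp add: dim_vec_cnj)
  have "Epos \<inter> Eneg = {0}"
  proof -
    have "x = 0" if "x \<in> Epos" "x \<in> Eneg" for x
      using ip_Epos_Eneg[OF that] ip_eq_0_iff by simp
    then show ?thesis using vec.subspace_0[OF subspace_Epos] vec.subspace_0[OF subspace_Eneg] by auto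
  qed
  moreover have "{x + y |x y. x \<in> Epos \<and> y \<in> Eneg} = UNIV"
    using Epos_Eneg_decomp by blast
  ultimately have "vec.dim (UNIV :: (complex^'v) set) = vec.dim Epos + vec.dim Eneg"
    using vec.dim_sums_Int[OF subspace_Epos subspace_Eneg] by simp
  then have "CARD('v) = 2 * vec.dim Epos" using eq by (metis vec_dim_card mult_2)
  then show "CARD('v) = 2 * n \<Longrightarrow> vec.dim Epos = n" "CARD('v) = 2 * n \<Longrightarrow> vec.dim Eneg = n"
    using eq by auto
qed

lemma lagrangian_pair_E: "CARD('v) = 2 * n \<Longrightarrow> lagrangian_pair n Epos Eneg"
  unfolding lagrangian_pair_def
  using subspace_Epos subspace_Eneg dim_Epos dim_Eneg Epos_isotropic Eneg_isotropic Epos_Eneg_decomp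
  by blast

definition orthonormal :: "nat \<Rightarrow> (nat \<Rightarrow> complex^'v) \<Rightarrow> bool" where
  "orthonormal m e \<longleftrightarrow> (\<forall>i<m. \<forall>j<m. ip (e i) (e j) = (if i = j then 1 else 0))"

lemma ip_orthonormal_sum:
  "orthonormal m e \<Longrightarrow> j < m \<Longrightarrow> ip (\<Sum>i<m. c i *s e i) (e j) = c j"
proof -
  assume e: "orthonormal m e" and j: "j < m"
  have "ip (\<Sum>i<m. c i *s e i) (e j) = (\<Sum>i<m. if i = j then c i else 0)"
    unfolding ip_sum using e j by (intro sum.cong) (auto simp: orthonormal_def)
  then show ?thesis using j by simp
qed

lemma orthonormal_independent:
  assumes "orthonormal m e" "(\<Sum>i<m. c i *s e i) = 0" "i < m" shows "c i = 0"
  using ip_orthonormal_sum[OF assms(1,3), of c] assms(2) by simp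

lemma orthonormal_expand:
  assumes "orthonormal m e" "x \<in> vec.span (e ` {..<m})"
  shows "x = (\<Sum>i<m. ip x (e i) *s e i)"
proof -
  obtain c where c: "x = (\<Sum>i<m. c i *s e i)" using assms(2) by (auto simp: span_family)
  then show ?thesis using ip_orthonormal_sum[OF assms(1)] by simp
qed

lemma orthonormal_extend:
  assumes "orthonormal m e" "e ` {..<m} \<subseteq> B" "vec.subspace B"
  obtains e' where "\<And>i. i < m \<Longrightarrow> e' i = e i" "orthonormal (vec.dim B) e'"
    "vec.span (e' ` {..<vec.dim B}) = B" "m \<le> vec.dim B"
  using assms
proof (induction "vec.dim B - m" arbitrary: m e thesis)
  case 0
  let ?S = "vec.span (e ` {..<m})"
  have dimS: "vec.dim ?S = m"
    using orthonormal_independent[OF 0(3)] by (intro dim_span_family) blast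
  have sub: "?S \<subseteq> B" using 0 by (intro vec.span_minimal)
  then have le: "m \<le> vec.dim B" using dimS vec.dim_subset[OF sub] by simp
  then have eq: "vec.dim B = m" using 0 by simp
  then have "?S = B" using sub dimS 0 by (intro vec.subspace_dim_equal) auto
  then show ?case using 0 eq le by (intro 0(2)[of e]) auto
next
  case (Suc k)
  let ?S = "vec.span (e ` {..<m})"
  have dimS: "vec.dim ?S = m"
    using orthonormal_independent[OF Suc(4)] by (intro dim_span_family) blast
  have "?S \<noteq> B" using dimS Suc(2) by auto
  moreover have "?S \<subseteq> B" using Suc by (intro vec.span_minimal)
  ultimately obtain x where x: "x \<in> B" "x \<notin> ?S" by blast
  define y where "y = x - (\<Sum>i<m. ip x (e i) *s e i)"
  have sum: "(\<Sum>i<m. ip x (e i) *s e i) \<in> ?S"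
    by (intro vec.span_sum vec.span_scale vec.span_base) auto
  then have yB: "y \<in> B" using \<open>?S \<subseteq> B\<close> x Suc(6) by (auto simp: y_def intro: vec.subspace_diff)
  have y0: "y \<noteq> 0" using x(2) sum by (auto simp: y_def)
  have ye: "ip y (e j) = 0" if "j < m" for j
    using ip_orthonormal_sum[OF Suc(4) that] by (simp add: y_def)
  define c where "c = complex_of_real (1 / sqrt (Re (ip y y)))"
  define f where "f = e(m := c *s y)"
  have "ip (c *s y) (c *s y) = 1"
  proof -
    have "ip (c *s y) (c *s y) = c * c * of_real (Re (ip y y))"
      using ip_self_real[of y] by (simp add: c_def)
    also have "\<dots> = of_real ((1 / sqrt (Re (ip y y)))\<^sup>2 * Re (ip y y))"
      by (simp only: c_def of_real_mult power2_eq_square)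
    also have "\<dots> = 1" using ip_pos[OF y0] by (simp add: power_divide)
    finally show ?thesis .
  qed
  moreover have "ip (e j) y = 0" if "j < m" for j
    using ye[OF that] ip_cnj_sym[of y "e j"] by simp
  ultimately have on: "orthonormal (Suc m) f"
    using Suc(4) ye by (auto simp: orthonormal_def f_def less_Suc_eq)
  have fB: "f ` {..<Suc m} \<subseteq> B"
    using Suc(5,6) yB by (auto simp: f_def less_Suc_eq vec.subspace_scale)
  have k: "k = vec.dim B - Suc m" using Suc(2) by linarith
  obtain e' where e': "\<And>i. i < Suc m \<Longrightarrow> e' i = f i" "orthonormal (vec.dim B) e'"
    "vec.span (e' ` {..<vec.dim B}) = B" "Suc m \<le> vec.dim B"
    by (rule Suc(1)[OF k _ on fB Suc(6)]) blast
  show ?case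
  proof (rule Suc(3)[of e'])
    show "e' i = e i" if "i < m" for i using e'(1)[of i] that by (simp add: f_def)
  qed (use e' in auto)
qed

lemma orthonormal_basis:
  assumes "vec.subspace B"
  obtains e where "orthonormal (vec.dim B) e" "vec.span (e ` {..<vec.dim B}) = B"
  using orthonormal_extend[of 0 "\<lambda>_. 0" B] assms by (auto simp: orthonormal_def)

end

section \<open>The action on planes and cycles\<close>

lemma linear_matrix_vector_mult: "Vector_Spaces.linear (*s) (*s) ((*v) (g :: 'a::field^'n^'m))"
  by (rule matrix_vector_mul_linear_gen)

lemma act_plane_span: "act_plane g (vec.span S) = vec.span ((*v) g ` S)"
  unfolding act_plane_def by (simp add: vec.linear_span_image[OF linear_matrix_vector_mult])

lemma act_plane_mult: "act_plane (g ** g') V = act_plane g (act_plane g' V)"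
  by (simp add: act_plane_def image_image matrix_vector_mul_assoc)

lemma act_plane_1 [simp]: "act_plane (mat 1) V = V"
  by (simp add: act_plane_def)

lemma subspace_act_plane: "vec.subspace V \<Longrightarrow> vec.subspace (act_plane g V)"
  unfolding act_plane_def by (rule vec.linear_subspace_image[OF linear_matrix_vector_mult])

lemma act_cycle_mult: "act_cycle (g ** g') C = act_cycle g (act_cycle g' C)"
  by (simp add: act_cycle_def image_image act_plane_mult)

lemma act_cycle_1 [simp]: "act_cycle (mat 1) C = C"
  by (simp add: act_cycle_def)

context symplectic_space
begin

lemma dim_act_plane: "g \<in> Sp_complex h \<Longrightarrow> vec.dim (act_plane g V) = vec.dim V"
  unfolding act_plane_def
  using Sp_complex_inj by (intro vec.dim_image_eq[OF linear_matrix_vector_mult]) (auto intro: inj_on_subset)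

lemma act_plane_inv [simp]:
  "g \<in> Sp_complex h \<Longrightarrow> act_plane (matrix_inv g) (act_plane g V) = V"
  "g \<in> Sp_complex h \<Longrightarrow> act_plane g (act_plane (matrix_inv g) V) = V"
  by (simp_all flip: act_plane_mult add: Sp_complex_inv)

lemma act_cycle_inv [simp]:
  "g \<in> Sp_complex h \<Longrightarrow> act_cycle (matrix_inv g) (act_cycle g V) = V"
  "g \<in> Sp_complex h \<Longrightarrow> act_cycle g (act_cycle (matrix_inv g) V) = V"
  by (simp_all flip: act_cycle_mult add: Sp_complex_inv)

lemma act_plane_Int: "g \<in> Sp_complex h \<Longrightarrow> act_plane g (A \<inter> B) = act_plane g A \<inter> act_plane g B"
  unfolding act_plane_def using Sp_complex_inj by (intro image_Int) auto

lemma act_plane_split_planes: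
  assumes g: "g \<in> Sp_complex h" and V: "V \<in> split_planes L M p q"
  shows "act_plane g V \<in> split_planes (act_plane g L) (act_plane g M) p q"
proof -
  have "\<exists>a\<in>act_plane g V \<inter> act_plane g L. \<exists>b\<in>act_plane g V \<inter> act_plane g M. x = a + b"
    if x: "x \<in> act_plane g V" for x
  proof -
    obtain y where y: "y \<in> V" "x = g *v y" using x by (auto simp: act_plane_def)
    then obtain a b where "a \<in> V \<inter> L" "b \<in> V \<inter> M" "y = a + b"
      using V unfolding split_planes_def by blast
    then have "g *v a \<in> act_plane g V \<inter> act_plane g L" "g *v b \<in> act_plane g V \<inter> act_plane g M"
      "x = g *v a + g *v b"
      using y by (auto simp: act_plane_def matrix_vector_right_distrib)
    then show ?thesis by blast
  qed
  moreover have "\<sigma> x y = 0" if "x \<in> act_plane g V" "y \<in> act_plane g V" for x y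
    using that V by (auto simp: act_plane_def split_planes_def Sp_complexD[OF g])
  ultimately show ?thesis
    using V by (auto simp: split_planes_def subspace_act_plane dim_act_plane[OF g] simp flip: act_plane_Int[OF g])
qed

lemma act_cycle_split_planes:
  assumes g: "g \<in> Sp_complex h"
  shows "act_cycle g (split_planes L M p q) = split_planes (act_plane g L) (act_plane g M) p q"
proof
  show "act_cycle g (split_planes L M p q) \<subseteq> split_planes (act_plane g L) (act_plane g M) p q"
    using act_plane_split_planes[OF g] by (auto simp: act_cycle_def)
  have "act_plane (matrix_inv g) V \<in> split_planes L M p q"
    if "V \<in> split_planes (act_plane g L) (act_plane g M) p q" for V
    using act_plane_split_planes[OF Sp_complex_group(3)[OF g] that] g by simp
  then show "split_planes (act_plane g L) (act_plane g M) p q \<subseteq> act_cycle g (split_planes L M p q)"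
    unfolding act_cycle_def using act_plane_inv(2)[OF g] by (metis image_eqI subsetI)
qed

lemma lagrangian_pair_act:
  assumes g: "g \<in> Sp_complex h" and L: "lagrangian_pair n L M"
  shows "lagrangian_pair n (act_plane g L) (act_plane g M)"
proof -
  have "\<exists>a\<in>act_plane g L. \<exists>b\<in>act_plane g M. x = a + b" for x
  proof -
    obtain a b where "a \<in> L" "b \<in> M" "matrix_inv g *v x = a + b"
      using L unfolding lagrangian_pair_def by blast
    then have "x = g *v a + g *v b"
      by (metis Sp_complex_inv(4) g matrix_vector_right_distrib)
    then show ?thesis using \<open>a \<in> L\<close> \<open>b \<in> M\<close> by (auto simp: act_plane_def)
  qed
  moreover have iso: "\<forall>x\<in>act_plane g A. \<forall>y\<in>act_plane g A. \<sigma> x y = 0"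
    if "\<forall>x\<in>A. \<forall>y\<in>A. \<sigma> x y = 0" for A
    using that by (auto simp: act_plane_def Sp_complexD[OF g])
  moreover have "vec.subspace (act_plane g L)" "vec.subspace (act_plane g M)"
    "vec.dim (act_plane g L) = n" "vec.dim (act_plane g M) = n"
    using L by (auto simp: lagrangian_pair_def subspace_act_plane dim_act_plane[OF g])
  moreover have "\<forall>x\<in>L. \<forall>y\<in>L. \<sigma> x y = 0" "\<forall>x\<in>M. \<forall>y\<in>M. \<sigma> x y = 0"
    using L by (auto simp: lagrangian_pair_def)
  ultimately show ?thesis
    unfolding lagrangian_pair_def by blast
qed

end

section \<open>Transitivity of the unitary group on split planes\<close>

context compatible_structure
begin

text \<open>Isotropy of \<open>V\<close> says that the conjugate of \<open>V \<inter> Eneg\<close>,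
  a subspace of \<open>Epos\<close>, is orthogonal to \<open>V \<inter> Epos\<close>. Both therefore
  fit into one orthonormal basis of \<open>Epos\<close>, which also gives
  \<open>p + q \<le> n\<close>.\<close>

lemma split_plane_basis:
  assumes V: "V \<in> split_planes Epos Eneg p q" and n: "CARD('v) = 2 * n"
  obtains e where "orthonormal n e" "vec.span (e ` {..<n}) = Epos" "p + q \<le> n"
    "V = vec.span (e ` {..<p} \<union> (\<lambda>i. vec_cnj (e i)) ` {p..<p+q})"
proof -
  define W where "W = vec_cnj ` (V \<inter> Eneg)"
  have sV: "vec.subspace V" using V by (simp add: split_planes_def)
  have sA: "vec.subspace (V \<inter> Epos)" and sB: "vec.subspace (V \<inter> Eneg)"
    using sV subspace_Epos subspace_Eneg by (auto intro: vec.subspace_inter)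
  have sW: "vec.subspace W" unfolding W_def by (rule subspace_vec_cnj[OF sB])
  have dA: "vec.dim (V \<inter> Epos) = p" and dW: "vec.dim W = q"
    using V by (auto simp: split_planes_def W_def dim_vec_cnj)
  obtain a where a: "orthonormal p a" "vec.span (a ` {..<p}) = V \<inter> Epos"
    using orthonormal_basis[OF sA] dA by blast
  obtain w where w: "orthonormal q w" "vec.span (w ` {..<q}) = W"
    using orthonormal_basis[OF sW] dW by blast
  have aV: "a i \<in> V \<inter> Epos" if "i < p" for i
    using that a(2) by (metis imageI lessThan_iff vec.span_base)
  have wW: "w i \<in> W" if "i < q" for i
    using that w(2) by (metis imageI lessThan_iff vec.span_base)
  have wE: "w i \<in> Epos" if "i < q" for i using wW[OF that] by (auto simp: W_def)
  have ortho: "ip x y = 0" if "x \<in> V \<inter> Epos" "y \<in> W" for x y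
  proof -
    obtain z where z: "z \<in> V" "z \<in> Eneg" "y = vec_cnj z" using \<open>y \<in> W\<close> by (auto simp: W_def)
    have "\<sigma> x z = 0" using V z(1) that(1) by (auto simp: split_planes_def)
    then show ?thesis using z(2) by (simp add: z(3) ip_def Eneg_def)
  qed
  then have ortho': "ip y x = 0" if "x \<in> V \<inter> Epos" "y \<in> W" for x y
    using that by (metis complex_cnj_zero ip_cnj_sym)
  define e0 where "e0 i = (if i < p then a i else w (i - p))" for i
  have "orthonormal (p + q) e0"
    unfolding orthonormal_def
  proof (intro allI impI)
    fix i j assume "i < p + q" "j < p + q"
    then show "ip (e0 i) (e0 j) = (if i = j then 1 else 0)"
      using a(1) w(1) ortho[OF aV wW] ortho'[OF aV wW]
      by (cases "i < p"; cases "j < p") (auto simp: e0_def orthonormal_def)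
  qed
  moreover have "e0 ` {..<p + q} \<subseteq> Epos"
    using aV wE by (auto simp: e0_def)
  ultimately obtain e where e: "\<And>i. i < p + q \<Longrightarrow> e i = e0 i" "orthonormal n e"
    "vec.span (e ` {..<n}) = Epos" "p + q \<le> n"
    using orthonormal_extend[OF _ _ subspace_Epos, of "p + q" e0] dim_Epos[OF n] by metis
  have "e ` {..<p} = a ` {..<p}"
    using e(1) by (intro image_cong) (auto simp: e0_def)
  then have 1: "V \<inter> Epos = vec.span (e ` {..<p})" using a(2) by simp
  have im: "(\<lambda>i. vec_cnj (e i)) ` {p..<p+q} = vec_cnj ` w ` {..<q}"
  proof -
    have "{p..<p+q} = (\<lambda>i. p + i) ` {..<q}"
      by (metis add.commute add_0 image_add_atLeastLessThan lessThan_atLeast0)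
    then show ?thesis using e(1) by (auto simp: image_image e0_def)
  qed
  have 2: "V \<inter> Eneg = vec.span (vec_cnj ` w ` {..<q})"
  proof
    have "vec_cnj (w i) \<in> V \<inter> Eneg" if "i < q" for i
      using wW[OF that] by (auto simp: W_def)
    then show "vec.span (vec_cnj ` w ` {..<q}) \<subseteq> V \<inter> Eneg"
      by (intro vec.span_minimal sB) auto
    show "V \<inter> Eneg \<subseteq> vec.span (vec_cnj ` w ` {..<q})"
    proof
      fix y assume "y \<in> V \<inter> Eneg"
      then have "vec_cnj y \<in> vec.span (w ` {..<q})" using w(2) by (auto simp: W_def)
      then show "y \<in> vec.span (vec_cnj ` w ` {..<q})" using span_vec_cnj by fastforce
    qed
  qed
  have "V = {x + y | x y. x \<in> V \<inter> Epos \<and> y \<in> V \<inter> Eneg}"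
  proof
    show "V \<subseteq> {x + y | x y. x \<in> V \<inter> Epos \<and> y \<in> V \<inter> Eneg}"
      using V unfolding split_planes_def by blast
  qed (use sV in \<open>auto intro: vec.subspace_add\<close>)
  then have "V = vec.span (e ` {..<p} \<union> (\<lambda>i. vec_cnj (e i)) ` {p..<p+q})"
    unfolding im vec.span_Un 1[symmetric] 2[symmetric] by auto
  then show ?thesis using e by (intro that[of e])
qed

lemma Epos_coordinates:
  assumes n: "CARD('v) = 2 * n" and e: "orthonormal n e" "vec.span (e ` {..<n}) = Epos"
  shows "x = (\<Sum>i<n. ip x (e i) *s e i + ip x (vec_cnj (e i)) *s vec_cnj (e i))"
proof -
  define a b where "a = (1/2) *s (x + \<i> *s (J *v x))" and "b = (1/2) *s (x - \<i> *s (J *v x))"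
  have ab: "a \<in> Epos" "b \<in> Eneg" "x = a + b"
    using Epos_Eneg_decomp[of x] by (simp_all add: a_def b_def)
  have eE: "e i \<in> Epos" if "i < n" for i using that e(2) by (metis imageI lessThan_iff vec.span_base)
  have "ip x (e i) = ip a (e i)" if "i < n" for i
    using ip_Epos_Eneg[OF eE[OF that] ab(2)] ip_cnj_sym[of "e i" b] by (simp add: ab(3))
  moreover have "ip x (vec_cnj (e i)) = cnj (ip (vec_cnj b) (e i))" if "i < n" for i
    using ip_Epos_Eneg[OF ab(1), of "vec_cnj (e i)"] eE[OF that] ip_cnj[of "vec_cnj b" "e i"]
    by (simp add: ab(3))
  moreover have "a = (\<Sum>i<n. ip a (e i) *s e i)"
    using orthonormal_expand[OF e(1)] e(2) ab(1) by blast
  moreover have "vec_cnj b = (\<Sum>i<n. ip (vec_cnj b) (e i) *s e i)"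
    using orthonormal_expand[OF e(1)] e(2) ab(2) by simp
  then have "b = (\<Sum>i<n. cnj (ip (vec_cnj b) (e i)) *s vec_cnj (e i))"
    by (subst vec_cnj_eq_iff[symmetric]) (simp add: vec_cnj_sum)
  ultimately have "(\<Sum>i<n. ip x (e i) *s e i + ip x (vec_cnj (e i)) *s vec_cnj (e i)) = a + b"
    by (simp add: sum.distrib)
  then show ?thesis using ab(3) by simp
qed

text \<open>A unitary map of \<open>Epos\<close> is extended to \<open>Eneg\<close> by conjugation.
  The extension is real by construction, and symplectic because \<open>\<sigma>\<close> pairs
  \<open>Epos\<close> with its conjugate through \<open>ip\<close>.\<close>

lemma unitary_between_bases:
  assumes n: "CARD('v) = 2 * n" and e: "orthonormal n e" "vec.span (e ` {..<n}) = Epos"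
    and e': "orthonormal n e'" "vec.span (e' ` {..<n}) = Epos"
  obtains g where "g \<in> unitary_group" "\<And>i. i < n \<Longrightarrow> g *v e i = e' i"
    "\<And>i. i < n \<Longrightarrow> g *v vec_cnj (e i) = vec_cnj (e' i)"
proof -
  define T :: "(nat \<Rightarrow> complex^'v) \<Rightarrow> complex^'v \<Rightarrow> complex^'v"
    where "T e' x = (\<Sum>i<n. ip x (e i) *s e' i + ip x (vec_cnj (e i)) *s vec_cnj (e' i))" for e' x
  define g where "g = matrix (T e')"
  have "Vector_Spaces.linear (*s) (*s) (T e')"
    unfolding T_def
    by (simp add: Vector_Spaces.linear_iff vec.vector_space_axioms)
      (simp add: vec.scale_left_distrib sum.distrib[symmetric] vec.scale_sum_right
        vec.scale_right_distrib vector_smult_assoc algebra_simps)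
  then have g: "g *v x = T e' x" for x unfolding g_def by (rule matrix_works)
  have Te: "T e x = x" for x unfolding T_def using Epos_coordinates[OF n e] by simp
  have mem: "u i \<in> Epos" if "vec.span (u ` {..<n}) = Epos" "i < n" for i and u :: "nat \<Rightarrow> complex^'v"
    using that by (metis imageI lessThan_iff vec.span_base)
  have ip0: "ip (vec_cnj (u j)) (u i) = 0" "ip (u i) (vec_cnj (u j)) = 0"
    if "vec.span (u ` {..<n}) = Epos" "i < n" "j < n" for i j and u :: "nat \<Rightarrow> complex^'v"
    using ip_Epos_Eneg[of "u i" "vec_cnj (u j)"] mem[OF that(1)] that ip_cnj_sym[of "u i" "vec_cnj (u j)"] by auto
  have e_i: "T u (e j) = u j" "T u (vec_cnj (e j)) = vec_cnj (u j)" if "j < n" for u j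
  proof -
    have "T u (e j) = (\<Sum>i<n. if i = j then u i else 0)"
      unfolding T_def using e(1) that ip0[OF e(2)] by (intro sum.cong) (auto simp: orthonormal_def)
    then show "T u (e j) = u j" using that by simp
    have "T u (vec_cnj (e j)) = (\<Sum>i<n. if i = j then vec_cnj (u i) else 0)"
      unfolding T_def using e(1) that ip0[OF e(2)]
      by (intro sum.cong) (auto simp: orthonormal_def ip_cnj)
    then show "T u (vec_cnj (e j)) = vec_cnj (u j)" using that by simp
  qed
  have form: "\<sigma> (T u x) (T u y) =
      (\<Sum>i<n. - \<i> * (ip x (e i) * ip y (vec_cnj (e i)) - ip x (vec_cnj (e i)) * ip y (e i)))"
    if u: "orthonormal n u" "vec.span (u ` {..<n}) = Epos" for u x y
  proof -
    have s: "\<sigma> (u i) (u j) = 0" "\<sigma> (vec_cnj (u i)) (vec_cnj (u j)) = 0"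
      "\<sigma> (u i) (vec_cnj (u j)) = (if i = j then - \<i> else 0)"
      "\<sigma> (vec_cnj (u i)) (u j) = (if i = j then \<i> else 0)" if "i < n" "j < n" for i j
      using Epos_isotropic[OF mem[OF u(2)] mem[OF u(2)]] that u(1) \<sigma>_Epos_cnj[OF mem[OF u(2)]]
        \<sigma>_swap[of "vec_cnj (u i)" "u j"]
      by (auto simp: orthonormal_def \<sigma>_cnj)
    have "\<sigma> (T u x) (T u y) = (\<Sum>i<n. \<Sum>j<n. if i = j then
        - \<i> * (ip x (e i) * ip y (vec_cnj (e j)) - ip x (vec_cnj (e i)) * ip y (e j)) else 0)"
      unfolding T_def \<sigma>_sum(1) unfolding \<sigma>_sum(2)
      by (intro sum.cong refl) (auto simp: s algebra_simps)
    then show ?thesis by simp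
  qed
  have "\<sigma> (g *v x) (g *v y) = \<sigma> x y" for x y
    using form[OF e', of x y] form[OF e, of x y] by (simp add: g Te)
  moreover have "vec_cnj (g *v x) = g *v vec_cnj x" for x
  proof -
    have "ip (vec_cnj x) y = cnj (ip x (vec_cnj y))" for y
      using ip_cnj[of x "vec_cnj y"] by simp
    then show ?thesis unfolding g T_def by (simp add: vec_cnj_sum add.commute)
  qed
  moreover have "g *v (J *v x) = J *v (g *v x)" for x
  proof -
    have 1: "ip (J *v x) y = - ip x (J *v y)" for y
      using ip_J[of "J *v x" y] by simp
    have J1: "J *v u i = - \<i> *s u i" "J *v vec_cnj (u i) = \<i> *s vec_cnj (u i)"
      if "vec.span (u ` {..<n}) = Epos" "i < n" for i and u :: "nat \<Rightarrow> complex^'v"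
      using mem[OF that] J_cnj(1)[OF mem[OF that]] by (auto simp: Epos_def)
    have "J *v T e' x = (\<Sum>i<n. ip x (e i) *s (J *v e' i) + ip x (vec_cnj (e i)) *s (J *v vec_cnj (e' i)))"
      by (simp add: T_def vec.linear_sum[OF linear_matrix_vector_mult] matrix_vector_right_distrib
          vector_scalar_commute del: cnj_J)
    also have "\<dots> = T e' (J *v x)"
      unfolding T_def using J1[OF e'(2)] J1[OF e(2)]
      by (intro sum.cong refl) (auto simp: 1 vector_smult_assoc mult.commute simp del: cnj_J)
    finally show ?thesis by (simp add: g)
  qed
  ultimately have "g \<in> unitary_group" by (simp add: unitary_group_def Sp_complex_def)
  then show ?thesis by (rule that) (simp_all add: g e_i)
qed

lemma unitary_transitive:
  assumes n: "CARD('v) = 2 * n" and V: "V \<in> split_planes Epos Eneg p q"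
    and V': "V' \<in> split_planes Epos Eneg p q"
  obtains g where "g \<in> unitary_group" "act_plane g V = V'"
proof -
  obtain e where e: "orthonormal n e" "vec.span (e ` {..<n}) = Epos" "p + q \<le> n"
    "V = vec.span (e ` {..<p} \<union> (\<lambda>i. vec_cnj (e i)) ` {p..<p+q})"
    using split_plane_basis[OF V n] .
  obtain e' where e': "orthonormal n e'" "vec.span (e' ` {..<n}) = Epos"
    "V' = vec.span (e' ` {..<p} \<union> (\<lambda>i. vec_cnj (e' i)) ` {p..<p+q})"
    using split_plane_basis[OF V' n] .
  obtain g where g: "g \<in> unitary_group" "\<And>i. i < n \<Longrightarrow> g *v e i = e' i"
    "\<And>i. i < n \<Longrightarrow> g *v vec_cnj (e i) = vec_cnj (e' i)"
    using unitary_between_bases[OF n e(1,2) e'(1,2)] by blast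
  have "(*v) g ` (e ` {..<p} \<union> (\<lambda>i. vec_cnj (e i)) ` {p..<p+q}) =
      e' ` {..<p} \<union> (\<lambda>i. vec_cnj (e' i)) ` {p..<p+q}"
    unfolding image_Un image_image using g(2,3) e(3) by (intro arg_cong2[where f = "(\<union>)"] image_cong) auto
  then have "act_plane g V = V'" unfolding e(4) e'(3) act_plane_span by simp
  with g(1) show ?thesis by (rule that)
qed

lemma act_unitary_E:
  assumes "g \<in> unitary_group" shows "act_plane g Epos = Epos" "act_plane g Eneg = Eneg"
proof -
  have sub: "act_plane g Epos \<subseteq> Epos" "act_plane g Eneg \<subseteq> Eneg" if "g \<in> unitary_group" for g
  proof -
    have *: "J *v (g *v x) = g *v (J *v x)" for x
      using that by (simp add: unitary_group_def)
    show "act_plane g Epos \<subseteq> Epos" "act_plane g Eneg \<subseteq> Eneg"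
      by (auto simp: act_plane_def Epos_def Eneg_def * vector_scalar_commute matrix_vector_mult_minus)
  qed
  have g: "g \<in> Sp_complex h" by (rule unitary_in_Sp[OF assms])
  have inv: "matrix_inv g \<in> unitary_group"
    using unitary_group_subgroup assms by (simp add: matrix_subgroup_def)
  have "act_plane g (act_plane (matrix_inv g) Epos) \<subseteq> act_plane g Epos"
    "act_plane g (act_plane (matrix_inv g) Eneg) \<subseteq> act_plane g Eneg"
    unfolding act_plane_def[of g] using sub[OF inv] by (simp_all add: image_mono)
  then show "act_plane g Epos = Epos" "act_plane g Eneg = Eneg"
    using sub[OF assms] g by auto
qed

lemma split_planes_orbit:
  assumes n: "CARD('v) = 2 * n" and V: "V \<in> split_planes Epos Eneg p q"
  shows "(\<lambda>g. act_plane g V) ` unitary_group = split_planes Epos Eneg p q"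
proof
  show "(\<lambda>g. act_plane g V) ` unitary_group \<subseteq> split_planes Epos Eneg p q"
    using act_plane_split_planes[OF unitary_in_Sp V] act_unitary_E by auto
  show "split_planes Epos Eneg p q \<subseteq> (\<lambda>g. act_plane g V) ` unitary_group"
    using unitary_transitive[OF n V] by (metis imageI subsetI)
qed

end

section \<open>Signatures of planes\<close>

context symplectic_space
begin

lemma finite_subspace_dims: "finite {vec.dim W | W :: (complex^'v) set. P W}"
proof (rule finite_subset)
  have "vec.dim W \<le> CARD('v)" for W :: "(complex^'v) set"
    using vec.dim_subset[of W UNIV] by (metis subset_UNIV vec_dim_card)
  then show "{vec.dim W | W :: (complex^'v) set. P W} \<subseteq> {..CARD('v)}" by auto
qed simp

lemma pos_index_ge:
  assumes "vec.subspace W" "W \<subseteq> V" "\<And>v. v \<in> W \<Longrightarrow> v \<noteq> 0 \<Longrightarrow> 0 < Re (hermitian_form h v v)"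
  shows "vec.dim W \<le> pos_index h V"
  unfolding pos_index_def by (rule Max_ge[OF finite_subspace_dims]) (use assms in blast)

lemma neg_index_ge:
  assumes "vec.subspace W" "W \<subseteq> V" "\<And>v. v \<in> W \<Longrightarrow> v \<noteq> 0 \<Longrightarrow> Re (hermitian_form h v v) < 0"
  shows "vec.dim W \<le> neg_index h V"
  unfolding neg_index_def by (rule Max_ge[OF finite_subspace_dims]) (use assms in blast)

end

text \<open>An invariant plane is the sum of its intersections with the two eigenspaces. These are
  definite, so their dimensions are at most p and q, and the total p + q leaves no slack.\<close>

lemma (in compatible_structure) J_invariant_plane_split:
  assumes V: "V \<in> flag_domain h p q" and J: "\<And>x. x \<in> V \<Longrightarrow> J *v x \<in> V"
  shows "V \<in> split_planes Epos Eneg p q"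
proof -
  have sV: "vec.subspace V" and dV: "vec.dim V = p + q" and iso: "\<forall>x\<in>V. \<forall>y\<in>V. \<sigma> x y = 0"
    and sig: "pos_index h V = p" "neg_index h V = q"
    using V by (auto simp: flag_domain_def isotropic_grassmannian_def signature_def)
  have sA: "vec.subspace (V \<inter> Epos)" and sB: "vec.subspace (V \<inter> Eneg)"
    using sV subspace_Epos subspace_Eneg by (auto intro: vec.subspace_inter)
  have split: "\<exists>a\<in>V \<inter> Epos. \<exists>b\<in>V \<inter> Eneg. x = a + b" if "x \<in> V" for x
  proof -
    have "(1/2) *s (x + \<i> *s (J *v x)) \<in> V" "(1/2) *s (x - \<i> *s (J *v x)) \<in> V"
      using sV that J[OF that]
      by (auto intro!: vec.subspace_scale vec.subspace_add vec.subspace_diff)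
    then show ?thesis using Epos_Eneg_decomp[of x] by blast
  qed
  have "vec.dim (V \<inter> Epos) \<le> p"
    unfolding sig(1)[symmetric] using ip_pos by (intro pos_index_ge sA) (auto simp: hermitian_Epos)
  moreover have "vec.dim (V \<inter> Eneg) \<le> q"
    unfolding sig(2)[symmetric] using ip_pos by (intro neg_index_ge sB) (auto simp: hermitian_Eneg)
  moreover have "p + q \<le> vec.dim (V \<inter> Epos) + vec.dim (V \<inter> Eneg)"
  proof -
    have "V \<subseteq> {x + y |x y. x \<in> V \<inter> Epos \<and> y \<in> V \<inter> Eneg}"
      using split by blast
    then have "p + q \<le> vec.dim {x + y |x y. x \<in> V \<inter> Epos \<and> y \<in> V \<inter> Eneg}"
      unfolding dV[symmetric] by (rule vec.dim_subset)
    then show ?thesis using vec.dim_sums_Int[OF sA sB] by linarith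
  qed
  ultimately show ?thesis
    unfolding split_planes_def using sV iso split by auto
qed


section \<open>The base cycle consists of all split planes\<close>

lemma mult_cnj_cmod: "z * cnj z = (complex_of_real (cmod z))\<^sup>2" "cnj z * z = (complex_of_real (cmod z))\<^sup>2"
  using complex_norm_square[of z] by (simp_all add: mult.commute)

context compatible_structure
begin

definition proj_perp :: "nat \<Rightarrow> (nat \<Rightarrow> complex^'v) \<Rightarrow> complex^'v \<Rightarrow> complex^'v" where
  "proj_perp k b x = x - (\<Sum>i<k. ip x (b i) *s b i)"

text \<open>The orthogonal projection onto \<open>Epos\<close>. The trace of its compression to a
  plane is, up to an affine change, the moment map of the circle generated by
  \<open>J\<close>.\<close>

definition proj_pos :: "complex^'v \<Rightarrow> complex^'v" where
  "proj_pos x = (1/2) *s (x + \<i> *s (J *v x))"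

lemma linear_proj_perp: "linear (proj_perp k b)"
  by (simp add: linear_iff proj_perp_def sum.distrib vec.scale_left_distrib scaleR_right_diff_distrib
      scaleR_sum_right scaleR_eq_vector_scalar vector_smult_assoc vec.scale_sum_right)

lemma bounded_linear_proj_perp: "bounded_linear (proj_perp k b)"
  using linear_proj_perp by (simp add: linear_conv_bounded_linear)

lemma linear_proj_pos: "linear proj_pos"
  by (simp add: linear_iff proj_pos_def matrix_vector_right_distrib scaleR_eq_vector_scalar
      vector_scalar_commute vector_smult_assoc vec.scale_right_distrib mult.commute)

lemma proj_perp_eq_0:
  assumes "orthonormal k b" shows "proj_perp k b x = 0 \<longleftrightarrow> x \<in> vec.span (b ` {..<k})"
proof
  assume "proj_perp k b x = 0"
  then have "x = (\<Sum>i<k. ip x (b i) *s b i)" by (simp add: proj_perp_def)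
  then show "x \<in> vec.span (b ` {..<k})" by (auto simp: span_family)
next
  assume "x \<in> vec.span (b ` {..<k})"
  then show "proj_perp k b x = 0"
    using orthonormal_expand[OF assms] by (simp add: proj_perp_def)
qed

lemma ip_proj_perp:
  assumes "orthonormal k b" "j < k" shows "ip (proj_perp k b x) (b j) = 0" "ip (b j) (proj_perp k b x) = 0"
proof -
  show "ip (proj_perp k b x) (b j) = 0"
    using ip_orthonormal_sum[OF assms] by (simp add: proj_perp_def)
  then show "ip (b j) (proj_perp k b x) = 0" by (metis complex_cnj_zero ip_cnj_sym)
qed

lemma ip_proj_perp_self:
  assumes "orthonormal k b" shows "ip x (proj_perp k b x) = ip (proj_perp k b x) (proj_perp k b x)"
proof -
  have "ip (\<Sum>i<k. ip x (b i) *s b i) (proj_perp k b x) = 0"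
    using ip_proj_perp[OF assms] by (simp add: ip_sum)
  then show ?thesis
    using ip_simps(3)[of x "\<Sum>i<k. ip x (b i) *s b i" "proj_perp k b x"] by (simp add: proj_perp_def)
qed

lemma ip_cauchy_schwarz: "(norm (ip x y))\<^sup>2 \<le> Re (ip x x) * Re (ip y y)"
proof (cases "y = 0")
  case False
  define r where "r = Re (ip y y)"
  have r: "0 < r" "ip y y = of_real r" using ip_pos[OF False] ip_self_real[of y] by (simp_all add: r_def)
  define c where "c = ip x y / of_real r"
  have "0 \<le> Re (ip (x - c *s y) (x - c *s y))" by (rule ip_nonneg)
  also have "ip (x - c *s y) (x - c *s y) = ip x x - ip x y * cnj (ip x y) / of_real r"
    using r ip_cnj_sym[of x y] by (simp add: c_def field_simps)
  also have "ip x y * cnj (ip x y) / of_real r = of_real ((norm (ip x y))\<^sup>2 / r)"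
    by (simp add: mult_cnj_cmod)
  finally show ?thesis using r by (simp add: r_def[symmetric] field_simps)
qed simp

lemma ip_proj_pos:
  "ip (proj_pos x) (proj_pos x) = ip (proj_pos x) x" "ip (proj_pos x) y = ip x (proj_pos y)"
proof -
  have J: "ip (J *v x) y = - ip x (J *v y)" for x y using ip_J[of "J *v x" y] by simp
  show "ip (proj_pos x) y = ip x (proj_pos y)" by (simp add: proj_pos_def J algebra_simps)
  show "ip (proj_pos x) (proj_pos x) = ip (proj_pos x) x"
    by (simp add: proj_pos_def J algebra_simps)
qed

lemma ip_proj_pos_expand:
  assumes e: "orthonormal n e" "vec.span (e ` {..<n}) = Epos"
  shows "Re (ip (proj_pos x) (proj_pos x)) = (\<Sum>i<n. (norm (ip x (e i)))\<^sup>2)"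
proof -
  have eE: "e i \<in> Epos" if "i < n" for i using that e(2) by (metis imageI lessThan_iff vec.span_base)
  have pe: "proj_pos (e i) = e i" if "i < n" for i
    using eE[OF that] by (simp add: proj_pos_def Epos_def vector_smult_assoc vec_eq_iff)
  have "proj_pos x \<in> Epos" unfolding proj_pos_def by (rule Epos_Eneg_decomp)
  then have "proj_pos x = (\<Sum>i<n. ip (proj_pos x) (e i) *s e i)"
    using orthonormal_expand[OF e(1)] e(2) by blast
  moreover have "ip (proj_pos x) (e i) = ip x (e i)" if "i < n" for i
    using ip_proj_pos(2)[of x "e i"] pe[OF that] by simp
  ultimately have "proj_pos x = (\<Sum>i<n. ip x (e i) *s e i)" by simp
  then have "ip x (proj_pos x) = (\<Sum>i<n. cnj (ip x (e i)) * ip x (e i))"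
    by (simp add: ip_sum)
  also have "\<dots> = of_real (\<Sum>i<n. (norm (ip x (e i)))\<^sup>2)"
    by (simp add: mult_cnj_cmod)
  finally have "ip x (proj_pos x) = of_real (\<Sum>i<n. (norm (ip x (e i)))\<^sup>2)" .
  moreover have "ip (proj_pos x) (proj_pos x) = ip x (proj_pos x)"
    using ip_proj_pos by metis
  ultimately show ?thesis by (metis Re_complex_of_real)
qed

text \<open>Bessel's inequality for an almost orthonormal family, with \<open>\<eta>\<close>
  measuring the distance of the Gram matrix from the identity. It follows from Cauchy-Schwarz
  between \<open>y\<close> and the combination of the \<open>\<beta> i\<close> with coefficients
  \<open>x i\<close>.\<close>

lemma gram_upper_bound:
  fixes k :: nat
  assumes \<eta>: "\<eta> = (\<Sum>i<k. \<Sum>l<k. norm (ip (\<beta> i) (\<beta> l) - (if i = l then 1 else 0)))"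
  shows "(\<Sum>i<k. (norm (ip (\<beta> i) y))\<^sup>2) \<le> (1 + \<eta>) * Re (ip y y)"
proof -
  define x where "x i = cnj (ip (\<beta> i) y)" for i
  define z where "z = (\<Sum>i<k. x i *s \<beta> i)"
  define B where "B = (\<Sum>i<k. (norm (x i))\<^sup>2)"
  have B0: "0 \<le> B" unfolding B_def by (intro sum_nonneg) simp
  have \<eta>0: "0 \<le> \<eta>" unfolding \<eta> by (intro sum_nonneg) simp
  have zy: "ip z y = of_real B"
    by (simp add: z_def B_def ip_sum x_def mult_cnj_cmod)
  have xle: "norm (x i) * norm (x l) \<le> B" if "i < k" "l < k" for i l
  proof -
    have "(norm (x j))\<^sup>2 \<le> B" if "j < k" for j
      unfolding B_def using that by (intro member_le_sum) auto
    from this[OF that(1)] this[OF that(2)] have "(norm (x i))\<^sup>2 \<le> B" "(norm (x l))\<^sup>2 \<le> B" .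
    moreover have "2 * (norm (x i) * norm (x l)) \<le> (norm (x i))\<^sup>2 + (norm (x l))\<^sup>2"
      using zero_le_power2[of "norm (x i) - norm (x l)"] by (simp add: power2_eq_square algebra_simps)
    ultimately show ?thesis by linarith
  qed
  have "ip z z = (\<Sum>i<k. \<Sum>l<k. x i * cnj (x l) * ip (\<beta> i) (\<beta> l))"
    unfolding z_def ip_sum(1) unfolding ip_sum(2) by (simp add: sum_distrib_left mult_ac)
  also have "\<dots> = (\<Sum>i<k. \<Sum>l<k. (if i = l then x i * cnj (x l) else 0) +
      x i * cnj (x l) * (ip (\<beta> i) (\<beta> l) - (if i = l then 1 else 0)))"
    by (intro sum.cong refl) (simp add: algebra_simps)
  also have "\<dots> = of_real B +
      (\<Sum>i<k. \<Sum>l<k. x i * cnj (x l) * (ip (\<beta> i) (\<beta> l) - (if i = l then 1 else 0)))"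
    unfolding sum.distrib by (simp add: B_def mult_cnj_cmod)
  finally have "Re (ip z z) \<le> B +
      norm (\<Sum>i<k. \<Sum>l<k. x i * cnj (x l) * (ip (\<beta> i) (\<beta> l) - (if i = l then 1 else 0)))"
    by (metis (no_types, lifting) add_left_mono complex_Re_le_cmod Re_complex_of_real plus_complex.sel(1))
  also have "norm (\<Sum>i<k. \<Sum>l<k. x i * cnj (x l) * (ip (\<beta> i) (\<beta> l) - (if i = l then 1 else 0)))
      \<le> (\<Sum>i<k. \<Sum>l<k. B * norm (ip (\<beta> i) (\<beta> l) - (if i = l then 1 else 0)))"
    by (intro order_trans[OF norm_sum] sum_mono) (auto simp: norm_mult intro!: mult_right_mono xle)
  also have "\<dots> = B * \<eta>" by (simp add: \<eta> sum_distrib_left)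
  finally have zz: "Re (ip z z) \<le> (1 + \<eta>) * B" by (simp add: algebra_simps)
  have "B * B \<le> Re (ip z z) * Re (ip y y)"
    using ip_cauchy_schwarz[of z y] B0 by (simp add: zy power2_eq_square)
  also have "\<dots> \<le> ((1 + \<eta>) * B) * Re (ip y y)"
    using zz ip_nonneg by (intro mult_right_mono) auto
  finally have "B * B \<le> B * ((1 + \<eta>) * Re (ip y y))" by (simp add: algebra_simps)
  then have "B \<le> (1 + \<eta>) * Re (ip y y)"
    using B0 \<eta>0 ip_nonneg[of y] by (cases "B = 0") auto
  then show ?thesis by (simp add: B_def x_def)
qed

lemma unitary_commutes: "g \<in> unitary_group \<Longrightarrow> proj_pos (g *v x) = g *v proj_pos x"
  by (simp add: unitary_group_def proj_pos_def vector_scalar_commute matrix_vector_right_distrib)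

text \<open>For an exactly orthonormal frame of the moved plane the energy is unchanged, since
  unitary elements commute with \<open>proj_pos\<close>. The factor \<open>1 + \<eta>\<close> pays
  for the \<open>\<beta> i\<close> being only nearly orthonormal.\<close>

lemma frame_energy_bound:
  assumes n: "CARD('v) = 2 * n" and b: "orthonormal k b"
    and g: "g \<in> unitary_group" and \<beta>: "\<And>i. i < k \<Longrightarrow> \<beta> i \<in> act_plane g (vec.span (b ` {..<k}))"
    and \<eta>: "\<eta> = (\<Sum>i<k. \<Sum>l<k. norm (ip (\<beta> i) (\<beta> l) - (if i = l then 1 else 0)))"
  shows "(\<Sum>i<k. Re (ip (proj_pos (\<beta> i)) (proj_pos (\<beta> i)))) \<le>
    (1 + \<eta>) * (\<Sum>i<k. Re (ip (proj_pos (b i)) (proj_pos (b i))))"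
proof -
  obtain e where e: "orthonormal n e" "vec.span (e ` {..<n}) = Epos"
    using orthonormal_basis[OF subspace_Epos] dim_Epos[OF n] by metis
  define u where "u j = g *v b j" for j
  have u: "orthonormal k u" using b unitary_ip[OF g] by (simp add: orthonormal_def u_def)
  have \<beta>u: "\<beta> i \<in> vec.span (u ` {..<k})" if "i < k" for i
    using \<beta>[OF that] by (simp add: act_plane_span image_image u_def)
  \<comment> \<open>The projection of \<open>e j\<close> onto the moved plane has the same pairings
    with the \<open>\<beta> i\<close>, while the squared lengths of these projections add up to the
    energy of the plane instead of to n.\<close>
  define y where "y j = (\<Sum>l<k. ip (e j) (u l) *s u l)" for j
  have iy: "ip (\<beta> i) (e j) = ip (\<beta> i) (y j)" if "i < k" for i j
  proof -
    have "ip (\<beta> i) (e j) = ip (\<Sum>l<k. ip (\<beta> i) (u l) *s u l) (e j)"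
      using orthonormal_expand[OF u \<beta>u[OF that]] by simp
    also have "\<dots> = (\<Sum>l<k. ip (\<beta> i) (u l) * ip (u l) (e j))" by (simp add: ip_sum)
    also have "\<dots> = ip (\<beta> i) (y j)"
      by (simp add: y_def ip_sum ip_cnj_sym mult.commute)
    finally show ?thesis .
  qed
  have yy: "Re (ip (y j) (y j)) = (\<Sum>l<k. (norm (ip (u l) (e j)))\<^sup>2)" for j
  proof -
    have "ip (y j) (y j) = (\<Sum>l<k. cnj (ip (e j) (u l)) * ip (y j) (u l))"
      by (subst (2) y_def) (simp add: ip_sum)
    also have "\<dots> = (\<Sum>l<k. cnj (ip (e j) (u l)) * ip (e j) (u l))"
      unfolding y_def using ip_orthonormal_sum[OF u] by (intro sum.cong) auto
    also have "\<dots> = of_real (\<Sum>l<k. (norm (ip (u l) (e j)))\<^sup>2)"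
      using mult_cnj_cmod(1)[of "ip (u _) (e j)"] by (simp add: ip_cnj_sym)
    finally show ?thesis by (metis Re_complex_of_real)
  qed
  have "(\<Sum>i<k. Re (ip (proj_pos (\<beta> i)) (proj_pos (\<beta> i)))) = (\<Sum>i<k. \<Sum>j<n. (norm (ip (\<beta> i) (y j)))\<^sup>2)"
    by (simp add: ip_proj_pos_expand[OF e] iy)
  also have "\<dots> = (\<Sum>j<n. \<Sum>i<k. (norm (ip (\<beta> i) (y j)))\<^sup>2)" by (rule sum.swap)
  also have "\<dots> \<le> (\<Sum>j<n. (1 + \<eta>) * Re (ip (y j) (y j)))"
    by (intro sum_mono gram_upper_bound[OF \<eta>])
  also have "\<dots> = (1 + \<eta>) * (\<Sum>l<k. \<Sum>j<n. (norm (ip (u l) (e j)))\<^sup>2)"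
    unfolding yy sum_distrib_left by (rule sum.swap)
  also have "(\<Sum>l<k. \<Sum>j<n. (norm (ip (u l) (e j)))\<^sup>2) = (\<Sum>i<k. Re (ip (proj_pos (b i)) (proj_pos (b i))))"
    by (simp add: ip_proj_pos_expand[OF e, symmetric] u_def unitary_commutes[OF g] unitary_ip[OF g])
  finally show ?thesis .
qed

text \<open>The energy of a plane, the trace of the compression of the projection to \<open>Epos\<close>, is invariant
  under the unitary group. A curve tangent to the gradient direction \<open>\<i> J\<close> must therefore be
  stationary.\<close>

lemma gradient_curve_in_orbit:
  assumes n: "CARD('v) = 2 * n" and b: "orthonormal k b"
    and \<beta>0: "\<And>i. i < k \<Longrightarrow> \<beta> i 0 = b i"
    and \<beta>': "\<And>i. i < k \<Longrightarrow> (\<beta> i has_vector_derivative proj_perp k b (\<i> *s (J *v b i))) (at 0)"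
    and orb: "eventually (\<lambda>s. \<exists>g\<in>unitary_group. \<forall>i<k. \<beta> i s \<in> act_plane g (vec.span (b ` {..<k}))) (at_right (0::real))"
    and x: "x \<in> vec.span (b ` {..<k})"
  shows "J *v x \<in> vec.span (b ` {..<k})"
proof -
  define d where "d i = proj_perp k b (\<i> *s (J *v b i))" for i
  define \<eta> where "\<eta> s = (\<Sum>i<k. \<Sum>l<k. norm (ip (\<beta> i s) (\<beta> l s) - (if i = l then 1 else 0)))" for s
  define E where "E s = (\<Sum>i<k. Re (ip (proj_pos (\<beta> i s)) (proj_pos (\<beta> i s))))" for s
  \<comment> \<open>The Gram matrix has zero derivative at 0, because every velocity
    \<open>d i\<close> is orthogonal to the plane.\<close>
  have \<eta>lim: "((\<lambda>s. \<eta> s / s) \<longlongrightarrow> 0) (at_right 0)"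
  proof -
    have "((\<lambda>s. norm (ip (\<beta> i s) (\<beta> l s) - (if i = l then 1 else 0)) / s) \<longlongrightarrow> 0) (at_right 0)"
      if il: "i < k" "l < k" for i l
    proof -
      have "((\<lambda>s. ip (\<beta> i s) (\<beta> l s)) has_vector_derivative (ip (\<beta> i 0) (d l) + ip (d i) (\<beta> l 0))) (at 0)"
        unfolding d_def using il by (intro bounded_bilinear.has_vector_derivative[OF bounded_bilinear_ip] \<beta>')
      then have "((\<lambda>s. ip (\<beta> i s) (\<beta> l s)) has_vector_derivative 0) (at 0)"
        using il ip_proj_perp[OF b] by (simp add: \<beta>0 d_def)
      then have "((\<lambda>s. (1 / norm (s - 0)) *\<^sub>R (ip (\<beta> i s) (\<beta> l s) - (ip (\<beta> i 0) (\<beta> l 0) + (s - 0) *\<^sub>R 0))) \<longlongrightarrow> 0) (at 0)"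
        unfolding has_vector_derivative_def has_derivative_within by blast
      then have "((\<lambda>s. (1 / norm s) *\<^sub>R (ip (\<beta> i s) (\<beta> l s) - ip (b i) (b l))) \<longlongrightarrow> 0) (at 0)"
        using il by (simp add: \<beta>0)
      then have "((\<lambda>s. norm ((1 / norm s) *\<^sub>R (ip (\<beta> i s) (\<beta> l s) - ip (b i) (b l)))) \<longlongrightarrow> 0) (at_right 0)"
        by (rule tendsto_mono[OF at_le[OF subset_UNIV] tendsto_norm_zero])
      moreover have "eventually (\<lambda>s. norm ((1 / norm s) *\<^sub>R (ip (\<beta> i s) (\<beta> l s) - ip (b i) (b l))) =
          norm (ip (\<beta> i s) (\<beta> l s) - (if i = l then 1 else 0)) / s) (at_right 0)"
        using b il by (intro eventually_at_rightI[of 0 1]) (auto simp: orthonormal_def)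
      ultimately show ?thesis by (rule Lim_transform_eventually)
    qed
    then have "((\<lambda>s. \<Sum>i<k. \<Sum>l<k. norm (ip (\<beta> i s) (\<beta> l s) - (if i = l then 1 else 0)) / s) \<longlongrightarrow> 0) (at_right 0)"
      by (intro tendsto_null_sum) auto
    then show ?thesis by (simp add: \<eta>_def sum_divide_distrib)
  qed
  define \<Lambda> where "\<Lambda> = (\<Sum>i<k. Re (ip (d i) (d i)))"
  \<comment> \<open>The derivative of the energy in the gradient direction is the squared length of
    the gradient. The factor 1/2 in \<open>proj_pos\<close> cancels against the two equal terms of
    the product rule.\<close>
  have E': "(E has_real_derivative \<Lambda>) (at 0)"
  proof -
    have pp: "((\<lambda>s. proj_pos (\<beta> i s)) has_vector_derivative proj_pos (d i)) (at 0)" if "i < k" for i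
      unfolding d_def using linear_proj_pos \<beta>'[OF that]
      by (simp only: linear_conv_bounded_linear bounded_linear.has_vector_derivative)
    have "((\<lambda>s. Re (ip (proj_pos (\<beta> i s)) (proj_pos (\<beta> i s)))) has_vector_derivative Re (ip (d i) (d i))) (at 0)"
      if i: "i < k" for i
    proof -
      have "((\<lambda>s. ip (proj_pos (\<beta> i s)) (proj_pos (\<beta> i s))) has_vector_derivative
          (ip (proj_pos (\<beta> i 0)) (proj_pos (d i)) + ip (proj_pos (d i)) (proj_pos (\<beta> i 0)))) (at 0)"
        by (intro bounded_bilinear.has_vector_derivative[OF bounded_bilinear_ip] pp i)
      then have "((\<lambda>s. Re (ip (proj_pos (\<beta> i s)) (proj_pos (\<beta> i s)))) has_vector_derivative
          Re (ip (proj_pos (\<beta> i 0)) (proj_pos (d i)) + ip (proj_pos (d i)) (proj_pos (\<beta> i 0)))) (at 0)"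
        by (rule bounded_linear.has_vector_derivative[OF bounded_linear_Re])
      moreover have "Re (ip (proj_pos (\<beta> i 0)) (proj_pos (d i)) + ip (proj_pos (d i)) (proj_pos (\<beta> i 0))) = Re (ip (d i) (d i))"
      proof -
        have idem: "proj_pos (proj_pos z) = proj_pos z" for z
          by (simp add: proj_pos_def matrix_vector_right_distrib vector_scalar_commute vec_eq_iff field_simps)
        have "ip (proj_pos (b i)) (proj_pos (d i)) = ip (proj_pos (b i)) (d i)"
          using ip_proj_pos(2)[of "proj_pos (b i)" "d i"] idem by simp
        also have "\<dots> = (1/2) * ip (d i) (d i)"
        proof -
          have "ip (b i) (d i) = 0" unfolding d_def by (rule ip_proj_perp(2)[OF b i])
          moreover have "ip (\<i> *s (J *v b i)) (d i) = ip (d i) (d i)"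
            unfolding d_def by (rule ip_proj_perp_self[OF b])
          ultimately show ?thesis unfolding proj_pos_def ip_simps by simp
        qed
        finally have 1: "ip (proj_pos (b i)) (proj_pos (d i)) = (1/2) * ip (d i) (d i)" .
        have "Re (ip (proj_pos (d i)) (proj_pos (b i))) = Re (ip (proj_pos (b i)) (proj_pos (d i)))"
          by (metis complex_cnj(1) complex.sel(1) complex.exhaust_sel ip_cnj_sym)
        moreover have "ip (d i) (d i) = 2 * ip (proj_pos (b i)) (proj_pos (d i))" unfolding 1 by simp
        ultimately show ?thesis by (simp add: \<beta>0 i)
      qed
      ultimately show ?thesis by simp
    qed
    then have "(E has_vector_derivative \<Lambda>) (at 0)"
      unfolding E_def \<Lambda>_def by (intro has_vector_derivative_sum) auto
    then show ?thesis by (simp add: has_real_derivative_iff_has_vector_derivative)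
  qed
  \<comment> \<open>Membership in the orbit bounds the growth of \<open>E\<close> by
    \<open>\<eta> s * E 0\<close>, which is o(s). Hence \<Lambda>, a sum of squares, is at most
    0.\<close>
  have "((\<lambda>s. (E s - E 0) / s) \<longlongrightarrow> \<Lambda>) (at_right 0)"
    using E' by (rule_tac tendsto_mono[OF at_le[OF subset_UNIV]]) (simp add: DERIV_def)
  moreover have "((\<lambda>s. (\<eta> s / s) * E 0) \<longlongrightarrow> 0 * E 0) (at_right 0)"
    by (intro tendsto_mult \<eta>lim tendsto_const)
  moreover have "eventually (\<lambda>s. (E s - E 0) / s \<le> (\<eta> s / s) * E 0) (at_right 0)"
    using orb eventually_at_right_less[of 0]
  proof eventually_elim
    case (elim s)
    then obtain g where g: "g \<in> unitary_group" "\<And>i. i < k \<Longrightarrow> \<beta> i s \<in> act_plane g (vec.span (b ` {..<k}))"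
      by blast
    have "E s \<le> (1 + \<eta> s) * E 0"
      using frame_energy_bound[OF n b g \<eta>_def] by (simp add: E_def \<beta>0)
    then have "E s - E 0 \<le> \<eta> s * E 0" by (simp add: algebra_simps)
    then show ?case using elim(2) by (simp add: divide_right_mono)
  qed
  ultimately have "\<Lambda> \<le> 0 * E 0"
    by (intro tendsto_le[OF trivial_limit_at_right_real])
  then have "\<Lambda> \<le> 0" by simp
  then have d0: "d i = 0" if "i < k" for i
  proof -
    have "Re (ip (d i) (d i)) \<le> \<Lambda>" unfolding \<Lambda>_def using that ip_nonneg by (intro member_le_sum) auto
    then show ?thesis using \<open>\<Lambda> \<le> 0\<close> ip_pos[of "d i"] by (cases "d i = 0") auto
  qed
  have Jb: "J *v b i \<in> vec.span (b ` {..<k})" if "i < k" for i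
  proof -
    have "\<i> *s (J *v b i) \<in> vec.span (b ` {..<k})"
      using d0[OF that] by (simp add: d_def proj_perp_eq_0[OF b])
    from vec.span_scale[OF this, of "- \<i>"] show ?thesis by (simp add: vector_smult_assoc)
  qed
  obtain c where "x = (\<Sum>i<k. c i *s b i)" using x by (auto simp: span_family)
  then have "J *v x = (\<Sum>i<k. c i *s (J *v b i))"
    by (simp add: vec.linear_sum[OF linear_matrix_vector_mult] vector_scalar_commute)
  then show ?thesis using Jb by (auto intro!: vec.span_sum vec.span_scale)
qed

end

section \<open>The rotation circle seen in a chart of the orbit\<close>

lemma bounded_family_subsequence:
  fixes c :: "nat \<Rightarrow> nat \<Rightarrow> complex"
  assumes "\<And>N j. j < m \<Longrightarrow> norm (c N j) \<le> B"
  obtains r \<xi> where "strict_mono (r :: nat \<Rightarrow> nat)" "\<And>j. j < m \<Longrightarrow> (\<lambda>N. c (r N) j) \<longlonglongrightarrow> \<xi> j"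
  using assms
proof (induction m arbitrary: thesis)
  case 0
  then show ?case using strict_mono_id by (metis less_nat_zero_code)
next
  case (Suc m)
  obtain r \<xi> where r: "strict_mono r" "\<And>j. j < m \<Longrightarrow> (\<lambda>N. c (r N) j) \<longlonglongrightarrow> \<xi> j"
    using Suc.IH Suc.prems(2) by (metis less_SucI)
  have "bounded (range (\<lambda>N. c (r N) m))"
    using Suc.prems(2)[of m] by (auto simp: bounded_iff)
  then obtain l r' where r': "strict_mono r'" "((\<lambda>N. c (r N) m) \<circ> r') \<longlonglongrightarrow> l"
    using bounded_imp_convergent_subsequence by blast
  have "(\<lambda>N. c ((r \<circ> r') N) j) \<longlonglongrightarrow> (\<xi>(m := l)) j" if "j < Suc m" for j
  proof (cases "j = m")
    case True
    then show ?thesis using r'(2) by (simp add: o_def)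
  next
    case False
    then show ?thesis
      using that LIMSEQ_subseq_LIMSEQ[OF r(2)[of j] r'(1)] by (simp add: o_def)
  qed
  then show ?case using strict_mono_o[OF r(1) r'(1)] by (rule Suc.prems(1)[rotated])
qed

lemma frames_iff:
  "b \<in> frames k \<longleftrightarrow> b \<in> extensional {..<k} \<and>
     (\<forall>c. (\<Sum>i<k. c i *s b i) = 0 \<longrightarrow> (\<forall>i<k. c i = 0))"
  unfolding frames_def independent_family_iff[symmetric] by (auto simp: PiE_def)

lemma frame_exists:
  assumes "vec.subspace V" "vec.dim V = k"
  obtains b where "b \<in> frames k" "vec.span (b ` {..<k}) = V"
proof -
  obtain B where B: "B \<subseteq> V" "vec.independent B" "V \<subseteq> vec.span B" "card B = k"
    using vec.basis_exists[of V] assms(2) by metis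
  have "finite B" using B(2) by (rule vec.finiteI_independent)
  then obtain f where f: "bij_betw f {0..<k} B"
    using ex_bij_betw_nat_finite B(4) by blast
  define b where "b = restrict f {..<k}"
  have im: "b ` {..<k} = B"
    using f by (simp add: b_def bij_betw_def atLeast0LessThan)
  have "inj_on b {..<k}"
    using f by (auto simp: b_def bij_betw_def atLeast0LessThan inj_on_def)
  then have "b \<in> frames k" using B im by (auto simp: frames_def b_def)
  moreover have "vec.span (b ` {..<k}) = V"
    unfolding im using B assms(1) by (metis subset_antisym vec.span_minimal)
  ultimately show ?thesis by (rule that)
qed

lemma topspace_frames:
  "topspace (subtopology (product_topology (\<lambda>_. euclidean) {..<k}) (frames k)) = frames k"
  by (auto simp: frames_def)

lemma continuous_map_quot: "continuous_map X (quot_topology X f) f"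
  by (auto simp: continuous_map_def topspace_quot_topology openin_quot_topology)

lemma continuous_map_span:
  "continuous_map (subtopology (product_topology (\<lambda>_. euclidean) {..<k}) (frames k))
     (grassmannian_topology k) (\<lambda>b. vec.span (b ` {..<k}))"
  unfolding grassmannian_topology_def by (rule continuous_map_quot)

context symplectic_space
begin

lemma frame_act:
  assumes "b \<in> frames k" "g \<in> Sp_complex h"
  shows "(\<lambda>i\<in>{..<k}. g *v b i) \<in> frames k"
proof -
  have "c i = 0" if "(\<Sum>i<k. c i *s (\<lambda>i\<in>{..<k}. g *v b i) i) = 0" "i < k" for c i
  proof -
    have "g *v (\<Sum>i<k. c i *s b i) = (\<Sum>i<k. c i *s (\<lambda>i\<in>{..<k}. g *v b i) i)"
      by (simp add: vec.linear_sum[OF linear_matrix_vector_mult] vector_scalar_commute)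
    also have "\<dots> = g *v 0" using that(1) by simp
    finally have "(\<Sum>i<k. c i *s b i) = 0"
      using Sp_complex_inj[OF assms(2)] by (metis injD)
    then show ?thesis using assms(1) that(2) by (simp add: frames_iff)
  qed
  then show ?thesis by (simp add: frames_iff)
qed

lemma continuous_map_orbit:
  assumes V: "vec.subspace V" "vec.dim V = k"
  shows "continuous_map (top_of_set (Sp_complex h)) (grassmannian_topology k) (\<lambda>g. act_plane g V)"
proof -
  obtain b where b: "b \<in> frames k" "vec.span (b ` {..<k}) = V" using frame_exists[OF V] .
  have "continuous_map (top_of_set (Sp_complex h))
      (subtopology (product_topology (\<lambda>_. euclidean) {..<k}) (frames k)) (\<lambda>g. \<lambda>i\<in>{..<k}. g *v b i)"
    unfolding continuous_map_in_subtopology continuous_map_componentwise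
    using frame_act[OF b(1)] by (auto intro!: continuous_intros)
  from continuous_map_compose[OF this continuous_map_span]
  show ?thesis
    unfolding b(2)[symmetric] by (simp add: o_def act_plane_span image_image)
qed

end

lemma scaleR_matrix_vector_mult: "(r *\<^sub>R A) *v x = r *\<^sub>R (A *v (x :: complex^'v))"
  by (simp add: matrix_vector_mult_def vec_eq_iff scaleR_sum_right)

definition box_at :: "nat \<Rightarrow> real \<Rightarrow> (nat \<Rightarrow> complex) set" where
  "box_at m r = {..<m} \<rightarrow>\<^sub>E ball 0 r"

lemma chart_image_open:
  assumes op: "openin (subtopology X S) (F ` box_at m r)"
    and emb: "embedding_map (product_topology (\<lambda>_. top_of_set (ball (0::complex) r)) {..<m}) (subtopology X S) F"
    and e: "0 < e" "e \<le> r"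
  shows "openin (subtopology X S) (F ` box_at m e)"
proof -
  let ?P = "product_topology (\<lambda>_. top_of_set (ball (0::complex) r)) {..<m}"
  have top: "topspace ?P = box_at m r" by (simp add: box_at_def)
  have "openin ?P (box_at m e)"
    unfolding box_at_def openin_PiE_gen
  proof (intro disjI2 conjI ballI)
    show "finite {i \<in> {..<m}. ball 0 e \<noteq> topspace (top_of_set (ball (0::complex) r))}" by simp
    show "openin (top_of_set (ball 0 r)) (ball (0::complex) e)" using e by (simp add: openin_open_eq subset_ball)
  qed
  then have "openin (subtopology (subtopology X S) (F ` box_at m r)) (F ` box_at m e)"
    using emb homeomorphic_imp_open_map unfolding embedding_map_def top open_map_def by blast
  then show ?thesis using op openin_trans_full by blast
qed

context compatible_structure
begin

definition rotation :: "real \<Rightarrow> complex^'v^'v" where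
  "rotation t = cos t *\<^sub>R mat 1 + sin t *\<^sub>R J"

lemma rotation: "rotation t *v x = cos t *\<^sub>R x + sin t *\<^sub>R (J *v x)"
  by (simp add: rotation_def matrix_vector_mult_add_rdistrib scaleR_matrix_vector_mult)

lemma rotation_unitary: "rotation t \<in> unitary_group"
proof -
  have J: "\<sigma> (J *v x) y = - \<sigma> x (J *v y)" for x y using \<sigma>_J[of "J *v x" y] by simp
  have "\<sigma> (rotation t *v x) (rotation t *v y) = \<sigma> x y" for x y
  proof -
    have 1: "of_real (cos t) * of_real (cos t) + of_real (sin t) * of_real (sin t) = (1::complex)"
      by (simp only: sin_cos_squared_add3 flip: of_real_mult of_real_add) simp
    have "\<sigma> (rotation t *v x) (rotation t *v y) =
        (of_real (cos t) * of_real (cos t) + of_real (sin t) * of_real (sin t)) * \<sigma> x y"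
      unfolding rotation by (simp add: J algebra_simps)
    then show ?thesis unfolding 1 by simp
  qed
  moreover have "rotation t *v (J *v x) = J *v (rotation t *v x)" for x
    unfolding rotation by (simp add: matrix_vector_right_distrib matrix_vector_mult_minus scaleR_eq_vector_scalar vector_scalar_commute)
  ultimately show ?thesis
    by (simp add: unitary_group_def Sp_complex_def) (simp add: rotation)
qed

lemma rotation_inverse: "rotation (- t) *v (rotation t *v x) = x"
proof -
  have "rotation (- t) *v (rotation t *v x) =
      (of_real (cos t) * of_real (cos t) + of_real (sin t) * of_real (sin t)) *s x"
    unfolding rotation
    by (simp add: matrix_vector_right_distrib scaleR_eq_vector_scalar vector_scalar_commute
        vec_eq_iff algebra_simps)
  also have "of_real (cos t) * of_real (cos t) + of_real (sin t) * of_real (sin t) = (1::complex)"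
    by (simp only: sin_cos_squared_add3 flip: of_real_mult of_real_add) simp
  finally show ?thesis by simp
qed

text \<open>Only continuity is used: a small rotation keeps the plane in the image of any smaller
  box of the chart, since that image is open in the orbit. Nothing is claimed about how fast the
  parameters tend to 0.\<close>

lemma chart_parameters_along_rotation:
  assumes C0: "C0 = (\<lambda>g. act_plane g V0) ` unitary_group" and V: "V \<in> C0"
    and dim: "vec.subspace V" "vec.dim V = k"
    and r: "0 < r" and F0: "F (\<lambda>j\<in>{..<m}. 0) = V"
    and op: "openin (subtopology (grassmannian_topology k) C0) (F ` box_at m r)"
    and emb: "embedding_map (product_topology (\<lambda>_. top_of_set (ball (0::complex) r)) {..<m})
        (subtopology (grassmannian_topology k) C0) F"
    and e: "0 < e"
  obtains t c where "0 < t" "t < e" "c \<in> box_at m e" "F c = act_plane (rotation t) V"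
proof -
  define e' where "e' = min e r"
  have e': "0 < e'" "e' \<le> r" "e' \<le> e" using e r by (auto simp: e'_def)
  have "openin (subtopology (grassmannian_topology k) C0) (F ` box_at m e')"
    by (rule chart_image_open[OF op emb e'(1,2)])
  moreover have "continuous_map euclideanreal (subtopology (grassmannian_topology k) C0) (\<lambda>t. act_plane (rotation t) V)"
  proof -
    have "continuous_map euclideanreal (top_of_set (Sp_complex h)) rotation"
      using unitary_in_Sp[OF rotation_unitary]
      by (auto simp: continuous_map_in_subtopology rotation_def[abs_def] intro!: continuous_intros)
    from continuous_map_compose[OF this continuous_map_orbit[OF dim]]
    have "continuous_map euclideanreal (grassmannian_topology k) (\<lambda>t. act_plane (rotation t) V)"
      by (simp add: o_def)
    moreover have "act_plane (rotation t) V \<in> C0" for t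
    proof -
      obtain g where g: "g \<in> unitary_group" "V = act_plane g V0" using V C0 by blast
      then have "rotation t ** g \<in> unitary_group"
        using unitary_group_subgroup rotation_unitary by (simp add: matrix_subgroup_def)
      then show ?thesis unfolding C0 g(2) by (simp flip: act_plane_mult)
    qed
    ultimately show ?thesis by (auto simp: continuous_map_in_subtopology)
  qed
  ultimately have "openin euclideanreal {t \<in> topspace euclideanreal. act_plane (rotation t) V \<in> F ` box_at m e'}"
    by (rule openin_continuous_map_preimage[rotated])
  then have "open {t. act_plane (rotation t) V \<in> F ` box_at m e'}" by simp
  moreover have "0 \<in> {t. act_plane (rotation t) V \<in> F ` box_at m e'}"
  proof -
    have "(\<lambda>j\<in>{..<m}. 0) \<in> box_at m e'" using e' by (simp add: box_at_def)
    moreover have "act_plane (rotation 0) V = F (\<lambda>j\<in>{..<m}. 0)" by (simp add: F0 rotation_def)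
    ultimately show ?thesis by auto
  qed
  ultimately obtain d where d: "0 < d" "ball 0 d \<subseteq> {t. act_plane (rotation t) V \<in> F ` box_at m e'}"
    by (meson open_contains_ball)
  define t where "t = min (d/2) (e/2)"
  have "t \<in> ball 0 d" using d e by (simp add: t_def min_def)
  then obtain c where "c \<in> box_at m e'" "act_plane (rotation t) V = F c" using d by blast
  moreover have "0 < t" "t < e" using d e by (auto simp: t_def)
  moreover have "box_at m e' \<subseteq> box_at m e" using e' by (force simp: box_at_def PiE_def Pi_def)
  ultimately show ?thesis using that by (metis subsetD)
qed

text \<open>The chart parameters of the rotated planes are not known to depend differentiably on the
  angle. Angle and parameters are therefore rescaled together and a limit direction is taken along a
  subsequence; full rank of the differential ensures that the angle contributes to this
  limit.\<close>

lemma J_tangent_to_orbit: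
  assumes C0: "C0 = (\<lambda>g. act_plane g V0) ` unitary_group" and V: "V \<in> C0"
    and dim: "vec.subspace V" "vec.dim V = k"
    and r: "0 < r" and F0: "F (\<lambda>j\<in>{..<m}. 0) = V"
    and op: "openin (subtopology (grassmannian_topology k) C0) (F ` box_at m r)"
    and emb: "embedding_map (product_topology (\<lambda>_. top_of_set (ball (0::complex) r)) {..<m})
        (subtopology (grassmannian_topology k) C0) F"
    and r1: "0 < r1" and fr: "holomorphic_frame k m F (box_at m r1) f"
    and D: "\<And>i. i < k \<Longrightarrow> has_complex_partials m (f i) (D i) (\<lambda>j\<in>{..<m}. 0)"
    and rank: "\<forall>v. (\<forall>i<k. (\<Sum>j<m. v j *s D i j) \<in> V) \<longrightarrow> (\<forall>j<m. v j = 0)"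
  obtains \<xi> where "\<And>i. i < k \<Longrightarrow> J *v f i (\<lambda>j\<in>{..<m}. 0) - (\<Sum>j<m. \<xi> j *s D i j) \<in> V"
proof -
  define z0 :: "nat \<Rightarrow> complex" where "z0 = (\<lambda>j\<in>{..<m}. 0)"
  obtain b where b: "orthonormal k b" "vec.span (b ` {..<k}) = V"
    using orthonormal_basis[OF dim(1)] dim(2) by metis
  let ?\<pi> = "proj_perp k b"
  interpret \<pi>: bounded_linear ?\<pi> by (rule bounded_linear_proj_perp)
  have \<pi>0: "?\<pi> x = 0 \<longleftrightarrow> x \<in> V" for x using proj_perp_eq_0[OF b(1)] b(2) by simp
  have "\<exists>t c. 0 < t \<and> t < 1 / real (Suc N) \<and> c \<in> box_at m (min (1 / real (Suc N)) r1) \<and> F c = act_plane (rotation t) V" for N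
  proof -
    obtain t c where "0 < t" "t < min (1 / real (Suc N)) r1" "c \<in> box_at m (min (1 / real (Suc N)) r1)"
      "F c = act_plane (rotation t) V"
      by (rule chart_parameters_along_rotation[OF C0 V dim r F0 op emb, of "min (1 / real (Suc N)) r1"])
        (use r1 in auto)
    then show ?thesis by auto
  qed
  then obtain t c where t: "\<And>N. 0 < t N" "\<And>N. t N < 1 / real (Suc N)"
    and c: "\<And>N. c N \<in> box_at m (min (1 / real (Suc N)) r1)" "\<And>N. F (c N) = act_plane (rotation (t N)) V"
    by metis
  have cr1: "c N \<in> box_at m r1" for N using c(1)[of N] by (auto simp: box_at_def PiE_def Pi_def)
  have cN: "norm (c N j) < 1 / real (Suc N)" if "j < m" for N j
    using c(1)[of N] that by (auto simp: box_at_def PiE_def Pi_def)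
  have t0: "t \<longlonglongrightarrow> 0"
    by (rule tendsto_sandwich[OF _ _ tendsto_const LIMSEQ_inverse_real_of_nat])
      (use t in \<open>auto intro!: always_eventually less_imp_le simp: inverse_eq_divide\<close>)
  define cs where "cs N = (\<Sum>j<m. norm (c N j))" for N
  \<comment> \<open>The common scale makes all quotients bounded and keeps the sum of their norms
    equal to 1, so the limit direction cannot vanish.\<close>
  define s where "s N = t N + cs N" for N
  have cs0: "0 \<le> cs N" for N unfolding cs_def by (intro sum_nonneg) simp
  have s0: "0 < s N" for N using t(1)[of N] cs0[of N] by (simp add: s_def)
  define q where "q N j = (if j < m then c N j / of_real (s N) else of_real (t N / s N))" for N j
  have "norm (q N j) \<le> 1" if "j < Suc m" for N j
  proof (cases "j < m")
    case True
    have "norm (c N j) \<le> cs N" unfolding cs_def using True by (intro member_le_sum) auto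
    then have "norm (c N j) \<le> s N" using t(1)[of N] by (simp add: s_def)
    then show ?thesis using True s0[of N] by (simp add: q_def norm_divide)
  next
    case False
    have "t N \<le> s N" using cs0[of N] by (simp add: s_def)
    then show ?thesis using False s0[of N] t(1)[of N] by (simp add: q_def norm_divide)
  qed
  then obtain \<phi> \<xi> where \<phi>: "strict_mono (\<phi> :: nat \<Rightarrow> nat)" "\<And>j. j < Suc m \<Longrightarrow> (\<lambda>N. q (\<phi> N) j) \<longlonglongrightarrow> \<xi> j"
    using bounded_family_subsequence[of "Suc m" q 1] by blast
  define \<tau> where "\<tau> = Re (\<xi> m)"
  have \<tau>: "(\<lambda>N. t (\<phi> N) / s (\<phi> N)) \<longlonglongrightarrow> \<tau>"
    using tendsto_Re[OF \<phi>(2)[of m]] by (simp add: q_def \<tau>_def)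
  have \<xi>: "(\<lambda>N. c (\<phi> N) j / of_real (s (\<phi> N))) \<longlonglongrightarrow> \<xi> j" if "j < m" for j
    using \<phi>(2)[of j] that by (simp add: q_def)
  have one: "\<tau> + (\<Sum>j<m. norm (\<xi> j)) = 1"
  proof -
    have "(\<lambda>N. t (\<phi> N) / s (\<phi> N) + (\<Sum>j<m. norm (c (\<phi> N) j / of_real (s (\<phi> N))))) \<longlonglongrightarrow> \<tau> + (\<Sum>j<m. norm (\<xi> j))"
      by (intro tendsto_add \<tau> tendsto_sum tendsto_norm \<xi>) auto
    moreover have "t N / s N + (\<Sum>j<m. norm (c N j / of_real (s N))) = 1" for N
    proof -
      have "norm (c N j / of_real (s N)) = norm (c N j) / s N" for j
        using s0[of N] by (simp add: norm_divide)
      then have "(\<Sum>j<m. norm (c N j / of_real (s N))) = cs N / s N"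
        by (simp add: cs_def sum_divide_distrib)
      moreover have "t N / s N + cs N / s N = s N / s N" by (simp only: s_def add_divide_distrib)
      ultimately show ?thesis using s0[of N] by simp
    qed
    ultimately show ?thesis by (simp add: LIMSEQ_const_iff)
  qed
  have key: "?\<pi> (\<Sum>j<m. \<xi> j *s D i j) = \<tau> *\<^sub>R ?\<pi> (J *v f i z0)" if i: "i < k" for i
  proof -
    have frame0: "f i z0 \<in> V"
    proof -
      have "z0 \<in> box_at m r1" using r1 by (simp add: box_at_def z0_def)
      then have "vec.span ((\<lambda>i. f i z0) ` {..<k}) = V" using fr F0 by (auto simp: holomorphic_frame_def z0_def)
      then show ?thesis using i by (metis (no_types, lifting) imageI lessThan_iff vec.span_base)
    qed
    define err where "err N = f i (c N) - f i z0 - (\<Sum>j<m. c N j *s D i j)" for N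
    have err: "(\<lambda>N. (1 / s N) *\<^sub>R err N) \<longlonglongrightarrow> 0"
    proof (rule LIMSEQ_I)
      fix e :: real assume "0 < e"
      then obtain d where d: "0 < d" "\<And>w. w \<in> {..<m} \<rightarrow>\<^sub>E UNIV \<Longrightarrow> (\<forall>j<m. norm (w j - z0 j) < d) \<Longrightarrow>
          norm (f i w - f i z0 - (\<Sum>j<m. (w j - z0 j) *s D i j)) \<le> (e/2) * (\<Sum>j<m. norm (w j - z0 j))"
        using D[OF i, unfolded has_complex_partials_def z0_def[symmetric], THEN spec[of _ "e/2"], THEN mp]
        by auto
      obtain N0 where N0: "1 / real (Suc N0) < d" using d(1) by (meson nat_approx_posE)
      have "norm ((1 / s N) *\<^sub>R err N - 0) < e" if "N0 \<le> N" for N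
      proof -
        have "1 / real (Suc N) \<le> 1 / real (Suc N0)" using that by (simp add: frac_le)
        then have "\<forall>j<m. norm (c N j - z0 j) < d"
          using cN[of _ N] N0 by (force simp: z0_def)
        moreover have "c N \<in> {..<m} \<rightarrow>\<^sub>E UNIV" using cr1[of N] by (auto simp: box_at_def PiE_def)
        ultimately have "norm (err N) \<le> (e/2) * cs N"
          using d(2)[of "c N"] by (simp add: err_def cs_def z0_def)
        also have "\<dots> \<le> (e/2) * s N" using t(1)[of N] \<open>0 < e\<close> by (simp add: s_def)
        finally have "norm ((1 / s N) *\<^sub>R err N) \<le> e / 2" using s0[of N] by (simp add: field_simps)
        then have "norm ((1 / s N) *\<^sub>R err N) < e" using \<open>0 < e\<close> by linarith
        then show ?thesis by simp
      qed
      then show "\<exists>no. \<forall>N\<ge>no. norm ((1 / s N) *\<^sub>R err N - 0) < e" by blast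
    qed
    have dq: "(\<lambda>N. (1 / s (\<phi> N)) *\<^sub>R (f i (c (\<phi> N)) - f i z0)) \<longlonglongrightarrow> (\<Sum>j<m. \<xi> j *s D i j)"
    proof -
      have "(1 / s N) *\<^sub>R (f i (c N) - f i z0) = (1 / s N) *\<^sub>R err N + (\<Sum>j<m. (c N j / of_real (s N)) *s D i j)" for N
        by (simp add: err_def scaleR_right_diff_distrib scaleR_sum_right)
          (simp add: scaleR_eq_vector_scalar vector_smult_assoc)
      moreover have "(\<lambda>N. (1 / s (\<phi> N)) *\<^sub>R err (\<phi> N) + (\<Sum>j<m. (c (\<phi> N) j / of_real (s (\<phi> N))) *s D i j))
          \<longlonglongrightarrow> 0 + (\<Sum>j<m. \<xi> j *s D i j)"
      proof (intro tendsto_add tendsto_sum)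
        show "(\<lambda>N. (1 / s (\<phi> N)) *\<^sub>R err (\<phi> N)) \<longlonglongrightarrow> 0"
          using LIMSEQ_subseq_LIMSEQ[OF err \<phi>(1)] by (simp add: o_def)
        fix j assume "j \<in> {..<m}"
        then show "(\<lambda>N. (c (\<phi> N) j / of_real (s (\<phi> N))) *s D i j) \<longlonglongrightarrow> \<xi> j *s D i j"
          unfolding vector_scalar_mult_def using \<xi>[of j] by (intro tendsto_vec_lambda tendsto_mult tendsto_const) auto
      qed
      ultimately show ?thesis by simp
    qed
    have fc: "(\<lambda>N. f i (c (\<phi> N))) \<longlonglongrightarrow> f i z0"
    proof -
      have "(\<lambda>N. s (\<phi> N)) \<longlonglongrightarrow> 0"
      proof -
        have "s \<longlonglongrightarrow> 0"
        proof (rule tendsto_sandwich[OF _ _ tendsto_const])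
          show "(\<lambda>N. (real m + 1) * inverse (real (Suc N))) \<longlonglongrightarrow> 0"
            using tendsto_mult_right_zero[OF LIMSEQ_inverse_real_of_nat] by simp
          have "s N \<le> (real m + 1) * inverse (real (Suc N))" for N
          proof -
            have "cs N \<le> (\<Sum>j<m. 1 / real (Suc N))" unfolding cs_def using cN by (intro sum_mono less_imp_le) auto
            then show ?thesis using t(2)[of N] by (simp add: s_def inverse_eq_divide field_simps)
          qed
          then show "eventually (\<lambda>N. s N \<le> (real m + 1) * inverse (real (Suc N))) sequentially" by simp
        qed (use s0 in \<open>auto intro!: always_eventually less_imp_le\<close>)
        from LIMSEQ_subseq_LIMSEQ[OF this \<phi>(1)] show ?thesis by (simp add: o_def)
      qed
      from tendsto_scaleR[OF this dq]
      have "(\<lambda>N. f i (c (\<phi> N)) - f i z0) \<longlonglongrightarrow> 0" using s0 by (simp add: less_imp_neq[symmetric])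
      then show ?thesis by (simp add: LIM_zero_iff)
    qed
    \<comment> \<open>Rotating \<open>f i (c N)\<close> back gives a vector of \<open>V\<close>,
      which \<open>?\<pi>\<close> kills; expanding the rotation leaves this relation between the
      difference quotient and \<open>J\<close>.\<close>
    have eq: "cos (t N) *\<^sub>R ?\<pi> ((1 / s N) *\<^sub>R (f i (c N) - f i z0)) = (sin (t N) / t N * (t N / s N)) *\<^sub>R ?\<pi> (J *v f i (c N))" for N
    proof -
      have "f i (c N) \<in> F (c N)"
      proof -
        have "vec.span ((\<lambda>i. f i (c N)) ` {..<k}) = F (c N)" using fr cr1 by (auto simp: holomorphic_frame_def)
        then show ?thesis using i by (metis (no_types, lifting) imageI lessThan_iff vec.span_base)
      qed
      then obtain v where v: "v \<in> V" "f i (c N) = rotation (t N) *v v" unfolding c(2) act_plane_def by blast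
      then have "rotation (- t N) *v f i (c N) \<in> V" using rotation_inverse by simp
      then have "?\<pi> (rotation (- t N) *v f i (c N)) = 0" using \<pi>0 by simp
      then have "cos (t N) *\<^sub>R ?\<pi> (f i (c N)) = sin (t N) *\<^sub>R ?\<pi> (J *v f i (c N))"
        by (simp add: rotation \<pi>.diff \<pi>.scaleR)
      moreover have "?\<pi> (f i z0) = 0" using \<pi>0 frame0 by simp
      ultimately have "(1 / s N) *\<^sub>R (cos (t N) *\<^sub>R ?\<pi> (f i (c N) - f i z0)) = (1 / s N) *\<^sub>R (sin (t N) *\<^sub>R ?\<pi> (J *v f i (c N)))"
        by (simp add: \<pi>.diff)
      then show ?thesis using t(1)[of N] by (simp add: \<pi>.scaleR mult.commute)
    qed
    have t\<phi>: "(\<lambda>N. t (\<phi> N)) \<longlonglongrightarrow> 0" using LIMSEQ_subseq_LIMSEQ[OF t0 \<phi>(1)] by (simp add: o_def)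
    have "(\<lambda>N. cos (t (\<phi> N)) *\<^sub>R ?\<pi> ((1 / s (\<phi> N)) *\<^sub>R (f i (c (\<phi> N)) - f i z0))) \<longlonglongrightarrow> cos 0 *\<^sub>R ?\<pi> (\<Sum>j<m. \<xi> j *s D i j)"
      by (intro tendsto_scaleR tendsto_cos t\<phi> \<pi>.tendsto dq)
    moreover have "(\<lambda>N. (sin (t (\<phi> N)) / t (\<phi> N) * (t (\<phi> N) / s (\<phi> N))) *\<^sub>R ?\<pi> (J *v f i (c (\<phi> N)))) \<longlonglongrightarrow> (1 * \<tau>) *\<^sub>R ?\<pi> (J *v f i z0)"
    proof (intro tendsto_scaleR tendsto_mult \<tau> \<pi>.tendsto tendsto_matrix_vector_mult tendsto_const fc)
      have "((\<lambda>x::real. sin x / x) \<longlongrightarrow> 1) (at 0)" using DERIV_sin[of 0] by (simp add: DERIV_def)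
      moreover have "filterlim (\<lambda>N. t (\<phi> N)) (at 0) sequentially"
        using t\<phi> t(1) by (auto simp: filterlim_at less_imp_neq[symmetric])
      ultimately show "(\<lambda>N. sin (t (\<phi> N)) / t (\<phi> N)) \<longlonglongrightarrow> 1" by (rule filterlim_compose)
    qed
    ultimately show ?thesis unfolding eq using LIMSEQ_unique by fastforce
  qed
  \<comment> \<open>If \<open>\<tau>\<close> were 0, the nonzero vector \<open>\<xi>\<close> would
    lie in the kernel of the differential of the chart.\<close>
  have \<tau>0: "0 < \<tau>"
  proof -
    have "0 \<le> \<tau>" by (rule LIMSEQ_le_const[OF \<tau>]) (use t s0 in \<open>auto intro!: divide_nonneg_pos less_imp_le\<close>)
    moreover have "\<tau> \<noteq> 0"
    proof
      assume "\<tau> = 0"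
      then have "(\<Sum>j<m. \<xi> j *s D i j) \<in> V" if "i < k" for i using key[OF that] \<pi>0 by simp
      then have "\<xi> j = 0" if "j < m" for j using rank that by blast
      then show False using one \<open>\<tau> = 0\<close> by simp
    qed
    ultimately show ?thesis by simp
  qed
  show ?thesis
  proof (rule that[of "\<lambda>j. \<xi> j / of_real \<tau>"])
    fix i assume i: "i < k"
    have "(\<Sum>j<m. (\<xi> j / of_real \<tau>) *s D i j) = (1/\<tau>) *\<^sub>R (\<Sum>j<m. \<xi> j *s D i j)"
      by (simp add: scaleR_sum_right scaleR_eq_vector_scalar vector_smult_assoc vec.scale_sum_right)
    then have "?\<pi> (J *v f i z0 - (\<Sum>j<m. (\<xi> j / of_real \<tau>) *s D i j)) = 0"
      using key[OF i] \<tau>0 by (simp add: \<pi>.diff \<pi>.scaleR)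
    then show "J *v f i (\<lambda>j\<in>{..<m}. 0) - (\<Sum>j<m. (\<xi> j / of_real \<tau>) *s D i j) \<in> V"
      using \<pi>0 by (simp add: z0_def)
  qed
qed

end

section \<open>The gradient direction and the planes of the base cycle\<close>

lemma bounded_linear_vector_scalar: "bounded_linear ((*s) c :: complex^'v \<Rightarrow> complex^'v)"
  by (simp add: linear_conv_bounded_linear[symmetric] linear_iff vec.scale_right_distrib
      scaleR_eq_vector_scalar vector_smult_assoc mult.commute)

lemma complex_partials_vector_derivative:
  assumes "has_complex_partials m f D (\<lambda>j\<in>{..<m}. 0)"
  shows "((\<lambda>s. f (\<lambda>j\<in>{..<m}. of_real s * v j)) has_vector_derivative (\<Sum>j<m. v j *s D j)) (at 0)"
  unfolding has_vector_derivative_def has_derivative_at_alt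
proof (intro conjI allI impI)
  show "bounded_linear (\<lambda>x. x *\<^sub>R (\<Sum>j<m. v j *s D j))" by (rule bounded_linear_scaleR_left)
  fix e :: real assume e: "0 < e"
  \<comment> \<open>The summand 1 keeps the divisor positive when \<open>m = 0\<close> or
    \<open>v\<close> vanishes.\<close>
  define X where "X = (\<Sum>j<m. norm (v j)) + 1"
  have X: "0 < X" "\<And>j. j < m \<Longrightarrow> norm (v j) < X"
  proof -
    show "0 < X" unfolding X_def by (intro add_nonneg_pos sum_nonneg) auto
    show "norm (v j) < X" if "j < m" for j
      using member_le_sum[of j "{..<m}" "\<lambda>j. norm (v j)"] that by (simp add: X_def)
  qed
  define z0 :: "nat \<Rightarrow> complex" where "z0 = (\<lambda>j\<in>{..<m}. 0)"
  have "0 < e / X" using e X by simp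
  then obtain d where d: "0 < d" "\<And>w. w \<in> {..<m} \<rightarrow>\<^sub>E UNIV \<Longrightarrow> (\<forall>j<m. norm (w j - z0 j) < d) \<Longrightarrow>
      norm (f w - f z0 - (\<Sum>j<m. (w j - z0 j) *s D j)) \<le> (e / X) * (\<Sum>j<m. norm (w j - z0 j))"
    using assms[unfolded has_complex_partials_def z0_def[symmetric], THEN spec[of _ "e / X"], THEN mp]
    by auto
  have "norm (f (\<lambda>j\<in>{..<m}. of_real s * v j) - f z0 - s *\<^sub>R (\<Sum>j<m. v j *s D j)) \<le> e * \<bar>s\<bar>"
    if s: "\<bar>s\<bar> < d / X" for s
  proof -
    define w where "w = (\<lambda>j\<in>{..<m}. of_real s * v j)"
    have wj: "w j - z0 j = of_real s * v j" if "j < m" for j using that by (simp add: w_def z0_def)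
    have "norm (w j - z0 j) < d" if "j < m" for j
    proof -
      have "norm (w j - z0 j) = \<bar>s\<bar> * norm (v j)" using wj[OF that] by (simp add: norm_mult)
      also have "\<dots> \<le> \<bar>s\<bar> * X" using X(2)[OF that] by (intro mult_left_mono) auto
      also have "\<dots> < d" using s X(1) by (simp add: field_simps)
      finally show ?thesis .
    qed
    moreover have "w \<in> {..<m} \<rightarrow>\<^sub>E UNIV" by (simp add: w_def)
    ultimately have "norm (f w - f z0 - (\<Sum>j<m. (w j - z0 j) *s D j)) \<le> (e / X) * (\<Sum>j<m. norm (w j - z0 j))"
      by (intro d(2)) auto
    moreover have "(\<Sum>j<m. (w j - z0 j) *s D j) = s *\<^sub>R (\<Sum>j<m. v j *s D j)"
      by (simp add: wj scaleR_sum_right scaleR_eq_vector_scalar vector_smult_assoc vec.scale_sum_right)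
    moreover have "(\<Sum>j<m. norm (w j - z0 j)) = \<bar>s\<bar> * (\<Sum>j<m. norm (v j))"
      by (simp add: wj norm_mult sum_distrib_left)
    moreover have "(e / X) * (\<bar>s\<bar> * (\<Sum>j<m. norm (v j))) \<le> (e / X) * (\<bar>s\<bar> * X)"
      using e X(1) by (intro mult_left_mono) (auto simp: X_def)
    ultimately show ?thesis using X(1) by (simp add: w_def)
  qed
  moreover have "z0 = (\<lambda>j\<in>{..<m}. of_real 0 * v j)" by (auto simp: z0_def)
  ultimately show "\<exists>d>0. \<forall>y. norm (y - 0) < d \<longrightarrow>
      norm (f (\<lambda>j\<in>{..<m}. of_real y * v j) - f (\<lambda>j\<in>{..<m}. of_real 0 * v j) - (y - 0) *\<^sub>R (\<Sum>j<m. v j *s D j))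
        \<le> e * norm (y - 0)"
    using d(1) X(1) by (intro exI[of _ "d / X"]) auto
qed

lemma eventually_in_box:
  assumes "0 < r"
  shows "eventually (\<lambda>s. (\<lambda>j\<in>{..<m}. of_real s * v j) \<in> box_at m r) (at_right (0::real))"
proof -
  have "eventually (\<lambda>s. norm (of_real s * v j) < r) (at_right 0)" for j
  proof -
    have "((\<lambda>s. norm (complex_of_real s * v j)) \<longlongrightarrow> norm (complex_of_real 0 * v j)) (at_right 0)"
      by (intro tendsto_intros)
    then show ?thesis using assms by (intro order_tendstoD(2)) auto
  qed
  then have "eventually (\<lambda>s. \<forall>j\<in>{..<m}. norm (of_real s * v j) < r) (at_right 0)"
    by (intro eventually_ball_finite) auto
  then show ?thesis by eventually_elim (auto simp: box_at_def)
qed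

context compatible_structure
begin

text \<open>Complex differentiability of the chart makes its tangent space a complex subspace, so
  together with the rotation direction it contains i times that direction, the gradient of the
  energy. A straight segment in the chart is then a curve in the orbit with this velocity.\<close>

lemma orbit_submanifold_J_invariant:
  assumes n: "CARD('v) = 2 * n" and C0: "C0 = (\<lambda>g. act_plane g V0) ` unitary_group" and V: "V \<in> C0"
    and dim: "vec.subspace V" "vec.dim V = k" and sub: "complex_submanifold k m C0"
    and x: "x \<in> V"
  shows "J *v x \<in> V"
proof -
  define z0 :: "nat \<Rightarrow> complex" where "z0 = (\<lambda>j\<in>{..<m}. 0)"
  obtain F r where r: "0 < r" and F0: "F z0 = V"
    and rank: "\<forall>z\<in>box_at m r. differential_rank_full k m F z"
    and op: "openin (subtopology (grassmannian_topology k) C0) (F ` box_at m r)"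
    and emb: "embedding_map (product_topology (\<lambda>_. top_of_set (ball (0::complex) r)) {..<m})
        (subtopology (grassmannian_topology k) C0) F"
    using sub V unfolding complex_submanifold_def Let_def box_at_def z0_def by blast
  have "z0 \<in> box_at m r" using r by (simp add: z0_def box_at_def)
  then have "differential_rank_full k m F z0" using rank by blast
  then obtain r1 f D where r1: "0 < r1"
    and fr': "holomorphic_frame k m F (PiE {..<m} (\<lambda>j. ball (z0 j) r1)) f"
    and D': "\<forall>i<k. has_complex_partials m (f i) (D i) z0"
    and inj': "\<forall>v. (\<forall>i<k. (\<Sum>j<m. v j *s D i j) \<in> V) \<longrightarrow> (\<forall>j<m. v j = 0)"
    unfolding differential_rank_full_def F0 by blast
  have D: "has_complex_partials m (f i) (D i) z0" if "i < k" for i using D' that by blast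
  have "PiE {..<m} (\<lambda>j. ball (z0 j) r1) = box_at m r1"
    unfolding box_at_def z0_def by (intro PiE_cong) simp
  with fr' have fr: "holomorphic_frame k m F (box_at m r1) f" by simp
  obtain \<xi> where \<xi>: "\<And>i. i < k \<Longrightarrow> J *v f i z0 - (\<Sum>j<m. \<xi> j *s D i j) \<in> V"
    using J_tangent_to_orbit[of C0 V0 V k r F m r1 f D, folded z0_def, OF C0 V dim r F0 op emb r1 fr D inj']
    by blast
  have z0r1: "z0 \<in> box_at m r1" using r1 by (simp add: z0_def box_at_def)
  obtain b where b: "orthonormal k b" "vec.span (b ` {..<k}) = V"
    using orthonormal_basis[OF dim(1)] dim(2) by metis
  have bV: "b i \<in> V" if "i < k" for i using that b(2) by (metis imageI lessThan_iff vec.span_base)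
  have span0: "vec.span ((\<lambda>i. f i z0) ` {..<k}) = V"
    using fr z0r1 F0 by (auto simp: holomorphic_frame_def)
  have "\<exists>c. b i = (\<Sum>l<k. c l *s f l z0)" if "i < k" for i
    using bV[OF that] unfolding span0[symmetric] span_family by blast
  then obtain M where M: "\<And>i. i < k \<Longrightarrow> b i = (\<Sum>l<k. M i l *s f l z0)" by metis
  \<comment> \<open>The factor \<open>\<i>\<close> turns the rotation direction \<open>\<xi>\<close>
    into the gradient direction.\<close>
  define w where "w s = (\<lambda>j\<in>{..<m}. complex_of_real s * (\<i> * \<xi> j))" for s
  define e where "e l = (\<Sum>j<m. (\<i> * \<xi> j) *s D l j)" for l
  define G where "G i s = (\<Sum>l<k. M i l *s f l (w s))" for i s
  define d where "d i = (\<Sum>l<k. M i l *s e l)" for i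
  \<comment> \<open>The correction is a combination of the moving frame, so
    \<open>\<beta> i s\<close> stays in \<open>F (w s)\<close>, while its velocity at 0 becomes
    orthogonal to \<open>V\<close>.\<close>
  define \<beta> where "\<beta> i s = G i s - s *\<^sub>R (\<Sum>l<k. ip (d i) (b l) *s G l s)" for i s
  have w0: "w 0 = z0" by (auto simp: w_def z0_def)
  have G0: "G i 0 = b i" if "i < k" for i using M[OF that] by (simp add: G_def w0)
  have G': "(G i has_vector_derivative d i) (at 0)" for i
    unfolding G_def d_def w_def e_def
    by (intro has_vector_derivative_sum bounded_linear.has_vector_derivative[OF bounded_linear_vector_scalar]
        complex_partials_vector_derivative) (use D in \<open>auto simp: z0_def\<close>)
  have eV: "e l - \<i> *s (J *v f l z0) \<in> V" if "l < k" for l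
  proof -
    have "e l - \<i> *s (J *v f l z0) = (- \<i>) *s (J *v f l z0 - (\<Sum>j<m. \<xi> j *s D l j))"
      by (simp add: e_def sum_negf vec.scale_right_diff_distrib vec.scale_sum_right vector_smult_assoc)
    then show ?thesis using vec.subspace_scale[OF dim(1) \<xi>[OF that]] by metis
  qed
  have dV: "d i - \<i> *s (J *v b i) \<in> V" if "i < k" for i
  proof -
    have eq: "d i - \<i> *s (J *v b i) = (\<Sum>l<k. M i l *s (e l - \<i> *s (J *v f l z0)))"
      unfolding d_def M[OF that]
      by (simp add: vec.linear_sum[OF linear_matrix_vector_mult] vector_scalar_commute vec.scale_sum_right
          vec.scale_right_diff_distrib sum_subtractf vector_smult_assoc mult.commute)
    show ?thesis
      unfolding eq by (intro vec.subspace_sum[OF dim(1)] vec.subspace_scale[OF dim(1)] eV) simp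
  qed
  show ?thesis
    unfolding b(2)[symmetric]
  proof (rule gradient_curve_in_orbit[OF n b(1), of \<beta>])
    show "\<beta> i 0 = b i" if "i < k" for i using G0[OF that] by (simp add: \<beta>_def)
    show "(\<beta> i has_vector_derivative proj_perp k b (\<i> *s (J *v b i))) (at 0)" if i: "i < k" for i
    proof -
      have "((\<lambda>s. \<Sum>l<k. ip (d i) (b l) *s G l s) has_vector_derivative (\<Sum>l<k. ip (d i) (b l) *s d l)) (at 0)"
        by (intro has_vector_derivative_sum bounded_linear.has_vector_derivative[OF bounded_linear_vector_scalar] G')
      then have "((\<lambda>s. s *\<^sub>R (\<Sum>l<k. ip (d i) (b l) *s G l s)) has_vector_derivative
          (0 *\<^sub>R (\<Sum>l<k. ip (d i) (b l) *s d l) + 1 *\<^sub>R (\<Sum>l<k. ip (d i) (b l) *s G l 0))) (at 0)"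
        by (intro has_vector_derivative_scaleR) auto
      then have "(\<beta> i has_vector_derivative (d i - (0 *\<^sub>R (\<Sum>l<k. ip (d i) (b l) *s d l) + 1 *\<^sub>R (\<Sum>l<k. ip (d i) (b l) *s G l 0)))) (at 0)"
        unfolding \<beta>_def by (intro has_vector_derivative_diff G')
      moreover have "d i - (0 *\<^sub>R (\<Sum>l<k. ip (d i) (b l) *s d l) + 1 *\<^sub>R (\<Sum>l<k. ip (d i) (b l) *s G l 0)) = proj_perp k b (d i)"
        by (simp add: proj_perp_def G0)
      moreover have "proj_perp k b (d i - \<i> *s (J *v b i)) = 0"
        using dV[OF i] proj_perp_eq_0[OF b(1)] b(2) by simp
      then have "proj_perp k b (d i) = proj_perp k b (\<i> *s (J *v b i))"
        by (simp add: linear_diff[OF linear_proj_perp])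
      ultimately show ?thesis by simp
    qed
    show "eventually (\<lambda>s. \<exists>g\<in>unitary_group. \<forall>i<k. \<beta> i s \<in> act_plane g (vec.span (b ` {..<k}))) (at_right 0)"
      using eventually_in_box[OF r, where m = m and v = "\<lambda>j. \<i> * \<xi> j"]
        eventually_in_box[OF r1, where m = m and v = "\<lambda>j. \<i> * \<xi> j"]
    proof eventually_elim
      case (elim s)
      have ws: "w s \<in> box_at m r" "w s \<in> box_at m r1" using elim by (simp_all add: w_def)
      have "F (w s) \<in> C0"
        using op ws(1) openin_subset[OF op] by auto
      then obtain g where g: "g \<in> unitary_group" "F (w s) = act_plane g V0" using C0 by blast
      obtain g0 where g0: "g0 \<in> unitary_group" "V = act_plane g0 V0" using V C0 by blast
      have "matrix_inv g0 \<in> unitary_group" "g ** matrix_inv g0 \<in> unitary_group"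
        using unitary_group_subgroup g(1) g0(1) by (auto simp: matrix_subgroup_def)
      moreover have "F (w s) = act_plane (g ** matrix_inv g0) V"
        unfolding g(2) g0(2) act_plane_mult using act_plane_inv(1)[OF unitary_in_Sp[OF g0(1)]] by simp
      moreover have "\<beta> i s \<in> F (w s)" for i
      proof -
        have sp: "vec.span ((\<lambda>i. f i (w s)) ` {..<k}) = F (w s)"
          using fr ws(2) by (auto simp: holomorphic_frame_def)
        have GF: "G i s \<in> F (w s)" for i
          unfolding sp[symmetric] G_def by (intro vec.span_sum vec.span_scale vec.span_base) auto
        have sF: "vec.subspace (F (w s))" unfolding sp[symmetric] by simp
        show ?thesis
          unfolding \<beta>_def scaleR_eq_vector_scalar
          by (intro vec.subspace_diff[OF sF] vec.subspace_scale[OF sF] vec.subspace_sum[OF sF] GF)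
      qed
      ultimately show ?case using b(2) by auto
    qed
    show "x \<in> vec.span (b ` {..<k})" using x b(2) by simp
  qed
qed

lemma base_cycle_eq_split_planes:
  assumes n: "CARD('v) = 2 * n" and C0: "base_cycle (p + q) (flag_domain h p q) unitary_group C0"
  shows "C0 = split_planes Epos Eneg p q" "split_planes Epos Eneg p q \<subseteq> flag_domain h p q"
    "split_planes Epos Eneg p q \<noteq> {}"
proof -
  obtain V m where V: "V \<in> flag_domain h p q" and C: "C0 = (\<lambda>g. act_plane g V) ` unitary_group"
    and sub: "complex_submanifold (p + q) m C0" and CD: "C0 \<subseteq> flag_domain h p q"
    using C0 unfolding base_cycle_def by blast
  have "mat 1 \<in> unitary_group" using unitary_group_subgroup by (simp add: matrix_subgroup_def)
  then have VC: "V \<in> C0" unfolding C by (intro image_eqI[of _ _ "mat 1"]) auto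
  have dim: "vec.subspace V" "vec.dim V = p + q"
    using V by (auto simp: flag_domain_def isotropic_grassmannian_def)
  have "V \<in> split_planes Epos Eneg p q"
    using orbit_submanifold_J_invariant[OF n C VC dim sub] by (intro J_invariant_plane_split[OF V])
  then show "C0 = split_planes Epos Eneg p q" "split_planes Epos Eneg p q \<noteq> {}"
    using split_planes_orbit[OF n] C by auto
  then show "split_planes Epos Eneg p q \<subseteq> flag_domain h p q" using CD by simp
qed

end


section \<open>Local transitivity on isotropic planes\<close>

lemma continuous_map_frame_combination:
  "continuous_map (subtopology (product_topology (\<lambda>_. euclidean) {..<k}) S) euclidean
     (\<lambda>b :: nat \<Rightarrow> complex^'v. \<Sum>j<k. c j *s b j)"
proof -
  have "continuous_map (product_topology (\<lambda>_. euclidean) {..<k}) euclidean (\<lambda>b :: nat \<Rightarrow> complex^'v. \<Sum>j<k. c j *s b j)"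
  proof (intro continuous_map_sum)
    fix j assume "j \<in> {..<k}"
    then have "continuous_map (product_topology (\<lambda>_. euclidean) {..<k}) euclidean (\<lambda>b :: nat \<Rightarrow> complex^'v. b j)"
      by (rule continuous_map_product_projection)
    moreover have "continuous_map euclidean euclidean ((*s) (c j) :: complex^'v \<Rightarrow> complex^'v)"
      by (simp add: linear_continuous_on bounded_linear_vector_scalar)
    ultimately show "continuous_map (product_topology (\<lambda>_. euclidean) {..<k}) euclidean (\<lambda>b :: nat \<Rightarrow> complex^'v. c j *s b j)"
      by (rule continuous_map_compose[unfolded o_def])
  qed simp
  then show ?thesis by (rule continuous_map_from_subtopology)
qed

lemma norm_vector_scalar: "norm (c *s x :: complex^'v) = norm c * norm x"
  unfolding norm_vec_def vector_scalar_mult_def by (simp add: norm_mult L2_set_right_distrib)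

lemma dim_frame: "b \<in> frames k \<Longrightarrow> vec.dim (vec.span (b ` {..<k})) = k"
  by (intro dim_span_family) (simp add: frames_iff)

text \<open>In the quotient topology the saturation has to be open. If a frame \<open>b\<close>
  spans the same plane as a frame \<open>b0\<close> near \<open>v\<close>, fixed coefficients carry
  \<open>b\<close> to \<open>b0\<close>; the same coefficients carry every frame close to
  \<open>b\<close> to one near \<open>v\<close> without changing the plane.\<close>

lemma openin_grassmannian_near:
  fixes v :: "nat \<Rightarrow> complex^'v"
  shows "openin (grassmannian_topology k)
    ((\<lambda>b. vec.span (b ` {..<k})) ` {b \<in> frames k. \<forall>i<k. norm (b i - v i) < \<delta>})"
proof -
  let ?T = "subtopology (product_topology (\<lambda>_. euclidean) {..<k}) (frames k) :: (nat \<Rightarrow> complex^'v) topology"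
  let ?sp = "\<lambda>b :: nat \<Rightarrow> complex^'v. vec.span (b ` {..<k})"
  let ?W = "{b \<in> frames k. \<forall>i<k. norm (b i - v i) < \<delta>}"
  have nbhd: "\<exists>S. openin ?T S \<and> b \<in> S \<and> S \<subseteq> {b \<in> frames k. ?sp b \<in> ?sp ` ?W}"
    if b: "b \<in> frames k" "b0 \<in> ?W" "?sp b = ?sp b0" for b b0
  proof -
    have "\<exists>c. b0 i = (\<Sum>j<k. c j *s b j)" if "i < k" for i
    proof -
      have "b0 i \<in> ?sp b" using b(3) that by (auto intro: vec.span_base)
      then show ?thesis unfolding span_family by blast
    qed
    then obtain c where c: "\<And>i. i < k \<Longrightarrow> b0 i = (\<Sum>j<k. c i j *s b j)" by metis
    define S where "S = {b1 \<in> topspace ?T. \<forall>i<k. (\<Sum>j<k. c i j *s b1 j) \<in> ball (v i) \<delta>}"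
    have "openin ?T S"
    proof -
      have "openin ?T {b1 \<in> topspace ?T. (\<Sum>j<k. c i j *s b1 j) \<in> ball (v i) \<delta>}" for i
        by (rule openin_continuous_map_preimage[OF continuous_map_frame_combination]) simp
      then have "openin ?T ((\<Inter>i\<in>{..<k}. {b1 \<in> topspace ?T. (\<Sum>j<k. c i j *s b1 j) \<in> ball (v i) \<delta>}) \<inter> topspace ?T)"
        by (intro openin_INT) auto
      moreover have "S = (\<Inter>i\<in>{..<k}. {b1 \<in> topspace ?T. (\<Sum>j<k. c i j *s b1 j) \<in> ball (v i) \<delta>}) \<inter> topspace ?T"
        by (auto simp: S_def)
      ultimately show ?thesis by simp
    qed
    moreover have "b \<in> S"
      using b c by (auto simp: S_def frames_def dist_norm norm_minus_commute)
    moreover have "?sp b1 \<in> ?sp ` ?W" if b1: "b1 \<in> S" for b1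
    proof -
      have fr: "b1 \<in> frames k" using b1 by (simp add: S_def)
      define b' where "b' = (\<lambda>i\<in>{..<k}. \<Sum>j<k. c i j *s b1 j)"
      have "x i = 0" if x: "(\<Sum>i<k. x i *s b' i) = 0" and i: "i < k" for x i
      proof -
        have comb: "(\<Sum>i<k. x i *s (\<Sum>j<k. c i j *s u j)) = (\<Sum>j<k. (\<Sum>i<k. x i * c i j) *s u j)" for u :: "nat \<Rightarrow> complex^'v"
        proof -
          have "(\<Sum>i<k. x i *s (\<Sum>j<k. c i j *s u j)) = (\<Sum>i<k. \<Sum>j<k. (x i * c i j) *s u j)"
            by (simp add: vec.scale_sum_right vector_smult_assoc)
          also have "\<dots> = (\<Sum>j<k. \<Sum>i<k. (x i * c i j) *s u j)" by (rule sum.swap)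
          finally show ?thesis by (simp add: vec.scale_sum_left)
        qed
        have "(\<Sum>j<k. (\<Sum>i<k. x i * c i j) *s b1 j) = 0" using x comb[of b1] by (simp add: b'_def)
        then have "(\<Sum>i<k. x i * c i j) = 0" if "j < k" for j
          using frames_iff[THEN iffD1, OF fr, THEN conjunct2, rule_format, of "\<lambda>j. \<Sum>i<k. x i * c i j"] that
          by blast
        then have "(\<Sum>i<k. x i *s b0 i) = 0" using comb[of b] c by simp
        then show ?thesis using b(2) i by (simp add: frames_iff)
      qed
      then have b'fr: "b' \<in> frames k" by (auto simp: frames_iff b'_def)
      have "?sp b' \<subseteq> ?sp b1"
        by (intro vec.span_minimal) (auto simp: b'_def intro!: vec.span_sum vec.span_scale intro: vec.span_base)
      then have eq: "?sp b' = ?sp b1"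
        using dim_frame[OF b'fr] dim_frame[OF fr] by (intro vec.subspace_dim_equal) auto
      have "b' \<in> ?W" using b'fr b1 by (auto simp: S_def b'_def dist_norm norm_minus_commute)
      then show ?thesis unfolding eq[symmetric] by (rule imageI)
    qed
    ultimately show ?thesis by (intro exI[of _ S]) (auto simp: S_def)
  qed
  have "openin ?T {b \<in> frames k. ?sp b \<in> ?sp ` ?W}"
  proof (subst openin_subopen, intro ballI)
    fix b assume "b \<in> {b \<in> frames k. ?sp b \<in> ?sp ` ?W}"
    then obtain b0 where "b \<in> frames k" "b0 \<in> ?W" "?sp b = ?sp b0" by blast
    then show "\<exists>S. openin ?T S \<and> b \<in> S \<and> S \<subseteq> {b \<in> frames k. ?sp b \<in> ?sp ` ?W}" by (rule nbhd)
  qed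
  then show ?thesis
    unfolding grassmannian_topology_def openin_quot_topology topspace_frames by auto
qed

context symplectic_space
begin

text \<open>A plane close to the span of \<open>v\<close> projects isomorphically onto it along the
  annihilator of the \<open>u j\<close>. The preimages of the \<open>v i\<close> form the frame that
  keeps the pairings with \<open>u\<close>, and estimating their coordinates shows that they stay
  close to \<open>v\<close>.\<close>

lemma nearby_dual_frame:
  assumes dual: "\<And>i j. i < k \<Longrightarrow> j < k \<Longrightarrow> \<sigma> (v i) (u j) = (if i = j then 1 else 0)" and e: "0 < (e::real)"
  obtains \<delta> where "0 < \<delta>" "\<And>b. b \<in> frames k \<Longrightarrow> (\<And>i. i < k \<Longrightarrow> norm (b i - v i) < \<delta>) \<Longrightarrow>
    \<exists>b'. vec.span (b' ` {..<k}) = vec.span (b ` {..<k}) \<and> (\<forall>i<k. norm (b' i - v i) < e) \<and>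
      (\<forall>i<k. \<forall>j<k. \<sigma> (b' i) (u j) = (if i = j then 1 else 0))"
proof -
  obtain B where B: "0 < B" "\<And>x y. norm (\<sigma> x y) \<le> norm x * norm y * B"
    using bounded_bilinear.pos_bounded[OF bounded_bilinear_\<sigma>] by blast
  define A where "A = B * (\<Sum>j<k. norm (u j)) + 1"
  have A: "0 < A" "\<And>x j. j < k \<Longrightarrow> norm (\<sigma> x (u j)) \<le> A * norm x"
  proof -
    show "0 < A" unfolding A_def using B(1) by (intro add_nonneg_pos mult_nonneg_nonneg sum_nonneg) auto
    fix x :: "complex^'v" and j assume "j < k"
    then have "norm (u j) \<le> (\<Sum>j<k. norm (u j))" by (intro member_le_sum) auto
    then have "norm x * norm (u j) * B \<le> norm x * (\<Sum>j<k. norm (u j)) * B"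
      using B(1) by (intro mult_right_mono mult_left_mono) auto
    moreover have "A * norm x = norm x * (\<Sum>j<k. norm (u j)) * B + norm x"
      by (simp add: A_def algebra_simps)
    ultimately show "norm (\<sigma> x (u j)) \<le> A * norm x"
      using B(2)[of x "u j"] norm_ge_zero[of x] by linarith
  qed
  define K where "K = (\<Sum>i<k. norm (v i))"
  have K: "0 \<le> K" unfolding K_def by (intro sum_nonneg) auto
  \<comment> \<open>The first bound makes the coordinate matrix differ from the identity by at most
    1/2, which gives injectivity; the second keeps the renormalized frame within
    \<open>e\<close>.\<close>
  define \<delta> where "\<delta> = min (1 / (2 * (real k + 1) * A)) (e / (4 * (A * K + 1)))"
  have \<delta>: "0 < \<delta>" using A(1) K e by (auto simp: \<delta>_def intro!: divide_pos_pos mult_pos_pos add_nonneg_pos)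
  have \<delta>1: "real k * A * \<delta> \<le> 1/2"
  proof -
    have "real k * A * \<delta> \<le> real k * A * (1 / (2 * (real k + 1) * A))"
      using A(1) by (intro mult_left_mono) (auto simp: \<delta>_def)
    also have "\<dots> = real k / (2 * (real k + 1))" using A(1) by simp
    also have "\<dots> \<le> 1/2" by (simp add: field_simps)
    finally show ?thesis .
  qed
  have \<delta>2: "2 * A * \<delta> * K + 2 * \<delta> < e"
  proof -
    have "2 * (A * K + 1) * \<delta> \<le> 2 * (A * K + 1) * (e / (4 * (A * K + 1)))"
      using A(1) K by (intro mult_left_mono) (auto simp: \<delta>_def)
    also have "\<dots> = e / 2" using A(1) K by (simp add: field_simps add_nonneg_eq_0_iff)
    finally show ?thesis using e by (simp add: algebra_simps)
  qed
  have "\<exists>b'. vec.span (b' ` {..<k}) = vec.span (b ` {..<k}) \<and> (\<forall>i<k. norm (b' i - v i) < e) \<and>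
      (\<forall>i<k. \<forall>j<k. \<sigma> (b' i) (u j) = (if i = j then 1 else 0))"
    if b: "b \<in> frames k" and near: "\<And>i. i < k \<Longrightarrow> norm (b i - v i) < \<delta>" for b
  proof -
    let ?V' = "vec.span (b ` {..<k})"
    have coord: "norm (y j - \<sigma> (\<Sum>m<k. y m *s b m) (u j)) \<le> A * \<delta> * (\<Sum>m<k. norm (y m))" if j: "j < k" for y j
    proof -
      have "\<sigma> (\<Sum>m<k. y m *s b m) (u j) = (\<Sum>m<k. y m * \<sigma> (v m) (u j)) + (\<Sum>m<k. y m * \<sigma> (b m - v m) (u j))"
        unfolding \<sigma>_sum sum.distrib[symmetric] by (intro sum.cong) (auto simp: algebra_simps)
      also have "(\<Sum>m<k. y m * \<sigma> (v m) (u j)) = (\<Sum>m<k. if m = j then y m else 0)"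
        using dual j by (intro sum.cong) auto
      finally have "y j - \<sigma> (\<Sum>m<k. y m *s b m) (u j) = - (\<Sum>m<k. y m * \<sigma> (b m - v m) (u j))" using j by simp
      then have "norm (y j - \<sigma> (\<Sum>m<k. y m *s b m) (u j)) \<le> (\<Sum>m<k. norm (y m * \<sigma> (b m - v m) (u j)))"
        by (simp add: norm_sum)
      also have "\<dots> \<le> (\<Sum>m<k. norm (y m) * (A * \<delta>))"
        unfolding norm_mult
      proof (intro sum_mono mult_left_mono)
        fix m assume "m \<in> {..<k}"
        then show "norm (\<sigma> (b m - v m) (u j)) \<le> A * \<delta>"
          using A(2)[OF j, of "b m - v m"] near[of m] A(1) by (smt (verit, best) lessThan_iff mult_left_mono)
      qed simp
      finally show ?thesis by (simp add: sum_distrib_left mult.commute)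
    qed
    have tot: "(\<Sum>j<k. norm (y j)) \<le> 2 * (\<Sum>j<k. norm (\<sigma> (\<Sum>m<k. y m *s b m) (u j)))" for y
    proof -
      have "(\<Sum>j<k. norm (y j)) \<le> (\<Sum>j<k. norm (\<sigma> (\<Sum>m<k. y m *s b m) (u j)) + A * \<delta> * (\<Sum>m<k. norm (y m)))"
      proof (intro sum_mono)
        fix j assume "j \<in> {..<k}"
        then show "norm (y j) \<le> norm (\<sigma> (\<Sum>m<k. y m *s b m) (u j)) + A * \<delta> * (\<Sum>m<k. norm (y m))"
          using coord[of j y] norm_triangle_sub[of "y j" "\<sigma> (\<Sum>m<k. y m *s b m) (u j)"] by auto
      qed
      also have "\<dots> = (\<Sum>j<k. norm (\<sigma> (\<Sum>m<k. y m *s b m) (u j))) + (real k * A * \<delta>) * (\<Sum>m<k. norm (y m))"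
        by (simp add: sum.distrib)
      also have "(real k * A * \<delta>) * (\<Sum>m<k. norm (y m)) \<le> (1/2) * (\<Sum>m<k. norm (y m))"
        by (intro mult_right_mono \<delta>1 sum_nonneg) auto
      finally show ?thesis by simp
    qed
    define \<pi> where "\<pi> x = (\<Sum>j<k. \<sigma> x (u j) *s v j)" for x
    have \<pi>u: "\<sigma> (\<pi> x) (u j) = \<sigma> x (u j)" if "j < k" for x j
    proof -
      have "\<sigma> (\<pi> x) (u j) = (\<Sum>i<k. if i = j then \<sigma> x (u i) else 0)"
        unfolding \<pi>_def \<sigma>_sum using dual that by (intro sum.cong) auto
      then show ?thesis using that by simp
    qed
    have lin: "Vector_Spaces.linear (*s) (*s) \<pi>"
      by (simp add: Vector_Spaces.linear_iff vec.vector_space_axioms \<pi>_def vec.scale_left_distrib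
          sum.distrib vec.scale_sum_right vector_smult_assoc)
    have inj: "inj_on \<pi> ?V'"
    proof (subst vec.linear_inj_on_iff_eq_0[OF lin])
      show "vec.subspace ?V'" by simp
      show "\<forall>x\<in>?V'. \<pi> x = 0 \<longrightarrow> x = 0"
      proof (intro ballI impI)
        fix x assume "x \<in> ?V'" "\<pi> x = 0"
        then obtain y where y: "x = (\<Sum>m<k. y m *s b m)" by (auto simp: span_family)
        have "\<sigma> x (u j) = 0" if "j < k" for j using \<pi>u[OF that, of x] \<open>\<pi> x = 0\<close> by simp
        then have "(\<Sum>j<k. norm (y j)) \<le> 0" using tot[of y] by (simp add: y)
        moreover have "norm (y j) \<le> (\<Sum>j<k. norm (y j))" if "j < k" for j
          using that by (intro member_le_sum) auto
        ultimately have "norm (y j) \<le> 0" if "j < k" for j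
          using that by (meson order_trans)
        then have "y j = 0" if "j < k" for j using that by simp
        then show "x = 0" by (simp add: y)
      qed
    qed
    have "vec.dim (\<pi> ` ?V') = k"
      using vec.dim_image_eq[OF lin, of ?V', unfolded vec.span_span, OF inj] dim_frame[OF b] by simp
    moreover have "\<pi> ` ?V' \<subseteq> vec.span (v ` {..<k})"
      unfolding \<pi>_def by (auto intro!: vec.span_sum vec.span_scale intro: vec.span_base)
    moreover have "vec.dim (vec.span (v ` {..<k})) \<le> k"
    proof -
      have "vec.dim (vec.span (v ` {..<k})) \<le> card (v ` {..<k})" by (intro vec.dim_le_card) auto
      also have "\<dots> \<le> k" using card_image_le[of "{..<k}" v] by simp
      finally show ?thesis .
    qed
    moreover have "vec.subspace (\<pi> ` ?V')" by (rule vec.linear_subspace_image[OF lin]) simp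
    ultimately have im: "\<pi> ` ?V' = vec.span (v ` {..<k})"
      by (intro vec.subspace_dim_equal) auto
    have "\<exists>y. y \<in> ?V' \<and> \<pi> y = v i" if "i < k" for i
    proof -
      have "v i \<in> \<pi> ` ?V'" unfolding im using that by (intro vec.span_base) auto
      then obtain y where "v i = \<pi> y" "y \<in> ?V'" by (rule imageE)
      then show ?thesis by (intro exI[of _ y]) simp
    qed
    then obtain b' where b': "\<And>i. i < k \<Longrightarrow> b' i \<in> ?V'" "\<And>i. i < k \<Longrightarrow> \<pi> (b' i) = v i" by metis
    have b'u: "\<sigma> (b' i) (u j) = (if i = j then 1 else 0)" if "i < k" "j < k" for i j
      using \<pi>u[OF that(2), of "b' i"] b'(2)[OF that(1)] dual that by simp
    have close: "norm (b' i - v i) < e" if i: "i < k" for i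
    proof -
      obtain y where y: "b' i = (\<Sum>m<k. y m *s b m)" using b'(1)[OF i] by (auto simp: span_family)
      have "(\<Sum>j<k. norm (\<sigma> (b' i) (u j))) = (\<Sum>j<k. if i = j then 1 else 0)"
        using b'u[OF i] by (intro sum.cong) auto
      then have S: "(\<Sum>j<k. norm (y j)) \<le> 2" using tot[of y] i by (simp add: y)
      have ym: "norm (y m - (if i = m then 1 else 0)) \<le> 2 * A * \<delta>" if "m < k" for m
      proof -
        have "norm (y m - (if i = m then 1 else 0)) \<le> A * \<delta> * (\<Sum>m<k. norm (y m))"
          using coord[OF that, of y] b'u[OF i that] by (simp add: y)
        also have "\<dots> \<le> A * \<delta> * 2" using A(1) \<delta> S by (intro mult_left_mono) auto
        finally show ?thesis by simp
      qed
      have "(\<Sum>m<k. (if i = m then 1 else 0) *s v m) = (\<Sum>m<k. if m = i then v m else 0)"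
        by (intro sum.cong) auto
      then have "b' i - v i = (\<Sum>m<k. (y m - (if i = m then 1 else 0)) *s v m) + (\<Sum>m<k. y m *s (b m - v m))"
        using i by (simp add: y vec.scale_left_diff_distrib vec.scale_right_diff_distrib sum_subtractf)
      then have "norm (b' i - v i) \<le> norm (\<Sum>m<k. (y m - (if i = m then 1 else 0)) *s v m) + norm (\<Sum>m<k. y m *s (b m - v m))"
        by (simp add: norm_triangle_ineq)
      also have "\<dots> \<le> (\<Sum>m<k. norm ((y m - (if i = m then 1 else 0)) *s v m)) + (\<Sum>m<k. norm (y m *s (b m - v m)))"
        by (intro add_mono norm_sum)
      also have "\<dots> \<le> (\<Sum>m<k. 2 * A * \<delta> * norm (v m)) + (\<Sum>m<k. norm (y m) * \<delta>)"
      proof (intro add_mono sum_mono)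
        fix m assume m: "m \<in> {..<k}"
        then show "norm ((y m - (if i = m then 1 else 0)) *s v m) \<le> 2 * A * \<delta> * norm (v m)"
          unfolding norm_vector_scalar by (intro mult_right_mono ym) auto
        show "norm (y m *s (b m - v m)) \<le> norm (y m) * \<delta>"
          unfolding norm_vector_scalar using less_imp_le[OF near[of m]] m by (intro mult_left_mono) auto
      qed
      also have "\<dots> = 2 * A * \<delta> * K + (\<Sum>m<k. norm (y m)) * \<delta>"
        by (simp add: K_def sum_distrib_left sum_distrib_right)
      also have "\<dots> \<le> 2 * A * \<delta> * K + 2 * \<delta>" using mult_right_mono[OF S, of \<delta>] \<delta> by simp
      finally show ?thesis using \<delta>2 by linarith
    qed
    have ind: "\<forall>c. (\<Sum>i<k. c i *s b' i) = 0 \<longrightarrow> (\<forall>i<k. c i = 0)"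
    proof (intro allI impI)
      fix c i assume c: "(\<Sum>i<k. c i *s b' i) = 0" and i: "i < k"
      have "\<sigma> (\<Sum>j<k. c j *s b' j) (u i) = (\<Sum>j<k. if j = i then c j else 0)"
        unfolding \<sigma>_sum using b'u i by (intro sum.cong) auto
      then show "c i = 0" using c i by simp
    qed
    have "vec.span (b' ` {..<k}) \<subseteq> ?V'" using b'(1) by (intro vec.span_minimal) auto
    then have "vec.span (b' ` {..<k}) = ?V'"
      using dim_span_family[OF ind] dim_frame[OF b] by (intro vec.subspace_dim_equal) auto
    then show ?thesis using close b'u by blast
  qed
  then show ?thesis using \<delta> by (intro that[of \<delta>]) auto
qed


text \<open>For dual isotropic families \<open>v\<close>, \<open>u\<close>, this is the element of the unipotent radical fixing the
  \<open>u j\<close> and moving each \<open>v i\<close> by \<open>a i\<close>.\<close>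

definition unipotent ::
    "nat \<Rightarrow> (nat \<Rightarrow> complex^'v) \<Rightarrow> (nat \<Rightarrow> complex^'v) \<Rightarrow> (nat \<Rightarrow> complex^'v) \<Rightarrow> complex^'v \<Rightarrow> complex^'v" where
  "unipotent k v u a x = x + (\<Sum>i<k. \<sigma> x (u i) *s a i) +
     (\<Sum>j<k. (\<sigma> x (a j) - (\<Sum>i<k. \<sigma> x (u i) * \<sigma> (v i) (a j))) *s u j)"

definition unipotent_matrix where
  "unipotent_matrix k v u a = matrix (unipotent k v u a)"

lemma unipotent_matrix: "unipotent_matrix k v u a *v x = unipotent k v u a x"
proof -
  have "Vector_Spaces.linear (*s) (*s) (unipotent k v u a)"
    by (simp add: Vector_Spaces.linear_iff vec.vector_space_axioms unipotent_def vec.scale_left_distrib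
        sum.distrib vec.scale_sum_right vector_smult_assoc vec.scale_right_distrib
        vec.scale_left_diff_distrib sum_subtractf sum_distrib_left distrib_right right_diff_distrib vec.scale_right_diff_distrib mult.assoc algebra_simps)
  then show ?thesis unfolding unipotent_matrix_def by (rule matrix_works)
qed

lemma tendsto_vector_scalar [tendsto_intros]:
  assumes "(c \<longlongrightarrow> C) F" "(x \<longlongrightarrow> X) F"
  shows "((\<lambda>a. c a *s x a :: complex^'v) \<longlongrightarrow> C *s X) F"
  unfolding vector_scalar_mult_def using assms by (intro tendsto_vec_lambda tendsto_mult tendsto_vec_nth)

lemma tendsto_unipotent_matrix:
  assumes "\<And>i. i < k \<Longrightarrow> ((\<lambda>N. a N i) \<longlongrightarrow> A i) F"
  shows "((\<lambda>N. unipotent_matrix k v u (a N)) \<longlongrightarrow> unipotent_matrix k v u A) F"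
proof -
  have "((\<lambda>N. unipotent k v u (a N) x) \<longlongrightarrow> unipotent k v u A x) F" for x
    unfolding unipotent_def using assms
    by (intro tendsto_add tendsto_sum tendsto_vector_scalar tendsto_diff tendsto_mult tendsto_\<sigma> tendsto_const) auto
  then have "((\<lambda>N. (unipotent_matrix k v u (a N) *v axis j 1) $ i) \<longlongrightarrow> (unipotent_matrix k v u A *v axis j 1) $ i) F" for i j
    unfolding unipotent_matrix by (rule tendsto_vec_nth)
  then show ?thesis
    by (intro vec_tendstoI) (simp add: matrix_vector_mult_axis)
qed

lemma unipotent_matrix_0: "(\<And>i. i < k \<Longrightarrow> a i = 0) \<Longrightarrow> unipotent_matrix k v u a = mat 1"
  by (simp add: matrix_eq unipotent_matrix unipotent_def)

lemma unipotent_frame: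
  assumes "\<And>i j. i < k \<Longrightarrow> j < k \<Longrightarrow> \<sigma> (v i) (u j) = (if i = j then 1 else 0)" and l: "l < k"
  shows "unipotent k v u a (v l) = v l + a l"
proof -
  have 1: "(\<Sum>i<k. \<sigma> (v l) (u i) *s a i) = (\<Sum>i<k. if i = l then a i else 0)"
    using assms by (intro sum.cong) auto
  have 2: "(\<Sum>i<k. \<sigma> (v l) (u i) * \<sigma> (v i) (a j)) = (\<Sum>i<k. if i = l then \<sigma> (v i) (a j) else 0)" for j
    using assms by (intro sum.cong) auto
  show ?thesis unfolding unipotent_def 1 2 using l by simp
qed

text \<open>When the \<open>v i\<close> span an isotropic plane, hypothesis \<open>iso\<close> says
  that the moved vectors \<open>v i + a i\<close> are pairwise orthogonal for
  \<open>\<sigma>\<close>. The \<open>u\<close>-component in \<open>unipotent\<close> is chosen so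
  that all other terms cancel.\<close>

lemma unipotent_symplectic:
  assumes uu: "\<And>i j. i < k \<Longrightarrow> j < k \<Longrightarrow> \<sigma> (u i) (u j) = 0"
    and au: "\<And>i j. i < k \<Longrightarrow> j < k \<Longrightarrow> \<sigma> (a i) (u j) = 0"
    and iso: "\<And>i j. i < k \<Longrightarrow> j < k \<Longrightarrow> \<sigma> (v i) (a j) - \<sigma> (v j) (a i) + \<sigma> (a i) (a j) = 0"
  shows "unipotent_matrix k v u a \<in> Sp_complex h"
proof -
  have "\<sigma> (unipotent k v u a x) (unipotent k v u a y) = \<sigma> x y" for x y
  proof -
    define X Y where "X i = \<sigma> x (u i)" and "Y i = \<sigma> y (u i)" for i
    define c where "c i j = \<sigma> (v i) (a j)" for i j
    define xa ya where "xa = (\<Sum>i<k. X i *s a i)" and "ya = (\<Sum>i<k. Y i *s a i)"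
    define xu yu where "xu = (\<Sum>j<k. (\<sigma> x (a j) - (\<Sum>i<k. X i * c i j)) *s u j)"
      and "yu = (\<Sum>j<k. (\<sigma> y (a j) - (\<Sum>i<k. Y i * c i j)) *s u j)"
    have ua: "\<sigma> (u i) (a j) = 0" if "i < k" "j < k" for i j
      using au[OF that(2,1)] \<sigma>_swap[of "u i" "a j"] by simp
    have z: "\<sigma> xa yu = 0" "\<sigma> xu ya = 0" "\<sigma> xu yu = 0"
      unfolding xa_def ya_def xu_def yu_def by (simp_all add: \<sigma>_sum uu au ua)
    have 1: "\<sigma> x ya = (\<Sum>j<k. Y j * \<sigma> x (a j))" by (simp add: ya_def \<sigma>_sum)
    have 2: "\<sigma> xa y = - (\<Sum>j<k. X j * \<sigma> y (a j))"
      unfolding xa_def \<sigma>_sum by (simp add: \<sigma>_swap[of "a _" y] sum_negf)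
    have 3: "\<sigma> x yu = (\<Sum>j<k. X j * \<sigma> y (a j)) - (\<Sum>j<k. \<Sum>i<k. Y i * X j * c i j)"
      unfolding yu_def \<sigma>_sum by (simp add: X_def[symmetric] sum_subtractf algebra_simps sum_distrib_left sum_distrib_right)
    have 4: "\<sigma> xu y = - (\<Sum>j<k. Y j * \<sigma> x (a j)) + (\<Sum>j<k. \<Sum>i<k. X i * Y j * c i j)"
      unfolding xu_def \<sigma>_sum
      by (simp add: \<sigma>_swap[of "u _" y] Y_def[symmetric] sum_subtractf algebra_simps sum_distrib_left sum_distrib_right sum_negf)
    have 5: "\<sigma> xa ya = (\<Sum>j<k. \<Sum>i<k. X i * Y j * \<sigma> (a i) (a j))"
    proof -
      have "\<sigma> xa ya = (\<Sum>i<k. \<Sum>j<k. X i * Y j * \<sigma> (a i) (a j))"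
        unfolding xa_def ya_def \<sigma>_sum(1) unfolding \<sigma>_sum(2) by (simp add: sum_distrib_left mult_ac)
      also have "\<dots> = (\<Sum>j<k. \<Sum>i<k. X i * Y j * \<sigma> (a i) (a j))" by (rule sum.swap)
      finally show ?thesis .
    qed
    have 6: "(\<Sum>j<k. \<Sum>i<k. Y i * X j * c i j) = (\<Sum>j<k. \<Sum>i<k. X i * Y j * c j i)"
    proof -
      have "(\<Sum>j<k. \<Sum>i<k. Y i * X j * c i j) = (\<Sum>i<k. \<Sum>j<k. Y i * X j * c i j)" by (rule sum.swap)
      also have "\<dots> = (\<Sum>j<k. \<Sum>i<k. X i * Y j * c j i)" by (intro sum.cong refl) (rule mult.commute[THEN arg_cong2[where f = "(*)", OF _ refl]])
      finally show ?thesis .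
    qed
    have "\<sigma> (unipotent k v u a x) (unipotent k v u a y) = \<sigma> (x + xa + xu) (y + ya + yu)"
      by (simp add: unipotent_def xa_def ya_def xu_def yu_def X_def Y_def c_def)
    also have "\<dots> = \<sigma> x y + (\<sigma> x ya + \<sigma> xa y + \<sigma> x yu + \<sigma> xu y + \<sigma> xa ya)"
      using z by simp
    also have "\<sigma> x ya + \<sigma> xa y + \<sigma> x yu + \<sigma> xu y + \<sigma> xa ya =
        (\<Sum>j<k. \<Sum>i<k. X i * Y j * (c i j - c j i + \<sigma> (a i) (a j)))"
      unfolding 1 2 3 4 5 6 by (simp add: sum.distrib[symmetric] sum_subtractf[symmetric] algebra_simps)
    also have "\<dots> = 0" using iso by (simp add: c_def)
    finally show ?thesis by simp
  qed
  then show ?thesis by (simp add: Sp_complex_def unipotent_matrix)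
qed

end

context compatible_structure
begin

text \<open>The symplectic group acts locally transitively on isotropic planes, along paths of small
  elements. The straight path \<open>t a\<close> violates the isotropy condition to second order, whence the
  correction in the directions \<open>u j\<close>.\<close>

lemma locally_transitive:
  assumes V: "V \<in> isotropic_grassmannian h k" and \<Omega>: "open \<Omega>" "mat 1 \<in> \<Omega>"
  obtains N where "openin (grassmannian_topology k) N" "V \<in> N"
    "\<And>V'. V' \<in> N \<Longrightarrow> V' \<in> isotropic_grassmannian h k \<Longrightarrow>
      \<exists>\<gamma>. continuous_on {0..1::real} \<gamma> \<and> \<gamma> 0 = mat 1 \<and> (\<forall>t\<in>{0..1}. \<gamma> t \<in> \<Omega> \<inter> Sp_complex h) \<and> act_plane (\<gamma> 1) V = V'"
proof -
  have sV: "vec.subspace V" and dV: "vec.dim V = k" and isoV: "\<And>x y. x \<in> V \<Longrightarrow> y \<in> V \<Longrightarrow> \<sigma> x y = 0"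
    using V by (auto simp: isotropic_grassmannian_def)
  obtain v0 where v0: "orthonormal k v0" "vec.span (v0 ` {..<k}) = V"
    using orthonormal_basis[OF sV] dV by metis
  define v where "v = restrict v0 {..<k}"
  have v: "orthonormal k v" "vec.span (v ` {..<k}) = V"
    using v0 by (simp_all add: v_def orthonormal_def)
  have vV: "v i \<in> V" if "i < k" for i using that v(2) by (metis imageI lessThan_iff vec.span_base)
  define u where "u j = J *v vec_cnj (v j)" for j
  have dual: "\<sigma> (v i) (u j) = (if i = j then 1 else 0)" if "i < k" "j < k" for i j
    using v(1) that by (simp add: orthonormal_def ip_def u_def)
  have uu: "\<sigma> (u i) (u j) = 0" if "i < k" "j < k" for i j
    using isoV[OF vV vV] that by (simp add: u_def \<sigma>_cnj)
  \<comment> \<open>The path \<open>t a\<close> misses the isotropy condition by t^2 - t times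
    \<open>\<sigma> (a i) (a j)\<close>. The correction enters once for i and once for j, hence the
    division by 2, and it vanishes at both ends.\<close>
  define ap where "ap a t i = of_real t *s a i + of_real ((t\<^sup>2 - t) / 2) *s (\<Sum>j<k. \<sigma> (a i) (a j) *s u j)"
    for a :: "nat \<Rightarrow> complex^'v" and t :: real and i
  \<comment> \<open>The bound must be uniform in \<open>t\<close>, so that the whole path stays in
    \<open>\<Omega>\<close>; sequences of counterexamples converge to the identity matrix.\<close>
  have "\<exists>\<epsilon>>0. \<forall>a t. (\<forall>i<k. norm (a i) < \<epsilon>) \<and> t \<in> {0..1} \<longrightarrow> unipotent_matrix k v u (ap a t) \<in> \<Omega>"
  proof (rule ccontr)
    assume "\<not> ?thesis"
    then have "\<exists>a t. (\<forall>i<k. norm (a i) < inverse (real (Suc N))) \<and> t \<in> {0..1} \<and> unipotent_matrix k v u (ap a t) \<notin> \<Omega>" for N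
      by (metis inverse_positive_iff_positive of_nat_0_less_iff zero_less_Suc)
    then obtain a t where a: "\<And>N i. i < k \<Longrightarrow> norm (a N i) < inverse (real (Suc N))" and t: "\<And>N. t N \<in> {0..1}"
      and notin: "\<And>N. unipotent_matrix k v u (ap (a N) (t N)) \<notin> \<Omega>" by metis
    have a0: "(\<lambda>N. a N i) \<longlonglongrightarrow> 0" if "i < k" for i
    proof (rule Lim_null_comparison)
      show "eventually (\<lambda>N. norm (a N i) \<le> inverse (real (Suc N))) sequentially"
        using a[OF that] by (simp add: less_imp_le)
    qed (rule LIMSEQ_inverse_real_of_nat)
    have "(\<lambda>N. ap (a N) (t N) i) \<longlonglongrightarrow> 0" if i: "i < k" for i
    proof -
      have "(\<lambda>N. \<Sum>j<k. \<sigma> (a N i) (a N j) *s u j) \<longlonglongrightarrow> (\<Sum>j<k. \<sigma> 0 0 *s u j)"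
        by (intro tendsto_sum tendsto_vector_scalar tendsto_\<sigma> a0 i tendsto_const) auto
      then have 1: "(\<lambda>N. \<Sum>j<k. \<sigma> (a N i) (a N j) *s u j) \<longlonglongrightarrow> 0" by simp
      have "(\<lambda>N. norm (a N i) + norm (\<Sum>j<k. \<sigma> (a N i) (a N j) *s u j)) \<longlonglongrightarrow> norm (0::complex^'v) + norm (0::complex^'v)"
        by (intro tendsto_add tendsto_norm a0 i 1)
      then have lim: "(\<lambda>N. norm (a N i) + norm (\<Sum>j<k. \<sigma> (a N i) (a N j) *s u j)) \<longlonglongrightarrow> 0" by simp
      show ?thesis
      proof (rule Lim_null_comparison[OF always_eventually[OF allI] lim])
        fix N
        have tN: "0 \<le> t N" "t N \<le> 1" using t[of N] by auto
        have "(t N)\<^sup>2 \<le> t N" using tN by (simp add: power2_eq_square mult_left_le)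
        moreover have "\<bar>(x - y) / 2\<bar> \<le> 1" if "0 \<le> x" "x \<le> y" "y \<le> 1" for x y :: real
          using that by (auto simp: abs_if)
        ultimately have "\<bar>((t N)\<^sup>2 - t N) / 2\<bar> \<le> 1" using tN(2) by (metis zero_le_power2)
        then have "norm (complex_of_real (((t N)\<^sup>2 - t N) / 2)) \<le> 1" by (simp only: norm_of_real)
        moreover have "norm (complex_of_real (t N)) \<le> 1" using tN by simp
        ultimately show "norm (ap (a N) (t N) i) \<le> norm (a N i) + norm (\<Sum>j<k. \<sigma> (a N i) (a N j) *s u j)"
          unfolding ap_def
          by (intro order_trans[OF norm_triangle_ineq] add_mono) (simp_all only: norm_vector_scalar mult_left_le_one_le norm_ge_zero)
      qed
    qed
    then have "(\<lambda>N. unipotent_matrix k v u (ap (a N) (t N))) \<longlonglongrightarrow> unipotent_matrix k v u (\<lambda>_. 0)"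
      by (intro tendsto_unipotent_matrix)
    then have "eventually (\<lambda>N. unipotent_matrix k v u (ap (a N) (t N)) \<in> \<Omega>) sequentially"
      using \<Omega> by (intro topological_tendstoD) (auto simp: unipotent_matrix_0)
    then show False using notin by simp
  qed
  then obtain \<epsilon> where \<epsilon>: "0 < \<epsilon>" "\<And>a t. (\<And>i. i < k \<Longrightarrow> norm (a i) < \<epsilon>) \<Longrightarrow> t \<in> {0..1} \<Longrightarrow> unipotent_matrix k v u (ap a t) \<in> \<Omega>"
    by blast
  obtain \<delta> where \<delta>: "0 < \<delta>" "\<And>b. b \<in> frames k \<Longrightarrow> (\<And>i. i < k \<Longrightarrow> norm (b i - v i) < \<delta>) \<Longrightarrow>
    \<exists>b'. vec.span (b' ` {..<k}) = vec.span (b ` {..<k}) \<and> (\<forall>i<k. norm (b' i - v i) < \<epsilon>) \<and>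
      (\<forall>i<k. \<forall>j<k. \<sigma> (b' i) (u j) = (if i = j then 1 else 0))"
    using nearby_dual_frame[of k v u \<epsilon>, OF dual \<epsilon>(1)] by blast
  let ?N = "(\<lambda>b. vec.span (b ` {..<k})) ` {b \<in> frames k. \<forall>i<k. norm (b i - v i) < \<delta>}"
  have "v \<in> extensional {..<k}" by (simp add: v_def)
  then have "v \<in> frames k" using orthonormal_independent[OF v(1)] by (simp add: frames_iff)
  then have VN: "V \<in> ?N" using v(2) \<delta>(1) by (intro image_eqI[of _ _ v]) auto
  show ?thesis
  proof (rule that[OF openin_grassmannian_near VN])
    fix V' assume "V' \<in> ?N" and V': "V' \<in> isotropic_grassmannian h k"
    then obtain b where b: "b \<in> frames k" "\<And>i. i < k \<Longrightarrow> norm (b i - v i) < \<delta>" "V' = vec.span (b ` {..<k})" by blast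
    obtain b' where b': "vec.span (b' ` {..<k}) = V'" "\<And>i. i < k \<Longrightarrow> norm (b' i - v i) < \<epsilon>"
      "\<And>i j. i < k \<Longrightarrow> j < k \<Longrightarrow> \<sigma> (b' i) (u j) = (if i = j then 1 else 0)"
      using \<delta>(2)[OF b(1,2)] b(3) by blast
    have b'V: "b' i \<in> V'" if "i < k" for i using that b'(1) by (metis imageI lessThan_iff vec.span_base)
    define a where "a i = b' i - v i" for i
    have au: "\<sigma> (a i) (u j) = 0" if "i < k" "j < k" for i j
      using b'(3)[OF that] dual[OF that] by (simp add: a_def)
    have iso: "\<sigma> (v i) (a j) - \<sigma> (v j) (a i) + \<sigma> (a i) (a j) = 0" if "i < k" "j < k" for i j
    proof -
      have "\<sigma> (v i + a i) (v j + a j) = 0"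
        using V' b'V that by (simp add: a_def isotropic_grassmannian_def)
      then have "\<sigma> (v i) (a j) + \<sigma> (a i) (v j) + \<sigma> (a i) (a j) = 0"
        using isoV[OF vV vV] that by (simp add: algebra_simps)
      then show ?thesis using \<sigma>_swap[of "a i" "v j"] by (simp only: diff_conv_add_uminus)
    qed
    have at_u: "\<sigma> (ap a t i) (u j) = 0" if "i < k" "j < k" for t i j
      using au uu that by (simp add: ap_def \<sigma>_sum)
    have at_va: "\<sigma> (v i) (ap a t j) = of_real t * \<sigma> (v i) (a j) + of_real ((t\<^sup>2 - t) / 2) * \<sigma> (a j) (a i)"
      if "i < k" "j < k" for t i j
    proof -
      have "\<sigma> (v i) (\<Sum>l<k. \<sigma> (a j) (a l) *s u l) = (\<Sum>l<k. if l = i then \<sigma> (a j) (a l) else 0)"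
        unfolding \<sigma>_sum using dual that by (intro sum.cong) auto
      then show ?thesis using that by (simp add: ap_def)
    qed
    have at_aa: "\<sigma> (ap a t i) (ap a t j) = of_real (t\<^sup>2) * \<sigma> (a i) (a j)" if "i < k" "j < k" for t i j
    proof -
      have ua: "\<sigma> (u i) (a j) = 0" if "i < k" "j < k" for i j
        using au[OF that(2,1)] \<sigma>_swap[of "u i" "a j"] by simp
      have "\<sigma> (a i) (\<Sum>l<k. \<sigma> (a j) (a l) *s u l) = 0" "\<sigma> (\<Sum>l<k. \<sigma> (a i) (a l) *s u l) (a j) = 0"
        "\<sigma> (\<Sum>l<k. \<sigma> (a i) (a l) *s u l) (\<Sum>l<k. \<sigma> (a j) (a l) *s u l) = 0"
        using that by (simp_all add: \<sigma>_sum au ua uu)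
      then show ?thesis by (simp add: ap_def power2_eq_square mult.assoc)
    qed
    have Sp: "unipotent_matrix k v u (ap a t) \<in> Sp_complex h" for t
    proof (rule unipotent_symplectic[OF uu at_u])
      fix i j assume ij: "i < k" "j < k"
      have "\<sigma> (v i) (ap a t j) - \<sigma> (v j) (ap a t i) + \<sigma> (ap a t i) (ap a t j) =
          of_real t * (\<sigma> (v i) (a j) - \<sigma> (v j) (a i) + \<sigma> (a i) (a j))"
        unfolding at_va[OF ij] at_va[OF ij(2,1)] at_aa[OF ij]
        using \<sigma>_swap[of "a j" "a i"] by (simp add: power2_eq_square field_simps)
      then show "\<sigma> (v i) (ap a t j) - \<sigma> (v j) (ap a t i) + \<sigma> (ap a t i) (ap a t j) = 0"
        using iso[OF ij] by simp
    qed
    define \<gamma> where "\<gamma> t = unipotent_matrix k v u (ap a t)" for t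
    have "continuous_on {0..1} \<gamma>"
      unfolding continuous_on_def \<gamma>_def ap_def
      by (intro ballI tendsto_unipotent_matrix tendsto_intros) auto
    moreover have "\<gamma> 0 = mat 1" by (simp add: \<gamma>_def ap_def unipotent_matrix_0)
    moreover have "\<forall>t\<in>{0..1}. \<gamma> t \<in> \<Omega> \<inter> Sp_complex h"
      using Sp \<epsilon>(2)[of a] b'(2) by (auto simp: \<gamma>_def a_def)
    moreover have "act_plane (\<gamma> 1) V = V'"
    proof -
      have "\<gamma> 1 *v v i = b' i" if "i < k" for i
        using unipotent_frame[of k v u i "ap a 1", OF dual that] that
        by (simp add: \<gamma>_def unipotent_matrix ap_def a_def)
      then have "(*v) (\<gamma> 1) ` v ` {..<k} = b' ` {..<k}" by (auto simp: image_image)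
      then show ?thesis unfolding v(2)[symmetric] act_plane_span b'(1)[symmetric] by simp
    qed
    ultimately show "\<exists>\<gamma>. continuous_on {0..1::real} \<gamma> \<and> \<gamma> 0 = mat 1 \<and> (\<forall>t\<in>{0..1}. \<gamma> t \<in> \<Omega> \<inter> Sp_complex h) \<and> act_plane (\<gamma> 1) V = V'"
      by blast
  qed
qed

end


section \<open>Topology of the cycle space\<close>

lemma hermitian_form_scaleR:
  "hermitian_form h (r *\<^sub>R x) (r *\<^sub>R x) = of_real (r * r) * hermitian_form h x x" if "symplectic_form h"
proof -
  interpret symplectic_space h by unfold_locales (rule that)
  show ?thesis by (simp add: hermitian_form_def)
qed

lemma open_forall_compact:
  fixes f :: "'a::euclidean_space \<Rightarrow> 'b::euclidean_space \<Rightarrow> real"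
  assumes "compact K" "continuous_on UNIV (\<lambda>(x, g). f x g)"
  shows "open {g. \<forall>x\<in>K. 0 < f x g}"
proof -
  have "closed {z. (case z of (x, g) \<Rightarrow> f x g) \<le> 0}"
    by (intro closed_Collect_le assms(2) continuous_on_const)
  from closed_compact_projection[OF assms(1) this]
  have "closed {g. \<exists>x. x \<in> K \<and> f x g \<le> 0}" by simp
  moreover have "{g. \<forall>x\<in>K. 0 < f x g} = - {g. \<exists>x. x \<in> K \<and> f x g \<le> 0}" by (auto simp: not_le)
  ultimately show ?thesis by (simp add: closed_def)
qed

section \<open>Openness of the flag domain and of the orbit map\<close>

context symplectic_space
begin

lemma Sp_preserves_isotropic:
  assumes "g \<in> Sp_complex h" "V \<in> isotropic_grassmannian h k"
  shows "act_plane g V \<in> isotropic_grassmannian h k"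
proof -
  have "\<sigma> x y = 0" if "x \<in> act_plane g V" "y \<in> act_plane g V" for x y
    using that assms by (auto simp: act_plane_def isotropic_grassmannian_def Sp_complexD)
  then show ?thesis
    using assms by (simp add: isotropic_grassmannian_def subspace_act_plane dim_act_plane)
qed

lemma subspace_real: "vec.subspace A \<Longrightarrow> subspace (A :: (complex^'v) set)"
  unfolding subspace_def vec.subspace_def scaleR_eq_vector_scalar by blast

text \<open>Homogeneity reduces the condition to the compact unit sphere of \<open>W\<close>. The
  factor \<open>s\<close> covers positive and negative definiteness at once.\<close>

lemma definite_open:
  assumes W: "vec.subspace W"
  shows "open {g :: complex^'v^'v. \<forall>x\<in>W. x \<noteq> 0 \<longrightarrow> 0 < s * Re (hermitian_form h (g *v x) (g *v x))}"
proof -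
  have "closed W" by (rule closed_subspace[OF subspace_real[OF W]])
  then have K: "compact (W \<inter> sphere 0 1)" by (intro closed_Int_compact compact_sphere)
  have "open {g :: complex^'v^'v. \<forall>x\<in>W \<inter> sphere 0 1. 0 < s * Re (hermitian_form h (g *v x) (g *v x))}"
    by (rule open_forall_compact[OF K])
      (auto simp: case_prod_unfold hermitian_form_def intro!: continuous_intros)
  moreover have "(\<forall>x\<in>W. x \<noteq> 0 \<longrightarrow> 0 < s * Re (hermitian_form h (g *v x) (g *v x))) \<longleftrightarrow>
      (\<forall>x\<in>W \<inter> sphere 0 1. 0 < s * Re (hermitian_form h (g *v x) (g *v x)))" for g :: "complex^'v^'v"
  proof
    assume *: "\<forall>x\<in>W \<inter> sphere 0 1. 0 < s * Re (hermitian_form h (g *v x) (g *v x))"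
    show "\<forall>x\<in>W. x \<noteq> 0 \<longrightarrow> 0 < s * Re (hermitian_form h (g *v x) (g *v x))"
    proof (intro ballI impI)
      fix x assume x: "x \<in> W" "x \<noteq> 0"
      define y where "y = (1 / norm x) *\<^sub>R x"
      have "y \<in> W \<inter> sphere 0 1"
        using x subspace_real[OF W] by (auto simp: y_def subspace_scale)
      then have "0 < s * Re (hermitian_form h (g *v y) (g *v y))" using * by blast
      moreover have "g *v y = (1 / norm x) *\<^sub>R (g *v x)"
        by (simp add: y_def scaleR_eq_vector_scalar vector_scalar_commute)
      ultimately have "0 < (1 / norm x * (1 / norm x)) * (s * Re (hermitian_form h (g *v x) (g *v x)))"
        by (simp add: hermitian_form_scaleR[OF symplectic] del: of_real_mult)
      then show "0 < s * Re (hermitian_form h (g *v x) (g *v x))"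
        by (rule zero_less_mult_pos) (use x(2) in simp)
    qed
  qed auto
  ultimately show ?thesis by simp
qed

lemma definite_subspaces_disjoint:
  assumes P: "vec.subspace P" "P \<subseteq> V" "\<And>v. v \<in> P \<Longrightarrow> v \<noteq> 0 \<Longrightarrow> 0 < Re (hermitian_form h v v)"
    and N: "vec.subspace N" "N \<subseteq> V" "\<And>v. v \<in> N \<Longrightarrow> v \<noteq> 0 \<Longrightarrow> Re (hermitian_form h v v) < 0"
    and V: "vec.subspace V"
  shows "vec.dim P + vec.dim N \<le> vec.dim V"
proof -
  have "P \<inter> N \<subseteq> {0}" using P(3) N(3) by (force simp: not_less_iff_gr_or_eq)
  then have "vec.dim (P \<inter> N) = 0" using vec.dim_subset[of "P \<inter> N" "{0}"] by simp
  moreover have "{x + y |x y. x \<in> P \<and> y \<in> N} \<subseteq> V" using P(2) N(2) V by (auto intro: vec.subspace_add)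
  then have "vec.dim {x + y |x y. x \<in> P \<and> y \<in> N} \<le> vec.dim V" by (rule vec.dim_subset)
  ultimately show ?thesis using vec.dim_sums_Int[OF P(1) N(1)] by linarith
qed

lemma index_attained:
  fixes s :: real
  assumes "(0::complex^'v) \<in> V"
  defines "P \<equiv> (\<lambda>W. vec.subspace W \<and> W \<subseteq> V \<and> (\<forall>v\<in>W. v \<noteq> 0 \<longrightarrow> s * Re (hermitian_form h v v) > 0))"
  shows "\<exists>W. P W \<and> vec.dim W = Max {vec.dim W | W. P W}"
proof -
  have "P {0}" using assms(1) by (simp add: P_def vec.subspace_single_0)
  then have "{vec.dim W | W. P W} \<noteq> {}" by blast
  then have "Max {vec.dim W | W. P W} \<in> {vec.dim W | W. P W}"
    using finite_subspace_dims by (intro Max_in) auto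
  then show ?thesis by (smt (verit) mem_Collect_eq)
qed

lemma flag_domain_definite_subspaces:
  assumes "V \<in> flag_domain h p q"
  obtains P N where "vec.subspace P" "P \<subseteq> V" "vec.dim P = p"
    "\<And>v. v \<in> P \<Longrightarrow> v \<noteq> 0 \<Longrightarrow> 0 < Re (hermitian_form h v v)"
    "vec.subspace N" "N \<subseteq> V" "vec.dim N = q"
    "\<And>v. v \<in> N \<Longrightarrow> v \<noteq> 0 \<Longrightarrow> Re (hermitian_form h v v) < 0"
proof -
  have sV: "vec.subspace V" and sig: "pos_index h V = p" "neg_index h V = q"
    using assms by (auto simp: flag_domain_def isotropic_grassmannian_def signature_def)
  have 0: "0 \<in> V" using vec.subspace_0[OF sV] .
  obtain P where "vec.subspace P" "P \<subseteq> V" "\<forall>v\<in>P. v \<noteq> 0 \<longrightarrow> 0 < Re (hermitian_form h v v)" "vec.dim P = p"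
    using index_attained[OF 0, of 1] sig(1) by (auto simp: pos_index_def)
  moreover obtain N where "vec.subspace N" "N \<subseteq> V" "\<forall>v\<in>N. v \<noteq> 0 \<longrightarrow> Re (hermitian_form h v v) < 0" "vec.dim N = q"
    using index_attained[OF 0, of "-1"] sig(2) by (auto simp: neg_index_def)
  ultimately show ?thesis by (intro that) auto
qed

text \<open>A definite subspace meets one of opposite sign only in 0. So a positive subspace of
  dimension p bounds the negative index by q, and conversely.\<close>

lemma flag_domainI:
  assumes V: "V \<in> isotropic_grassmannian h (p + q)"
    and P: "vec.subspace P" "P \<subseteq> V" "vec.dim P = p" "\<And>v. v \<in> P \<Longrightarrow> v \<noteq> 0 \<Longrightarrow> 0 < Re (hermitian_form h v v)"
    and N: "vec.subspace N" "N \<subseteq> V" "vec.dim N = q" "\<And>v. v \<in> N \<Longrightarrow> v \<noteq> 0 \<Longrightarrow> Re (hermitian_form h v v) < 0"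
  shows "V \<in> flag_domain h p q"
proof -
  have sV: "vec.subspace V" and dV: "vec.dim V = p + q" using V by (auto simp: isotropic_grassmannian_def)
  have 0: "0 \<in> V" using vec.subspace_0[OF sV] .
  obtain P' where P': "vec.subspace P'" "P' \<subseteq> V" "\<forall>v\<in>P'. v \<noteq> 0 \<longrightarrow> 0 < Re (hermitian_form h v v)" "vec.dim P' = pos_index h V"
    using index_attained[OF 0, of 1] by (auto simp: pos_index_def)
  obtain N' where N': "vec.subspace N'" "N' \<subseteq> V" "\<forall>v\<in>N'. v \<noteq> 0 \<longrightarrow> Re (hermitian_form h v v) < 0" "vec.dim N' = neg_index h V"
    using index_attained[OF 0, of "-1"] by (auto simp: neg_index_def)
  have "pos_index h V + q \<le> p + q"
    using definite_subspaces_disjoint[OF P'(1,2) _ N(1,2,4) sV] P'(3,4) N(3) dV by auto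
  moreover have "p + neg_index h V \<le> p + q"
    using definite_subspaces_disjoint[OF P(1,2,4) N'(1,2) _ sV] N'(3,4) P(3) dV by auto
  moreover have "p \<le> pos_index h V" "q \<le> neg_index h V"
    using pos_index_ge[OF P(1,2,4)] neg_index_ge[OF N(1,2,4)] P(3) N(3) by auto
  ultimately show ?thesis using V by (simp add: flag_domain_def signature_def)
qed

text \<open>Signature is stable: maximal definite subspaces, pulled back to \<open>V\<close>, remain
  definite under all nearby group elements.\<close>

lemma flag_domain_orbit_open:
  assumes V: "V \<in> isotropic_grassmannian h (p + q)"
  shows "openin (top_of_set (Sp_complex h)) {g \<in> Sp_complex h. act_plane g V \<in> flag_domain h p q}"
proof (subst openin_subopen, intro ballI)
  fix g assume "g \<in> {g \<in> Sp_complex h. act_plane g V \<in> flag_domain h p q}"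
  then have g: "g \<in> Sp_complex h" and gV: "act_plane g V \<in> flag_domain h p q" by auto
  obtain P N where P: "vec.subspace P" "P \<subseteq> act_plane g V" "vec.dim P = p"
      "\<And>v. v \<in> P \<Longrightarrow> v \<noteq> 0 \<Longrightarrow> 0 < Re (hermitian_form h v v)"
    and N: "vec.subspace N" "N \<subseteq> act_plane g V" "vec.dim N = q"
      "\<And>v. v \<in> N \<Longrightarrow> v \<noteq> 0 \<Longrightarrow> Re (hermitian_form h v v) < 0"
    using flag_domain_definite_subspaces[OF gV] by metis
  define P0 N0 where "P0 = act_plane (matrix_inv g) P" and "N0 = act_plane (matrix_inv g) N"
  have gi: "matrix_inv g \<in> Sp_complex h" using Sp_complex_group(3)[OF g] .
  have s0: "vec.subspace P0" "vec.subspace N0" "vec.dim P0 = p" "vec.dim N0 = q"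
    using P N by (simp_all add: P0_def N0_def subspace_act_plane dim_act_plane[OF gi])
  have sub0: "P0 \<subseteq> V" "N0 \<subseteq> V"
  proof -
    have "act_plane (matrix_inv g) P \<subseteq> act_plane (matrix_inv g) (act_plane g V)"
      "act_plane (matrix_inv g) N \<subseteq> act_plane (matrix_inv g) (act_plane g V)"
      unfolding act_plane_def[of "matrix_inv g"] using P(2) N(2) by (simp_all add: image_mono)
    then show "P0 \<subseteq> V" "N0 \<subseteq> V" using act_plane_inv(1)[OF g] by (simp_all add: P0_def N0_def)
  qed
  define \<Omega> where "\<Omega> = {g :: complex^'v^'v. \<forall>x\<in>P0. x \<noteq> 0 \<longrightarrow> 0 < 1 * Re (hermitian_form h (g *v x) (g *v x))} \<inter>
     {g. \<forall>x\<in>N0. x \<noteq> 0 \<longrightarrow> 0 < - 1 * Re (hermitian_form h (g *v x) (g *v x))}"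
  have "open \<Omega>" unfolding \<Omega>_def by (intro open_Int definite_open s0)
  moreover have "g \<in> \<Omega>"
  proof -
    have "g *v x \<in> P" if "x \<in> P0" for x
      using that Sp_complex_inv(4)[OF g] by (auto simp: P0_def act_plane_def)
    moreover have "g *v x \<in> N" if "x \<in> N0" for x
      using that Sp_complex_inv(4)[OF g] by (auto simp: N0_def act_plane_def)
    moreover have "g *v x \<noteq> 0" if "x \<noteq> 0" for x
      using that Sp_complex_inv(3)[OF g, of x] by auto
    ultimately show ?thesis using P(4) N(4) by (auto simp: \<Omega>_def)
  qed
  moreover have "act_plane g' V \<in> flag_domain h p q" if g': "g' \<in> Sp_complex h" "g' \<in> \<Omega>" for g'
  proof (rule flag_domainI)
    show "act_plane g' V \<in> isotropic_grassmannian h (p + q)" by (rule Sp_preserves_isotropic[OF g'(1) V])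
    show "vec.subspace (act_plane g' P0)" "vec.subspace (act_plane g' N0)"
      "vec.dim (act_plane g' P0) = p" "vec.dim (act_plane g' N0) = q"
      using s0 by (simp_all add: subspace_act_plane dim_act_plane[OF g'(1)])
    show "act_plane g' P0 \<subseteq> act_plane g' V" "act_plane g' N0 \<subseteq> act_plane g' V"
      unfolding act_plane_def using sub0 by (auto intro!: image_mono)
    show "0 < Re (hermitian_form h v v)" if "v \<in> act_plane g' P0" "v \<noteq> 0" for v
      using that g'(2) by (auto simp: act_plane_def \<Omega>_def)
    show "Re (hermitian_form h v v) < 0" if "v \<in> act_plane g' N0" "v \<noteq> 0" for v
      using that g'(2) by (auto simp: act_plane_def \<Omega>_def)
  qed
  ultimately show "\<exists>T. openin (top_of_set (Sp_complex h)) T \<and> g \<in> T \<and>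
      T \<subseteq> {g \<in> Sp_complex h. act_plane g V \<in> flag_domain h p q}"
    using g by (intro exI[of _ "Sp_complex h \<inter> \<Omega>"]) (auto simp: openin_open)
qed

lemma openin_orbit_preimage:
  "openin (cycle_orbit_topology h C) U \<Longrightarrow> openin (top_of_set (Sp_complex h)) {g \<in> Sp_complex h. act_cycle g C \<in> U}"
  by (simp add: cycle_orbit_topology_def openin_quot_topology)

lemma topspace_orbit: "topspace (cycle_orbit_topology h C) = (\<lambda>g. act_cycle g C) ` Sp_complex h"
  by (simp add: cycle_orbit_topology_def topspace_quot_topology)

text \<open>Two group elements giving the same cycle differ by a right factor in the stabilizer of
  \<open>C\<close>. Right translations are continuous, so the saturation of an open set is
  open.\<close>

lemma openin_orbit_image:
  assumes A: "openin (top_of_set (Sp_complex h)) A"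
  shows "openin (cycle_orbit_topology h C) ((\<lambda>g. act_cycle g C) ` A)"
proof -
  have AS: "A \<subseteq> Sp_complex h" using openin_subset[OF A] by simp
  have "openin (top_of_set (Sp_complex h)) {x \<in> Sp_complex h. act_cycle x C \<in> (\<lambda>g. act_cycle g C) ` A}"
  proof (subst openin_subopen, intro ballI)
    fix x assume "x \<in> {x \<in> Sp_complex h. act_cycle x C \<in> (\<lambda>g. act_cycle g C) ` A}"
    then obtain a where x: "x \<in> Sp_complex h" and a: "a \<in> A" "act_cycle x C = act_cycle a C" by auto
    have aS: "a \<in> Sp_complex h" using a AS by blast
    define s where "s = matrix_inv x ** a"
    have s: "s \<in> Sp_complex h" using x aS by (simp add: s_def Sp_complex_group)
    have sC: "act_cycle s C = C" using a(2) x by (simp add: s_def act_cycle_mult flip: a(2))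
    have xs: "x ** s = a" by (simp add: s_def matrix_mul_assoc Sp_complex_inv[OF x])
    define B where "B = Sp_complex h \<inter> (\<lambda>y. y ** s) -` A"
    have "continuous_map (top_of_set (Sp_complex h)) (top_of_set (Sp_complex h)) (\<lambda>y. y ** s)"
      using s by (auto simp: continuous_map_in_subtopology Sp_complex_group intro!: continuous_intros)
    from openin_continuous_map_preimage[OF this A]
    have "openin (top_of_set (Sp_complex h)) B" by (simp add: B_def vimage_def Int_def)
    moreover have "x \<in> B" using x xs a(1) by (simp add: B_def)
    moreover have "act_cycle y C \<in> (\<lambda>g. act_cycle g C) ` A" if "y \<in> B" for y
    proof -
      have "act_cycle y C = act_cycle (y ** s) C" by (simp add: act_cycle_mult sC)
      then show ?thesis using that by (simp add: B_def)
    qed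
    ultimately show "\<exists>T. openin (top_of_set (Sp_complex h)) T \<and> x \<in> T \<and>
        T \<subseteq> {x \<in> Sp_complex h. act_cycle x C \<in> (\<lambda>g. act_cycle g C) ` A}"
      by (intro exI[of _ B]) (auto simp: B_def)
  qed
  then show ?thesis
    using AS by (auto simp: cycle_orbit_topology_def openin_quot_topology)
qed

lemma continuous_map_cycle_orbit:
  "continuous_map (top_of_set (Sp_complex h)) (cycle_orbit_topology h C) (\<lambda>g. act_cycle g C)"
  unfolding cycle_orbit_topology_def by (rule continuous_map_quot)


section \<open>Transvections and paths leaving the flag domain\<close>

definition transvection :: "complex \<Rightarrow> complex^'v \<Rightarrow> complex^'v^'v" where
  "transvection c x = matrix (\<lambda>v. v + (c * \<sigma> x v) *s x)"

lemma transvection: "transvection c x *v v = v + (c * \<sigma> x v) *s x"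
proof -
  have "Vector_Spaces.linear (*s) (*s) (\<lambda>v. v + (c * \<sigma> x v) *s x)"
    by (simp add: Vector_Spaces.linear_iff vec.vector_space_axioms vec.scale_left_distrib
        vec.scale_right_distrib vector_smult_assoc algebra_simps)
  then show ?thesis unfolding transvection_def by (rule matrix_works)
qed

lemma transvection_Sp: "transvection c x \<in> Sp_complex h"
proof -
  have "\<sigma> (transvection c x *v v) (transvection c x *v w) = \<sigma> v w" for v w
    using \<sigma>_swap[of v x] by (simp add: transvection algebra_simps)
  then show ?thesis by (simp add: Sp_complex_def)
qed

lemma transvection_0: "transvection 0 x = mat 1"
  by (simp add: matrix_eq transvection)

lemma tendsto_transvection:
  assumes "(c \<longlongrightarrow> C) F" shows "((\<lambda>t. transvection (c t) x) \<longlongrightarrow> transvection C x) F"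
proof -
  have "((\<lambda>t. v + (c t * \<sigma> x v) *s x) \<longlongrightarrow> v + (C * \<sigma> x v) *s x) F" for v
    using assms by (intro tendsto_add tendsto_vector_scalar tendsto_mult tendsto_const)
  then have "((\<lambda>t. (transvection (c t) x *v axis j 1) $ i) \<longlongrightarrow> (transvection C x *v axis j 1) $ i) F" for i j
    unfolding transvection by (rule tendsto_vec_nth)
  then show ?thesis
    by (intro vec_tendstoI) (simp add: matrix_vector_mult_axis)
qed

lemma hermitian_cnj: "hermitian_form h y x = cnj (hermitian_form h x y)"
proof -
  have "\<sigma> y (vec_cnj x) = - cnj (\<sigma> x (vec_cnj y))"
    using \<sigma>_cnj[of x "vec_cnj y"] \<sigma>_swap[of y "vec_cnj x"] by simp
  then show ?thesis by (simp add: hermitian_form_def)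
qed

text \<open>Maximal positive and negative subspaces together span \<open>V\<close>. Splitting a
  radical vector accordingly gives two components with the same Hermitian value, although the signs
  are opposite.\<close>

lemma flag_domain_nondegenerate:
  assumes V: "V \<in> flag_domain h p q" and r: "r \<in> V" "\<And>v. v \<in> V \<Longrightarrow> hermitian_form h r v = 0"
  shows "r = 0"
proof -
  have sV: "vec.subspace V" and dV: "vec.dim V = p + q"
    using V by (auto simp: flag_domain_def isotropic_grassmannian_def)
  obtain P N where P: "vec.subspace P" "P \<subseteq> V" "vec.dim P = p"
    "\<And>v. v \<in> P \<Longrightarrow> v \<noteq> 0 \<Longrightarrow> 0 < Re (hermitian_form h v v)"
    and N: "vec.subspace N" "N \<subseteq> V" "vec.dim N = q"
    "\<And>v. v \<in> N \<Longrightarrow> v \<noteq> 0 \<Longrightarrow> Re (hermitian_form h v v) < 0"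
    using flag_domain_definite_subspaces[OF V] by metis
  have "P \<inter> N \<subseteq> {0}" using P(4) N(4) by (force simp: not_less_iff_gr_or_eq)
  then have "vec.dim (P \<inter> N) = 0" using vec.dim_subset[of "P \<inter> N" "{0}"] by simp
  then have "vec.dim {x + y |x y. x \<in> P \<and> y \<in> N} = p + q"
    using vec.dim_sums_Int[OF P(1) N(1)] P(3) N(3) by linarith
  moreover have "{x + y |x y. x \<in> P \<and> y \<in> N} \<subseteq> V" using P(2) N(2) sV by (auto intro: vec.subspace_add)
  ultimately have "{x + y |x y. x \<in> P \<and> y \<in> N} = V"
    using dV sV vec.subspace_sums[OF P(1) N(1)] by (intro vec.subspace_dim_equal) auto
  then obtain a b where ab: "a \<in> P" "b \<in> N" "r = a + b" using r(1) by auto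
  have "hermitian_form h r a = 0" "hermitian_form h r b = 0" using r(2) ab P(2) N(2) by auto
  then have "hermitian_form h a a + hermitian_form h b a = 0" "hermitian_form h a b + hermitian_form h b b = 0"
    by (simp_all add: ab(3) hermitian_form_def distrib_left)
  then have "Re (hermitian_form h a a) + Re (hermitian_form h b a) = 0"
    "Re (hermitian_form h a b) + Re (hermitian_form h b b) = 0"
    by (metis plus_complex.sel(1) zero_complex.sel(1))+
  moreover have "Re (hermitian_form h b a) = Re (hermitian_form h a b)" by (simp add: hermitian_cnj[of b a])
  ultimately have eq: "Re (hermitian_form h a a) = Re (hermitian_form h b b)" by linarith
  have "a = 0 \<and> b = 0"
    using P(4)[OF ab(1)] N(4)[OF ab(2)] eq by (cases "a = 0"; cases "b = 0") (auto simp: hermitian_form_def)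
  then show ?thesis using ab(3) by simp
qed

text \<open>A transvection along \<open>vec_cnj e\<close> makes the vector \<open>e\<close> null and orthogonal to the whole plane.\<close>

lemma path_leaving_flag_domain:
  assumes V: "V \<in> flag_domain h p q" and pq: "1 \<le> p + q"
  obtains x c where "act_plane (transvection c x) V \<notin> flag_domain h p q"
proof -
  have sV: "vec.subspace V" and dV: "vec.dim V = p + q" and iso: "\<And>x y. x \<in> V \<Longrightarrow> y \<in> V \<Longrightarrow> \<sigma> x y = 0"
    using V by (auto simp: flag_domain_def isotropic_grassmannian_def)
  obtain e where e: "e \<in> V" "hermitian_form h e e \<noteq> 0"
  proof -
    obtain P N where P: "vec.subspace P" "P \<subseteq> V" "vec.dim P = p"
      "\<And>v. v \<in> P \<Longrightarrow> v \<noteq> 0 \<Longrightarrow> 0 < Re (hermitian_form h v v)"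
      and N: "vec.subspace N" "N \<subseteq> V" "vec.dim N = q"
      "\<And>v. v \<in> N \<Longrightarrow> v \<noteq> 0 \<Longrightarrow> Re (hermitian_form h v v) < 0"
      using flag_domain_definite_subspaces[OF V] by metis
    have "\<not> (P \<subseteq> {0} \<and> N \<subseteq> {0})"
      using vec.dim_eq_0[of P] vec.dim_eq_0[of N] P(3) N(3) pq by (metis add_0 not_one_le_zero)
    then obtain e where "e \<in> P \<or> e \<in> N" "e \<noteq> 0" by blast
    then show ?thesis using P(2) N(2) P(4)[of e] N(4)[of e] that[of e] by fastforce
  qed
  define f where "f = vec_cnj e"
  have fe: "\<sigma> f e \<noteq> 0"
    using e(2) \<sigma>_swap[of e f] by (auto simp: hermitian_form_def f_def)
  \<comment> \<open>The constant is chosen so that \<open>e\<close> is sent to \<open>e + f\<close>.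
    This is \<open>e\<close> plus its conjugate, hence a real vector and null for the Hermitian
    form.\<close>
  define g where "g = transvection (1 / \<sigma> f e) f"
  have gv: "g *v v = v + (\<sigma> f v / \<sigma> f e) *s f" for v by (simp add: g_def transvection)
  have "act_plane g V \<notin> flag_domain h p q"
  proof
    assume D: "act_plane g V \<in> flag_domain h p q"
    have "hermitian_form h (e + f) w = 0" if w: "w \<in> act_plane g V" for w
    proof -
      obtain v where v: "v \<in> V" "w = g *v v" using w by (auto simp: act_plane_def)
      have 1: "\<sigma> f (vec_cnj v) = 0" using iso[OF e(1) v(1)] by (simp add: f_def \<sigma>_cnj)
      have 2: "\<sigma> e (vec_cnj v) = cnj (\<sigma> f v)" "\<sigma> e f = cnj (\<sigma> f e)"
        using \<sigma>_cnj[of f v] \<sigma>_cnj[of f e] by (simp_all add: f_def)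
      have 3: "\<sigma> f e = - cnj (\<sigma> f e)" using \<sigma>_swap[of f e] 2(2) by simp
      have "\<sigma> (e + f) (vec_cnj w) = cnj (\<sigma> f v) + cnj (\<sigma> f v / \<sigma> f e) * \<sigma> f e"
        by (simp add: v(2) gv 1 2(1)) (simp add: f_def)
      also have "cnj (\<sigma> f v / \<sigma> f e) * \<sigma> f e = - cnj (\<sigma> f v)"
        using fe by (subst (2) 3) simp
      finally show ?thesis by (simp add: hermitian_form_def)
    qed
    moreover have "e + f \<in> act_plane g V"
      using e(1) fe gv[of e] by (auto simp: act_plane_def intro!: image_eqI[of _ _ e])
    ultimately have "e + f = 0" by (intro flag_domain_nondegenerate[OF D])
    then have "\<sigma> f (e + f) = 0" by simp
    then show False using fe by simp
  qed
  then show ?thesis unfolding g_def by (rule that)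
qed

end

section \<open>Openness, incidence and boundary of the swept set\<close>

locale base_cycle_structure = compatible_structure h J
  for h :: "real^'v \<Rightarrow> real^'v \<Rightarrow> real" and J :: "complex^'v^'v" +
  fixes n p q :: nat
  assumes card: "CARD('v) = 2 * n" and pq_pos: "1 \<le> p + q"
    and sub: "split_planes Epos Eneg p q \<subseteq> flag_domain h p q"
    and ne: "split_planes Epos Eneg p q \<noteq> {}"
begin

abbreviation C0 :: "(complex^'v) set set" where "C0 \<equiv> split_planes Epos Eneg p q"
abbreviation D :: "(complex^'v) set set" where "D \<equiv> flag_domain h p q"
abbreviation Z :: "(complex^'v) set set" where "Z \<equiv> isotropic_grassmannian h (p + q)"
abbreviation \<theta> :: "complex^'v^'v \<Rightarrow> (complex^'v) set set" where "\<theta> g \<equiv> act_cycle g C0"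
abbreviation M_D :: "(complex^'v) set set topology" where "M_D \<equiv> cycle_space_topology h D C0"

lemma D_subset_Z: "D \<subseteq> Z" by (auto simp: flag_domain_def)

lemma C0_orbit:
  obtains V0 where "V0 \<in> C0" "V0 \<in> Z" "C0 = (\<lambda>g. act_plane g V0) ` unitary_group"
proof -
  obtain V0 where V0: "V0 \<in> C0" using ne by blast
  then show ?thesis using that[OF V0] sub D_subset_Z split_planes_orbit[OF card V0] by auto
qed

text \<open>The base cycle is an orbit of a compact group, so containment of a whole cycle in
  \<open>D\<close> is an open condition on \<open>g\<close> by projection of a closed set along a
  compact factor.\<close>

lemma \<theta>_in_D_open: "openin (top_of_set (Sp_complex h)) {g \<in> Sp_complex h. \<theta> g \<subseteq> D}"
proof -
  obtain V0 where V0: "V0 \<in> C0" "V0 \<in> Z" "C0 = (\<lambda>g. act_plane g V0) ` unitary_group" by (rule C0_orbit)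
  obtain \<Omega> where \<Omega>: "open \<Omega>" "{g \<in> Sp_complex h. act_plane g V0 \<in> D} = Sp_complex h \<inter> \<Omega>"
    using flag_domain_orbit_open[OF V0(2)] by (auto simp: openin_open)
  have "closed ((\<lambda>(\<kappa>, g). g ** \<kappa>) -` (- \<Omega>))"
    using \<Omega>(1) by (intro closed_vimage) (auto simp: case_prod_unfold closed_def intro!: continuous_intros)
  from closed_compact_projection[OF compact_unitary_group this]
  have "closed {g. \<exists>\<kappa>. \<kappa> \<in> unitary_group \<and> g ** \<kappa> \<notin> \<Omega>}" by simp
  then have "open (- {g. \<exists>\<kappa>. \<kappa> \<in> unitary_group \<and> g ** \<kappa> \<notin> \<Omega>})" by (simp add: closed_def)
  moreover have "{g \<in> Sp_complex h. \<theta> g \<subseteq> D} = Sp_complex h \<inter> - {g. \<exists>\<kappa>. \<kappa> \<in> unitary_group \<and> g ** \<kappa> \<notin> \<Omega>}"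
  proof -
    have "\<theta> g \<subseteq> D \<longleftrightarrow> (\<forall>\<kappa>\<in>unitary_group. g ** \<kappa> \<in> \<Omega>)" if g: "g \<in> Sp_complex h" for g
    proof -
      have "\<theta> g = (\<lambda>\<kappa>. act_plane (g ** \<kappa>) V0) ` unitary_group"
        by (subst V0(3)) (simp add: act_cycle_def image_image act_plane_mult)
      moreover have "act_plane (g ** \<kappa>) V0 \<in> D \<longleftrightarrow> g ** \<kappa> \<in> \<Omega>" if "\<kappa> \<in> unitary_group" for \<kappa>
        using \<Omega>(2) Sp_complex_group(2)[OF g unitary_in_Sp[OF that]] by blast
      ultimately show ?thesis by auto
    qed
    then show ?thesis by auto
  qed
  ultimately show ?thesis by (auto simp: openin_open)
qed

lemma cycle_space_D:
  assumes "C \<in> cycle_space h D C0"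
  obtains g where "g \<in> Sp_complex h" "C = \<theta> g" "C \<subseteq> D"
proof -
  have "C \<in> topspace (subtopology (cycle_orbit_topology h C0) {C. C \<subseteq> D})"
    using assms connected_component_of_subset_topspace unfolding cycle_space_def by fastforce
  then show ?thesis using that by (auto simp: topspace_orbit)
qed

lemma cycle_space_path:
  assumes \<gamma>: "continuous_on {0..1::real} \<gamma>" "\<And>t. t \<in> {0..1} \<Longrightarrow> \<gamma> t \<in> Sp_complex h \<and> \<theta> (\<gamma> t) \<subseteq> D"
    and start: "\<theta> (\<gamma> 0) \<in> cycle_space h D C0"
  shows "\<theta> (\<gamma> 1) \<in> cycle_space h D C0"
proof -
  let ?X = "subtopology (cycle_orbit_topology h C0) {C. C \<subseteq> D}"
  have "continuous_map (top_of_set {0..1}) (top_of_set (Sp_complex h)) \<gamma>"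
    using \<gamma> by (auto simp: continuous_map_in_subtopology)
  from continuous_map_compose[OF this continuous_map_cycle_orbit[of C0]]
  have "continuous_map (top_of_set {0..1}) ?X (\<lambda>t. \<theta> (\<gamma> t))"
    using \<gamma> by (auto simp: continuous_map_in_subtopology o_def)
  from connectedin_continuous_map_image[OF this, of "{0..1}"]
  have "connectedin ?X ((\<lambda>t. \<theta> (\<gamma> t)) ` {0..1})"
    by (simp add: connectedin_subtopology)
  then have "connected_component_of ?X (\<theta> (\<gamma> 0)) (\<theta> (\<gamma> 1))"
    unfolding connected_component_of_def by (intro exI[of _ "(\<lambda>t. \<theta> (\<gamma> t)) ` {0..1}"]) auto
  then show ?thesis
    using start connected_component_of_trans unfolding cycle_space_def by fastforce
qed

text \<open>An open set of the cycle space pulls back to an open condition on the group only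
  together with membership in a connected component. A path in \<open>\<Omega>\<close> starting at
  \<open>g\<close> secures that membership, so local connectedness of the group is not
  invoked.\<close>

lemma path_stays_in_open:
  assumes U: "openin M_D U" and g: "g \<in> Sp_complex h" "\<theta> g \<in> U"
  obtains \<Omega> where "open \<Omega>" "g \<in> \<Omega>"
    "\<And>\<gamma>. continuous_on {0..1::real} \<gamma> \<Longrightarrow> \<gamma> 0 = g \<Longrightarrow> (\<And>t. t \<in> {0..1} \<Longrightarrow> \<gamma> t \<in> \<Omega> \<inter> Sp_complex h) \<Longrightarrow> \<theta> (\<gamma> 1) \<in> U"
proof -
  obtain W where W: "openin (cycle_orbit_topology h C0) W" "U = W \<inter> cycle_space h D C0"
    using U by (auto simp: cycle_space_topology_def openin_subtopology)
  have "openin (top_of_set (Sp_complex h)) ({g \<in> Sp_complex h. \<theta> g \<in> W} \<inter> {g \<in> Sp_complex h. \<theta> g \<subseteq> D})"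
    by (intro openin_Int openin_orbit_preimage W \<theta>_in_D_open)
  then obtain \<Omega> where \<Omega>: "open \<Omega>" "{g \<in> Sp_complex h. \<theta> g \<in> W} \<inter> {g \<in> Sp_complex h. \<theta> g \<subseteq> D} = Sp_complex h \<inter> \<Omega>"
    by (auto simp: openin_open)
  have gc: "\<theta> g \<in> cycle_space h D C0" "\<theta> g \<in> W" using g(2) W(2) by auto
  have "\<theta> g \<subseteq> D" using cycle_space_D[OF gc(1)] by blast
  then have "g \<in> \<Omega>" using \<Omega>(2) gc g by blast
  moreover have "\<theta> (\<gamma> 1) \<in> U"
    if \<gamma>: "continuous_on {0..1::real} \<gamma>" "\<gamma> 0 = g" "\<And>t. t \<in> {0..1} \<Longrightarrow> \<gamma> t \<in> \<Omega> \<inter> Sp_complex h" for \<gamma>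
  proof -
    have mem: "\<gamma> t \<in> Sp_complex h \<and> \<theta> (\<gamma> t) \<subseteq> D" "\<theta> (\<gamma> t) \<in> W" if "t \<in> {0..1}" for t
      using \<gamma>(3)[OF that] \<Omega>(2) by blast+
    have "\<theta> (\<gamma> 1) \<in> cycle_space h D C0"
      using \<gamma>(2) gc(1) mem(1) by (intro cycle_space_path[OF \<gamma>(1)]) auto
    then show ?thesis using mem(2)[of 1] W(2) by simp
  qed
  ultimately show ?thesis by (rule that[OF \<Omega>(1)])
qed

lemma swept_set_iff:
  "V \<in> swept_set h D C0 B \<longleftrightarrow> V \<in> D \<and> (\<exists>C\<in>B. C \<in> cycle_space h D C0 \<and> V \<in> C)"
  unfolding swept_set_def universal_family_def by force

lemma swept_setI:
  assumes "C \<in> B" "C \<in> cycle_space h D C0" "V \<in> C" shows "V \<in> swept_set h D C0 B"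
proof -
  have "C \<subseteq> D" using assms(2) by (rule cycle_space_D)
  then show ?thesis using assms by (auto simp: swept_set_iff)
qed

lemma openin_MD_subset: "openin M_D B \<Longrightarrow> B \<subseteq> cycle_space h D C0"
  using openin_subset[of M_D B] by (auto simp: cycle_space_topology_def)

text \<open>A nearby isotropic plane is the image of \<open>V\<close> under a small group element,
  which moves the cycle through \<open>V\<close> along with it. Local transitivity supplies a path
  to that element, as needed to stay in \<open>B\<close>.\<close>

lemma swept_set_neighborhood:
  assumes B: "openin M_D B" and V: "V \<in> swept_set h D C0 B"
  obtains N where "openin (grassmannian_topology (p + q)) N" "V \<in> N" "N \<inter> Z \<subseteq> swept_set h D C0 B"
proof -
  obtain C where C: "C \<in> B" "C \<in> cycle_space h D C0" "V \<in> C" and VD: "V \<in> D" using V by (auto simp: swept_set_iff)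
  obtain g where g: "g \<in> Sp_complex h" "C = \<theta> g" using C(2) by (rule cycle_space_D)
  obtain \<Omega> where \<Omega>: "open \<Omega>" "g \<in> \<Omega>"
    "\<And>\<gamma>. continuous_on {0..1::real} \<gamma> \<Longrightarrow> \<gamma> 0 = g \<Longrightarrow> (\<And>t. t \<in> {0..1} \<Longrightarrow> \<gamma> t \<in> \<Omega> \<inter> Sp_complex h) \<Longrightarrow> \<theta> (\<gamma> 1) \<in> B"
    using path_stays_in_open[OF B g(1)] C(1) g(2) by metis
  have "open ((\<lambda>a. a ** g) -` \<Omega>)" using \<Omega>(1) by (intro open_vimage continuous_intros)
  moreover have "mat 1 \<in> (\<lambda>a. a ** g) -` \<Omega>" using \<Omega>(2) by simp
  ultimately obtain N where N: "openin (grassmannian_topology (p + q)) N" "V \<in> N"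
    "\<And>V'. V' \<in> N \<Longrightarrow> V' \<in> Z \<Longrightarrow> \<exists>\<gamma>. continuous_on {0..1::real} \<gamma> \<and> \<gamma> 0 = mat 1 \<and>
      (\<forall>t\<in>{0..1}. \<gamma> t \<in> ((\<lambda>a. a ** g) -` \<Omega>) \<inter> Sp_complex h) \<and> act_plane (\<gamma> 1) V = V'"
    using locally_transitive[of V "p + q" "(\<lambda>a. a ** g) -` \<Omega>"] VD D_subset_Z by blast
  have "V' \<in> swept_set h D C0 B" if V': "V' \<in> N" "V' \<in> Z" for V'
  proof -
    obtain \<gamma> where \<gamma>: "continuous_on {0..1::real} \<gamma>" "\<gamma> 0 = mat 1"
      "\<forall>t\<in>{0..1}. \<gamma> t \<in> ((\<lambda>a. a ** g) -` \<Omega>) \<inter> Sp_complex h" "act_plane (\<gamma> 1) V = V'"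
      using N(3)[OF V'] by blast
    have "\<theta> (\<gamma> 1 ** g) \<in> B"
      using \<gamma>(1-3) g(1) by (intro \<Omega>(3)[of "\<lambda>t. \<gamma> t ** g"]) (auto intro!: continuous_intros Sp_complex_group)
    moreover have "V' \<in> \<theta> (\<gamma> 1 ** g)"
      using C(3) unfolding g(2) act_cycle_mult act_cycle_def[of "\<gamma> 1"] \<gamma>(4)[symmetric] by (rule imageI)
    ultimately show ?thesis using openin_MD_subset[OF B] by (intro swept_setI) auto
  qed
  then show ?thesis by (intro that[OF N(1,2)]) auto
qed

lemma openin_swept_set:
  assumes "openin M_D B"
  shows "openin (isotropic_grassmannian_topology h (p + q)) (swept_set h D C0 B)"
proof (subst openin_subopen, intro ballI)
  fix V assume V: "V \<in> swept_set h D C0 B"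
  obtain N where N: "openin (grassmannian_topology (p + q)) N" "V \<in> N" "N \<inter> Z \<subseteq> swept_set h D C0 B"
    using swept_set_neighborhood[OF assms V] .
  have "V \<in> Z" using V D_subset_Z by (auto simp: swept_set_iff)
  moreover have "openin (isotropic_grassmannian_topology h (p + q)) (N \<inter> Z)"
    unfolding isotropic_grassmannian_topology_def openin_subtopology using N(1) by blast
  ultimately show "\<exists>T. openin (isotropic_grassmannian_topology h (p + q)) T \<and> V \<in> T \<and> T \<subseteq> swept_set h D C0 B"
    using N by blast
qed

text \<open>Incidence of planes and cycles is a closed condition. It says that some unitary element
  makes the plane a translate of \<open>V0\<close>; the orbit is compact, so closedness survives the
  elimination of that element.\<close>

lemma incidence_separation:
  assumes P: "P \<in> Z" and g: "g \<in> Sp_complex h" and notin: "P \<notin> \<theta> g"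
  obtains N \<Omega> where "openin (grassmannian_topology (p + q)) N" "P \<in> N" "open \<Omega>" "g \<in> \<Omega>"
    "\<And>g' V'. g' \<in> \<Omega> \<Longrightarrow> g' \<in> Sp_complex h \<Longrightarrow> V' \<in> N \<Longrightarrow> V' \<in> Z \<Longrightarrow> V' \<notin> \<theta> g'"
proof -
  obtain V0 where V0: "V0 \<in> C0" "V0 \<in> Z" "C0 = (\<lambda>g. act_plane g V0) ` unitary_group" by (rule C0_orbit)
  have \<theta>V0: "\<theta> g = (\<lambda>\<kappa>. act_plane (g ** \<kappa>) V0) ` unitary_group" for g
    by (subst V0(3)) (simp add: act_cycle_def image_image act_plane_mult)
  have dims: "vec.subspace V0" "vec.dim V0 = p + q" "vec.subspace P" "vec.dim P = p + q"
    using V0(2) P by (auto simp: isotropic_grassmannian_def)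
  define perp where "perp = {w. \<forall>v\<in>V0. \<sigma> v w = 0}"
  \<comment> \<open>Containment in the translated plane is expressed by annihilator equations, whose
    solution set is visibly closed. For planes of equal dimension containment amounts to
    equality.\<close>
  define R where "R = {ag :: (complex^'v^'v) \<times> (complex^'v^'v). \<exists>\<kappa>. \<kappa> \<in> unitary_group \<and>
     (\<kappa>, ag) \<in> {z. \<forall>x\<in>P. \<forall>w\<in>perp. \<sigma> ((snd (snd z) ** fst z) *v w) (fst (snd z) *v x) = 0}}"
  have eq: "{z :: (complex^'v^'v) \<times> (complex^'v^'v) \<times> (complex^'v^'v).
        \<forall>x\<in>P. \<forall>w\<in>perp. \<sigma> ((snd (snd z) ** fst z) *v w) (fst (snd z) *v x) = 0} =
      (\<Inter>x\<in>P. \<Inter>w\<in>perp. {z. \<sigma> ((snd (snd z) ** fst z) *v w) (fst (snd z) *v x) = 0})" by auto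
  have "closed {z :: (complex^'v^'v) \<times> (complex^'v^'v) \<times> (complex^'v^'v).
        \<forall>x\<in>P. \<forall>w\<in>perp. \<sigma> ((snd (snd z) ** fst z) *v w) (fst (snd z) *v x) = 0}"
    unfolding eq by (intro closed_INT ballI closed_Collect_eq continuous_intros)
  from closed_compact_projection[OF compact_unitary_group this]
  have "closed R" by (simp add: R_def)
  have in_R: "(a, g') \<in> R" if inc: "act_plane a P \<in> \<theta> g'" "g' \<in> Sp_complex h" for a g'
  proof -
    obtain \<kappa> where \<kappa>: "\<kappa> \<in> unitary_group" "act_plane a P = act_plane (g' ** \<kappa>) V0"
      using inc(1) \<theta>V0 by auto
    have Sp: "g' ** \<kappa> \<in> Sp_complex h" using inc(2) unitary_in_Sp[OF \<kappa>(1)] by (rule Sp_complex_group)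
    have "\<sigma> ((g' ** \<kappa>) *v w) (a *v x) = 0" if "x \<in> P" "w \<in> perp" for x w
    proof -
      have "a *v x \<in> act_plane (g' ** \<kappa>) V0" unfolding \<kappa>(2)[symmetric] using that(1) by (simp add: act_plane_def)
      then obtain v where "v \<in> V0" "a *v x = (g' ** \<kappa>) *v v" by (auto simp: act_plane_def)
      then show ?thesis using that(2) Sp_complexD[OF Sp] \<sigma>_swap[of w v] by (simp add: perp_def)
    qed
    then show ?thesis using \<kappa>(1) by (auto simp: R_def)
  qed
  have "(mat 1, g) \<notin> R"
  proof
    assume "(mat 1, g) \<in> R"
    then obtain \<kappa> where \<kappa>: "\<kappa> \<in> unitary_group" "\<And>x w. x \<in> P \<Longrightarrow> w \<in> perp \<Longrightarrow> \<sigma> ((g ** \<kappa>) *v w) x = 0"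
      by (auto simp: R_def)
    have Sp: "g ** \<kappa> \<in> Sp_complex h" using g unitary_in_Sp[OF \<kappa>(1)] by (rule Sp_complex_group)
    have "x \<in> act_plane (g ** \<kappa>) V0" if x: "x \<in> P" for x
    proof (rule ccontr)
      assume n: "x \<notin> act_plane (g ** \<kappa>) V0"
      define y where "y = matrix_inv (g ** \<kappa>) *v x"
      have gy: "(g ** \<kappa>) *v y = x" by (simp add: y_def Sp_complex_inv[OF Sp])
      then have "y \<notin> V0" using n by (auto simp: act_plane_def)
      then obtain w where w: "\<And>a. a \<in> V0 \<Longrightarrow> \<sigma> a w = 0" "\<sigma> y w \<noteq> 0"
        using separating_vector[OF dims(1)] by metis
      have "\<sigma> ((g ** \<kappa>) *v w) x = 0" using \<kappa>(2)[OF x] w(1) by (simp add: perp_def)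
      then have "\<sigma> w y = 0" using Sp_complexD[OF Sp, of w y] gy by simp
      then show False using w(2) \<sigma>_swap[of w y] by simp
    qed
    then have "P \<subseteq> act_plane (g ** \<kappa>) V0" by blast
    then have "P = act_plane (g ** \<kappa>) V0"
      using dims dim_act_plane[OF Sp] by (intro vec.subspace_dim_equal subspace_act_plane) auto
    then show False using notin \<theta>V0 \<kappa>(1) by auto
  qed
  then have "(mat 1, g) \<in> - R" "open (- R)" using \<open>closed R\<close> by auto
  then obtain A \<Omega> where A: "open A" "open \<Omega>" "(mat 1, g) \<in> A \<times> \<Omega>" "A \<times> \<Omega> \<subseteq> - R"
    using open_prod_elim[of "- R" "(mat 1, g)"] by blast
  obtain N where N: "openin (grassmannian_topology (p + q)) N" "P \<in> N"
    "\<And>V'. V' \<in> N \<Longrightarrow> V' \<in> Z \<Longrightarrow> \<exists>\<gamma>. continuous_on {0..1::real} \<gamma> \<and> \<gamma> 0 = mat 1 \<and>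
      (\<forall>t\<in>{0..1}. \<gamma> t \<in> A \<inter> Sp_complex h) \<and> act_plane (\<gamma> 1) P = V'"
    using locally_transitive[OF P A(1)] A(3) by blast
  show ?thesis
  proof (rule that[OF N(1,2) A(2)])
    show "g \<in> \<Omega>" using A(3) by simp
    fix g' V' assume g': "g' \<in> \<Omega>" "g' \<in> Sp_complex h" and V': "V' \<in> N" "V' \<in> Z"
    obtain \<gamma> where \<gamma>: "\<forall>t\<in>{0..1::real}. \<gamma> t \<in> A \<inter> Sp_complex h" "act_plane (\<gamma> 1) P = V'"
      using N(3)[OF V'] by blast
    show "V' \<notin> \<theta> g'"
    proof
      assume "V' \<in> \<theta> g'"
      then have "(\<gamma> 1, g') \<in> R" using in_R \<gamma>(2) g'(2) by simp
      moreover have "\<gamma> 1 \<in> A" using \<gamma>(1) by simp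
      ultimately show False using A(4) g'(1) by blast
    qed
  qed
qed


text \<open>If \<open>P\<close> met no cycle in the closure of \<open>B\<close>, compactness would
  give one neighbourhood of \<open>P\<close> missing them all, although \<open>P\<close> is a limit
  of swept planes. A cycle of the closure through \<open>P\<close> is not in \<open>B\<close>, since
  \<open>P\<close> lies outside the open swept set.\<close>

lemma supporting_cycle_exists:
  assumes B: "openin M_D B" and cpt: "compactin M_D (M_D closure_of B)"
    and P: "P \<in> isotropic_grassmannian_topology h (p + q) frontier_of swept_set h D C0 B"
  obtains C where "C \<in> supporting_cycles h D C0 B P"
proof -
  let ?X = "isotropic_grassmannian_topology h (p + q)"
  let ?Y = "swept_set h D C0 B"
  have topX: "topspace ?X \<subseteq> Z" by (auto simp: isotropic_grassmannian_topology_def)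
  have PX: "P \<in> topspace ?X" using P frontier_of_subset_topspace by fastforce
  then have PZ: "P \<in> Z" using topX by blast
  have PG: "P \<in> topspace (grassmannian_topology (p + q))"
    using PX by (simp add: isotropic_grassmannian_topology_def)
  have P_cl: "P \<in> ?X closure_of ?Y" and P_int: "P \<notin> ?X interior_of ?Y"
    using P by (auto simp: frontier_of_def)
  have PY: "P \<notin> ?Y"
    using P_int interior_of_openin[OF openin_swept_set[OF B]] by simp
  have cl_sub: "M_D closure_of B \<subseteq> cycle_space h D C0"
    using closure_of_subset_topspace[of M_D B] by (auto simp: cycle_space_topology_def)
  have "\<exists>C\<in>M_D closure_of B. P \<in> C"
  proof (rule ccontr)
    assume no: "\<not> (\<exists>C\<in>M_D closure_of B. P \<in> C)"
    have "\<exists>g N \<Omega>. g \<in> Sp_complex h \<and> C = \<theta> g \<and> openin (grassmannian_topology (p + q)) N \<and> P \<in> N \<and>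
        open \<Omega> \<and> g \<in> \<Omega> \<and> (\<forall>g'\<in>\<Omega> \<inter> Sp_complex h. \<forall>V'\<in>N \<inter> Z. V' \<notin> \<theta> g')"
      if C: "C \<in> M_D closure_of B" for C
    proof -
      have "C \<in> cycle_space h D C0" using C cl_sub by blast
      then obtain g where g: "g \<in> Sp_complex h" "C = \<theta> g" by (rule cycle_space_D)
      have "P \<notin> \<theta> g" using no C g(2) by blast
      then obtain N \<Omega> where "openin (grassmannian_topology (p + q)) N" "P \<in> N" "open \<Omega>" "g \<in> \<Omega>"
        "\<And>g' V'. g' \<in> \<Omega> \<Longrightarrow> g' \<in> Sp_complex h \<Longrightarrow> V' \<in> N \<Longrightarrow> V' \<in> Z \<Longrightarrow> V' \<notin> \<theta> g'"
        by (rule incidence_separation[OF PZ g(1)]) blast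
      then show ?thesis using g by blast
    qed
    then obtain G N \<Omega> where sep: "\<And>C. C \<in> M_D closure_of B \<Longrightarrow> G C \<in> Sp_complex h \<and> C = \<theta> (G C) \<and>
        openin (grassmannian_topology (p + q)) (N C) \<and> P \<in> N C \<and> open (\<Omega> C) \<and> G C \<in> \<Omega> C \<and>
        (\<forall>g'\<in>\<Omega> C \<inter> Sp_complex h. \<forall>V'\<in>N C \<inter> Z. V' \<notin> \<theta> g')"
      by metis
    define W where "W C = \<theta> ` (Sp_complex h \<inter> \<Omega> C) \<inter> cycle_space h D C0" for C
    have Wop: "openin M_D (W C)" if "C \<in> M_D closure_of B" for C
    proof -
      have "openin (top_of_set (Sp_complex h)) (Sp_complex h \<inter> \<Omega> C)" using sep[OF that] by (auto simp: openin_open)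
      from openin_orbit_image[OF this, of C0] show ?thesis
        by (auto simp: W_def cycle_space_topology_def openin_subtopology)
    qed
    have cover: "M_D closure_of B \<subseteq> \<Union> (W ` (M_D closure_of B))"
    proof
      fix C assume C: "C \<in> M_D closure_of B"
      then have "C \<in> W C" using sep[OF C] cl_sub unfolding W_def by blast
      then show "C \<in> \<Union> (W ` (M_D closure_of B))" using C by blast
    qed
    from cover obtain \<F> where \<F>: "finite \<F>" "\<F> \<subseteq> W ` (M_D closure_of B)" "M_D closure_of B \<subseteq> \<Union>\<F>"
      using compactinD[OF cpt, of "W ` (M_D closure_of B)"] Wop by blast
    then obtain S where S: "finite S" "S \<subseteq> M_D closure_of B" "\<F> = W ` S"
      by (meson finite_subset_image)
    \<comment> \<open>The intersection with the whole space covers the case of an empty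
      \<open>S\<close>.\<close>
    have "openin (grassmannian_topology (p + q)) ((\<Inter>C\<in>S. N C) \<inter> topspace (grassmannian_topology (p + q)))"
      using S sep by (intro openin_INT) auto
    then have op: "openin ?X (((\<Inter>C\<in>S. N C) \<inter> topspace (grassmannian_topology (p + q))) \<inter> Z)"
      unfolding isotropic_grassmannian_topology_def openin_subtopology by blast
    have PN: "P \<in> N C" if "C \<in> S" for C
    proof -
      have "C \<in> M_D closure_of B" using S(2) that by (rule subsetD)
      from sep[OF this] show ?thesis by (elim conjE)
    qed
    have Pin: "P \<in> ((\<Inter>C\<in>S. N C) \<inter> topspace (grassmannian_topology (p + q))) \<inter> Z"
      using PG PZ PN by (intro IntI INT_I)
    obtain V' where V': "V' \<in> ?Y" "V' \<in> ((\<Inter>C\<in>S. N C) \<inter> topspace (grassmannian_topology (p + q))) \<inter> Z"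
      using P_cl[unfolded in_closure_of, THEN conjunct2, rule_format, OF conjI[OF Pin op]] by (elim exE conjE)
    obtain C' where C': "C' \<in> B" "V' \<in> C'" using V'(1) by (auto simp: swept_set_iff)
    have "B \<subseteq> M_D closure_of B" using openin_subset[OF B] by (rule closure_of_subset)
    then obtain C where C: "C \<in> S" "C' \<in> W C" using C'(1) \<F>(3) S(3) by blast
    then obtain g' where g': "g' \<in> Sp_complex h \<inter> \<Omega> C" "C' = \<theta> g'" by (auto simp: W_def)
    have "V' \<in> N C \<inter> Z" using V'(2) C(1) by blast
    then have "V' \<notin> \<theta> g'" using sep[OF subsetD[OF S(2) C(1)]] g'(1) by blast
    then show False using C'(2) g'(2) by simp
  qed
  then obtain C where C: "C \<in> M_D closure_of B" "P \<in> C" by blast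
  have "C \<notin> B"
    using PY swept_setI[of C B P] C cl_sub by blast
  then have "C \<in> M_D frontier_of B"
    using C(1) interior_of_openin[OF B] by (simp add: frontier_of_def)
  then show ?thesis using C(2) by (intro that[of C]) (simp add: supporting_cycles_def)
qed

text \<open>With empty boundary the swept set would be open and closed, so a path of isotropic
  planes starting in it could never leave it; but transvections lead out of \<open>D\<close>, which
  contains it.\<close>

lemma swept_set_frontier_nonempty:
  assumes B: "openin M_D B" and C0B: "C0 \<in> B"
  shows "isotropic_grassmannian_topology h (p + q) frontier_of swept_set h D C0 B \<noteq> {}"
proof
  let ?X = "isotropic_grassmannian_topology h (p + q)"
  let ?Y = "swept_set h D C0 B"
  assume "?X frontier_of ?Y = {}"
  then have clopen: "openin ?X ?Y" "closedin ?X ?Y"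
    using frontier_of_eq_empty[of ?Y ?X] openin_subset[OF openin_swept_set[OF B]] by auto
  obtain V0 where V0: "V0 \<in> C0" "V0 \<in> Z" using C0_orbit by metis
  have VY: "V0 \<in> ?Y" using V0(1) C0B openin_MD_subset[OF B] by (intro swept_setI) auto
  then have "V0 \<in> D" by (simp add: swept_set_iff)
  then obtain x c where xc: "act_plane (transvection c x) V0 \<notin> D"
    using path_leaving_flag_domain pq_pos by metis
  have dim: "vec.subspace V0" "vec.dim V0 = p + q" using V0(2) by (auto simp: isotropic_grassmannian_def)
  define \<gamma> where "\<gamma> t = transvection (of_real t * c) x" for t :: real
  have "continuous_on {0..1} \<gamma>"
    unfolding continuous_on_def \<gamma>_def by (intro ballI tendsto_transvection tendsto_intros)
  then have "continuous_map (top_of_set {0..1}) (top_of_set (Sp_complex h)) \<gamma>"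
    by (auto simp: continuous_map_in_subtopology \<gamma>_def transvection_Sp)
  from continuous_map_compose[OF this continuous_map_orbit[OF dim]]
  have "continuous_map (top_of_set {0..1}) ?X (\<lambda>t. act_plane (\<gamma> t) V0)"
    unfolding isotropic_grassmannian_topology_def
    using Sp_preserves_isotropic[OF transvection_Sp V0(2)]
    by (auto simp: continuous_map_in_subtopology o_def \<gamma>_def)
  then have "openin (top_of_set {0..1}) {t \<in> {0..1}. act_plane (\<gamma> t) V0 \<in> ?Y}"
    "closedin (top_of_set {0..1}) {t \<in> {0..1}. act_plane (\<gamma> t) V0 \<in> ?Y}"
    using clopen openin_continuous_map_preimage closedin_continuous_map_preimage by fastforce+
  moreover have "connected_space (top_of_set {0..1::real})"
    by (simp add: connected_space_subtopology)
  ultimately have "{t \<in> {0..1}. act_plane (\<gamma> t) V0 \<in> ?Y} = {} \<or> {t \<in> {0..1}. act_plane (\<gamma> t) V0 \<in> ?Y} = {0..1}"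
    unfolding connected_space_clopen_in by auto
  moreover have "0 \<in> {t \<in> {0..1}. act_plane (\<gamma> t) V0 \<in> ?Y}" using VY by (simp add: \<gamma>_def transvection_0)
  ultimately have "{t \<in> {0..1}. act_plane (\<gamma> t) V0 \<in> ?Y} = {0..1}" by blast
  then have "1 \<in> {t \<in> {0..1}. act_plane (\<gamma> t) V0 \<in> ?Y}" by simp
  then have "act_plane (transvection c x) V0 \<in> D" by (simp add: swept_set_iff \<gamma>_def)
  then show False using xc by blast
qed

end


section \<open>Polydisks in a cycle\<close>

lemma family_of_complement:
  assumes A: "vec.subspace A" and B: "vec.subspace B" and AB: "A \<subseteq> B"
  obtains \<zeta> :: "nat \<Rightarrow> complex^'v" where "\<And>j. j < vec.dim B - vec.dim A \<Longrightarrow> \<zeta> j \<in> B"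
    "\<And>z. (\<Sum>j<vec.dim B - vec.dim A. z j *s \<zeta> j) \<in> A \<Longrightarrow> (\<And>j. j < vec.dim B - vec.dim A \<Longrightarrow> z j = 0)"
proof -
  obtain S where S: "S \<subseteq> A" "vec.independent S" "A \<subseteq> vec.span S" "card S = vec.dim A"
    using vec.basis_exists[of A] by blast
  obtain T where T: "S \<subseteq> T" "T \<subseteq> B" "vec.independent T" "B \<subseteq> vec.span T"
    using vec.maximal_independent_subset_extend[of S B] S AB by (metis subset_trans)
  have fT: "finite T" using T(3) by (rule vec.finiteI_independent)
  have cT: "card T = vec.dim B" using vec.basis_card_eq_dim[OF T(2,4,3)] .
  have "card (T - S) = vec.dim B - vec.dim A"
    using card_Diff_subset[of S T] T(1) fT S(4) cT finite_subset by metis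
  then obtain f where f: "bij_betw f {0..<vec.dim B - vec.dim A} (T - S)"
    using ex_bij_betw_nat_finite[of "T - S"] fT by auto
  let ?d = "vec.dim B - vec.dim A"
  have fim: "f ` {..<?d} = T - S" and finj: "inj_on f {..<?d}"
    using f by (auto simp: bij_betw_def atLeast0LessThan)
  show ?thesis
  proof (rule that[of f])
    show "f j \<in> B" if "j < ?d" for j using fim that T(2) by blast
    fix z j assume z: "(\<Sum>j<?d. z j *s f j) \<in> A" and j: "j < ?d"
    define c where "c v = z (the_inv_into {..<?d} f v)" for v
    have cf: "c (f i) = z i" if "i < ?d" for i using that finj by (simp add: c_def the_inv_into_f_f)
    have sum: "(\<Sum>v\<in>T - S. c v *s v) = (\<Sum>j<?d. z j *s f j)"
      unfolding fim[symmetric] using finj cf by (simp add: sum.reindex)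
    have "(\<Sum>j<?d. z j *s f j) \<in> vec.span S" using z S(3) by blast
    then obtain u where u: "(\<Sum>j<?d. z j *s f j) = (\<Sum>v\<in>S. u v *s v)"
      using vec.span_finite[of S] finite_subset[OF T(1) fT] by auto
    define w where "w v = (if v \<in> S then - u v else c v)" for v
    have "(\<Sum>v\<in>T. w v *s v) = (\<Sum>v\<in>T - S. w v *s v) + (\<Sum>v\<in>S. w v *s v)"
      by (rule sum.subset_diff[OF T(1) fT])
    also have "\<dots> = (\<Sum>v\<in>T - S. c v *s v) - (\<Sum>v\<in>S. u v *s v)"
      by (simp add: w_def sum_negf)
    also have "\<dots> = 0" using sum u by simp
    finally have "w (f j) = 0"
      using vec.independentD[OF T(3) fT subset_refl] fim j by blast
    moreover have "f j \<notin> S" using fim j by blast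
    ultimately show "z j = 0" using cf[OF j] by (simp add: w_def)
  qed
qed

text \<open>A subspace is not the union of two proper subspaces; one of \<open>a\<close>,
  \<open>b\<close>, \<open>a + b\<close> avoids both kernels.\<close>

lemma nonvanishing_for_both:
  assumes A: "vec.subspace A" and a: "a \<in> A" "f a \<noteq> 0" and b: "b \<in> A" "g b \<noteq> 0"
    and f: "\<And>x y. f (x + y) = f x + f y" and g: "\<And>x y. g (x + y) = g x + (g y :: complex)"
  obtains x where "x \<in> A" "f x \<noteq> (0::complex)" "g x \<noteq> 0"
proof (cases "g a = 0")
  case False
  then show ?thesis using a that by blast
next
  case True
  show ?thesis
  proof (cases "f b = 0")
    case False
    then show ?thesis using b that by blast
  next
    case f0: True
    show ?thesis using a b True f0 f g vec.subspace_add[OF A] by (intro that[of "a + b"]) auto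
  qed
qed

context symplectic_space
begin

lemma dim_hyperplane_section:
  assumes A: "vec.subspace A" and a: "a \<in> A" "\<sigma> w a \<noteq> 0"
  shows "vec.dim A = vec.dim (A \<inter> {y. \<sigma> w y = 0}) + 1"
proof -
  let ?H = "A \<inter> {y. \<sigma> w y = 0}"
  have sH: "vec.subspace ?H"
    using A by (auto simp: vec.subspace_def)
  have a0: "a \<noteq> 0" using a(2) by auto
  have sp: "vec.span {a} = {c *s a | c. True}" using vec.span_breakdown_eq[of _ a "{}"] by (auto simp: vec.span_singleton)
  have eqA: "{x + y |x y. x \<in> ?H \<and> y \<in> vec.span {a}} = A"
  proof
    show "{x + y |x y. x \<in> ?H \<and> y \<in> vec.span {a}} \<subseteq> A"
      using A a(1) by (auto simp: sp intro!: vec.subspace_add vec.subspace_scale)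
    show "A \<subseteq> {x + y |x y. x \<in> ?H \<and> y \<in> vec.span {a}}"
    proof
      fix x assume x: "x \<in> A"
      define c where "c = \<sigma> w x / \<sigma> w a"
      have "x - c *s a \<in> ?H" using x a A by (auto simp: c_def intro!: vec.subspace_diff vec.subspace_scale)
      moreover have "c *s a \<in> vec.span {a}" by (auto simp: sp)
      moreover have "x = (x - c *s a) + c *s a" by simp
      ultimately show "x \<in> {x + y |x y. x \<in> ?H \<and> y \<in> vec.span {a}}" by blast
    qed
  qed
  have d1: "vec.dim (vec.span {a}) = 1"
    using vec.dim_span_eq_card_independent[of "{a}"] a0 by simp
  have "?H \<inter> vec.span {a} \<subseteq> {0}"
    using a(2) by (auto simp: sp)
  then have d0: "vec.dim (?H \<inter> vec.span {a}) = 0"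
    using vec.dim_subset[of "?H \<inter> vec.span {a}" "{0}"] by simp
  show ?thesis using vec.dim_sums_Int[OF sH vec.subspace_span, of "{a}"] unfolding eqA d1 d0 by simp
qed

text \<open>Two coefficients are kept because being symplectic couples them by
  \<open>a - b = a * b * \<sigma> \<zeta> w\<close>. They may coincide when
  \<open>\<sigma> \<zeta> w = 0\<close>, as on the polydisks, but not in general when a curve of
  shears is drawn in a given direction.\<close>

definition shear :: "complex \<Rightarrow> complex \<Rightarrow> complex^'v \<Rightarrow> complex^'v \<Rightarrow> complex^'v^'v" where
  "shear a b \<zeta> w = matrix (\<lambda>v. v + (a * \<sigma> \<zeta> v) *s w + (b * \<sigma> w v) *s \<zeta>)"

lemma shear: "shear a b \<zeta> w *v v = v + (a * \<sigma> \<zeta> v) *s w + (b * \<sigma> w v) *s \<zeta>"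
proof -
  have "Vector_Spaces.linear (*s) (*s) (\<lambda>v. v + (a * \<sigma> \<zeta> v) *s w + (b * \<sigma> w v) *s \<zeta>)"
    by (simp add: Vector_Spaces.linear_iff vec.vector_space_axioms vec.scale_left_distrib
        vec.scale_right_distrib vector_smult_assoc algebra_simps)
  then show ?thesis unfolding shear_def by (rule matrix_works)
qed

lemma shear_Sp:
  assumes "a - b = a * b * \<sigma> \<zeta> w" shows "shear a b \<zeta> w \<in> Sp_complex h"
proof -
  have "\<sigma> (shear a b \<zeta> w *v v) (shear a b \<zeta> w *v v') = \<sigma> v v'" for v v'
  proof -
    have "\<sigma> (shear a b \<zeta> w *v v) (shear a b \<zeta> w *v v') = \<sigma> v v' +
        (a - b - a * b * \<sigma> \<zeta> w) * (\<sigma> \<zeta> v * \<sigma> w v' - \<sigma> w v * \<sigma> \<zeta> v')"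
      using \<sigma>_swap[of v w] \<sigma>_swap[of v \<zeta>] \<sigma>_swap[of w \<zeta>]
      by (simp add: shear algebra_simps)
    then show ?thesis using assms by simp
  qed
  then show ?thesis by (simp add: Sp_complex_def)
qed

lemma shear_preserves_lagrangian:
  assumes LM: "lagrangian_pair n L M" and w: "w \<in> L" and \<zeta>: "\<zeta> \<in> M" and Sp: "shear a b \<zeta> w \<in> Sp_complex h"
  shows "act_plane (shear a b \<zeta> w) L = L" "act_plane (shear a b \<zeta> w) M = M"
proof -
  have s: "vec.subspace L" "vec.subspace M" using LM by (auto simp: lagrangian_pair_def)
  have "shear a b \<zeta> w *v v \<in> L" if "v \<in> L" for v
  proof -
    have "\<sigma> w v = 0" using LM w that by (simp add: lagrangian_pair_def)
    then show ?thesis using s w that by (auto simp: shear intro!: vec.subspace_add vec.subspace_scale)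
  qed
  then have L: "act_plane (shear a b \<zeta> w) L \<subseteq> L" by (auto simp: act_plane_def)
  have "shear a b \<zeta> w *v v \<in> M" if "v \<in> M" for v
  proof -
    have "\<sigma> \<zeta> v = 0" using LM \<zeta> that by (simp add: lagrangian_pair_def)
    then show ?thesis using s \<zeta> that by (auto simp: shear intro!: vec.subspace_add vec.subspace_scale)
  qed
  then have M: "act_plane (shear a b \<zeta> w) M \<subseteq> M" by (auto simp: act_plane_def)
  show "act_plane (shear a b \<zeta> w) L = L"
    by (rule vec.subspace_dim_equal[OF subspace_act_plane[OF s(1)] s(1) L]) (simp add: dim_act_plane[OF Sp])
  show "act_plane (shear a b \<zeta> w) M = M"
    by (rule vec.subspace_dim_equal[OF subspace_act_plane[OF s(2)] s(2) M]) (simp add: dim_act_plane[OF Sp])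
qed

lemma shear_preserves_split_planes:
  assumes "lagrangian_pair n L M" "w \<in> L" "\<zeta> \<in> M" "shear a b \<zeta> w \<in> Sp_complex h"
  shows "act_cycle (shear a b \<zeta> w) (split_planes L M p q) = split_planes L M p q"
  using act_cycle_split_planes[OF assms(4)] shear_preserves_lagrangian[OF assms] by simp

text \<open>The directions \<open>\<zeta> j\<close> of the polydisk: a basis of the hyperplane of \<open>M\<close> annihilating \<open>w\<close>,
  modulo its intersection with the given plane.\<close>

lemma polydisk_directions:
  assumes LM: "lagrangian_pair n L M" and V: "V \<in> split_planes L M p q"
    and Q: "\<And>x y z. Q (x + y) z = Q x z + (Q y z :: complex)" "\<And>c x z. Q (c *s x) z = c * Q x z"
      "\<And>x y. Q x y = Q y x"
    and Q0: "\<And>x. (\<And>v. v \<in> V \<Longrightarrow> \<sigma> v x = 0) \<Longrightarrow> Q x x = 0"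
    and w: "w \<in> L" "Q w w \<noteq> 0"
  obtains \<zeta> b r where "\<And>j. j < n - q \<Longrightarrow> \<zeta> j \<in> M" "\<And>j. j < n - q \<Longrightarrow> \<sigma> (\<zeta> j) w = 0"
    "b \<in> V \<inter> M" "\<sigma> w b \<noteq> 0"
    "\<And>z. (\<Sum>j<n - q. z j *s \<zeta> j) \<in> V \<Longrightarrow> (\<And>j. j < n - q \<Longrightarrow> z j = 0)"
    "0 < r"
    "\<And>z. (\<And>j. j < n - q \<Longrightarrow> norm (z j) \<le> r) \<Longrightarrow> \<exists>j<n - q. z j \<noteq> 0 \<Longrightarrow>
      \<exists>u. u \<in> L \<and> (\<forall>v\<in>V. \<sigma> v u = 0) \<and>
        Q (u + \<sigma> (\<Sum>j<n - q. z j *s \<zeta> j) u *s w) (u + \<sigma> (\<Sum>j<n - q. z j *s \<zeta> j) u *s w) \<noteq> 0"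
proof -
  have sL: "vec.subspace L" and sM: "vec.subspace M" and dM: "vec.dim M = n"
    and LL: "\<And>x y. x \<in> L \<Longrightarrow> y \<in> L \<Longrightarrow> \<sigma> x y = 0" and MM: "\<And>x y. x \<in> M \<Longrightarrow> y \<in> M \<Longrightarrow> \<sigma> x y = 0"
    and dec: "\<And>x. \<exists>a\<in>L. \<exists>b\<in>M. x = a + b"
    using LM by (auto simp: lagrangian_pair_def)
  have sV: "vec.subspace V" and dVM: "vec.dim (V \<inter> M) = q"
    and split: "\<And>x. x \<in> V \<Longrightarrow> \<exists>a\<in>V \<inter> L. \<exists>b\<in>V \<inter> M. x = a + b"
    using V by (auto simp: split_planes_def)
  have sVM: "vec.subspace (V \<inter> M)" using sV sM by (rule vec.subspace_inter)
  \<comment> \<open>\<open>w\<close> is not orthogonal to \<open>V\<close>, for otherwise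
    \<open>Q w w\<close> would vanish. The part of \<open>x\<close> in \<open>L\<close> pairs to 0
    with \<open>w\<close>, so the part \<open>b\<close> in \<open>M\<close> does not.\<close>
  obtain x where x: "x \<in> V" "\<sigma> x w \<noteq> 0" using Q0[of w] w(2) by blast
  obtain a b where ab: "a \<in> V \<inter> L" "b \<in> V \<inter> M" "x = a + b" using split[OF x(1)] by blast
  have bw: "\<sigma> w b \<noteq> 0" using x(2) LL[of a w] ab w(1) \<sigma>_swap[of b w] by auto
  define A where "A = (V \<inter> M) \<inter> {y. \<sigma> w y = 0}"
  define B where "B = M \<inter> {y. \<sigma> w y = 0}"
  have sH: "vec.subspace {y. \<sigma> w y = 0}" by (auto simp: vec.subspace_def)
  have sA: "vec.subspace A" and sB: "vec.subspace B"
    unfolding A_def B_def by (intro vec.subspace_inter sVM sM sH)+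
  \<comment> \<open>Because of \<open>b\<close>, the annihilator of \<open>w\<close> is a proper
    hyperplane both in \<open>M\<close> and in \<open>V \<inter> M\<close>; the two losses of one
    dimension cancel.\<close>
  have dim_eq: "vec.dim B - vec.dim A = n - q"
    using dim_hyperplane_section[OF sVM ab(2) bw] dim_hyperplane_section[OF sM _ bw] ab(2) dVM dM
    by (simp add: A_def B_def)
  have "A \<subseteq> B" by (auto simp: A_def B_def)
  then obtain \<zeta> where \<zeta>: "\<And>j. j < n - q \<Longrightarrow> \<zeta> j \<in> B"
    "\<And>z j. (\<Sum>j<n - q. z j *s \<zeta> j) \<in> A \<Longrightarrow> j < n - q \<Longrightarrow> z j = 0"
    using family_of_complement[OF sA sB, unfolded dim_eq] by blast
  have \<zeta>M: "\<zeta> j \<in> M" "\<sigma> (\<zeta> j) w = 0" if "j < n - q" for j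
    using \<zeta>(1)[OF that] \<sigma>_swap[of "\<zeta> j" w] by (auto simp: B_def)
  have sumB: "(\<Sum>j<n - q. z j *s \<zeta> j) \<in> B" for z
    using \<zeta>(1) by (intro vec.subspace_sum[OF sB] vec.subspace_scale[OF sB]) auto
  have indep: "z j = 0" if "(\<Sum>j<n - q. z j *s \<zeta> j) \<in> V" "j < n - q" for z j
    using that sumB[of z] by (intro \<zeta>(2)[of z]) (auto simp: A_def B_def)
  define W where "W = {u \<in> L. \<forall>v\<in>V. \<sigma> v u = 0}"
  have sW: "vec.subspace W" using sL by (auto simp: W_def vec.subspace_def)
  have QW: "Q u u = 0" if "u \<in> W" for u using Q0 that by (auto simp: W_def)
  \<comment> \<open>On \<open>W\<close> the first term vanishes. With \<open>c\<close> the pairing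
    of \<open>u\<close> with the tilting direction, what remains is a product of two functionals
    linear in \<open>u\<close>, and it is enough to make each of them nonzero somewhere.\<close>
  have Qexp: "Q (u + c *s w) (u + c *s w) = Q u u + c * (2 * Q u w + c * Q w w)" for u c
    using Q(1)[of u "c *s w" "u + c *s w"] Q(1)[of u "c *s w" u] Q(1)[of u "c *s w" w]
      Q(3)[of u "u + c *s w"] Q(3)[of w "u + c *s w"] Q(3)[of w u]
    by (simp add: Q(2) algebra_simps)
  have nz: "\<exists>u\<in>W. \<sigma> (\<Sum>j<n - q. z j *s \<zeta> j) u \<noteq> 0" if z: "\<exists>j<n - q. z j \<noteq> 0" for z
  proof -
    let ?\<zeta> = "\<Sum>j<n - q. z j *s \<zeta> j"
    have "?\<zeta> \<notin> V \<inter> M" using indep[of z] z by blast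
    then obtain y where y: "\<And>a. a \<in> V \<inter> M \<Longrightarrow> \<sigma> a y = 0" "\<sigma> ?\<zeta> y \<noteq> 0"
      using separating_vector[OF sVM] by metis
    obtain u u' where u: "u \<in> L" "u' \<in> M" "y = u + u'" using dec by blast
    have "?\<zeta> \<in> M" using sumB by (auto simp: B_def)
    then have "\<sigma> ?\<zeta> u \<noteq> 0" using y(2) MM[of ?\<zeta> u'] u by simp
    moreover have "\<sigma> v u = 0" if "v \<in> V" for v
    proof -
      obtain a b where ab: "a \<in> V \<inter> L" "b \<in> V \<inter> M" "v = a + b" using split \<open>v \<in> V\<close> by blast
      have "\<sigma> b u = 0" using y(1)[OF ab(2)] MM[of b u'] ab u by simp
      then show ?thesis using LL[of a u] ab u by simp
    qed
    ultimately show ?thesis using u(1) by (auto simp: W_def)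
  qed
  \<comment> \<open>If \<open>Q u0 w\<close> is nonzero for some \<open>u0\<close> in
    \<open>W\<close>, it dominates for small \<open>z\<close>. If \<open>Q u w\<close> vanishes on
    all of \<open>W\<close>, only the term with \<open>Q w w\<close> is left, and any radius will
    do.\<close>
  have "\<exists>r>0. \<forall>z. (\<forall>j<n - q. norm (z j) \<le> r) \<longrightarrow>
      (\<exists>u\<in>W. 2 * Q u w + \<sigma> (\<Sum>j<n - q. z j *s \<zeta> j) u * Q w w \<noteq> 0) \<or> \<not> (\<exists>j<n - q. z j \<noteq> 0)"
  proof (cases "\<exists>u0\<in>W. Q u0 w \<noteq> 0")
    case True
    then obtain u0 where u0: "u0 \<in> W" "Q u0 w \<noteq> 0" by blast
    define K where "K = (\<Sum>j<n - q. norm (\<sigma> (\<zeta> j) u0)) * norm (Q w w) + 1"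
    have K: "0 < K" unfolding K_def by (intro add_nonneg_pos mult_nonneg_nonneg sum_nonneg) auto
    define r where "r = norm (Q u0 w) / K"
    have r: "0 < r" using K u0(2) by (simp add: r_def)
    have "2 * Q u0 w + \<sigma> (\<Sum>j<n - q. z j *s \<zeta> j) u0 * Q w w \<noteq> 0" if z: "\<forall>j<n - q. norm (z j) \<le> r" for z
    proof
      assume "2 * Q u0 w + \<sigma> (\<Sum>j<n - q. z j *s \<zeta> j) u0 * Q w w = 0"
      then have "norm (2 * Q u0 w) = norm (\<sigma> (\<Sum>j<n - q. z j *s \<zeta> j) u0 * Q w w)"
        by (metis add_eq_0_iff norm_minus_cancel)
      also have "\<dots> = norm (\<Sum>j<n - q. z j * \<sigma> (\<zeta> j) u0) * norm (Q w w)"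
        by (simp add: \<sigma>_sum norm_mult)
      also have "\<dots> \<le> (\<Sum>j<n - q. r * norm (\<sigma> (\<zeta> j) u0)) * norm (Q w w)"
        using z by (intro mult_right_mono order_trans[OF norm_sum] sum_mono) (auto simp: norm_mult intro!: mult_right_mono)
      also have "\<dots> = r * (K - 1)" by (simp add: K_def sum_distrib_left mult.assoc sum_distrib_right)
      also have "\<dots> \<le> norm (Q u0 w)" using K r by (simp add: r_def field_simps)
      finally show False using u0(2) by (simp add: norm_mult)
    qed
    then show ?thesis using r u0(1) by blast
  next
    case False
    have "\<exists>u\<in>W. 2 * Q u w + \<sigma> (\<Sum>j<n - q. z j *s \<zeta> j) u * Q w w \<noteq> 0" if "\<exists>j<n - q. z j \<noteq> 0" for z
      using nz[OF that] False w(2) by auto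
    then show ?thesis by (intro exI[of _ 1]) auto
  qed
  then obtain r where r: "0 < r" "\<And>z. \<forall>j<n - q. norm (z j) \<le> r \<Longrightarrow> \<exists>j<n - q. z j \<noteq> 0 \<Longrightarrow>
      \<exists>u\<in>W. 2 * Q u w + \<sigma> (\<Sum>j<n - q. z j *s \<zeta> j) u * Q w w \<noteq> 0" by blast
  have final: "\<exists>u. u \<in> L \<and> (\<forall>v\<in>V. \<sigma> v u = 0) \<and>
        Q (u + \<sigma> (\<Sum>j<n - q. z j *s \<zeta> j) u *s w) (u + \<sigma> (\<Sum>j<n - q. z j *s \<zeta> j) u *s w) \<noteq> 0"
    if z: "\<And>j. j < n - q \<Longrightarrow> norm (z j) \<le> r" "\<exists>j<n - q. z j \<noteq> 0" for z
  proof -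
    let ?\<zeta> = "\<Sum>j<n - q. z j *s \<zeta> j"
    obtain u1 where u1: "u1 \<in> W" "\<sigma> ?\<zeta> u1 \<noteq> 0" using nz[OF z(2)] by blast
    obtain u2 where u2: "u2 \<in> W" "2 * Q u2 w + \<sigma> ?\<zeta> u2 * Q w w \<noteq> 0" using r(2)[of z] z by blast
    obtain u where u: "u \<in> W" "\<sigma> ?\<zeta> u \<noteq> 0" "2 * Q u w + \<sigma> ?\<zeta> u * Q w w \<noteq> 0"
      using nonvanishing_for_both[OF sW u1(1), of "\<sigma> ?\<zeta>" u2 "\<lambda>u. 2 * Q u w + \<sigma> ?\<zeta> u * Q w w"] u1 u2
      by (auto simp: Q(1) algebra_simps)
    have "Q (u + \<sigma> ?\<zeta> u *s w) (u + \<sigma> ?\<zeta> u *s w) \<noteq> 0"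
      using Qexp[of u "\<sigma> ?\<zeta> u"] QW[OF u(1)] u(2,3) by simp
    then show ?thesis using u(1) by (auto simp: W_def)
  qed
  show ?thesis by (rule that[of \<zeta> b r]) (fact \<zeta>M ab(2) bw indep r(1) final)+
qed

text \<open>Shears tilting \<open>P\<close> along \<open>w\<close> and \<open>S z\<close> preserve
  \<open>L\<close> and \<open>M\<close>, hence the cycle. They carry a vector \<open>u\<close>
  annihilated by \<open>P\<close> to \<open>u + \<sigma> (S z) u *s w\<close>, which is annihilated
  by the moved plane; \<open>polydisk_directions\<close> makes \<open>Q\<close> nonzero there, and
  \<open>Y\<close> puts that plane into the swept set.\<close>

lemma polydisk_exists:
  assumes LM: "lagrangian_pair n L M" and P: "P \<in> split_planes L M p q" and k: "vec.dim P = k"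
    and Q: "\<And>x y z. Q (x + y) z = Q x z + (Q y z :: complex)" "\<And>c x z. Q (c *s x) z = c * Q x z"
      "\<And>x y. Q x y = Q y x"
    and Q0: "\<And>x. (\<And>v. v \<in> P \<Longrightarrow> \<sigma> v x = 0) \<Longrightarrow> Q x x = 0"
    and Y: "\<And>V x. V \<in> split_planes L M p q \<Longrightarrow> (\<And>v. v \<in> V \<Longrightarrow> \<sigma> v x = 0) \<Longrightarrow> Q x x \<noteq> 0 \<Longrightarrow> V \<in> Y"
    and w: "w \<in> L" "Q w w \<noteq> 0"
  shows "polydisk_in_cycle k (n - q) Y (split_planes L M p q) P"
proof -
  obtain \<zeta> b r where \<zeta>: "\<And>j. j < n - q \<Longrightarrow> \<zeta> j \<in> M" "\<And>j. j < n - q \<Longrightarrow> \<sigma> (\<zeta> j) w = 0"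
    and b: "b \<in> P \<inter> M" "\<sigma> w b \<noteq> 0"
    and indep: "\<And>z j. (\<Sum>j<n - q. z j *s \<zeta> j) \<in> P \<Longrightarrow> j < n - q \<Longrightarrow> z j = 0"
    and r: "0 < r"
    and dir: "\<And>z. (\<And>j. j < n - q \<Longrightarrow> norm (z j) \<le> r) \<Longrightarrow> \<exists>j<n - q. z j \<noteq> 0 \<Longrightarrow>
      \<exists>u. u \<in> L \<and> (\<forall>v\<in>P. \<sigma> v u = 0) \<and>
        Q (u + \<sigma> (\<Sum>j<n - q. z j *s \<zeta> j) u *s w) (u + \<sigma> (\<Sum>j<n - q. z j *s \<zeta> j) u *s w) \<noteq> 0"
    using polydisk_directions[of n L M P p q Q w, OF LM P Q Q0 w] by blast
  define d where "d = n - q"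
  define S where "S z = (\<Sum>j<d. z j *s \<zeta> j)" for z
  define G where "G z = shear 1 1 (S z) w" for z
  define F where "F z = act_plane (G z) P" for z
  have sM: "vec.subspace M" and MM: "\<And>x y. x \<in> M \<Longrightarrow> y \<in> M \<Longrightarrow> \<sigma> x y = 0"
    and LL: "\<And>x y. x \<in> L \<Longrightarrow> y \<in> L \<Longrightarrow> \<sigma> x y = 0" using LM by (auto simp: lagrangian_pair_def)
  have sP: "vec.subspace P" using P by (simp add: split_planes_def)
  have SM: "S z \<in> M" for z
    unfolding S_def using \<zeta>(1) by (intro vec.subspace_sum[OF sM] vec.subspace_scale[OF sM]) (auto simp: d_def)
  have Sw: "\<sigma> (S z) w = 0" for z using \<zeta>(2) by (simp add: S_def \<sigma>_sum d_def)
  have wS: "\<sigma> w (S z) = 0" for z using Sw[of z] \<sigma>_swap[of w "S z"] by simp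
  have GSp: "G z \<in> Sp_complex h" for z unfolding G_def by (rule shear_Sp) (simp add: Sw)
  have Gv: "G z *v x = x + \<sigma> (S z) x *s w + \<sigma> w x *s S z" for z x by (simp add: G_def shear)
  have FC: "F z \<in> split_planes L M p q" for z
  proof -
    have "F z \<in> act_cycle (G z) (split_planes L M p q)" using P by (auto simp: F_def act_cycle_def)
    then show ?thesis unfolding G_def using shear_preserves_split_planes[OF LM w(1) SM GSp[unfolded G_def]] by simp
  qed
  obtain bb where bb: "bb \<in> frames k" "vec.span (bb ` {..<k}) = P" using frame_exists[OF sP k] .
  define f where "f i z = G z *v bb i" for i z
  define D where "D i j = \<sigma> (\<zeta> j) (bb i) *s w + \<sigma> w (bb i) *s \<zeta> j" for i j
  have Dsum: "(\<Sum>j<d. v j *s D i j) = \<sigma> (S v) (bb i) *s w + \<sigma> w (bb i) *s S v" for v i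
    by (simp add: D_def S_def \<sigma>_sum vec.scale_right_distrib vector_smult_assoc sum.distrib
        vec.scale_sum_left vec.scale_sum_right mult.commute)
  have Sdiff: "S (\<lambda>j. z' j - z j) = S z' - S z" for z z'
    by (simp add: S_def vec.scale_left_diff_distrib sum_subtractf)
  \<comment> \<open>The frame is affine in \<open>z\<close>, so the first-order error is identically
    zero.\<close>
  have partials: "has_complex_partials d (f i) (D i) z" for i z
  proof -
    have "f i z' - f i z - (\<Sum>j<d. (z' j - z j) *s D i j) = 0" for z'
      using Dsum[of "\<lambda>j. z' j - z j" i] unfolding Sdiff
      by (simp add: f_def Gv vec.scale_left_diff_distrib vec.scale_right_diff_distrib)
    then show ?thesis
      unfolding has_complex_partials_def
      by (auto intro!: exI[of _ 1] mult_nonneg_nonneg sum_nonneg)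
  qed
  have frame: "holomorphic_frame k d F U f" for U
    unfolding holomorphic_frame_def
  proof (intro ballI conjI allI impI)
    fix z
    show "(\<lambda>i\<in>{..<k}. f i z) \<in> frames k" unfolding f_def by (rule frame_act[OF bb(1) GSp])
    show "vec.span ((\<lambda>i. f i z) ` {..<k}) = F z"
      by (simp add: F_def f_def act_plane_span image_image flip: bb(2))
    show "\<exists>D. has_complex_partials d (f i) D z" for i using partials by blast
  qed
  have rank: "differential_rank_full k d F z" for z
    unfolding differential_rank_full_def
  proof (intro exI[of _ 1] conjI exI[of _ f] exI[of _ D] frame allI impI partials)
    fix v :: "nat \<Rightarrow> complex" and j assume v: "\<forall>i<k. (\<Sum>j<d. v j *s D i j) \<in> F z" and j: "j < d"
    have sF: "vec.subspace (F z)" unfolding F_def by (rule subspace_act_plane[OF sP])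
    obtain c where c: "b = (\<Sum>i<k. c i *s bb i)" using b(1) bb(2) by (auto simp: span_family)
    \<comment> \<open>Evaluating the differential on \<open>b\<close> isolates \<open>S v\<close>,
      since \<open>M\<close> is isotropic. The shear fixes \<open>S v\<close>, so \<open>S v\<close>
      in the moved plane means \<open>S v\<close> in \<open>P\<close>, where the directions are
      independent.\<close>
    have "\<sigma> (S v) b *s w + \<sigma> w b *s S v = (\<Sum>i<k. c i *s (\<sigma> (S v) (bb i) *s w + \<sigma> w (bb i) *s S v))"
      by (simp add: c \<sigma>_sum vec.scale_right_distrib vector_smult_assoc sum.distrib vec.scale_sum_left)
    also have "\<dots> \<in> F z"
      using v by (intro vec.subspace_sum[OF sF] vec.subspace_scale[OF sF]) (auto simp: Dsum)
    finally have "\<sigma> w b *s S v \<in> F z" using MM[OF SM[of v], of b] b(1) by simp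
    from vec.subspace_scale[OF sF this, of "1 / \<sigma> w b"] have "S v \<in> F z"
      using b(2) by (simp add: vector_smult_assoc)
    then obtain y where y: "y \<in> P" "S v = G z *v y" by (auto simp: F_def act_plane_def)
    have "G z *v S v = S v" using MM[OF SM SM] by (simp add: Gv wS)
    then have "y = S v" using y(2) Sp_complex_inj[OF GSp] by (metis injD)
    then have "S v \<in> P" using y(1) by simp
    then show "v j = 0" using indep[of v j] j by (simp add: S_def d_def)
  qed simp
  define origin where "origin = (\<lambda>j\<in>{..<d}. 0 :: complex)"
  have "polydisk_in_cycle k d Y (split_planes L M p q) P"
    unfolding polydisk_in_cycle_def Let_def origin_def[symmetric]
  proof (intro exI[of _ F] exI[of _ r] conjI r)
    show "F ` ({..<d} \<rightarrow>\<^sub>E cball 0 r) \<subseteq> split_planes L M p q" using FC by blast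
    have "S origin = 0" by (simp add: S_def origin_def)
    then have "G origin = mat 1" by (simp add: matrix_eq Gv)
    then show "F origin = P" by (simp add: F_def)
    show "holomorphic_into_grassmannian k d F ({..<d} \<rightarrow>\<^sub>E cball 0 r)"
      unfolding holomorphic_into_grassmannian_def using frame zero_less_one by blast
    show "\<forall>z\<in>{..<d} \<rightarrow>\<^sub>E cball 0 r. differential_rank_full k d F z" using rank by blast
    show "F ` (({..<d} \<rightarrow>\<^sub>E cball 0 r) - {origin}) \<subseteq> Y"
    proof
      fix V assume "V \<in> F ` (({..<d} \<rightarrow>\<^sub>E cball 0 r) - {origin})"
      then obtain z where z: "z \<in> {..<d} \<rightarrow>\<^sub>E cball 0 r" "z \<noteq> origin" "V = F z" by blast
      have "\<exists>j<d. z j \<noteq> 0"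
      proof (rule ccontr)
        assume "\<not> ?thesis"
        then have "z = origin" using z(1) by (auto simp: origin_def PiE_def extensional_def)
        then show False using z(2) by simp
      qed
      moreover have "norm (z j) \<le> r" if "j < d" for j using z(1) that by (auto simp: PiE_def Pi_def)
      ultimately obtain u where u: "u \<in> L" "\<forall>v\<in>P. \<sigma> v u = 0" "Q (u + \<sigma> (S z) u *s w) (u + \<sigma> (S z) u *s w) \<noteq> 0"
        using dir[of z] by (auto simp: d_def S_def)
      have Gu: "G z *v u = u + \<sigma> (S z) u *s w" using LL[OF w(1) u(1)] by (simp add: Gv)
      show "V \<in> Y"
        unfolding z(3)
      proof (rule Y[OF FC])
        show "Q (G z *v u) (G z *v u) \<noteq> 0" using u(3) by (simp add: Gu)
        show "\<sigma> v (G z *v u) = 0" if "v \<in> F z" for v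
          using that u(2) by (auto simp: F_def act_plane_def Sp_complexD[OF GSp])
      qed
    qed
  qed
  then show ?thesis by (simp add: d_def)
qed

end

section \<open>Finiteness of the set of polydisk dimensions\<close>

lemma homogeneous_system_solution:
  fixes A :: "'e \<Rightarrow> 's \<Rightarrow> complex"
  assumes "finite E" "finite S" "card E < card S"
  obtains v where "\<exists>j\<in>S. v j \<noteq> 0" "\<And>j. j \<notin> S \<Longrightarrow> v j = 0" "\<And>e. e \<in> E \<Longrightarrow> (\<Sum>j\<in>S. A e j * v j) = 0"
proof -
  have "\<exists>v. (\<exists>j\<in>S. v j \<noteq> 0) \<and> (\<forall>j. j \<notin> S \<longrightarrow> v j = 0) \<and> (\<forall>e\<in>E. (\<Sum>j\<in>S. A e j * v j) = 0)"
    using assms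
  proof (induction E arbitrary: S rule: finite_induct)
    case empty
    then show ?case by (intro exI[of _ "\<lambda>j. if j \<in> S then 1 else 0"]) (auto simp: card_gt_0_iff)
  next
    case (insert e E)
    have restrict: "(\<Sum>j\<in>S - {s}. A e j * v j) = (\<Sum>j\<in>S. A e j * v j)" if "v s = 0" for v s e
      using insert.prems(1) that by (intro sum.mono_neutral_left) auto
    obtain s where s: "s \<in> S" using insert.prems by fastforce
    have "card E < card (S - {s})" for s using insert by (auto simp: card_Diff_singleton_if)
    then have IH: "\<exists>v. (\<exists>j\<in>S - {s}. v j \<noteq> 0) \<and> (\<forall>j. j \<notin> S - {s} \<longrightarrow> v j = 0) \<and> (\<forall>e\<in>E. (\<Sum>j\<in>S. A e j * v j) = 0)" for s
      using insert.IH[of "S - {s}"] insert.prems(1) restrict by (metis Diff_iff finite_Diff insertCI)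
    obtain v where v: "\<exists>j\<in>S - {s}. v j \<noteq> 0" "\<forall>j. j \<notin> S - {s} \<longrightarrow> v j = 0" "\<forall>e\<in>E. (\<Sum>j\<in>S. A e j * v j) = 0"
      using IH[of s] by blast
    obtain j0 where j0: "j0 \<in> S" "v j0 \<noteq> 0" using v(1) by blast
    obtain v' where v': "\<exists>j\<in>S - {j0}. v' j \<noteq> 0" "\<forall>j. j \<notin> S - {j0} \<longrightarrow> v' j = 0" "\<forall>e\<in>E. (\<Sum>j\<in>S. A e j * v' j) = 0"
      using IH[of j0] by blast
    define a where "a = (\<Sum>j\<in>S. A e j * v j)"
    define a' where "a' = (\<Sum>j\<in>S. A e j * v' j)"
    show ?case
    proof (cases "a' = 0")
      case True
      then show ?thesis using v' by (intro exI[of _ v']) (auto simp: a'_def)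
    next
      case False
      \<comment> \<open>The coefficients are the residues of the two solutions in the new equation,
        so the combination satisfies it. It is nonzero at \<open>j0\<close>, because
        \<open>v'\<close> was chosen to vanish there.\<close>
      define u where "u j = a * v' j - a' * v j" for j
      have "(\<Sum>j\<in>S. A f j * u j) = a * (\<Sum>j\<in>S. A f j * v' j) - a' * (\<Sum>j\<in>S. A f j * v j)" for f
        by (simp add: u_def sum_distrib_left sum_subtractf[symmetric] algebra_simps)
      moreover have "u j0 \<noteq> 0" using v'(2) False j0(2) by (simp add: u_def)
      moreover have "u j = 0" if "j \<notin> S" for j using that v(2) v'(2) by (simp add: u_def)
      ultimately show ?thesis using v(3) v'(3) j0(1)
        by (intro exI[of _ u]) (auto simp: a_def[symmetric] a'_def[symmetric])
    qed
  qed
  then show ?thesis using that by blast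
qed

text \<open>The bound is crude and serves only to make the maxima well defined. In higher dimension
  some nonzero direction kills all coordinates of the derivatives of the frame, against full
  rank.\<close>

lemma polydisk_dimension_bound:
  fixes P :: "(complex^'v) set"
  assumes "polydisk_in_cycle k d Y C P" shows "d \<le> k * CARD('v)"
proof (rule ccontr)
  assume "\<not> d \<le> k * CARD('v)"
  then have card: "card ({..<k} \<times> (UNIV :: 'v set)) < card {..<d}" by (simp add: card_cartesian_product)
  obtain F :: "(nat \<Rightarrow> complex) \<Rightarrow> (complex^'v) set" and \<rho> where \<rho>: "\<rho> > 0" and rank: "\<forall>z\<in>{..<d} \<rightarrow>\<^sub>E cball 0 \<rho>. differential_rank_full k d F z"
    using assms unfolding polydisk_in_cycle_def Let_def by blast
  have "(\<lambda>j\<in>{..<d}. 0) \<in> {..<d} \<rightarrow>\<^sub>E cball (0::complex) \<rho>" using \<rho> by simp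
  then have "differential_rank_full k d F (\<lambda>j\<in>{..<d}. 0)" using rank by blast
  then obtain r f D where r: "r > 0" "holomorphic_frame k d F (PiE {..<d} (\<lambda>j. ball ((\<lambda>j\<in>{..<d}. 0) j) r)) f"
    and inj: "\<forall>v :: nat \<Rightarrow> complex. (\<forall>i<k. (\<Sum>j<d. v j *s D i j) \<in> F (\<lambda>j\<in>{..<d}. 0)) \<longrightarrow> (\<forall>j<d. v j = 0)"
    unfolding differential_rank_full_def by (elim exE conjE)
  have "(\<lambda>j\<in>{..<d}. 0) \<in> PiE {..<d} (\<lambda>j. ball ((\<lambda>j\<in>{..<d}. 0 :: complex) j) r)" using r(1) by simp
  then have span: "vec.span ((\<lambda>i. f i (\<lambda>j\<in>{..<d}. 0)) ` {..<k}) = F (\<lambda>j\<in>{..<d}. 0)"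
    using r(2) unfolding holomorphic_frame_def by blast
  obtain v where v: "\<exists>j\<in>{..<d}. v j \<noteq> 0"
    "\<And>e. e \<in> {..<k} \<times> (UNIV :: 'v set) \<Longrightarrow> (\<Sum>j\<in>{..<d}. D (fst e) j $ snd e * v j) = 0"
    by (rule homogeneous_system_solution[OF _ _ card, of "\<lambda>e j. D (fst e) j $ snd e"]) (simp, simp, blast)
  have "(\<Sum>j<d. v j *s D i j) = 0" if "i < k" for i
    using v(2)[of "(i, _)"] that by (auto simp: vec_eq_iff mult.commute)
  moreover have "0 \<in> F (\<lambda>j\<in>{..<d}. 0)" unfolding span[symmetric] by (rule vec.span_zero)
  ultimately have "\<forall>j<d. v j = 0" using inj by simp
  then show False using v(1) by auto
qed


section \<open>Cycles on the boundary\<close>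

definition cscale :: "complex \<Rightarrow> complex^'n^'m \<Rightarrow> complex^'n^'m" where
  "cscale c A = (\<chi> i j. c * A $ i $ j)"

lemma cscale_mult_vec: "cscale c A *v x = c *s (A *v x)"
  by (simp add: cscale_def matrix_vector_mult_def vec_eq_iff sum_distrib_left mult.assoc)

lemma cscale_simps: "cscale (of_real r) A = r *\<^sub>R A" "cscale c (cscale d A) = cscale (c * d) A"
  "cscale c (A + B) = cscale c A + cscale c B" "cscale (c + d) A = cscale c A + cscale d A"
  by (simp_all add: cscale_def vec_eq_iff algebra_simps) (simp add: scaleR_conv_of_real)

lemma cscale_mult: "cscale c A ** B = cscale c (A ** B)"
  by (simp add: cscale_def matrix_matrix_mult_def vec_eq_iff sum_distrib_left mult.assoc)

lemma bounded_linear_cscale: "bounded_linear (\<lambda>c. cscale c A)"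
proof -
  have "linear (\<lambda>c. cscale c A)"
    by (simp add: linear_iff cscale_def vec_eq_iff distrib_right)
  then show ?thesis by (simp add: linear_conv_bounded_linear)
qed

lemma matrix_add_rdistrib: "(A + B) ** C = A ** C + B ** (C :: 'a::semiring_1^'n^'m)"
  by (simp add: matrix_matrix_mult_def vec_eq_iff distrib_right sum.distrib)

lemma linear_matrix_mult_right: "linear (\<lambda>X :: complex^'m^'p. X ** (g :: complex^'n^'m))"
proof -
  have "(r *\<^sub>R X) ** g = r *\<^sub>R (X ** g)" for r and X :: "complex^'m^'p"
    using cscale_mult[of "of_real r" X g] by (simp add: cscale_simps)
  then show ?thesis by (simp add: linear_iff matrix_add_rdistrib)
qed

context symplectic_space
begin

definition rank1 :: "complex^'v \<Rightarrow> complex^'v \<Rightarrow> complex^'v^'v" where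
  "rank1 x y = matrix (\<lambda>v. \<sigma> x v *s y)"

lemma rank1: "rank1 x y *v v = \<sigma> x v *s y"
proof -
  have "Vector_Spaces.linear (*s) (*s) (\<lambda>v. \<sigma> x v *s y)"
    by (simp add: Vector_Spaces.linear_iff vec.vector_space_axioms vec.scale_left_distrib vector_smult_assoc)
  then show ?thesis unfolding rank1_def by (rule matrix_works)
qed

definition symprod :: "complex^'v \<Rightarrow> complex^'v \<Rightarrow> complex^'v^'v" where
  "symprod x y = rank1 x y + rank1 y x"

lemma symprod: "symprod x y *v v = \<sigma> x v *s y + \<sigma> y v *s x"
  by (simp add: symprod_def matrix_vector_mult_add_rdistrib rank1)

lemma symprod_simps: "symprod (x + y) z = symprod x z + symprod y z"
  "symprod (c *s x) z = cscale c (symprod x z)" "symprod x y = symprod y x"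
  by (simp_all add: matrix_eq symprod matrix_vector_mult_add_rdistrib cscale_mult_vec
      vec.scale_left_distrib vec.scale_right_distrib vector_smult_assoc algebra_simps)

lemma transvection_rank1: "transvection c x = mat 1 + cscale (c / 2) (symprod x x)"
  by (simp add: matrix_eq transvection symprod matrix_vector_mult_add_rdistrib cscale_mult_vec
      vec.scale_right_distrib vector_smult_assoc vec.scale_left_distrib[symmetric])

lemma shear_rank1: "shear a b \<zeta> w = mat 1 + cscale a (rank1 \<zeta> w) + cscale b (rank1 w \<zeta>)"
  by (simp add: matrix_eq shear rank1 matrix_vector_mult_add_rdistrib cscale_mult_vec vector_smult_assoc)

text \<open>The symmetric products \<open>x y\<close> span the symplectic Lie algebra: with vectors representing the
  coordinate functionals, \<open>2 X\<close> is a sum of symmetric products.\<close>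

lemma symprod_span:
  assumes X: "\<And>x y. \<sigma> (X *v x) y + \<sigma> x (X *v y) = 0"
  obtains f where "2 *\<^sub>R X = (\<Sum>i\<in>UNIV. symprod (f i) (X *v axis i 1))"
proof -
  have "\<exists>f. \<forall>v. \<sigma> f v = v $ i" for i
  proof -
    obtain x where x: "\<And>v. \<sigma> v x = (\<Sum>j\<in>UNIV. v $ j * axis i 1 $ j)"
      using functional_representable by blast
    have "\<sigma> v x = v $ i" for v by (simp add: x axis_def if_distrib cong: if_cong)
    then have "\<sigma> (- x) v = v $ i" for v using \<sigma>_swap[of x v] by simp
    then show ?thesis by blast
  qed
  then obtain f where f: "\<And>i v. \<sigma> (f i) v = v $ i" by metis
  have 1: "(\<Sum>i\<in>UNIV. \<sigma> (f i) v *s (X *v axis i 1)) = X *v v" for v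
  proof -
    have "X *v v = X *v (\<Sum>i\<in>UNIV. v $ i *s axis i 1)" by (simp add: basis_expansion)
    then show ?thesis by (simp add: f vec.linear_sum[OF linear_matrix_vector_mult] vector_scalar_commute)
  qed
  \<comment> \<open>The other half of the symmetric products gives the same operator because
    \<open>X\<close> is skew for \<open>\<sigma>\<close>; pairing with \<open>y\<close> reduces it
    to the expansion of \<open>X *v y\<close>.\<close>
  have 2: "(\<Sum>i\<in>UNIV. \<sigma> (X *v axis i 1) v *s f i) = X *v v" for v
  proof -
    let ?d = "(\<Sum>i\<in>UNIV. \<sigma> (X *v axis i 1) v *s f i) - X *v v"
    have "\<sigma> ?d y = 0" for y
    proof -
      have "\<sigma> (\<Sum>i\<in>UNIV. \<sigma> (X *v axis i 1) v *s f i) y = \<sigma> (\<Sum>i\<in>UNIV. \<sigma> (f i) y *s (X *v axis i 1)) v"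
        by (simp add: \<sigma>_sum mult.commute)
      also have "\<dots> = \<sigma> (X *v y) v" by (simp add: 1)
      also have "\<dots> = - \<sigma> y (X *v v)" using X[of y v] by (simp only: eq_neg_iff_add_eq_0)
      also have "\<dots> = \<sigma> (X *v v) y" using \<sigma>_swap[of "X *v v" y] by simp
      finally show ?thesis by simp
    qed
    then have "?d = 0" by (rule \<sigma>_nondegenerate)
    then show ?thesis by simp
  qed
  have "(2 *\<^sub>R X) *v v = (\<Sum>i\<in>UNIV. symprod (f i) (X *v axis i 1)) *v v" for v
  proof -
    have "(\<Sum>i\<in>UNIV. symprod (f i) (X *v axis i 1)) *v v = (\<Sum>i\<in>UNIV. symprod (f i) (X *v axis i 1) *v v)"
      by (induction rule: infinite_finite_induct[of _ UNIV]) (auto simp: matrix_vector_mult_add_rdistrib)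
    also have "\<dots> = X *v v + X *v v" by (simp add: symprod sum.distrib 1 2)
    finally show ?thesis by (simp only: matrix_vector_mult_add_rdistrib scaleR_2)
  qed
  then have "2 *\<^sub>R X = (\<Sum>i\<in>UNIV. symprod (f i) (X *v axis i 1))" by (simp add: matrix_eq)
  then show ?thesis by (rule that)
qed

text \<open>A real functional on a complex space is the real part of a unique complex linear one,
  here evaluated on symmetric products.\<close>

definition functional_form :: "(complex^'v^'v \<Rightarrow> real) \<Rightarrow> complex^'v \<Rightarrow> complex^'v \<Rightarrow> complex" where
  "functional_form \<psi> x y = of_real (\<psi> (symprod x y)) - \<i> * of_real (\<psi> (cscale \<i> (symprod x y)))"

lemma functional_form:
  assumes \<psi>: "linear \<psi>"
  shows "functional_form \<psi> (x + y) z = functional_form \<psi> x z + functional_form \<psi> y z"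
    "functional_form \<psi> (c *s x) z = c * functional_form \<psi> x z"
    "functional_form \<psi> x y = functional_form \<psi> y x"
    "Re (functional_form \<psi> x y) = \<psi> (symprod x y)"
proof -
  show "functional_form \<psi> (x + y) z = functional_form \<psi> x z + functional_form \<psi> y z"
    by (simp add: functional_form_def symprod_simps(1) cscale_simps linear_add[OF \<psi>] algebra_simps)
  show "functional_form \<psi> x y = functional_form \<psi> y x"
    unfolding functional_form_def using symprod_simps(3)[of x y] by simp
  show "Re (functional_form \<psi> x y) = \<psi> (symprod x y)" by (simp add: functional_form_def)
  have exp: "\<psi> (cscale c A) = Re c * \<psi> A + Im c * \<psi> (cscale \<i> A)" for c A
  proof -
    have "cscale c A = Re c *\<^sub>R A + Im c *\<^sub>R cscale \<i> A"
      by (simp add: cscale_def vec_eq_iff complex_eq_iff)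
    then show ?thesis by (simp add: linear_add[OF \<psi>] linear_cmul[OF \<psi>])
  qed
  show "functional_form \<psi> (c *s x) z = c * functional_form \<psi> x z"
    using exp[of c "symprod x z"] exp[of "\<i> * c" "symprod x z"]
    by (simp add: functional_form_def symprod_simps(2) cscale_simps complex_eq_iff)
qed

end

lemma smooth_onD: "smooth_on \<phi> W \<Longrightarrow> x \<in> W \<Longrightarrow> \<phi> differentiable (at x)"
  unfolding smooth_on_def by (metis Ck_on.simps(2))

lemma smooth_on_continuous: "smooth_on \<phi> W \<Longrightarrow> continuous_on W \<phi>"
  unfolding smooth_on_def by (metis Ck_on.simps(1))

lemma derivative_along_curve:
  assumes "(\<phi> has_derivative \<phi>') (at g)" "(\<gamma> has_vector_derivative X) (at 0)" "\<gamma> (0::real) = g"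
  shows "((\<lambda>t. \<phi> (\<gamma> t) :: real) has_real_derivative \<phi>' X) (at 0)"
proof -
  have "((\<lambda>t. \<phi> (\<gamma> t)) has_derivative (\<lambda>t. \<phi>' (t *\<^sub>R X))) (at 0)"
    using has_derivative_compose[of \<gamma> "\<lambda>t. t *\<^sub>R X" 0 UNIV \<phi> \<phi>'] assms
    by (simp add: has_vector_derivative_def)
  moreover have "linear \<phi>'" using assms(1) has_derivative_linear by blast
  ultimately show ?thesis
    by (simp add: has_field_derivative_def linear_cmul mult.commute[of _ "\<phi>' X"])
qed

context base_cycle_structure
begin

text \<open>That \<open>P\<close> is not swept enters as the vanishing of \<open>Q\<close> on the
  annihilator of \<open>P\<close>; all other information about \<open>Q\<close> concerns the cycle
  \<open>C\<close> alone. The dimension is existential because the position of \<open>C\<close>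
  decides between \<open>n - q\<close> and \<open>n - p\<close>.\<close>

lemma boundary_polydisk:
  assumes B: "openin M_D B" and smooth: "smooth_boundary h D C0 B"
    and C: "C \<in> supporting_cycles h D C0 B P" and PnY: "P \<notin> swept_set h D C0 B"
  shows "\<exists>d. min (n - p) (n - q) \<le> d \<and> polydisk_in_cycle (p + q) d (swept_set h D C0 B) C P"
proof -
  have CF: "C \<in> M_D frontier_of B" and PC: "P \<in> C" using C by (auto simp: supporting_cycles_def)
  have Ccl: "C \<in> M_D closure_of B" and CB: "C \<notin> B"
    using CF interior_of_openin[OF B] by (auto simp: frontier_of_def)
  have CS: "C \<in> cycle_space h D C0"
    using Ccl closure_of_subset_topspace[of M_D B] by (auto simp: cycle_space_topology_def)
  then obtain g where g: "g \<in> Sp_complex h" "C = \<theta> g" "C \<subseteq> D" by (rule cycle_space_D)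
  obtain U \<rho> where U: "openin M_D U" "C \<in> U" and nc: "smooth_noncritical h C0 \<rho> U"
    and BU: "B \<inter> U = {C' \<in> U. \<rho> C' < 0}"
    using smooth CF unfolding smooth_boundary_def by blast
  obtain W \<phi> where W: "open W" "g \<in> W" "smooth_on \<phi> W"
    and \<phi>\<rho>: "\<And>g'. g' \<in> W \<inter> Sp_complex h \<Longrightarrow> \<theta> g' \<in> U \<Longrightarrow> \<phi> g' = \<rho> (\<theta> g')"
    and crit: "\<exists>X\<in>Sp_tangent_space h g. frechet_derivative \<phi> (at g) X \<noteq> 0"
    using nc g U(2) unfolding smooth_noncritical_def by metis
  define \<phi>' where "\<phi>' = frechet_derivative \<phi> (at g)"
  have \<phi>': "(\<phi> has_derivative \<phi>') (at g)"
    unfolding \<phi>'_def using smooth_onD[OF W(3,2)] by (simp add: frechet_derivative_works)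
  \<comment> \<open>Right translation by \<open>g\<close> identifies the tangent space at
    \<open>g\<close> with the symplectic Lie algebra.\<close>
  define \<psi> where "\<psi> X = \<phi>' (X ** g)" for X :: "complex^'v^'v"
  have \<psi>: "linear \<psi>"
  proof -
    have "linear (\<phi>' \<circ> (\<lambda>X. X ** g))"
      by (rule linear_compose[OF linear_matrix_mult_right has_derivative_linear[OF \<phi>']])
    then show ?thesis by (simp add: \<psi>_def[abs_def] o_def)
  qed
  \<comment> \<open>\<open>C\<close> is a limit of cycles of \<open>B\<close>, where
    \<open>\<rho>\<close> is negative. Were \<open>\<phi> g\<close> positive, it would stay positive
    nearby, and the openness of the orbit map would exclude such cycles.\<close>
  have \<phi>g: "\<phi> g \<le> 0"
  proof (rule ccontr)
    assume "\<not> \<phi> g \<le> 0"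
    then have "0 < \<phi> g" by simp
    have "open {a \<in> W. \<phi> a \<in> {0<..}}"
      using continuous_open_preimage[OF smooth_on_continuous[OF W(3)] W(1), of "{0<..}"] by (simp add: vimage_def Int_def)
    then have "openin (top_of_set (Sp_complex h)) (Sp_complex h \<inter> {a \<in> W. \<phi> a \<in> {0<..}})" by (auto simp: openin_open)
    from openin_orbit_image[OF this, of C0]
    have "openin M_D (\<theta> ` (Sp_complex h \<inter> {a \<in> W. \<phi> a \<in> {0<..}}) \<inter> cycle_space h D C0)"
      by (auto simp: cycle_space_topology_def openin_subtopology)
    then have op: "openin M_D (\<theta> ` (Sp_complex h \<inter> {a \<in> W. \<phi> a \<in> {0<..}}) \<inter> cycle_space h D C0 \<inter> U)"
      using U(1) by (rule openin_Int)
    have mem: "C \<in> \<theta> ` (Sp_complex h \<inter> {a \<in> W. \<phi> a \<in> {0<..}}) \<inter> cycle_space h D C0 \<inter> U"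
      using g W(2) \<open>0 < \<phi> g\<close> CS U(2) by auto
    obtain C' where C': "C' \<in> B" "C' \<in> \<theta> ` (Sp_complex h \<inter> {a \<in> W. \<phi> a \<in> {0<..}}) \<inter> cycle_space h D C0 \<inter> U"
      using Ccl[unfolded in_closure_of, THEN conjunct2, rule_format, OF conjI[OF mem op]] by (elim exE conjE)
    then obtain a where a: "a \<in> Sp_complex h" "a \<in> W" "0 < \<phi> a" "C' = \<theta> a" "C' \<in> U" by auto
    have "\<rho> C' < 0" using BU C'(1) a(5) by blast
    then show False using \<phi>\<rho>[of a] a by simp
  qed
  obtain \<Omega> where \<Omega>: "open \<Omega>" "g \<in> \<Omega>"
    "\<And>\<gamma>. continuous_on {0..1::real} \<gamma> \<Longrightarrow> \<gamma> 0 = g \<Longrightarrow> (\<And>t. t \<in> {0..1} \<Longrightarrow> \<gamma> t \<in> \<Omega> \<inter> Sp_complex h) \<Longrightarrow> \<theta> (\<gamma> 1) \<in> U"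
    using path_stays_in_open[OF U(1) g(1)] U(2) g(2) by metis
  define L M where "L = act_plane g Epos" and "M = act_plane g Eneg"
  have LM: "lagrangian_pair n L M"
    unfolding L_def M_def by (rule lagrangian_pair_act[OF g(1) lagrangian_pair_E[OF card]])
  have Csplit: "C = split_planes L M p q"
    unfolding g(2) L_def M_def by (rule act_cycle_split_planes[OF g(1)])
  define Q where "Q = functional_form \<psi>"
  note Q = functional_form[OF \<psi>, folded Q_def]
  have inY: "V \<in> swept_set h D C0 B"
    if V: "V \<in> C" and x: "\<And>v. v \<in> V \<Longrightarrow> \<sigma> v x = 0" and Qx: "Q x x \<noteq> 0" for V x
  proof -
    \<comment> \<open>A complex multiple of \<open>x\<close> normalizes the quadratic form to -1, so
      the corresponding direction decreases \<open>\<phi>\<close> whatever the argument of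
      \<open>Q x x\<close>.\<close>
    define c where "c = csqrt (- 1 / Q x x)"
    have c2: "c * c * Q x x = - 1" using Qx by (simp add: c_def flip: power2_eq_square)
    define y where "y = c *s x"
    have "Q y y = - 1"
      using c2 Q(3)[of x "c *s x"] by (simp add: y_def Q(2) mult.assoc)
    then have \<psi>y: "\<psi> (symprod y y) = - 1" using Q(4)[of y y] by simp
    have yV: "\<sigma> y v = 0" if "v \<in> V" for v using x[OF that] \<sigma>_swap[of x v] by (simp add: y_def)
    \<comment> \<open>\<open>symprod y y\<close> counts the transvection twice; the factor 2 makes
      it the exact velocity of the curve, which is affine in \<open>t\<close>.\<close>
    define \<gamma> where "\<gamma> t = transvection (of_real (2 * t)) y ** g" for t :: real
    have \<gamma>eq: "\<gamma> t = g + t *\<^sub>R (symprod y y ** g)" for t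
      using cscale_mult[of "of_real t" "symprod y y" g]
      by (simp add: \<gamma>_def transvection_rank1 matrix_add_rdistrib cscale_simps)
    have \<gamma>Sp: "\<gamma> t \<in> Sp_complex h" for t unfolding \<gamma>_def by (intro Sp_complex_group transvection_Sp g(1))
    have "(\<gamma> has_vector_derivative symprod y y ** g) (at 0)"
      unfolding \<gamma>eq[abs_def] by (auto intro!: derivative_eq_intros)
    from derivative_along_curve[OF \<phi>' this]
    have "((\<lambda>t. \<phi> (\<gamma> t)) has_real_derivative - 1) (at 0)" using \<psi>y by (simp add: \<gamma>eq \<psi>_def)
    from DERIV_neg_dec_right[OF this]
    obtain e where e: "0 < e" "\<And>t. 0 < t \<Longrightarrow> t < e \<Longrightarrow> \<phi> (\<gamma> t) < \<phi> g" by (auto simp: \<gamma>eq)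
    have cont: "continuous_on UNIV \<gamma>" unfolding \<gamma>eq[abs_def] by (intro continuous_intros)
    have "open (\<gamma> -` (\<Omega> \<inter> W))" using \<Omega>(1) W(1) cont by (intro open_vimage) auto
    moreover have "0 \<in> \<gamma> -` (\<Omega> \<inter> W)" using \<Omega>(2) W(2) by (simp add: \<gamma>eq)
    ultimately obtain e' where e': "0 < e'" "ball 0 e' \<subseteq> \<gamma> -` (\<Omega> \<inter> W)" by (meson open_contains_ball)
    define t where "t = min e e' / 2"
    have t: "0 < t" "t < e" "t < e'" using e(1) e'(1) by (auto simp: t_def min_def)
    have near: "\<gamma> s \<in> \<Omega> \<inter> W" if "0 \<le> s" "s \<le> t" for s
      using e'(2) that t(3) by (force simp: dist_norm)
    \<comment> \<open>The whole segment from \<open>g\<close> to \<open>\<gamma> t\<close> lies in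
      \<open>\<Omega>\<close>, as membership in \<open>U\<close> requires.\<close>
    have "\<theta> (\<gamma> (t * 1)) \<in> U"
    proof (rule \<Omega>(3)[of "\<lambda>s. \<gamma> (t * s)"])
      show "continuous_on {0..1} (\<lambda>s. \<gamma> (t * s))" unfolding \<gamma>eq by (intro continuous_intros)
      show "\<gamma> (t * s) \<in> \<Omega> \<inter> Sp_complex h" if "s \<in> {0..1}" for s
        using near[of "t * s"] \<gamma>Sp that t(1) by (auto simp: mult_left_le)
    qed (simp add: \<gamma>eq)
    then have tU: "\<theta> (\<gamma> t) \<in> U" by simp
    have "\<gamma> t \<in> W" using near[of t] t(1) by simp
    then have "\<rho> (\<theta> (\<gamma> t)) < 0"
      using \<phi>\<rho>[of "\<gamma> t"] \<gamma>Sp tU e(2)[OF t(1,2)] \<phi>g by simp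
    then have tB: "\<theta> (\<gamma> t) \<in> B" using BU tU by blast
    have "act_plane (transvection (of_real (2 * t)) y) V = V"
      unfolding act_plane_def using yV by (auto simp: transvection image_iff)
    then have "V \<in> \<theta> (\<gamma> t)"
      using V unfolding \<gamma>_def act_cycle_mult g(2)[symmetric] act_cycle_def[of "transvection (of_real (2 * t)) y"]
      by (metis imageI)
    then show ?thesis using tB openin_MD_subset[OF B] by (intro swept_setI) auto
  qed
  have PY: "Q x x = 0" if "\<And>v. v \<in> P \<Longrightarrow> \<sigma> v x = 0" for x
    using inY[OF PC that] PnY by blast
  have QLM: "Q \<zeta> w = 0" if w: "w \<in> L" and \<zeta>: "\<zeta> \<in> M" for w \<zeta>
  proof -
    have zero: "\<psi> (symprod \<zeta> w) = 0" if w: "w \<in> L" for w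
    proof -
      define c where "c = \<sigma> \<zeta> w"
      \<comment> \<open>This solves \<open>a - b = a * b * c\<close> for b. Its derivative at 0 is
        1, so the curve of shears has velocity \<open>symprod \<zeta> w ** g\<close> at 0.\<close>
      define \<beta> where "\<beta> a = a / (1 + a * c)" for a :: complex
      define \<gamma> where "\<gamma> t = shear (of_real t) (\<beta> (of_real t)) \<zeta> w ** g" for t :: real
      have \<gamma>eq: "\<gamma> t = g + cscale (of_real t) (rank1 \<zeta> w ** g) + cscale (\<beta> (of_real t)) (rank1 w \<zeta> ** g)" for t
        by (simp add: \<gamma>_def shear_rank1 matrix_add_rdistrib cscale_mult)
      have \<gamma>0: "\<gamma> 0 = g" by (simp add: \<gamma>eq \<beta>_def) (simp add: cscale_def vec_eq_iff)
      have "(\<beta> has_field_derivative 1) (at (of_real 0))"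
        unfolding \<beta>_def[abs_def] by (auto intro!: derivative_eq_intros)
      then have \<beta>': "((\<lambda>t. \<beta> (of_real t)) has_vector_derivative 1) (at 0)"
        by (rule has_vector_derivative_real_field)
      have "((\<lambda>t. of_real t :: complex) has_vector_derivative 1) (at (0::real))"
        by (auto intro!: derivative_eq_intros)
      then have "(\<gamma> has_vector_derivative (0 + cscale 1 (rank1 \<zeta> w ** g) + cscale 1 (rank1 w \<zeta> ** g))) (at 0)"
        unfolding \<gamma>eq[abs_def]
        by (intro has_vector_derivative_add has_vector_derivative_const
            bounded_linear.has_vector_derivative[OF bounded_linear_cscale] \<beta>')
      moreover have "0 + cscale 1 (rank1 \<zeta> w ** g) + cscale 1 (rank1 w \<zeta> ** g) = symprod \<zeta> w ** g"
        by (simp add: symprod_def matrix_add_rdistrib) (simp add: cscale_def vec_eq_iff)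
      ultimately have "(\<gamma> has_vector_derivative symprod \<zeta> w ** g) (at 0)" by simp
      note der = this derivative_along_curve[OF \<phi>' this \<gamma>0]
      have "isCont \<gamma> 0" using der(1) by (rule has_vector_derivative_continuous)
      then have "(\<gamma> \<longlongrightarrow> \<gamma> 0) (nhds 0)" by (simp add: isCont_def tendsto_at_iff_tendsto_nhds)
      then have "eventually (\<lambda>t. \<gamma> t \<in> W) (nhds 0)"
        using topological_tendstoD W(1,2) \<gamma>0 by simp
      moreover have "eventually (\<lambda>t. 1 + of_real t * c \<noteq> 0) (nhds (0::real))"
      proof -
        have "open {t :: real. 1 + of_real t * c \<noteq> 0}"
          by (intro open_Collect_neq continuous_intros)
        from eventually_nhds_in_open[OF this, of 0] show ?thesis by simp
      qed
      \<comment> \<open>The shears preserve \<open>L\<close> and \<open>M\<close>, hence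
        \<open>C\<close>, so the defining function is constant along the curve.\<close>
      ultimately have "eventually (\<lambda>t. \<phi> (\<gamma> t) = \<rho> C) (nhds 0)"
      proof eventually_elim
        case (elim t)
        have Sp: "shear (of_real t) (\<beta> (of_real t)) \<zeta> w \<in> Sp_complex h"
          using elim(2) by (intro shear_Sp) (simp add: \<beta>_def c_def field_simps)
        have "\<theta> (\<gamma> t) = C"
          unfolding \<gamma>_def act_cycle_mult g(2)[symmetric]
          using shear_preserves_split_planes[OF LM w \<zeta> Sp] Csplit by simp
        moreover have "\<gamma> t \<in> Sp_complex h" unfolding \<gamma>_def by (rule Sp_complex_group(2)[OF Sp g(1)])
        ultimately show ?case using \<phi>\<rho>[of "\<gamma> t"] elim(1) U(2) by simp
      qed
      then have "((\<lambda>t. \<phi> (\<gamma> t)) has_real_derivative \<phi>' (symprod \<zeta> w ** g)) (at 0) \<longleftrightarrow>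
          ((\<lambda>t. \<rho> C) has_real_derivative \<phi>' (symprod \<zeta> w ** g)) (at 0)"
        by (intro DERIV_cong_ev) auto
      then have "((\<lambda>t. \<rho> C) has_real_derivative \<phi>' (symprod \<zeta> w ** g)) (at 0)" using der(2) by simp
      then show ?thesis using DERIV_unique[OF _ DERIV_const] by (auto simp: \<psi>_def)
    qed
    have sL: "vec.subspace L" using LM by (simp add: lagrangian_pair_def)
    \<comment> \<open>\<open>L\<close> is a complex subspace, so applying the real statement to
      \<open>\<i> *s w\<close> removes the imaginary part of \<open>Q \<zeta> w\<close> too.\<close>
    have "cscale \<i> (symprod \<zeta> w) = symprod \<zeta> (\<i> *s w)"
      by (metis symprod_simps(2,3))
    then show ?thesis
      using zero[OF w] zero[OF vec.subspace_scale[OF sL w, of \<i>]] by (simp add: Q_def functional_form_def)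
  qed
  \<comment> \<open>Otherwise polarization kills \<open>\<psi>\<close> on all symmetric products.
    These span the Lie algebra, so the differential of \<open>\<phi>\<close> would vanish on the
    tangent space of the group, contrary to \<open>crit\<close>.\<close>
  have "\<exists>x. Q x x \<noteq> 0"
  proof (rule ccontr)
    assume "\<not> ?thesis"
    then have diag: "Q x x = 0" for x by blast
    have "Q x y = 0" for x y
      using diag[of "x + y"] diag[of x] diag[of y] Q(1)[of x y "x + y"] Q(1)[of x y x] Q(1)[of x y y]
        Q(3)[of x "x + y"] Q(3)[of y "x + y"] Q(3)[of x y] by simp
    then have sz: "\<psi> (symprod x y) = 0" for x y using Q(4)[of x y] by simp
    obtain X where X: "X \<in> Sp_tangent_space h g" "\<phi>' X \<noteq> 0" using crit by (auto simp: \<phi>'_def)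
    define Y where "Y = X ** matrix_inv g"
    have Yg: "Y ** g = X" by (simp add: Y_def matrix_mul_assoc[symmetric] Sp_complex_inv[OF g(1)])
    have "\<sigma> (Y *v x) y + \<sigma> x (Y *v y) = 0" for x y
    proof -
      have "\<sigma> (X *v (matrix_inv g *v x)) (g *v (matrix_inv g *v y)) + \<sigma> (g *v (matrix_inv g *v x)) (X *v (matrix_inv g *v y)) = 0"
        using X(1) unfolding Sp_tangent_space_def by blast
      then show ?thesis by (simp add: Y_def Sp_complex_inv[OF g(1)] flip: matrix_vector_mul_assoc)
    qed
    then obtain f where "2 *\<^sub>R Y = (\<Sum>i\<in>UNIV. symprod (f i) (Y *v axis i 1))" by (rule symprod_span)
    then have "\<psi> (2 *\<^sub>R Y) = 0" by (simp add: linear_sum[OF \<psi>] sz)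
    then have "\<psi> Y = 0" by (simp add: linear_cmul[OF \<psi>])
    then show False using X(2) by (simp add: \<psi>_def Yg)
  qed
  then obtain x where x: "Q x x \<noteq> 0" by blast
  obtain a b where ab: "a \<in> L" "b \<in> M" "x = a + b" using LM unfolding lagrangian_pair_def by blast
  \<comment> \<open>The mixed terms vanish by \<open>QLM\<close>, so \<open>Q\<close> is already
    nonzero on one of the two Lagrangians.\<close>
  have "Q x x = Q a a + Q b b"
    using QLM[OF ab(1,2)] Q(1)[of a b "a + b"] Q(3)[of a "a + b"] Q(3)[of b "a + b"] Q(1)[of a b a] Q(1)[of a b b] Q(3)[of a b]
    by (simp add: ab(3))
  then have "Q a a \<noteq> 0 \<or> Q b b \<noteq> 0" using x by auto
  have dP: "vec.dim P = p + q"
    using g(3) PC by (auto simp: flag_domain_def isotropic_grassmannian_def)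
  have P: "P \<in> split_planes L M p q" "P \<in> split_planes M L q p"
    using PC Csplit split_planes_swap[of L M p q] by auto
  have Y: "V \<in> swept_set h D C0 B"
    if "V \<in> split_planes L M p q" "\<And>v. v \<in> V \<Longrightarrow> \<sigma> v x = 0" "Q x x \<noteq> 0" for V x
    using inY that unfolding Csplit by blast
  show ?thesis
  proof (cases "Q a a = 0")
    case False
    have "polydisk_in_cycle (p + q) (n - q) (swept_set h D C0 B) (split_planes L M p q) P"
      by (rule polydisk_exists[OF LM P(1) dP Q(1-3) PY Y ab(1) False])
    then show ?thesis unfolding Csplit by (intro exI[of _ "n - q"]) simp
  next
    case True
    then have Qb: "Q b b \<noteq> 0" using \<open>Q a a \<noteq> 0 \<or> Q b b \<noteq> 0\<close> by blast
    have "polydisk_in_cycle (p + q) (n - p) (swept_set h D C0 B) (split_planes M L q p) P"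
      by (rule polydisk_exists[OF lagrangian_pair_swap[OF LM] P(2) dP Q(1-3) PY Y[unfolded split_planes_swap[of L M]] ab(2) Qb])
    then show ?thesis
      unfolding Csplit split_planes_swap[of L M p q] by (intro exI[of _ "n - p"]) simp
  qed
qed

end

section \<open>Evaluation of the extrema that define c(Y)\<close>

theorem corollary6p4:
  fixes h :: "real^'v \<Rightarrow> real^'v \<Rightarrow> real"
    and n k p q :: nat
    and D C0 :: "(complex^'v) set set"
    and K0 :: "(complex^'v^'v) set"
    and B :: "(complex^'v) set set set"
  assumes "CARD('v) = 2 * n" and "n \<ge> 2"
    and "symplectic_form h"
    and "k = p + q" and "1 \<le> k" and "k < n"
    and "D = flag_domain h p q"
    and "maximal_compact_subgroup K0 (Sp_real h)"
    and "base_cycle k D K0 C0"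
    and "relatively_compact_domain (cycle_space_topology h D C0) B"
    and "smooth_boundary h D C0 B"
    and "C0 \<in> B"
  shows "c_swept h k D C0 B \<ge> min (n - p) (n - q)"
proof -
  interpret symplectic_space h using assms(3) by unfold_locales
  obtain J where J: "compatible_structure h J" and K0: "K0 = compatible_structure.unitary_group h J"
    using maximal_compact_is_unitary_group[OF assms(8)] .
  interpret compatible_structure h J by (rule J)
  have base: "base_cycle (p + q) (flag_domain h p q) unitary_group C0"
    using assms(9) by (simp add: K0 assms(4,7))
  note eq = base_cycle_eq_split_planes[OF assms(1) base]
  interpret base_cycle_structure h J n p q
    using assms(1,4,5) eq(2,3) by unfold_locales auto
  let ?C0 = "split_planes Epos Eneg p q" and ?D = "flag_domain h p q"
  let ?X = "isotropic_grassmannian_topology h (p + q)"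
  let ?Y = "swept_set h ?D ?C0 B"
  let ?m = "min (n - p) (n - q)" and ?N = "(p + q) * CARD('v)"
  have B: "openin M_D B" "compactin M_D (M_D closure_of B)" and smooth: "smooth_boundary h ?D ?C0 B"
    and C0B: "?C0 \<in> B"
    using assms(10-12) eq(1) by (auto simp: relatively_compact_domain_def assms(7))
  \<comment> \<open>The upper bound \<open>?N\<close> is carried along for finiteness: for a given
    \<open>P\<close> there may be infinitely many supporting cycles, and infinitely many boundary
    points, but only finitely many values.\<close>
  have cyc: "?m \<le> c_cycle (p + q) ?Y C P \<and> c_cycle (p + q) ?Y C P \<le> ?N"
    if P: "P \<in> ?X frontier_of ?Y" and C: "C \<in> supporting_cycles h ?D ?C0 B P" for P C
  proof -
    have "P \<notin> ?Y"
      using P interior_of_openin[OF openin_swept_set[OF B(1)]] by (simp add: frontier_of_def)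
    then obtain d where d: "?m \<le> d" "polydisk_in_cycle (p + q) d ?Y C P"
      using boundary_polydisk[OF B(1) smooth C] by blast
    let ?S = "{d. polydisk_in_cycle (p + q) d ?Y C P}"
    have fin: "finite ?S"
      by (rule finite_subset[of _ "{..?N}"]) (auto dest: polydisk_dimension_bound)
    have "d \<le> Max ?S" using fin d(2) by (intro Max_ge) auto
    moreover have "Max ?S \<in> ?S" by (rule Max_in[OF fin]) (use d(2) in blast)
    then have "Max ?S \<le> ?N" using polydisk_dimension_bound by blast
    ultimately show ?thesis using d(1) unfolding c_cycle_def by simp
  qed
  have pt: "?m \<le> c_point h (p + q) ?D ?C0 B P \<and> c_point h (p + q) ?D ?C0 B P \<le> ?N"
    if P: "P \<in> ?X frontier_of ?Y" for P
  proof -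
    let ?S = "(\<lambda>C. c_cycle (p + q) ?Y C P) ` supporting_cycles h ?D ?C0 B P"
    obtain C where C: "C \<in> supporting_cycles h ?D ?C0 B P"
      using supporting_cycle_exists[OF B P] .
    have "finite ?S" by (rule finite_subset[of _ "{..?N}"]) (use cyc[OF P] in auto)
    then have "Max ?S \<in> ?S" using C by (intro Max_in) auto
    then show ?thesis using cyc[OF P] unfolding c_point_def by auto
  qed
  let ?S = "c_point h (p + q) ?D ?C0 B ` (?X frontier_of ?Y)"
  have "finite ?S" by (rule finite_subset[of _ "{..?N}"]) (use pt in auto)
  then have "Min ?S \<in> ?S"
    using swept_set_frontier_nonempty[OF B(1) C0B] by (intro Min_in) auto
  then have "?m \<le> c_swept h (p + q) ?D ?C0 B" using pt unfolding c_swept_def by auto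
  then show ?thesis by (simp add: assms(4,7) eq(1))
qed

end
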